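(* Let $n\ge 1$, let $\Omega\subset\mathbb{R}^n$ be an exterior domain with smooth compact boundary (with $\Omega=(0,\infty)$ when $n=1$), and let $\phi_0$ be the positive harmonic function on $\Omega$ vanishing on $\partial\Omega$ described in the context. Consider the initial boundary value problem $$\begin{cases} u_{tt}-\Delta u-\Delta u_t=|u|^p, & t>0,\ x\in\Omega,\\ u(0,x)=u_0(x),\quad u_t(0,x)=u_1(x), & x\in\Omega,\\ u=0, & t\ge 0,\ x\in\partial\Omega.\end{cases}$$ Assume that $(u_0,u_1)\in (H^2(\Omega)\cap H^1_0(\Omega))\times L^2(\Omega)$, that $u_0\ge 0$ and $u_1\ge0$, and that $$\int_{\Omega}[u_1(x)-\Delta u_0(x)]\,\phi_0(x)\,dx>0.$$ If $$\begin{cases} 1<p\le 3, & \text{for } n=1,\\ 1<p<3, & \text{for } n=2,\\ 1<p\le 1+\dfrac{2}{n-1}, & \text{for } n\ge 3,\end{cases}$$ then the solution of the problem blows up in finite time, i.e. its maximal existence time satisfies $T_{\max}<\infty$.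
   Context: Exterior domain: for $n\ge2$, $\Omega$ is a connected open set that is the complement in $\mathbb{R}^n$ of a bounded obstacle $\mathcal{O}$ with smooth compact boundary $\partial\Omega$. For $n=1$, $\Omega=(0,\infty)$ and $\partial\Omega=\{0\}$. All functions are real-valued. The function $\phi_0$ is as follows. - For $n\ge3$: $\phi_0\in C^2(\Omega)\cap C(\overline\Omega)$ satisfies $\Delta\phi_0=0$ in $\Omega$, $\phi_0=0$ on $\partial\Omega$, and $\phi_0(x)\to1$ as $|x|\to\infty$. It satisfies $0<\phi_0<1$ in $\Omega$. - For $n=2$: $\phi_0\in C^2(\Omega)\cap C(\overline\Omega)$ satisfies $\Delta\phi_0=0$ in $\Omega$, $\phi_0=0$ on $\partial\Omega$, $\phi_0>0$ in $\Omega$, and $\phi_0(x)\to+\infty$ as $|x|\to\infty$ at the rate of $\ln|x|$, i.e. there are constants $c_1,c_2>0$ with $c_1\ln|x|\le\phi_0(x)\le c_2\ln|x|$ for all sufficiently large $|x|$. - For $n=1$: $\phi_0(x)=Cx$ on $[0,\infty)$ for some constant $C>0$. Solution and maximal existence time: for $(u_0,u_1)\in (H^2(\Omega)\cap H^1_0(\Omega))\times L^2(\Omega)$ and $1<p<\infty$ if $n=1,2$, $1<p\le \frac{n}{n-2}$ if $n\ge3$, it is known that there is a maximal existence time $T_{\max}\in(0,\infty]$ such that the problem has a unique weak solution $u\in C([0,T_{\max}),H^1_0(\Omega))\cap C^1([0,T_{\max}),L^2(\Omega))$; moreover either $T_{\max}=\infty$, or $T_{\max}<\infty$ and $\|u(t,\cdot)\|_{H^1_0(\Omega)}+\|u_t(t,\cdot)\|_{L^2(\Omega)}\to\infty$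 as $t\to T_{\max}$. "The solution" means this $u$. It is global if $T_{\max}=\infty$, and it blows up in finite time if $T_{\max}<\infty$. Weak solution: $u(0)=u_0$, $u_t(0)=u_1$, and for every $0<T<T_{\max}$, $$\int_0^T\!\!\int_\Omega |u|^p\varphi\,dx\,dt+\int_\Omega [u_1-\Delta u_0]\varphi(0,x)\,dx-\int_\Omega u_0\varphi_t(0,x)\,dx=\int_0^T\!\!\int_\Omega u\varphi_{tt}\,dx\,dt+\int_0^T\!\!\int_\Omega u\Delta\varphi_t\,dx\,dt-\int_0^T\!\!\int_\Omega u\Delta\varphi\,dx\,dt$$ for all test functions $\varphi\in C^2([0,T]\times\overline\Omega)$ with compact support in $[0,T]\times\overline\Omega$, with $\Delta\varphi_t$ continuous on $[0,T]\times\overline\Omega$, with $\varphi=0$ on $[0,T]\times\partial\Omega$, and with $\varphi(T,\cdot)=0$, $\varphi_t(T,\cdot)=0$. *)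

theory Defs
  imports "HOL-Analysis.Analysis"
begin

text \<open>
  Euclidean space \<open>\<real>\<^sup>n\<close> is an arbitrary type of class \<^class>\<open>euclidean_space\<close>, with \<open>n = DIM('a)\<close> and
  coordinate directions \<open>i \<in> Basis\<close>. Elements of \<open>L\<^sup>2\<close> and of the Sobolev spaces are represented by
  functions; only their values almost everywhere in the domain matter.
\<close>

definition partial_deriv :: "'a::euclidean_space \<Rightarrow> ('a \<Rightarrow> real) \<Rightarrow> 'a \<Rightarrow> real" where
  "partial_deriv i f x = deriv (\<lambda>s. f (x + s *\<^sub>R i)) 0"

definition laplacian :: "('a::euclidean_space \<Rightarrow> real) \<Rightarrow> 'a \<Rightarrow> real" where
  "laplacian f x = (\<Sum>i\<in>Basis. partial_deriv i (partial_deriv i f) x)"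

text \<open>Meant for open sets \<open>S\<close> only.\<close>

primrec Ck_on :: "nat \<Rightarrow> 'a::euclidean_space set \<Rightarrow> ('a \<Rightarrow> real) \<Rightarrow> bool" where
  "Ck_on 0 S f \<longleftrightarrow> continuous_on S f"
| "Ck_on (Suc k) S f \<longleftrightarrow>
     (\<forall>x\<in>S. f differentiable (at x)) \<and> (\<forall>i\<in>Basis. Ck_on k S (partial_deriv i f))"

definition smooth_on :: "'a::euclidean_space set \<Rightarrow> ('a \<Rightarrow> real) \<Rightarrow> bool" where
  "smooth_on S f \<longleftrightarrow> (\<forall>k. Ck_on k S f)"

definition extends_continuously :: "'a::euclidean_space set \<Rightarrow> ('a \<Rightarrow> real) \<Rightarrow> bool" where
  "extends_continuously S f \<longleftrightarrow> (\<exists>g. continuous_on (closure S) g \<and> (\<forall>x\<in>S. g x = f x))"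

text \<open>
  For an open set \<open>S\<close>: all partial derivatives of order at most \<open>k\<close> exist in \<open>S\<close> and extend
  continuously to the closure of \<open>S\<close>. The values of \<open>f\<close> outside \<open>S\<close> play no role here.
\<close>

primrec Ck_up_to_boundary :: "nat \<Rightarrow> 'a::euclidean_space set \<Rightarrow> ('a \<Rightarrow> real) \<Rightarrow> bool" where
  "Ck_up_to_boundary 0 S f \<longleftrightarrow> extends_continuously S f"
| "Ck_up_to_boundary (Suc k) S f \<longleftrightarrow>
     extends_continuously S f \<and> (\<forall>x\<in>S. f differentiable (at x)) \<and>
     (\<forall>i\<in>Basis. Ck_up_to_boundary k S (partial_deriv i f))"

text \<open>Smoothness of the boundary is expressed by local defining functions with nonzero gradient.\<close>

definition smooth_boundary :: "'a::euclidean_space set \<Rightarrow> bool" where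
  "smooth_boundary \<Omega> \<longleftrightarrow>
     (\<forall>a\<in>frontier \<Omega>. \<exists>U \<rho>. open U \<and> a \<in> U \<and> smooth_on U \<rho> \<and>
        (\<forall>x\<in>U. \<exists>i\<in>Basis. partial_deriv i \<rho> x \<noteq> 0) \<and>
        \<Omega> \<inter> U = {x\<in>U. \<rho> x < 0})"

text \<open>
  In dimension one \<open>Basis\<close> has a single element, so the first case is the half-line \<open>(0,\<infinity>)\<close>.
  In the second case the obstacle \<open>- \<Omega>\<close> is closed and bounded, so the boundary is compact.
\<close>

definition exterior_domain :: "'a::euclidean_space set \<Rightarrow> bool" where
  "exterior_domain \<Omega> \<longleftrightarrow>
     (if DIM('a) = 1 then \<Omega> = {x. \<forall>i\<in>Basis. 0 < x \<bullet> i}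
      else open \<Omega> \<and> connected \<Omega> \<and> - \<Omega> \<noteq> {} \<and> bounded (- \<Omega>) \<and> smooth_boundary \<Omega>)"

definition exterior_harmonic :: "'a::euclidean_space set \<Rightarrow> ('a \<Rightarrow> real) \<Rightarrow> bool" where
  "exterior_harmonic \<Omega> \<phi>0 \<longleftrightarrow>
     (if DIM('a) = 1 then \<exists>C>0. \<forall>x\<in>closure \<Omega>. \<forall>i\<in>Basis. \<phi>0 x = C * (x \<bullet> i)
      else
        Ck_on 2 \<Omega> \<phi>0 \<and> continuous_on (closure \<Omega>) \<phi>0 \<and>
        (\<forall>x\<in>\<Omega>. laplacian \<phi>0 x = 0) \<and> (\<forall>x\<in>frontier \<Omega>. \<phi>0 x = 0) \<and>
        (if DIM('a) = 2
         then (\<forall>x\<in>\<Omega>. 0 < \<phi>0 x) \<and> filterlim \<phi>0 at_top at_infinity \<and>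
              (\<exists>c1>0. \<exists>c2>0. \<forall>\<^sub>F x in at_infinity.
                 c1 * ln (norm x) \<le> \<phi>0 x \<and> \<phi>0 x \<le> c2 * ln (norm x))
         else (\<forall>x\<in>\<Omega>. 0 < \<phi>0 x \<and> \<phi>0 x < 1) \<and> (\<phi>0 \<longlongrightarrow> 1) at_infinity))"

definition L2 :: "'a::euclidean_space set \<Rightarrow> ('a \<Rightarrow> real) \<Rightarrow> bool" where
  "L2 \<Omega> f \<longleftrightarrow>
     set_borel_measurable lebesgue \<Omega> f \<and> set_integrable lebesgue \<Omega> (\<lambda>x. (f x)\<^sup>2)"

definition L2_norm :: "'a::euclidean_space set \<Rightarrow> ('a \<Rightarrow> real) \<Rightarrow> real" where
  "L2_norm \<Omega> f = sqrt (LINT x:\<Omega>|lebesgue. (f x)\<^sup>2)"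

definition locally_integrable :: "'a::euclidean_space set \<Rightarrow> ('a \<Rightarrow> real) \<Rightarrow> bool" where
  "locally_integrable \<Omega> f \<longleftrightarrow> (\<forall>K. compact K \<and> K \<subseteq> \<Omega> \<longrightarrow> set_integrable lebesgue K f)"

definition Cc_infinity :: "'a::euclidean_space set \<Rightarrow> ('a \<Rightarrow> real) set" where
  "Cc_infinity \<Omega> =
     {\<psi>. smooth_on UNIV \<psi> \<and> compact (closure {x. \<psi> x \<noteq> 0}) \<and> closure {x. \<psi> x \<noteq> 0} \<subseteq> \<Omega>}"

definition has_weak_partial ::
    "'a::euclidean_space set \<Rightarrow> 'a \<Rightarrow> ('a \<Rightarrow> real) \<Rightarrow> ('a \<Rightarrow> real) \<Rightarrow> bool" where
  "has_weak_partial \<Omega> i f g \<longleftrightarrow>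
     locally_integrable \<Omega> f \<and> locally_integrable \<Omega> g \<and>
     (\<forall>\<psi>\<in>Cc_infinity \<Omega>.
        (LINT x:\<Omega>|lebesgue. f x * partial_deriv i \<psi> x) = - (LINT x:\<Omega>|lebesgue. g x * \<psi> x))"

text \<open>The weak derivative is unique up to null sets, so the choice is immaterial.\<close>

definition weak_partial :: "'a::euclidean_space set \<Rightarrow> 'a \<Rightarrow> ('a \<Rightarrow> real) \<Rightarrow> 'a \<Rightarrow> real" where
  "weak_partial \<Omega> i f = (SOME g. has_weak_partial \<Omega> i f g)"

definition weak_laplacian :: "'a::euclidean_space set \<Rightarrow> ('a \<Rightarrow> real) \<Rightarrow> 'a \<Rightarrow> real" where
  "weak_laplacian \<Omega> f x = (\<Sum>i\<in>Basis. weak_partial \<Omega> i (weak_partial \<Omega> i f) x)"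

primrec sobolev :: "nat \<Rightarrow> 'a::euclidean_space set \<Rightarrow> ('a \<Rightarrow> real) \<Rightarrow> bool" where
  "sobolev 0 \<Omega> f \<longleftrightarrow> L2 \<Omega> f"
| "sobolev (Suc k) \<Omega> f \<longleftrightarrow>
     L2 \<Omega> f \<and> (\<forall>i\<in>Basis. \<exists>g. has_weak_partial \<Omega> i f g \<and> sobolev k \<Omega> g)"

definition H1_norm :: "'a::euclidean_space set \<Rightarrow> ('a \<Rightarrow> real) \<Rightarrow> real" where
  "H1_norm \<Omega> f = sqrt ((L2_norm \<Omega> f)\<^sup>2 + (\<Sum>i\<in>Basis. (L2_norm \<Omega> (weak_partial \<Omega> i f))\<^sup>2))"

definition sobolev_zero :: "'a::euclidean_space set \<Rightarrow> ('a \<Rightarrow> real) \<Rightarrow> bool" where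
  "sobolev_zero \<Omega> f \<longleftrightarrow>
     sobolev 1 \<Omega> f \<and> (\<forall>e>0. \<exists>\<psi>\<in>Cc_infinity \<Omega>. H1_norm \<Omega> (\<lambda>x. f x - \<psi> x) < e)"

text \<open>Time derivative of a function on \<open>[0,T] \<times> \<real>\<^sup>n\<close>, one-sided at the endpoints.\<close>

definition time_deriv ::
    "real \<Rightarrow> (real \<times> 'a::euclidean_space \<Rightarrow> real) \<Rightarrow> real \<times> 'a \<Rightarrow> real" where
  "time_deriv T \<phi> = (\<lambda>(t, x). vector_derivative (\<lambda>s. \<phi> (s, x)) (at t within {0..T}))"

definition space_laplacian :: "(real \<times> 'a::euclidean_space \<Rightarrow> real) \<Rightarrow> real \<times> 'a \<Rightarrow> real" where
  "space_laplacian \<phi> = (\<lambda>(t, x). laplacian (\<lambda>y. \<phi> (t, y)) x)"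

text \<open>
  Membership in \<open>C\<^sup>2([0,T] \<times> closure \<Omega>)\<close> and continuity of \<open>\<Delta>\<phi>\<^sub>t\<close> on \<open>[0,T] \<times> closure \<Omega>\<close> mean that
  the derivatives exist in the interior \<open>(0,T) \<times> \<Omega>\<close> and extend continuously to the closure. The
  second spatial derivatives of \<open>\<phi>\<^sub>t\<close> are of third order in \<open>\<phi>\<close>, so their existence is required
  separately (fourth conjunct).
\<close>

definition test_function ::
    "'a::euclidean_space set \<Rightarrow> real \<Rightarrow> (real \<times> 'a \<Rightarrow> real) \<Rightarrow> bool" where
  "test_function \<Omega> T \<phi> \<longleftrightarrow>
     continuous_on ({0..T} \<times> closure \<Omega>) \<phi> \<and>
     Ck_up_to_boundary 2 ({0<..<T} \<times> \<Omega>) \<phi> \<and>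
     compact (closure {z \<in> {0..T} \<times> closure \<Omega>. \<phi> z \<noteq> 0}) \<and>
     (\<forall>t\<in>{0<..<T}. \<forall>x\<in>\<Omega>. \<forall>i\<in>Basis.
        (\<lambda>s. partial_deriv i (\<lambda>y. time_deriv T \<phi> (t, y)) (x + s *\<^sub>R i)) differentiable (at 0)) \<and>
     extends_continuously ({0<..<T} \<times> \<Omega>) (space_laplacian (time_deriv T \<phi>)) \<and>
     (\<forall>t\<in>{0..T}. \<forall>x\<in>frontier \<Omega>. \<phi> (t, x) = 0) \<and>
     (\<forall>x\<in>closure \<Omega>. \<phi> (T, x) = 0) \<and>
     (\<forall>x\<in>closure \<Omega>. time_deriv T \<phi> (T, x) = 0)"

text \<open>Continuity in time with respect to a norm \<open>N\<close> on functions of the space variable.\<close>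

definition continuous_in_norm ::
    "(('a \<Rightarrow> real) \<Rightarrow> real) \<Rightarrow> real set \<Rightarrow> (real \<Rightarrow> 'a \<Rightarrow> real) \<Rightarrow> bool" where
  "continuous_in_norm N I u \<longleftrightarrow>
     (\<forall>t\<in>I. ((\<lambda>s. N (\<lambda>x. u s x - u t x)) \<longlongrightarrow> 0) (at t within I))"

definition has_deriv_in_norm ::
    "(('a \<Rightarrow> real) \<Rightarrow> real) \<Rightarrow> real set \<Rightarrow> (real \<Rightarrow> 'a \<Rightarrow> real) \<Rightarrow> (real \<Rightarrow> 'a \<Rightarrow> real) \<Rightarrow> bool" where
  "has_deriv_in_norm N I u ut \<longleftrightarrow>
     (\<forall>t\<in>I. ((\<lambda>s. N (\<lambda>x. (u s x - u t x) / (s - t) - ut t x)) \<longlongrightarrow> 0) (at t within I))"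

text \<open>
  \<open>u \<in> C([0,T), H\<^sup>1\<^sub>0(\<Omega>)) \<inter> C\<^sup>1([0,T), L\<^sup>2(\<Omega>))\<close>, with \<open>L\<^sup>2\<close>-valued time derivative \<open>ut\<close>, is a weak solution
  of \<open>u\<^sub>t\<^sub>t - \<Delta>u - \<Delta>u\<^sub>t = |u|\<^sup>p\<close> with initial data \<open>u0\<close>, \<open>u1\<close> and zero boundary values.
\<close>

definition weak_solution ::
    "'a::euclidean_space set \<Rightarrow> real \<Rightarrow> ('a \<Rightarrow> real) \<Rightarrow> ('a \<Rightarrow> real) \<Rightarrow> ereal \<Rightarrow>
     (real \<Rightarrow> 'a \<Rightarrow> real) \<Rightarrow> (real \<Rightarrow> 'a \<Rightarrow> real) \<Rightarrow> bool" where
  "weak_solution \<Omega> p u0 u1 T u ut \<longleftrightarrow>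
     0 < T \<and>
     (let I = {t. 0 \<le> t \<and> ereal t < T} in
        (\<forall>t\<in>I. sobolev_zero \<Omega> (u t)) \<and> continuous_in_norm (H1_norm \<Omega>) I u \<and>
        (\<forall>t\<in>I. L2 \<Omega> (ut t)) \<and> has_deriv_in_norm (L2_norm \<Omega>) I u ut \<and>
        continuous_in_norm (L2_norm \<Omega>) I ut) \<and>
     (AE x in lebesgue. x \<in> \<Omega> \<longrightarrow> u 0 x = u0 x) \<and>
     (AE x in lebesgue. x \<in> \<Omega> \<longrightarrow> ut 0 x = u1 x) \<and>
     (\<forall>S \<phi>. 0 < S \<and> ereal S < T \<and> test_function \<Omega> S \<phi> \<longrightarrow>
        (LINT t:{0..S}|lebesgue. LINT x:\<Omega>|lebesgue. \<bar>u t x\<bar> powr p * \<phi> (t, x))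
          + (LINT x:\<Omega>|lebesgue. (u1 x - weak_laplacian \<Omega> u0 x) * \<phi> (0, x))
          - (LINT x:\<Omega>|lebesgue. u0 x * time_deriv S \<phi> (0, x))
        = (LINT t:{0..S}|lebesgue. LINT x:\<Omega>|lebesgue. u t x * time_deriv S (time_deriv S \<phi>) (t, x))
          + (LINT t:{0..S}|lebesgue. LINT x:\<Omega>|lebesgue. u t x * space_laplacian (time_deriv S \<phi>) (t, x))
          - (LINT t:{0..S}|lebesgue. LINT x:\<Omega>|lebesgue. u t x * space_laplacian \<phi> (t, x)))"

text \<open>
  \<open>u\<close> is the solution and \<open>T\<close> its maximal existence time: no weak solution lives longer, and if \<open>T\<close> is
  finite then the norm of \<open>(u, u\<^sub>t)\<close> tends to infinity as \<open>t \<rightarrow> T\<close>.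
\<close>

definition maximal_weak_solution ::
    "'a::euclidean_space set \<Rightarrow> real \<Rightarrow> ('a \<Rightarrow> real) \<Rightarrow> ('a \<Rightarrow> real) \<Rightarrow> ereal \<Rightarrow>
     (real \<Rightarrow> 'a \<Rightarrow> real) \<Rightarrow> (real \<Rightarrow> 'a \<Rightarrow> real) \<Rightarrow> bool" where
  "maximal_weak_solution \<Omega> p u0 u1 T u ut \<longleftrightarrow>
     weak_solution \<Omega> p u0 u1 T u ut \<and>
     (\<forall>T' v vt. weak_solution \<Omega> p u0 u1 T' v vt \<longrightarrow> T' \<le> T) \<and>
     (T = \<infinity> \<or>
      filterlim (\<lambda>t. H1_norm \<Omega> (u t) + L2_norm \<Omega> (ut t)) at_top (at_left (real_of_ereal T)))"

end

theory Submission
  imports Defs "HOL-Real_Asymp.Real_Asymp"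
begin

text \<open>
  Suppose the solution is global. Test the equation with \<open>\<eta>(t / R) F(\<phi>) \<chi>(x / R)\<close>, where \<open>\<phi>\<close> is
  the positive harmonic function and \<open>F s = \<epsilon> (y - arctan y)\<close> with \<open>y = max 0 (s / \<epsilon> - 1)\<close>.
  Since \<open>F\<close> vanishes near 0, the test function has compact support inside the domain, so no
  regularity of \<open>\<phi>\<close> up to the boundary is needed; since \<open>F\<close> is convex, \<open>F(\<phi>)\<close> is subharmonic. For
  functions in \<open>H\<^sup>1\<^sub>0\<close> the limit \<open>\<epsilon> \<rightarrow> 0\<close>, in which \<open>F(\<phi>)\<close> becomes \<open>\<phi>\<close>, is justified by density and
  Caccioppoli's inequality. If \<open>n \<le> 2\<close>, an \<open>L\<^sup>4\<close> bound on the solution makes the power of \<open>u\<close>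
  locally integrable.

  The remaining derivatives fall on \<open>\<eta>\<close> and \<open>\<chi>\<close>, and are controlled by \<open>\<phi>(x) \<le> C m(R)\<close> and
  \<open>\<bar>\<nabla>\<phi>(x)\<bar> \<le> C m(R) / R\<close> for \<open>\<bar>x\<bar>\<close> comparable to \<open>R\<close>, where \<open>m(R)\<close> is \<open>R\<close>, \<open>ln R\<close> or \<open>1\<close> according to
  the dimension. Let \<open>J\<close> be the datum term, \<open>I\<close> the power of \<open>u\<close> integrated against the test function,
  and \<open>Y\<close> the part of \<open>I\<close> where both cutoffs are 1. Young's inequality gives
  \<open>I + J \<le> K (I - Y) + C K\<close> to the power \<open>- 1 / (p - 1)\<close>, uniformly in \<open>R\<close>, because \<open>m(R) R\<close> to the
  power \<open>n + 1 - 2 p / (p - 1)\<close> is bounded for the exponents in question. With \<open>K = 1 / 2\<close> this bounds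
  \<open>Y\<close>, hence \<open>I - Y\<close> tends to 0 along \<open>R = 2\<^sup>j\<close>. Letting first \<open>j\<close> and then \<open>K\<close> tend to infinity
  contradicts \<open>J \<rightarrow> \<integral>(u\<^sub>1 - \<Delta>u\<^sub>0) \<phi> > 0\<close>.
\<close>

section \<open>Partial derivatives and the Laplacian\<close>

text \<open>The exponents come from a dimension count. The linear terms carry
  \<open>\<eta>''\<close> times \<phi> \<chi>, and \<open>\<eta>'\<close> - \<eta> times the
  Laplacian of \<phi> \<chi>. With time and space cut at the same scale R both are at most of order
  m(R) / R^2; the damping, which carries \<open>\<eta>'\<close>, is smaller by a factor 1 / R. The
  conjugate exponent p' = p / (p - 1) and a region of volume R^(n+1) leave m(R) R^(n+1-2p'). For n
  >= 3 this is bounded iff p <= 1 + 2/(n-1); for n = 1 the factor m(R) = R puts the threshold at p =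
  3; for n = 2 the logarithm costs the endpoint. At a critical exponent there is no decay, so the
  region where both cutoffs are 1 is subtracted: as \<phi> is harmonic, the kernel vanishes there.
  The obstacle is the boundary. The Laplacian of F(\<phi>) contains \<open>F''\<close>(\<phi>) |grad
  \<phi>|^2, which concentrates near the boundary as \<epsilon> tends to 0. One integration by parts
  against compactly supported functions replaces it by gradients, which converge in L^2. Both
  cutoffs are k-th powers with k large, so that two derivatives still leave the factor \<chi>^(1/p)
  that Young's inequality consumes.\<close>

lemma has_derivative_along_line:
  fixes f :: "'a::real_normed_vector \<Rightarrow> real"
  assumes "(f has_derivative D) (at (x + t *\<^sub>R i))"
  shows "((\<lambda>s. f (x + s *\<^sub>R i)) has_real_derivative D i) (at t)"
proof -
  have "((\<lambda>s. x + s *\<^sub>R i) has_derivative (\<lambda>s. s *\<^sub>R i)) (at t)"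
    by (auto intro!: derivative_eq_intros)
  then have "((\<lambda>s. f (x + s *\<^sub>R i)) has_derivative (\<lambda>s. D (s *\<^sub>R i))) (at t)"
    using assms by (rule has_derivative_compose)
  moreover have "linear D" using assms by (rule has_derivative_linear)
  then have "(\<lambda>s. D (s *\<^sub>R i)) = (*) (D i)"
    by (simp add: fun_eq_iff linear_cmul)
  ultimately show ?thesis
    by (simp add: has_field_derivative_def)
qed

lemma partial_deriv_eqI:
  assumes "(f has_derivative D) (at x)"
  shows "partial_deriv i f x = D i"
  unfolding partial_deriv_def
  by (rule DERIV_imp_deriv, rule has_derivative_along_line) (use assms in simp)

lemma DERIV_partial_deriv:
  fixes f :: "'a::euclidean_space \<Rightarrow> real"
  assumes "f differentiable at (x + t *\<^sub>R i)"
  shows "((\<lambda>s. f (x + s *\<^sub>R i)) has_real_derivative partial_deriv i f (x + t *\<^sub>R i)) (at t)"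
proof -
  from assms obtain D where D: "(f has_derivative D) (at (x + t *\<^sub>R i))"
    by (auto simp: differentiable_def)
  show ?thesis using has_derivative_along_line[OF D] partial_deriv_eqI[OF D] by simp
qed

lemma partial_deriv_cong:
  fixes f :: "'a::euclidean_space \<Rightarrow> real"
  assumes "open S" "x \<in> S" "\<And>y. y \<in> S \<Longrightarrow> f y = g y"
  shows "partial_deriv i f x = partial_deriv i g x"
proof -
  have "((\<lambda>s. x + s *\<^sub>R i) \<longlongrightarrow> x + 0 *\<^sub>R i) (at 0)" by (intro tendsto_intros)
  then have "\<forall>\<^sub>F s in at 0. x + s *\<^sub>R i \<in> S"
    using assms(1,2) by (simp add: topological_tendstoD)
  then have "\<forall>\<^sub>F s in nhds 0. x + s *\<^sub>R i \<in> S"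
    using assms(2) by (simp add: eventually_nhds_conv_at)
  then have "\<forall>\<^sub>F s in nhds 0. f (x + s *\<^sub>R i) = g (x + s *\<^sub>R i)"
    by eventually_elim (use assms(3) in auto)
  then show ?thesis unfolding partial_deriv_def by (rule deriv_cong_ev) simp
qed

lemma differentiable_cong_open:
  assumes "open S" "x \<in> S" "\<And>y. y \<in> S \<Longrightarrow> f y = g y" "f differentiable at x"
  shows "g differentiable at x"
proof -
  from assms(4) obtain D where "(f has_derivative D) (at x)" by (auto simp: differentiable_def)
  from has_derivative_transform_within_open[OF this assms(1,2,3)]
  show ?thesis by (auto simp: differentiable_def)
qed

lemma Ck_on_cong:
  assumes "open S" "\<And>x. x \<in> S \<Longrightarrow> f x = g x"
  shows "Ck_on k S f \<longleftrightarrow> Ck_on k S g"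
  using assms(2)
proof (induction k arbitrary: f g)
  case 0
  then show ?case by (auto intro: continuous_on_cong)
next
  case (Suc k)
  have "Ck_on k S (partial_deriv i f) \<longleftrightarrow> Ck_on k S (partial_deriv i g)" for i
    by (rule Suc.IH) (rule partial_deriv_cong[OF assms(1)], simp, erule Suc.prems)
  moreover have "(\<forall>x\<in>S. f differentiable at x) \<longleftrightarrow> (\<forall>x\<in>S. g differentiable at x)"
    using differentiable_cong_open[OF assms(1), of _ f g]
      differentiable_cong_open[OF assms(1), of _ g f] Suc.prems by (intro ball_cong) auto
  ultimately show ?case by (simp only: Ck_on.simps)
qed

lemma Ck_on_subset: "Ck_on k S f \<Longrightarrow> T \<subseteq> S \<Longrightarrow> Ck_on k T f"
  by (induction k arbitrary: f) (auto intro: continuous_on_subset)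

lemma differentiable_imp_continuous_on_Ball:
  "\<forall>x\<in>S. f differentiable at x \<Longrightarrow> continuous_on S f"
  by (simp add: continuous_at_imp_continuous_on differentiable_imp_continuous_within)

lemma Ck_on_Suc_D: "Ck_on (Suc k) S f \<Longrightarrow> Ck_on k S f"
proof (induction k arbitrary: f)
  case 0
  then show ?case by (auto intro: differentiable_imp_continuous_on_Ball)
qed auto

lemma Ck_on_mono:
  assumes "Ck_on k S f" "j \<le> k"
  shows "Ck_on j S f"
proof -
  have "Ck_on (j + m) S f \<Longrightarrow> Ck_on j S f" for m
    by (induction m) (auto dest: Ck_on_Suc_D simp del: Ck_on.simps)
  then show ?thesis using assms by (metis le_add_diff_inverse)
qed

lemma Ck_on_imp_continuous_on: "Ck_on k S f \<Longrightarrow> continuous_on S f"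
  using Ck_on_mono[of k S f 0] by simp

lemma Ck_on_imp_differentiable: "Ck_on k S f \<Longrightarrow> 1 \<le> k \<Longrightarrow> x \<in> S \<Longrightarrow> f differentiable at x"
  using Ck_on_mono[of k S f 1] by simp

lemma partial_deriv_const [simp]: "partial_deriv i (\<lambda>x. c) = (\<lambda>x. 0)"
  by (simp add: partial_deriv_def fun_eq_iff)

lemma Ck_on_const [simp]: "Ck_on k S (\<lambda>x. c)"
  by (induction k arbitrary: c) simp_all

lemma partial_deriv_add:
  fixes f g :: "'a::euclidean_space \<Rightarrow> real"
  assumes "f differentiable at x" "g differentiable at x"
  shows "partial_deriv i (\<lambda>x. f x + g x) x = partial_deriv i f x + partial_deriv i g x"
proof -
  from assms obtain D E where "(f has_derivative D) (at x)" "(g has_derivative E) (at x)"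
    by (auto simp: differentiable_def)
  then show ?thesis by (simp add: partial_deriv_eqI partial_deriv_eqI[OF has_derivative_add])
qed

lemma partial_deriv_mult:
  fixes f g :: "'a::euclidean_space \<Rightarrow> real"
  assumes "f differentiable at x" "g differentiable at x"
  shows "partial_deriv i (\<lambda>x. f x * g x) x = f x * partial_deriv i g x + partial_deriv i f x * g x"
proof -
  from assms obtain D E where "(f has_derivative D) (at x)" "(g has_derivative E) (at x)"
    by (auto simp: differentiable_def)
  then show ?thesis by (simp add: partial_deriv_eqI partial_deriv_eqI[OF has_derivative_mult])
qed

lemma partial_deriv_cmult:
  fixes f :: "'a::euclidean_space \<Rightarrow> real"
  assumes "f differentiable at x"
  shows "partial_deriv i (\<lambda>x. c * f x) x = c * partial_deriv i f x"
  using partial_deriv_mult[of "\<lambda>x. c" x f i] assms by simp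

lemma partial_deriv_diff:
  fixes f g :: "'a::euclidean_space \<Rightarrow> real"
  assumes "f differentiable at x" "g differentiable at x"
  shows "partial_deriv i (\<lambda>x. f x - g x) x = partial_deriv i f x - partial_deriv i g x"
  using partial_deriv_add[of f x "\<lambda>x. -1 * g x" i] partial_deriv_cmult[of g x i "-1"] assms by simp

lemma partial_deriv_compose:
  fixes f :: "'a::euclidean_space \<Rightarrow> real" and F :: "real \<Rightarrow> real"
  assumes "f differentiable at x" "(F has_real_derivative F') (at (f x))"
  shows "partial_deriv i (\<lambda>x. F (f x)) x = F' * partial_deriv i f x"
    and "(\<lambda>x. F (f x)) differentiable at x"
proof -
  from assms(1) obtain D where D: "(f has_derivative D) (at x)" by (auto simp: differentiable_def)
  have "((\<lambda>x. F (f x)) has_derivative (\<lambda>h. F' * D h)) (at x)"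
    using has_derivative_compose[OF D] assms(2) unfolding has_field_derivative_def by blast
  then show "partial_deriv i (\<lambda>x. F (f x)) x = F' * partial_deriv i f x"
    "(\<lambda>x. F (f x)) differentiable at x"
    using partial_deriv_eqI[OF D] by (auto simp: partial_deriv_eqI differentiable_def)
qed

lemma Ck_on_add:
  assumes "open S" "Ck_on k S f" "Ck_on k S g"
  shows "Ck_on k S (\<lambda>x. f x + g x)"
  using assms(2,3)
proof (induction k arbitrary: f g)
  case (Suc k)
  have *: "Ck_on k S (partial_deriv i (\<lambda>x. f x + g x)) \<longleftrightarrow>
      Ck_on k S (\<lambda>x. partial_deriv i f x + partial_deriv i g x)" for i
    using Suc.prems by (intro Ck_on_cong[OF assms(1)] partial_deriv_add) (simp_all only: Ck_on.simps)
  have "Ck_on k S (partial_deriv i (\<lambda>x. f x + g x))" if "i \<in> Basis" for i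
    unfolding * using Suc.prems that by (intro Suc.IH) (simp_all only: Ck_on.simps)
  moreover have "\<forall>x\<in>S. (\<lambda>x. f x + g x) differentiable at x"
    using Suc.prems by (intro ballI differentiable_add) (simp_all only: Ck_on.simps)
  ultimately show ?case by (simp only: Ck_on.simps) blast
qed (simp add: continuous_on_add)

lemma Ck_on_mult:
  assumes "open S" "Ck_on k S f" "Ck_on k S g"
  shows "Ck_on k S (\<lambda>x. f x * g x)"
  using assms(2,3)
proof (induction k arbitrary: f g)
  case (Suc k)
  have *: "Ck_on k S (partial_deriv i (\<lambda>x. f x * g x)) \<longleftrightarrow>
      Ck_on k S (\<lambda>x. f x * partial_deriv i g x + partial_deriv i f x * g x)" for i
    using Suc.prems by (intro Ck_on_cong[OF assms(1)] partial_deriv_mult) (simp_all only: Ck_on.simps)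
  have fg: "Ck_on k S f" "Ck_on k S g" using Suc.prems Ck_on_Suc_D by blast+
  have "Ck_on k S (partial_deriv i f)" "Ck_on k S (partial_deriv i g)" if "i \<in> Basis" for i
    using Suc.prems that by (simp_all only: Ck_on.simps)
  then have "Ck_on k S (partial_deriv i (\<lambda>x. f x * g x))" if "i \<in> Basis" for i
    unfolding * using that fg by (intro Ck_on_add[OF assms(1)] Suc.IH)
  moreover have "\<forall>x\<in>S. (\<lambda>x. f x * g x) differentiable at x"
    using Suc.prems by (intro ballI differentiable_mult) (simp_all only: Ck_on.simps)
  ultimately show ?case by (simp only: Ck_on.simps) blast
qed (simp add: continuous_on_mult)

lemma Ck_on_cmult: "open S \<Longrightarrow> Ck_on k S f \<Longrightarrow> Ck_on k S (\<lambda>x. c * f x)"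
  by (rule Ck_on_mult) simp_all

lemma Ck_on_diff: "open S \<Longrightarrow> Ck_on k S f \<Longrightarrow> Ck_on k S g \<Longrightarrow> Ck_on k S (\<lambda>x. f x - g x)"
  using Ck_on_add[of S k f "\<lambda>x. -1 * g x"] Ck_on_cmult[of S k g "-1"] by simp

lemma Ck_on_prod:
  assumes "open S" "\<And>j. j \<in> A \<Longrightarrow> Ck_on k S (f j)"
  shows "Ck_on k S (\<lambda>x. \<Prod>j\<in>A. f j x)"
  using assms(2) by (induction A rule: infinite_finite_induct) (simp_all add: Ck_on_mult[OF assms(1)])

lemma Ck_on_sum:
  assumes "open S" "\<And>j. j \<in> A \<Longrightarrow> Ck_on k S (f j)"
  shows "Ck_on k S (\<lambda>x. \<Sum>j\<in>A. f j x)"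
  using assms(2) by (induction A rule: infinite_finite_induct) (simp_all add: Ck_on_add[OF assms(1)])

lemma Ck_on_compose:
  fixes F F' :: "real \<Rightarrow> real"
  assumes "open S" "Ck_on (Suc k) S f" "\<And>y. (F has_real_derivative F' y) (at y)"
    and "Ck_on k S (\<lambda>x. F' (f x))"
  shows "Ck_on (Suc k) S (\<lambda>x. F (f x))"
proof -
  have d: "f differentiable at x" if "x \<in> S" for x using assms(2) that by simp
  have "Ck_on k S (partial_deriv i (\<lambda>x. F (f x))) \<longleftrightarrow> Ck_on k S (\<lambda>x. F' (f x) * partial_deriv i f x)" for i
    by (rule Ck_on_cong[OF assms(1)], rule partial_deriv_compose(1)) (erule d, rule assms(3))
  moreover have "Ck_on k S (\<lambda>x. F' (f x) * partial_deriv i f x)" if "i \<in> Basis" for i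
    by (rule Ck_on_mult[OF assms(1,4)]) (use assms(2) that in simp)
  ultimately show ?thesis
    using partial_deriv_compose(2)[OF d assms(3)] by simp
qed

lemma Ck_on_2_compose:
  fixes F F' F'' :: "real \<Rightarrow> real"
  assumes "open S" "Ck_on 2 S f"
    and "\<And>y. (F has_real_derivative F' y) (at y)" "\<And>y. (F' has_real_derivative F'' y) (at y)"
    and "continuous_on UNIV F''"
  shows "Ck_on 2 S (\<lambda>x. F (f x))"
proof -
  have f: "Ck_on (Suc (Suc 0)) S f" using assms(2) by (simp only: numeral_2_eq_2)
  note f' = Ck_on_Suc_D[OF f]
  have "continuous_on S (\<lambda>x. F'' (f x))"
    by (rule continuous_on_compose2[OF assms(5) Ck_on_imp_continuous_on[OF f]]) simp
  then have "Ck_on (Suc 0) S (\<lambda>x. F' (f x))"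
    by (intro Ck_on_compose[OF assms(1) f' assms(4)]) (simp only: Ck_on.simps)
  from Ck_on_compose[OF assms(1) f assms(3) this] show ?thesis by (simp only: numeral_2_eq_2)
qed

text \<open>Differentiability in \<open>Ck_on\<close> is required pointwise in the full space, so
  only the continuity at the bottom of the induction has to be glued. This is what makes extensions
  by zero regular.\<close>

lemma Ck_on_Un:
  assumes "open S" "open T" "Ck_on k S f" "Ck_on k T f"
  shows "Ck_on k (S \<union> T) f"
  using assms(3,4)
proof (induction k arbitrary: f)
  case 0
  then show ?case using assms(1,2) by (simp add: continuous_on_open_Un)
next
  case (Suc k)
  then show ?case by (simp add: Ball_def)
qed

lemma Ck_on_linear:
  fixes L :: "'a::euclidean_space \<Rightarrow> real"
  assumes "bounded_linear L"
  shows "Ck_on k S L"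
proof (cases k)
  case (Suc j)
  have "partial_deriv i L = (\<lambda>x. L i)" for i
    using partial_deriv_eqI[OF bounded_linear_imp_has_derivative[OF assms]] by auto
  then show ?thesis using Suc bounded_linear_imp_differentiable[OF assms] by auto
qed (use assms linear_continuous_on in auto)

lemma laplacian_cong:
  fixes f :: "'a::euclidean_space \<Rightarrow> real"
  assumes "open S" "x \<in> S" "\<And>y. y \<in> S \<Longrightarrow> f y = g y"
  shows "laplacian f x = laplacian g x"
proof -
  have "partial_deriv i f y = partial_deriv i g y" if "y \<in> S" for i y
    by (rule partial_deriv_cong[OF assms(1) that]) (rule assms(3))
  then show ?thesis unfolding laplacian_def
    by (intro sum.cong refl partial_deriv_cong[OF assms(1,2)])
qed

lemma Ck_on_2_D:
  assumes "Ck_on 2 S f" "x \<in> S"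
  shows "f differentiable at x" "i \<in> Basis \<Longrightarrow> partial_deriv i f differentiable at x"
    "i \<in> Basis \<Longrightarrow> Ck_on 1 S (partial_deriv i f)"
  using assms by (auto simp: numeral_2_eq_2)

lemma Ck_on_laplacian: "Ck_on 2 S f \<Longrightarrow> continuous_on S (laplacian f)"
  unfolding laplacian_def[abs_def] by (rule continuous_on_sum) (simp add: numeral_2_eq_2)

lemma laplacian_mult:
  fixes f g :: "'a::euclidean_space \<Rightarrow> real"
  assumes "open S" "Ck_on 2 S f" "Ck_on 2 S g" "x \<in> S"
  shows "laplacian (\<lambda>x. f x * g x) x =
    f x * laplacian g x + 2 * (\<Sum>i\<in>Basis. partial_deriv i f x * partial_deriv i g x) + laplacian f x * g x"
proof -
  have *: "partial_deriv i (partial_deriv i (\<lambda>x. f x * g x)) x =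
     f x * partial_deriv i (partial_deriv i g) x + 2 * (partial_deriv i f x * partial_deriv i g x) +
     partial_deriv i (partial_deriv i f) x * g x" (is "partial_deriv i (partial_deriv i ?h) x = ?rhs i") if i: "i \<in> Basis" for i
  proof -
    note d = Ck_on_2_D(1)[OF assms(2)] Ck_on_2_D(1)[OF assms(3)]
    note dx = d[OF assms(4)] Ck_on_2_D(2)[OF assms(2,4) i] Ck_on_2_D(2)[OF assms(3,4) i]
    have "partial_deriv i (partial_deriv i (\<lambda>x. f x * g x)) x =
        partial_deriv i (\<lambda>x. f x * partial_deriv i g x + partial_deriv i f x * g x) x"
      by (rule partial_deriv_cong[OF assms(1,4)], rule partial_deriv_mult) (erule d)+
    also have "\<dots> = partial_deriv i (\<lambda>x. f x * partial_deriv i g x) x + partial_deriv i (\<lambda>x. partial_deriv i f x * g x) x"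
      by (rule partial_deriv_add) (rule differentiable_mult dx)+
    finally show ?thesis by (simp only: partial_deriv_mult[OF dx(1,4)] partial_deriv_mult[OF dx(3,2)])
  qed
  have "laplacian ?h x = (\<Sum>i\<in>Basis. ?rhs i)"
    unfolding laplacian_def by (rule sum.cong[OF refl *])
  then show ?thesis unfolding laplacian_def
    by (simp only: sum.distrib sum_distrib_left sum_distrib_right)
qed

lemma laplacian_compose:
  fixes f :: "'a::euclidean_space \<Rightarrow> real" and F F' F'' :: "real \<Rightarrow> real"
  assumes "open S" "Ck_on 2 S f" "x \<in> S"
    and F: "\<And>y. (F has_real_derivative F' y) (at y)" "\<And>y. (F' has_real_derivative F'' y) (at y)"
  shows "laplacian (\<lambda>x. F (f x)) x = F'' (f x) * (\<Sum>i\<in>Basis. (partial_deriv i f x)\<^sup>2) + F' (f x) * laplacian f x"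
proof -
  have *: "partial_deriv i (partial_deriv i (\<lambda>x. F (f x))) x =
     F'' (f x) * (partial_deriv i f x)\<^sup>2 + F' (f x) * partial_deriv i (partial_deriv i f) x"
     (is "partial_deriv i (partial_deriv i ?h) x = ?rhs i") if i: "i \<in> Basis" for i
  proof -
    note d = Ck_on_2_D(1)[OF assms(2)]
    note dx = d[OF assms(3)] Ck_on_2_D(2)[OF assms(2,3) i]
    have "partial_deriv i (partial_deriv i (\<lambda>x. F (f x))) x =
        partial_deriv i (\<lambda>x. F' (f x) * partial_deriv i f x) x"
      by (rule partial_deriv_cong[OF assms(1,3)], rule partial_deriv_compose) (erule d, rule F)
    also have "\<dots> = F' (f x) * partial_deriv i (partial_deriv i f) x + partial_deriv i (\<lambda>x. F' (f x)) x * partial_deriv i f x"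
      by (rule partial_deriv_mult) (rule partial_deriv_compose(2)[OF dx(1) F(2)] dx)+
    also have "partial_deriv i (\<lambda>x. F' (f x)) x = F'' (f x) * partial_deriv i f x"
      by (rule partial_deriv_compose(1)[OF dx(1) F(2)])
    finally show ?thesis by (simp add: power2_eq_square)
  qed
  have "laplacian ?h x = (\<Sum>i\<in>Basis. ?rhs i)"
    unfolding laplacian_def by (rule sum.cong[OF refl *])
  then show ?thesis unfolding laplacian_def
    by (simp only: sum.distrib sum_distrib_left)
qed

section \<open>Compactly supported functions\<close>

lemma lebesgue_integral_lborel: "f \<in> borel_measurable borel \<Longrightarrow> integral\<^sup>L lebesgue f = integral\<^sup>L lborel (f :: 'a::euclidean_space \<Rightarrow> real)"
  by (rule integral_completion) simp

lemma integrable_lebesgue_lborel: "integrable lborel f \<Longrightarrow> integrable lebesgue (f :: 'a::euclidean_space \<Rightarrow> real)"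
  by (subst integrable_completion) (auto intro: borel_measurable_integrable)

lemma integrable_continuous_compact_support:
  fixes f :: "'a::euclidean_space \<Rightarrow> real"
  assumes "continuous_on UNIV f" "\<And>x. r < norm x \<Longrightarrow> f x = 0"
  shows "integrable lborel f"
proof -
  have "integrable lborel (\<lambda>x. indicator (cball 0 r) x *\<^sub>R f x)"
    by (rule borel_integrable_compact) (use assms(1) continuous_on_subset in auto)
  moreover have "indicator (cball 0 r) x *\<^sub>R f x = f x" for x
    using assms(2)[of x] by (cases "norm x \<le> r") auto
  ultimately show ?thesis by (simp only:)
qed

lemma bounded_continuous_compact_support:
  fixes f :: "'a::euclidean_space \<Rightarrow> real"
  assumes "continuous_on UNIV f" "\<And>x. r < norm x \<Longrightarrow> f x = 0"
  obtains B where "B > 0" "\<And>x. \<bar>f x\<bar> \<le> B"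
proof -
  have "bounded (f ` cball 0 r)"
    by (rule compact_imp_bounded, rule compact_continuous_image)
      (use assms(1) continuous_on_subset in auto)
  then obtain B where B: "B > 0" "\<And>x. x \<in> cball 0 r \<Longrightarrow> \<bar>f x\<bar> \<le> B"
    by (auto simp: bounded_pos)
  have "\<bar>f x\<bar> \<le> B" for x
    using B assms(2)[of x] by (cases "norm x \<le> r") auto
  with B show ?thesis using that by blast
qed

lemma partial_deriv_zero_outside:
  fixes f :: "'a::euclidean_space \<Rightarrow> real"
  assumes "\<And>x. r < norm x \<Longrightarrow> f x = 0" "r < norm x"
  shows "partial_deriv i f x = 0"
proof -
  have "open {x::'a. r < norm x}" by (intro open_Collect_less continuous_intros)
  then have "partial_deriv i f x = partial_deriv i (\<lambda>x. 0) x"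
    by (rule partial_deriv_cong) (use assms in auto)
  then show ?thesis by simp
qed

lemma lborel_integral_translate:
  fixes f :: "'a::euclidean_space \<Rightarrow> real"
  assumes "f \<in> borel_measurable borel"
  shows "(\<integral>x. f (x + c) \<partial>lborel) = integral\<^sup>L lborel f"
proof -
  have "integral\<^sup>L lborel f = integral\<^sup>L (distr lborel borel ((+) c)) f"
    by (simp only: lborel_distr_plus)
  also have "\<dots> = (\<integral>x. f (c + x) \<partial>lborel)"
    by (rule integral_distr) (use assms in auto)
  finally show ?thesis by (simp add: add.commute)
qed

text \<open>Limit of the integrals of difference quotients, which vanish by translation invariance.\<close>

lemma integral_partial_deriv_eq_0:
  fixes f :: "'a::euclidean_space \<Rightarrow> real"
  assumes f: "Ck_on 1 UNIV f" and supp: "\<And>x. r < norm x \<Longrightarrow> f x = 0" and i: "i \<in> Basis"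
  shows "integral\<^sup>L lborel (partial_deriv i f) = 0" "integral\<^sup>L lebesgue (partial_deriv i f) = 0"
proof -
  have dif: "f differentiable at x" for x using f by simp
  have cf: "continuous_on UNIV f" by (rule Ck_on_imp_continuous_on[OF f])
  have cg: "continuous_on UNIV (partial_deriv i f)" using f i by simp
  have mf[measurable]: "f \<in> borel_measurable borel"
    using cf by (rule borel_measurable_continuous_onI)
  have mg[measurable]: "partial_deriv i f \<in> borel_measurable borel"
    using cg by (rule borel_measurable_continuous_onI)
  have gs: "partial_deriv i f x = 0" if "r < norm x" for x
    by (rule partial_deriv_zero_outside[OF supp that])
  obtain B where B: "B > 0" "\<And>x. \<bar>partial_deriv i f x\<bar> \<le> B"
    using bounded_continuous_compact_support[OF cg gs] by blast
  define s where "s n x = (f (x + (1 / Suc n) *\<^sub>R i) - f x) / (1 / Suc n)" for n x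
  have int_f: "integrable lborel f" by (rule integrable_continuous_compact_support[OF cf supp])
  have int_fs: "integrable lborel (\<lambda>x. f (x + c))" for c
    by (rule integrable_continuous_compact_support[where r="r + norm c"])
      (use norm_triangle_ineq4[of "_ + c" c] supp in \<open>auto intro!: continuous_on_compose2[OF cf] continuous_intros, smt (verit) add_diff_cancel_right'\<close>)
  have s0: "integral\<^sup>L lborel (s n) = 0" for n
    unfolding s_def using int_f int_fs lborel_integral_translate[OF mf] by simp
  have lim: "(\<lambda>n. s n x) \<longlonglongrightarrow> partial_deriv i f x" for x
  proof -
    have "((\<lambda>t. f (x + t *\<^sub>R i)) has_real_derivative partial_deriv i f x) (at 0)"
      using DERIV_partial_deriv[of f x 0 i] dif by simp
    then have "((\<lambda>h. (f (x + h *\<^sub>R i) - f x) / h) \<longlongrightarrow> partial_deriv i f x) (at 0)"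
      by (simp add: DERIV_def)
    moreover have "filterlim (\<lambda>n. 1 / real (Suc n)) (at 0) sequentially"
      by (rule filterlim_atI, rule LIMSEQ_Suc[OF lim_1_over_n]) simp
    ultimately show ?thesis unfolding s_def by (rule filterlim_compose)
  qed
  \<comment> \<open>The mean value theorem turns the quotient into a derivative at a point at
    distance less than 1. Hence \<open>B\<close> bounds it, and the support grows by at most
    1.\<close>
  have bound: "\<bar>s n x\<bar> \<le> B * indicator (cball 0 (r + 1)) x" for n x
  proof -
    let ?h = "1 / real (Suc n)"
    have "\<exists>z::real. 0 < z \<and> z < ?h \<and>
        f (x + ?h *\<^sub>R i) - f (x + 0 *\<^sub>R i) = (?h - 0) * partial_deriv i f (x + z *\<^sub>R i)"
      by (rule MVT2) (auto intro!: DERIV_partial_deriv dif)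
    then obtain z where z: "0 < z" "z < ?h"
      "f (x + ?h *\<^sub>R i) - f x = ?h * partial_deriv i f (x + z *\<^sub>R i)" by auto
    then have s: "s n x = partial_deriv i f (x + z *\<^sub>R i)" by (simp add: s_def)
    show ?thesis
    proof (cases "norm x \<le> r + 1")
      case False
      have "z < 1" using z(2) by (smt (verit) divide_le_eq_1 of_nat_Suc of_nat_0_le_iff)
      then have "norm (z *\<^sub>R i) \<le> 1" using z(1) i by simp
      moreover have "norm x \<le> norm (x + z *\<^sub>R i) + norm (z *\<^sub>R i)"
        using norm_triangle_ineq4[of "x + z *\<^sub>R i" "z *\<^sub>R i"] by simp
      ultimately have "r < norm (x + z *\<^sub>R i)" using False by linarith
      then show ?thesis using gs s False by simp
    qed (use B s in simp)
  qed
  have "(\<lambda>n. integral\<^sup>L lborel (s n)) \<longlonglongrightarrow> integral\<^sup>L lborel (partial_deriv i f)"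
  proof (rule integral_dominated_convergence[where w="\<lambda>x. B * indicator (cball 0 (r + 1)) x"])
    show "s n \<in> borel_measurable lborel" for n unfolding s_def by measurable
    show "integrable lborel (\<lambda>x::'a. B * indicator (cball 0 (r + 1)) x)"
      by (intro integrable_mult_right integrable_real_indicator) (use emeasure_bounded_finite[of "cball (0::'a) (r + 1)"] in \<open>simp_all add: infinity_ennreal_def\<close>)
  qed (use lim bound in auto)
  then show "integral\<^sup>L lborel (partial_deriv i f) = 0" by (simp add: s0 LIMSEQ_const_iff)
  then show "integral\<^sup>L lebesgue (partial_deriv i f) = 0" by (simp add: lebesgue_integral_lborel)
qed

section \<open>Smooth bumps and the fundamental lemma of the calculus of variations\<close>

definition flat_exp :: "nat \<Rightarrow> real \<Rightarrow> real" where
  "flat_exp m s = (if s \<le> 0 then 0 else exp (- (1 / s)) / s ^ m)"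

lemma flat_exp_tendsto_0: "(flat_exp m \<longlongrightarrow> 0) (at 0)"
proof -
  have "((\<lambda>x::real. x ^ m / exp x) \<longlongrightarrow> 0) at_top" by (rule tendsto_power_div_exp_0)
  then have "((\<lambda>s::real. inverse s ^ m / exp (inverse s)) \<longlongrightarrow> 0) (at_right 0)"
    by (rule filterlim_compose[OF _ filterlim_inverse_at_top_right])
  then have "(flat_exp m \<longlongrightarrow> 0) (at_right 0)"
    by (rule Lim_transform_eventually)
      (auto simp: flat_exp_def eventually_at_filter exp_minus field_simps)
  moreover have "(flat_exp m \<longlongrightarrow> 0) (at_left 0)"
    by (rule tendsto_eventually) (auto simp: flat_exp_def eventually_at_filter)
  ultimately show ?thesis by (simp add: filterlim_at_split)
qed

text \<open>The family over all \<open>m\<close> is closed under differentiation up to linear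
  combinations, so smoothness of every member follows by a single induction with \<open>m\<close>
  arbitrary.\<close>

lemma DERIV_flat_exp:
  "(flat_exp m has_real_derivative flat_exp (m + 2) s - real m * flat_exp (m + 1) s) (at s)"
proof -
  consider "s < 0" | "s = 0" | "s > 0" by linarith
  then show ?thesis
  proof cases
    case 1
    have "((\<lambda>s. 0) has_real_derivative 0) (at s)" by simp
    then have "(flat_exp m has_real_derivative 0) (at s)"
      by (rule has_field_derivative_transform_within_open[where S="{..<0}"]) (use 1 in \<open>auto simp: flat_exp_def\<close>)
    then show ?thesis using 1 by (simp add: flat_exp_def)
  next
    case 2
    \<comment> \<open>At 0 the difference quotient is \<open>flat_exp (Suc m)\<close> itself, which
      tends to 0; the claimed derivative is 0 there as well.\<close>
    have "((\<lambda>h. flat_exp m h / h) \<longlongrightarrow> 0) (at 0)"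
      by (rule Lim_transform_eventually[OF flat_exp_tendsto_0[of "Suc m"]])
        (auto simp: flat_exp_def eventually_at_filter)
    then show ?thesis using 2 by (simp add: DERIV_def flat_exp_def)
  next
    case 3
    have "((\<lambda>s. exp (- (1 / s)) / s ^ m) has_real_derivative flat_exp (m + 2) s - real m * flat_exp (m + 1) s) (at s)"
      using 3 by (cases m, auto intro!: derivative_eq_intros simp: flat_exp_def field_simps power2_eq_square)
        (metis One_nat_def Suc_pred gr0I power_Suc)
    then show ?thesis
      by (rule has_field_derivative_transform_within_open[where S="{0<..}"]) (use 3 in \<open>auto simp: flat_exp_def\<close>)
  qed
qed

lemma Ck_on_flat_exp:
  "Ck_on k UNIV (\<lambda>x::'a::euclidean_space. flat_exp m (c * (x \<bullet> j) + d))"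
proof (induction k arbitrary: m)
  case 0
  have "continuous_on UNIV (flat_exp m)"
    using DERIV_isCont[OF DERIV_flat_exp] by (intro continuous_at_imp_continuous_on) auto
  then show ?case by (auto intro!: continuous_on_compose2[of UNIV "flat_exp m"] continuous_intros)
next
  case (Suc k)
  have L: "Ck_on (Suc k) UNIV (\<lambda>x::'a. c * (x \<bullet> j) + d)"
    by (intro Ck_on_add Ck_on_const Ck_on_linear bounded_linear_const_mult bounded_linear_inner_left) simp_all
  show ?case
    by (rule Ck_on_compose[OF _ L DERIV_flat_exp])
      (auto intro!: Ck_on_diff Ck_on_cmult Suc)
qed

text \<open>For s > 0 the value \<open>flat_exp 0\<close> at (n + 1) s is exp (-1 / ((n + 1) s)),
  which tends to 1. The product over both faces in every coordinate therefore tends to the indicator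
  of the open box, with values in [0, 1] and without any mollification.\<close>

definition box_bump :: "'a::euclidean_space \<Rightarrow> 'a \<Rightarrow> nat \<Rightarrow> 'a \<Rightarrow> real" where
  "box_bump a b n x = (\<Prod>j\<in>Basis. flat_exp 0 (Suc n * (x \<bullet> j) + - (Suc n * (a \<bullet> j))) *
     flat_exp 0 (- Suc n * (x \<bullet> j) + Suc n * (b \<bullet> j)))"

lemma flat_exp_0_nonneg: "0 \<le> flat_exp 0 s" "flat_exp 0 s \<le> 1"
  by (auto simp: flat_exp_def)

lemma box_bump_range: "0 \<le> box_bump a b n x" "box_bump a b n x \<le> 1"
  unfolding box_bump_def
  by (auto intro!: prod_nonneg prod_le_1 mult_nonneg_nonneg mult_le_one simp: flat_exp_0_nonneg)

lemma box_bump_outside: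
  assumes "x \<notin> box a b"
  shows "box_bump a b n x = 0"
proof -
  from assms obtain j where j: "j \<in> Basis" "x \<bullet> j \<le> a \<bullet> j \<or> b \<bullet> j \<le> x \<bullet> j"
    by (auto simp: mem_box not_less)
  have "real (Suc n) * (x \<bullet> j) + - (Suc n * (a \<bullet> j)) \<le> 0 \<or> - real (Suc n) * (x \<bullet> j) + Suc n * (b \<bullet> j) \<le> 0"
    using j(2)
  proof
    assume "x \<bullet> j \<le> a \<bullet> j"
    from mult_left_mono[OF this, of "real (Suc n)"] show ?thesis by (simp only: mult_minus_left) simp
  next
    assume "b \<bullet> j \<le> x \<bullet> j"
    from mult_left_mono[OF this, of "real (Suc n)"] show ?thesis by (simp add: algebra_simps)
  qed
  then show ?thesis unfolding box_bump_def
    by (intro prod_zero) (use j(1) in \<open>auto simp: flat_exp_def intro!: bexI[of _ j]\<close>)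
qed

lemma box_bump_tendsto: "(\<lambda>n. box_bump a b n x) \<longlonglongrightarrow> indicator (box a b) x"
proof (cases "x \<in> box a b")
  case True
  have *: "(\<lambda>n. flat_exp 0 (real (Suc n) * s)) \<longlonglongrightarrow> 1" if "s > 0" for s
  proof -
    have "(\<lambda>n. exp (- (1 / real (Suc n) * (1 / s)))) \<longlonglongrightarrow> exp (- (0 * (1 / s)))"
      by (intro tendsto_intros LIMSEQ_Suc[OF lim_1_over_n])
    then show ?thesis using that by (simp add: flat_exp_def mult_le_0_iff)
  qed
  have "(\<lambda>n. flat_exp 0 (Suc n * (x \<bullet> j) + - (Suc n * (a \<bullet> j))) * flat_exp 0 (- Suc n * (x \<bullet> j) + Suc n * (b \<bullet> j))) \<longlonglongrightarrow> 1 * 1"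
    if "j \<in> Basis" for j
  proof (rule tendsto_mult)
    show "(\<lambda>n. flat_exp 0 (Suc n * (x \<bullet> j) + - (Suc n * (a \<bullet> j)))) \<longlonglongrightarrow> 1"
      using *[of "x \<bullet> j - a \<bullet> j"] True that by (simp add: mem_box algebra_simps)
    show "(\<lambda>n. flat_exp 0 (- Suc n * (x \<bullet> j) + Suc n * (b \<bullet> j))) \<longlonglongrightarrow> 1"
      using *[of "b \<bullet> j - x \<bullet> j"] True that by (simp add: mem_box algebra_simps)
  qed
  then have "(\<lambda>n. box_bump a b n x) \<longlonglongrightarrow> (\<Prod>j\<in>(Basis::'a set). 1 * 1)"
    unfolding box_bump_def by (rule tendsto_prod)
  then show ?thesis using True by simp
qed (simp add: box_bump_outside)

lemma smooth_box_bump: "smooth_on UNIV (box_bump a b n)"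
  unfolding smooth_on_def box_bump_def[abs_def]
  by (intro allI Ck_on_prod Ck_on_mult Ck_on_flat_exp) simp_all

lemma box_bump_Cc_infinity:
  assumes "cbox a b \<subseteq> \<Omega>"
  shows "box_bump a b n \<in> Cc_infinity \<Omega>"
proof -
  have "{x. box_bump a b n x \<noteq> 0} \<subseteq> cbox a b" using box_bump_outside[of _ a b n] box_subset_cbox by blast
  then have *: "closure {x. box_bump a b n x \<noteq> 0} \<subseteq> cbox a b" by (rule closure_minimal) (rule closed_cbox)
  then have "compact (closure {x. box_bump a b n x \<noteq> 0})"
    by (meson bounded_cbox bounded_subset closed_closure compact_eq_bounded_closed)
  with * assms show ?thesis unfolding Cc_infinity_def by (auto simp: smooth_box_bump)
qed

text \<open>The bumps lie in [0, 1] and vanish off the box, so \<open>w\<close> restricted to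
  \<open>cbox a b\<close> dominates. Local integrability speaks about compact sets, hence the demand
  that the closed box lie in the domain.\<close>

lemma box_integral_eq_0:
  fixes w :: "'a::euclidean_space \<Rightarrow> real"
  assumes w: "locally_integrable \<Omega> w"
    and eq: "\<And>\<psi>. \<psi> \<in> Cc_infinity \<Omega> \<Longrightarrow> (LINT x:\<Omega>|lebesgue. w x * \<psi> x) = 0"
    and ab: "cbox a b \<subseteq> \<Omega>"
  shows "set_lebesgue_integral lebesgue (box a b) w = 0"
proof -
  have int: "integrable lebesgue (\<lambda>x. indicator (cbox a b) x * w x)"
    using w ab by (auto simp: locally_integrable_def set_integrable_def)
  have [measurable]: "(\<lambda>x. indicator (cbox a b) x * w x) \<in> borel_measurable lebesgue"
    using int by simp
  have [measurable]: "box_bump a b n \<in> borel_measurable lebesgue" for n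
  proof -
    have "continuous_on UNIV (box_bump a b n)"
      using smooth_box_bump[of a b n] Ck_on_imp_continuous_on unfolding smooth_on_def by blast
    then show ?thesis by (intro measurable_completion) (simp add: borel_measurable_continuous_onI) 
  qed
  have eqi: "indicator \<Omega> x * (w x * box_bump a b n x) = indicator (cbox a b) x * w x * box_bump a b n x" for x n
    using ab box_bump_outside[of x a b n] box_subset_cbox[of a b]
    by (cases "x \<in> box a b") (auto simp: indicator_def)
  have "(\<lambda>n. \<integral>x. indicator (cbox a b) x * w x * box_bump a b n x \<partial>lebesgue) \<longlonglongrightarrow>
      (\<integral>x. indicator (cbox a b) x * w x * indicator (box a b) x \<partial>lebesgue)"
  proof (rule integral_dominated_convergence[where w="\<lambda>x. \<bar>indicator (cbox a b) x * w x\<bar>"])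
    show "AE x in lebesgue. (\<lambda>n. indicator (cbox a b) x * w x * box_bump a b n x) \<longlonglongrightarrow>
        indicator (cbox a b) x * w x * indicator (box a b) x"
      by (intro AE_I2 tendsto_intros box_bump_tendsto)
    show "AE x in lebesgue. norm (indicator (cbox a b) x * w x * box_bump a b n x) \<le> \<bar>indicator (cbox a b) x * w x\<bar>" for n
      by (intro AE_I2) (simp add: abs_mult box_bump_range mult_left_le)
    show "(\<lambda>x. indicator (cbox a b) x * w x * indicator (box a b) x) \<in> borel_measurable lebesgue"
      by (intro borel_measurable_times[where f="\<lambda>x. indicator (cbox a b) x * w x"] borel_measurable_indicator) simp_all
    show "(\<lambda>x. indicator (cbox a b) x * w x * box_bump a b n x) \<in> borel_measurable lebesgue" for n
      by measurable
  qed (use int in auto)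
  moreover have "(\<integral>x. indicator (cbox a b) x * w x * box_bump a b n x \<partial>lebesgue) = 0" for n
    using eq[OF box_bump_Cc_infinity[OF ab, of n]]
    by (simp add: set_lebesgue_integral_def eqi)
  ultimately have "(\<integral>x. indicator (cbox a b) x * w x * indicator (box a b) x \<partial>lebesgue) = 0"
    by (simp add: LIMSEQ_const_iff)
  moreover have "indicator (cbox a b) x * w x * indicator (box a b) x = indicator (box a b) x * w x" for x
    using box_subset_cbox[of a b] by (auto simp: indicator_def)
  ultimately show ?thesis by (simp add: set_lebesgue_integral_def)
qed

text \<open>Boxes are stable under intersection and generate the Borel sets, so the vanishing
  spreads to all Borel sets by a Dynkin argument; the total integral 0 serves the complement step. A
  Lebesgue set differs from a Borel set by a null set, and a function whose integral over every
  measurable set is 0 vanishes almost everywhere.\<close>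

lemma AE_eq_0_if_box_integrals_eq_0:
  fixes f :: "'a::euclidean_space \<Rightarrow> real"
  assumes f: "integrable lebesgue f" and f0: "integral\<^sup>L lebesgue f = 0"
    and box: "\<And>a b. set_lebesgue_integral lebesgue (box a b) f = 0"
  shows "AE x in lebesgue. f x = 0"
proof (rule density_unique_real[OF f integrable_zero])
  have si: "set_integrable lebesgue A f" if "A \<in> sets lebesgue" for A
    using f that unfolding set_integrable_def by (rule integrable_mult_indicator[rotated])
  fix A :: "'a set" assume "A \<in> sets lebesgue"
  then obtain S N N' where S: "A = S \<union> N" "S \<in> sets lborel" "N' \<in> null_sets lborel" "N \<subseteq> N'"
    by (auto elim: sets_completionE)
  have sig: "S \<in> sigma_sets UNIV (range (\<lambda>(a, b). box a b :: 'a set))"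
    using S(2) by (simp add: borel_eq_box)
  have int: "Int_stable (range (\<lambda>(a, b). box a b :: 'a set))"
    by (auto simp: Int_stable_def box_Int_box)
  have "S \<in> sets borel \<and> set_lebesgue_integral lebesgue S f = 0"
  proof (induction rule: sigma_sets_induct_disjoint[OF int _ sig, case_names closed basic empty compl union])
    case closed
    then show ?case by simp
  next
    case (basic A)
    then show ?case using box by auto
  next
    case empty
    then show ?case by (simp add: set_lebesgue_integral_def)
  next
    case (compl A)
    then have "A \<in> sets lebesgue" by simp
    then have "set_lebesgue_integral lebesgue (A \<union> (UNIV - A)) f =
        set_lebesgue_integral lebesgue A f + set_lebesgue_integral lebesgue (UNIV - A) f"
      by (intro set_integral_Un si) auto
    then show ?case using compl f0 by (simp add: set_lebesgue_integral_def) auto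
  next
    case (union A)
    then have "set_lebesgue_integral lebesgue (\<Union>i. A i) f = (\<Sum>i. set_lebesgue_integral lebesgue (A i) f)"
      by (intro lebesgue_integral_countable_add si) (auto simp: disjoint_family_on_def intro!: sets.countable_UN)
    then show ?case using union by auto
  qed
  moreover have "set_lebesgue_integral lebesgue A f = set_lebesgue_integral lebesgue S f"
    unfolding set_lebesgue_integral_def
  proof (rule integral_cong_AE)
    have "AE x in lborel. x \<notin> N'" using S(3) by (rule AE_not_in)
    then have "AE x in lebesgue. x \<notin> N'" by (rule AE_completion)
    then show "AE x in lebesgue. indicator A x *\<^sub>R f x = indicator S x *\<^sub>R f x"
      by eventually_elim (use S in \<open>auto simp: indicator_def\<close>)
  qed (use si[of A] si[of S] S(2) \<open>A \<in> sets lebesgue\<close> in \<open>auto simp: set_integrable_def\<close>)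
  ultimately show "set_lebesgue_integral lebesgue A f = set_lebesgue_integral lebesgue A (\<lambda>x. 0)"
    by (simp add: set_lebesgue_integral_def)
qed

text \<open>An open set is a countable union of closed boxes. On each of them \<open>w\<close> is
  cut off by the open box, so that the result is integrable on the whole space; the faces are
  negligible.\<close>

lemma AE_eq_0_if_Cc_infinity_integrals_eq_0:
  fixes w :: "'a::euclidean_space \<Rightarrow> real"
  assumes \<Omega>: "open \<Omega>" and w: "locally_integrable \<Omega> w"
    and eq: "\<And>\<psi>. \<psi> \<in> Cc_infinity \<Omega> \<Longrightarrow> (LINT x:\<Omega>|lebesgue. w x * \<psi> x) = 0"
  shows "AE x in lebesgue. x \<in> \<Omega> \<longrightarrow> w x = 0"
proof -
  have box0: "set_lebesgue_integral lebesgue (box a b) w = 0" if "cbox a b \<subseteq> \<Omega>" for a b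
    by (rule box_integral_eq_0[OF w _ that]) (rule eq)
  have cb: "AE x in lebesgue. x \<in> cbox c d \<longrightarrow> w x = 0" if cd: "cbox c d \<subseteq> \<Omega>" for c d
  proof -
    let ?f = "\<lambda>x. indicator (box c d) x * w x"
    have "set_integrable lebesgue (cbox c d) w"
      using w cd by (auto simp: locally_integrable_def)
    then have "set_integrable lebesgue (box c d) w"
      by (rule set_integrable_subset) (auto simp: box_subset_cbox)
    then have f: "integrable lebesgue ?f" by (simp add: set_integrable_def)
    have f0: "integral\<^sup>L lebesgue ?f = 0" using box0[OF cd] by (simp add: set_lebesgue_integral_def)
    have "set_lebesgue_integral lebesgue (box a b) ?f = 0" for a b
    proof -
      obtain a' b' where ab: "box a b \<inter> box c d = box a' b'" by (simp add: box_Int_box)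
      have "indicator (box a b) x *\<^sub>R ?f x = indicator (box a' b') x *\<^sub>R w x" for x
        unfolding ab[symmetric] by (auto simp: indicator_def)
      moreover have "set_lebesgue_integral lebesgue (box a' b') w = 0"
      \<comment> \<open>When the open box is empty, \<open>cbox a' b'\<close> can still be nonempty
        and leave the domain. Only a nonempty open box has \<open>cbox a' b'\<close> as its
        closure.\<close>
      proof (cases "box a' b' = {}")
        case True
        then show ?thesis by (simp add: set_lebesgue_integral_def)
      next
        case False
        have "cbox a' b' = closure (box a' b')" using False by (simp add: closure_box)
        also have "\<dots> \<subseteq> closure (cbox c d)" using ab box_subset_cbox[of c d] by (intro closure_mono) auto
        finally show ?thesis using cd by (intro box0) auto
      qed
      ultimately show ?thesis by (simp only: set_lebesgue_integral_def)
    qed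
    from AE_eq_0_if_box_integrals_eq_0[OF f f0 this]
    have "AE x in lebesgue. ?f x = 0" .
    moreover have "AE x in lebesgue. x \<notin> cbox c d - box c d"
    proof -
      have "negligible (cbox c d - box c d)" by (rule negligible_frontier_interval)
      then show ?thesis unfolding negligible_iff_null_sets by (rule AE_not_in)
    qed
    ultimately show ?thesis by eventually_elim auto
  qed
  obtain \<D> where D: "countable \<D>" "\<D> \<subseteq> Pow \<Omega>" "\<And>X. X \<in> \<D> \<Longrightarrow> \<exists>a b. X = cbox a b" "\<Union>\<D> = \<Omega>"
    using open_countable_Union_open_cbox[OF \<Omega>] by metis
  have "AE x in lebesgue. \<forall>X\<in>\<D>. x \<in> X \<longrightarrow> w x = 0"
    unfolding AE_ball_countable[OF D(1)] using D(2,3) cb by blast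
  then show ?thesis by eventually_elim (use D(4) in blast)
qed

section \<open>Weak derivatives and Sobolev functions\<close>

lemma Cc_infinity_D:
  assumes "\<psi> \<in> Cc_infinity \<Omega>"
  shows "Ck_on k UNIV \<psi>" "x \<notin> \<Omega> \<Longrightarrow> \<psi> x = 0" "x \<notin> \<Omega> \<Longrightarrow> partial_deriv i \<psi> x = 0"
    "\<exists>r. \<forall>x. r < norm x \<longrightarrow> \<psi> x = 0"
proof -
  let ?K = "closure {x. \<psi> x \<noteq> 0}"
  have K: "compact ?K" "?K \<subseteq> \<Omega>" and sm: "smooth_on UNIV \<psi>"
    using assms by (auto simp: Cc_infinity_def)
  show "Ck_on k UNIV \<psi>" using sm by (simp add: smooth_on_def)
  have z: "\<psi> x = 0" if "x \<notin> ?K" for x using that closure_subset[of "{x. \<psi> x \<noteq> 0}"] by blast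
  show "\<psi> x = 0" if "x \<notin> \<Omega>" by (rule z) (use K(2) that in blast)
  show "partial_deriv i \<psi> x = 0" if "x \<notin> \<Omega>"
  proof -
    have "partial_deriv i \<psi> x = partial_deriv i (\<lambda>x. 0) x"
      by (rule partial_deriv_cong[of "- ?K"], simp only: open_Compl closed_closure) (use K that in blast, use z in blast)
    then show ?thesis by simp
  qed
  from compact_imp_bounded[OF K(1)] obtain r where "\<And>x. x \<in> ?K \<Longrightarrow> norm x \<le> r"
    by (auto simp: bounded_iff)
  then show "\<exists>r. \<forall>x. r < norm x \<longrightarrow> \<psi> x = 0" using z by (meson not_le)
qed

text \<open>A continuous function vanishing off a compact set is bounded, so a multiple of |g|
  restricted to that set dominates the product.\<close>

lemma set_integrable_locally_integrable_mult:
  assumes g: "locally_integrable \<Omega> g" and K: "compact K" "K \<subseteq> \<Omega>"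
    and h: "continuous_on UNIV h" "\<And>x. x \<notin> K \<Longrightarrow> h x = 0"
  shows "set_integrable lebesgue \<Omega> (\<lambda>x. g x * h x)"
proof -
  have g': "integrable lebesgue (\<lambda>x. indicator K x * g x)"
    using g K by (auto simp: locally_integrable_def set_integrable_def)
  obtain r where r: "\<And>x. x \<in> K \<Longrightarrow> norm x \<le> r" using compact_imp_bounded[OF K(1)] by (auto simp: bounded_iff)
  obtain B where B: "B > 0" "\<And>x. \<bar>h x\<bar> \<le> B"
    by (rule bounded_continuous_compact_support[OF h(1), of r]) (use h(2) r in force)+
  have [measurable]: "h \<in> borel_measurable lebesgue"
    using h(1) by (intro measurable_completion) (simp add: borel_measurable_continuous_onI)
  have [measurable]: "(\<lambda>x. indicator K x * g x) \<in> borel_measurable lebesgue" using g' by simp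
  have "integrable lebesgue (\<lambda>x. (indicator K x * g x) * h x)"
  proof (rule Bochner_Integration.integrable_bound)
    show "integrable lebesgue (\<lambda>x. B * (indicator K x * g x))" using g' by simp
    show "AE x in lebesgue. norm ((indicator K x * g x) * h x) \<le> norm (B * (indicator K x * g x))"
      using B by (intro AE_I2) (simp add: abs_mult, subst mult.commute, intro mult_right_mono, auto)
  qed (intro borel_measurable_times[where f="\<lambda>x. indicator K x * g x"]; fact)
  moreover have "indicator \<Omega> x *\<^sub>R (g x * h x) = (indicator K x * g x) * h x" for x
    using h(2)[of x] K(2) by (auto simp: indicator_def)
  ultimately show ?thesis by (simp only: set_integrable_def)
qed

lemma set_integrable_locally_integrable_Cc:
  assumes g: "locally_integrable \<Omega> g" and \<psi>: "\<psi> \<in> Cc_infinity \<Omega>"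
  shows "set_integrable lebesgue \<Omega> (\<lambda>x. g x * \<psi> x)"
    and "i \<in> Basis \<Longrightarrow> set_integrable lebesgue \<Omega> (\<lambda>x. g x * partial_deriv i \<psi> x)"
proof -
  let ?K = "closure {x. \<psi> x \<noteq> 0}"
  have K: "compact ?K" "?K \<subseteq> \<Omega>" using \<psi> by (auto simp: Cc_infinity_def)
  have z: "\<psi> x = 0" if "x \<notin> ?K" for x using that closure_subset[of "{x. \<psi> x \<noteq> 0}"] by blast
  have z': "partial_deriv i \<psi> x = 0" if "x \<notin> ?K" for x i
  proof -
    have "partial_deriv i \<psi> x = partial_deriv i (\<lambda>x. 0) x"
      by (rule partial_deriv_cong[of "- ?K"], simp only: open_Compl closed_closure) (use that in blast, use z in blast)
    then show ?thesis by simp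
  qed
  show "set_integrable lebesgue \<Omega> (\<lambda>x. g x * \<psi> x)"
    using set_integrable_locally_integrable_mult[OF g K Ck_on_imp_continuous_on[OF Cc_infinity_D(1)[OF \<psi>, of 0]] z] .
  show "set_integrable lebesgue \<Omega> (\<lambda>x. g x * partial_deriv i \<psi> x)" if "i \<in> Basis"
    using that Cc_infinity_D(1)[OF \<psi>, of 1]
    by (intro set_integrable_locally_integrable_mult[OF g K _ z']) auto
qed

lemma locally_integrable_diff:
  "locally_integrable \<Omega> f \<Longrightarrow> locally_integrable \<Omega> g \<Longrightarrow> locally_integrable \<Omega> (\<lambda>x. f x - g x)"
  by (auto simp: locally_integrable_def)

lemma has_weak_partial_diff:
  assumes "has_weak_partial \<Omega> i f g" "has_weak_partial \<Omega> i f' g'" "i \<in> Basis"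
  shows "has_weak_partial \<Omega> i (\<lambda>x. f x - f' x) (\<lambda>x. g x - g' x)"
  using assms
  by (auto simp: has_weak_partial_def left_diff_distrib set_integrable_locally_integrable_Cc
      intro!: locally_integrable_diff)

lemma has_weak_partial_unique:
  assumes "open \<Omega>" "has_weak_partial \<Omega> i f g" "has_weak_partial \<Omega> i f h"
  shows "AE x in lebesgue. x \<in> \<Omega> \<longrightarrow> g x = h x"
proof -
  have "AE x in lebesgue. x \<in> \<Omega> \<longrightarrow> g x - h x = 0"
  proof (rule AE_eq_0_if_Cc_infinity_integrals_eq_0[OF assms(1)])
    show "locally_integrable \<Omega> (\<lambda>x. g x - h x)"
      using assms by (auto simp: has_weak_partial_def intro: locally_integrable_diff)
    show "(LINT x:\<Omega>|lebesgue. (g x - h x) * \<psi> x) = 0" if "\<psi> \<in> Cc_infinity \<Omega>" for \<psi>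
    proof -
      have "(LINT x:\<Omega>|lebesgue. (g x - h x) * \<psi> x) = (LINT x:\<Omega>|lebesgue. g x * \<psi> x) - (LINT x:\<Omega>|lebesgue. h x * \<psi> x)"
        unfolding left_diff_distrib
        using assms that by (intro set_integral_diff set_integrable_locally_integrable_Cc) (auto simp: has_weak_partial_def)
      moreover have "- (LINT x:\<Omega>|lebesgue. g x * \<psi> x) = - (LINT x:\<Omega>|lebesgue. h x * \<psi> x)"
        using assms that unfolding has_weak_partial_def by metis
      ultimately show ?thesis by simp
    qed
  qed
  then show ?thesis by eventually_elim simp
qed

lemma locally_integrable_continuous:
  assumes "continuous_on UNIV (f :: 'a::euclidean_space \<Rightarrow> real)"
  shows "locally_integrable \<Omega> f"
  unfolding locally_integrable_def
proof (intro allI impI)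
  fix K :: "'a set" assume "compact K \<and> K \<subseteq> \<Omega>"
  then have "integrable lborel (\<lambda>x. indicator K x *\<^sub>R f x)"
    using assms by (intro borel_integrable_compact) (auto intro: continuous_on_subset)
  then show "set_integrable lebesgue K f"
    unfolding set_integrable_def by (rule integrable_lebesgue_lborel)
qed

lemma continuous_set_borel_measurable:
  assumes "continuous_on UNIV (f :: 'a::euclidean_space \<Rightarrow> real)"
  shows "f \<in> borel_measurable lebesgue"
  using assms by (intro measurable_completion) (simp add: borel_measurable_continuous_onI)

lemma integrable_continuous_compact_support_lebesgue:
  fixes f :: "'a::euclidean_space \<Rightarrow> real"
  assumes "continuous_on UNIV f" "\<And>x. r < norm x \<Longrightarrow> f x = 0"
  shows "integrable lebesgue f"
  by (rule integrable_lebesgue_lborel, rule integrable_continuous_compact_support[OF assms])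

lemma set_integral_eq_integral:
  fixes f :: "'a::euclidean_space \<Rightarrow> real"
  assumes "\<And>x. x \<notin> \<Omega> \<Longrightarrow> f x = 0"
  shows "(LINT x:\<Omega>|lebesgue. f x) = integral\<^sup>L lebesgue f"
    "set_integrable lebesgue \<Omega> f = integrable lebesgue f"
    "set_borel_measurable lebesgue \<Omega> f = (f \<in> borel_measurable lebesgue)"
proof -
  have "indicator \<Omega> x *\<^sub>R f x = f x" for x using assms[of x] by (cases "x \<in> \<Omega>") auto
  then show "(LINT x:\<Omega>|lebesgue. f x) = integral\<^sup>L lebesgue f"
    "set_integrable lebesgue \<Omega> f = integrable lebesgue f"
    "set_borel_measurable lebesgue \<Omega> f = (f \<in> borel_measurable lebesgue)"
    by (simp_all only: set_lebesgue_integral_def set_integrable_def set_borel_measurable_def)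
qed

lemma L2_Cc_infinity:
  assumes \<psi>: "\<psi> \<in> Cc_infinity \<Omega>"
  shows "L2 \<Omega> \<psi>" "i \<in> Basis \<Longrightarrow> L2 \<Omega> (partial_deriv i \<psi>)"
proof -
  note d = Cc_infinity_D[OF \<psi>]
  obtain r where r: "\<And>x. r < norm x \<Longrightarrow> \<psi> x = 0" using d(4) by blast
  have c: "continuous_on UNIV \<psi>" using d(1)[of 0] by simp
  show "L2 \<Omega> \<psi>" unfolding L2_def using d(2) r
    by (auto simp: set_integral_eq_integral continuous_set_borel_measurable[OF c]
       intro!: integrable_continuous_compact_support_lebesgue[of _ r] continuous_intros c)
  assume i: "i \<in> Basis"
  then have c: "continuous_on UNIV (partial_deriv i \<psi>)" using d(1)[of 1] by simp
  show "L2 \<Omega> (partial_deriv i \<psi>)" unfolding L2_def using d(3) partial_deriv_zero_outside[OF r]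
    by (auto simp: set_integral_eq_integral continuous_set_borel_measurable[OF c]
       intro!: integrable_continuous_compact_support_lebesgue[of _ r] continuous_intros c)
qed

text \<open>Integration by parts: the classical derivative of the compactly supported product
  \<open>v x * \<psi> x\<close> has integral 0.\<close>

lemma has_weak_partial_Cc_infinity:
  assumes v: "v \<in> Cc_infinity \<Omega>" and i: "i \<in> Basis"
  shows "has_weak_partial \<Omega> i v (partial_deriv i v)"
  unfolding has_weak_partial_def
proof (intro conjI ballI)
  note d = Cc_infinity_D[OF v]
  have c: "continuous_on UNIV v" "continuous_on UNIV (partial_deriv i v)"
    using d(1)[of 0] d(1)[of 1] i by auto
  show "locally_integrable \<Omega> v" "locally_integrable \<Omega> (partial_deriv i v)"
    using c by (auto intro: locally_integrable_continuous)
  fix \<psi> assume psi: "\<psi> \<in> Cc_infinity \<Omega>"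
  note e = Cc_infinity_D[OF psi]
  obtain r where r: "\<And>x. r < norm x \<Longrightarrow> v x = 0" using d(4) by blast
  have vp: "Ck_on 1 UNIV (\<lambda>x. v x * \<psi> x)" by (intro Ck_on_mult d e) simp
  have "partial_deriv i (\<lambda>x. v x * \<psi> x) = (\<lambda>x. v x * partial_deriv i \<psi> x + partial_deriv i v x * \<psi> x)"
    using partial_deriv_mult[of v _ \<psi> i] d(1)[of 1] e(1)[of 1] by auto
  moreover have "integral\<^sup>L lebesgue (partial_deriv i (\<lambda>x. v x * \<psi> x)) = 0"
    by (rule integral_partial_deriv_eq_0[OF vp _ i, of r]) (simp add: r)
  moreover have "integrable lebesgue (\<lambda>x. v x * partial_deriv i \<psi> x)"
      "integrable lebesgue (\<lambda>x. partial_deriv i v x * \<psi> x)"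
    using set_integrable_locally_integrable_Cc[OF locally_integrable_continuous[OF c(1)] psi]
      set_integrable_locally_integrable_Cc(1)[OF locally_integrable_continuous[OF c(2)] psi] i d e
    by (simp_all add: set_integral_eq_integral)
  ultimately show "(LINT x:\<Omega>|lebesgue. v x * partial_deriv i \<psi> x) = - (LINT x:\<Omega>|lebesgue. partial_deriv i v x * \<psi> x)"
    using d e by (simp add: set_integral_eq_integral)
qed

text \<open>\<open>weak_partial\<close> is a choice among functions that agree only almost
  everywhere. Completeness of the Lebesgue measure carries measurability and integrals from one
  representative to another.\<close>

lemma L2_AE_cong:
  assumes "L2 \<Omega> f" "AE x in lebesgue. x \<in> \<Omega> \<longrightarrow> f x = g x"
  shows "L2 \<Omega> g" and "(LINT x:\<Omega>|lebesgue. (f x)\<^sup>2) = (LINT x:\<Omega>|lebesgue. (g x)\<^sup>2)"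
proof -
  have 1: "AE x in lebesgue. indicator \<Omega> x *\<^sub>R f x = indicator \<Omega> x *\<^sub>R g x"
    using assms(2) by eventually_elim (auto simp: indicator_def)
  have 2: "AE x in lebesgue. indicator \<Omega> x *\<^sub>R (f x)\<^sup>2 = indicator \<Omega> x *\<^sub>R (g x)\<^sup>2"
    using assms(2) by eventually_elim (auto simp: indicator_def)
  have i: "integrable lebesgue (\<lambda>x. indicator \<Omega> x *\<^sub>R (f x)\<^sup>2)"
    using assms(1) by (auto simp: L2_def set_integrable_def)
  have m: "(\<lambda>x. indicator \<Omega> x *\<^sub>R (g x)\<^sup>2) \<in> borel_measurable lebesgue"
    by (rule borel_measurable_AE[OF _ 2]) (use i in simp)
  have "(\<lambda>x. indicator \<Omega> x *\<^sub>R g x) \<in> borel_measurable lebesgue"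
    by (rule borel_measurable_AE[OF _ 1]) (use assms(1) in \<open>simp add: L2_def set_borel_measurable_def\<close>)
  moreover have "integrable lebesgue (\<lambda>x. indicator \<Omega> x *\<^sub>R (g x)\<^sup>2)"
    by (rule integrable_cong_AE_imp[OF i m]) (use 2 in \<open>auto elim: eventually_mono\<close>)
  ultimately show "L2 \<Omega> g" by (simp add: L2_def set_borel_measurable_def set_integrable_def)
  show "(LINT x:\<Omega>|lebesgue. (f x)\<^sup>2) = (LINT x:\<Omega>|lebesgue. (g x)\<^sup>2)"
    unfolding set_lebesgue_integral_def using i m 2 by (intro integral_cong_AE) auto
qed

lemma L2_mult:
  assumes "L2 \<Omega> f" "L2 \<Omega> g"
  shows "set_integrable lebesgue \<Omega> (\<lambda>x. f x * g x)"
  unfolding set_integrable_def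
proof (rule Bochner_Integration.integrable_bound)
  show "integrable lebesgue (\<lambda>x. indicator \<Omega> x *\<^sub>R (f x)\<^sup>2 + indicator \<Omega> x *\<^sub>R (g x)\<^sup>2)"
    using assms by (intro Bochner_Integration.integrable_add) (auto simp: L2_def set_integrable_def)
  have "(\<lambda>x. (indicator \<Omega> x *\<^sub>R f x) * (indicator \<Omega> x *\<^sub>R g x)) \<in> borel_measurable lebesgue"
    using assms by (intro borel_measurable_times) (auto simp: L2_def set_borel_measurable_def)
  moreover have "(indicator \<Omega> x *\<^sub>R f x) * (indicator \<Omega> x *\<^sub>R g x) = indicator \<Omega> x *\<^sub>R (f x * g x)" for x
    by (simp add: indicator_def)
  ultimately show "(\<lambda>x. indicator \<Omega> x *\<^sub>R (f x * g x)) \<in> borel_measurable lebesgue" by (simp only:)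
  have "\<bar>f x * g x\<bar> \<le> (f x)\<^sup>2 + (g x)\<^sup>2" for x
  proof -
    have "0 \<le> \<bar>f x\<bar> * \<bar>g x\<bar>" by simp
    moreover have "0 \<le> (\<bar>f x\<bar> - \<bar>g x\<bar>)\<^sup>2" by simp
    ultimately show ?thesis unfolding abs_mult power2_diff power2_abs by linarith
  qed
  then show "AE x in lebesgue. norm (indicator \<Omega> x *\<^sub>R (f x * g x)) \<le> norm (indicator \<Omega> x *\<^sub>R (f x)\<^sup>2 + indicator \<Omega> x *\<^sub>R (g x)\<^sup>2)"
    by (intro AE_I2) (auto simp: indicator_def)
qed

lemma L2_add_diff:
  assumes "L2 \<Omega> f" "L2 \<Omega> g"
  shows "L2 \<Omega> (\<lambda>x. f x - g x)" "L2 \<Omega> (\<lambda>x. f x + g x)"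
proof -
  have *: "set_integrable lebesgue \<Omega> (\<lambda>x. (f x)\<^sup>2 + (g x)\<^sup>2)" "set_integrable lebesgue \<Omega> (\<lambda>x. 2 * (f x * g x))"
    using assms L2_mult[OF assms] by (auto simp: L2_def)
  have "set_borel_measurable lebesgue \<Omega> (\<lambda>x. f x - g x)" "set_borel_measurable lebesgue \<Omega> (\<lambda>x. f x + g x)"
    using assms by (auto simp: L2_def set_borel_measurable_def scaleR_right_diff_distrib scaleR_right_distrib
        simp del: real_scaleR_def)
  with set_integral_diff(1)[OF *] set_integral_add(1)[OF *]
  show "L2 \<Omega> (\<lambda>x. f x - g x)" "L2 \<Omega> (\<lambda>x. f x + g x)"
    by (simp_all add: L2_def power2_diff power2_sum mult.assoc)
qed

lemma L2_square_triangle: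
  assumes "L2 \<Omega> f" "L2 \<Omega> g"
  shows "(LINT x:\<Omega>|lebesgue. (f x)\<^sup>2) \<le> 2 * (LINT x:\<Omega>|lebesgue. (f x - g x)\<^sup>2) + 2 * (LINT x:\<Omega>|lebesgue. (g x)\<^sup>2)"
proof -
  have i: "set_integrable lebesgue \<Omega> (\<lambda>x. (f x - g x)\<^sup>2)" "set_integrable lebesgue \<Omega> (\<lambda>x. (g x)\<^sup>2)"
      "set_integrable lebesgue \<Omega> (\<lambda>x. (f x)\<^sup>2)"
    using assms L2_add_diff(1)[OF assms] by (auto simp: L2_def)
  have "(LINT x:\<Omega>|lebesgue. (f x)\<^sup>2) \<le> (LINT x:\<Omega>|lebesgue. 2 * (f x - g x)\<^sup>2 + 2 * (g x)\<^sup>2)"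
  proof (rule set_integral_mono)
    show "(f x)\<^sup>2 \<le> 2 * (f x - g x)\<^sup>2 + 2 * (g x)\<^sup>2" for x
    proof -
      have "0 \<le> (f x - 2 * g x)\<^sup>2" by simp
      then show ?thesis by (simp add: power2_eq_square algebra_simps)
    qed
  qed (use i in auto)
  then show ?thesis using i by simp
qed

text \<open>The chosen weak derivative need not be the square integrable witness supplied by
  \<open>sobolev\<close>; uniqueness almost everywhere identifies the two.\<close>

lemma sobolev_1_weak_partial:
  assumes "open \<Omega>" "sobolev 1 \<Omega> f" "i \<in> Basis"
  shows "has_weak_partial \<Omega> i f (weak_partial \<Omega> i f)" "L2 \<Omega> (weak_partial \<Omega> i f)"
proof -
  obtain g where g: "has_weak_partial \<Omega> i f g" "L2 \<Omega> g"
    using assms(2,3) unfolding One_nat_def sobolev.simps by blast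
  show h: "has_weak_partial \<Omega> i f (weak_partial \<Omega> i f)"
    unfolding weak_partial_def by (rule someI[of "has_weak_partial \<Omega> i f", OF g(1)])
  show "L2 \<Omega> (weak_partial \<Omega> i f)"
    by (rule L2_AE_cong(1)[OF g(2) has_weak_partial_unique[OF assms(1) g(1) h]])
qed

lemma sobolev_1_Cc_infinity: "v \<in> Cc_infinity \<Omega> \<Longrightarrow> sobolev 1 \<Omega> v"
  unfolding One_nat_def sobolev.simps using L2_Cc_infinity[of v \<Omega>] has_weak_partial_Cc_infinity[of v \<Omega>] by blast

lemma weak_partial_Cc_infinity:
  assumes "open \<Omega>" "v \<in> Cc_infinity \<Omega>" "i \<in> Basis"
  shows "AE x in lebesgue. x \<in> \<Omega> \<longrightarrow> weak_partial \<Omega> i v x = partial_deriv i v x"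
  using has_weak_partial_unique[OF assms(1) sobolev_1_weak_partial(1)[OF assms(1) sobolev_1_Cc_infinity[OF assms(2)] assms(3)]
      has_weak_partial_Cc_infinity[OF assms(2,3)]] .

lemma sobolev_1_diff:
  assumes "open \<Omega>" "sobolev 1 \<Omega> f" "sobolev 1 \<Omega> g"
  shows "sobolev 1 \<Omega> (\<lambda>x. f x - g x)"
  unfolding One_nat_def sobolev.simps
proof (intro conjI ballI)
  show "L2 \<Omega> (\<lambda>x. f x - g x)" using assms(2,3) by (intro L2_add_diff) simp_all
  fix i :: 'a assume i: "i \<in> Basis"
  note w = sobolev_1_weak_partial[OF assms(1) _ i]
  show "\<exists>h. has_weak_partial \<Omega> i (\<lambda>x. f x - g x) h \<and> L2 \<Omega> h"
    using has_weak_partial_diff[OF w(1)[OF assms(2)] w(1)[OF assms(3)] i]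
      L2_add_diff(1)[OF w(2)[OF assms(2)] w(2)[OF assms(3)]] by blast
qed

section \<open>The Sobolev norm, density of smooth functions, bounds on time intervals\<close>

lemma H1_norm_square:
  "(H1_norm \<Omega> f)\<^sup>2 = (LINT x:\<Omega>|lebesgue. (f x)\<^sup>2) + (\<Sum>i\<in>Basis. LINT x:\<Omega>|lebesgue. (weak_partial \<Omega> i f x)\<^sup>2)"
proof -
  have *: "0 \<le> (LINT x:\<Omega>|lebesgue. (g x)\<^sup>2)" for g :: "'a \<Rightarrow> real"
    unfolding set_lebesgue_integral_def by (rule integral_nonneg_AE) simp
  show ?thesis unfolding H1_norm_def L2_norm_def
    by (simp add: * sum_nonneg)
qed

text \<open>Weak derivatives are additive only almost everywhere, so each summand first changes
  representative. Working with squares, the pointwise inequality a^2 <= 2 (a - b)^2 + 2 b^2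
  suffices, at the price of a factor 2 that is harmless everywhere below.\<close>

lemma H1_norm_square_triangle:
  assumes "open \<Omega>" "sobolev 1 \<Omega> f" "sobolev 1 \<Omega> g"
  shows "(H1_norm \<Omega> f)\<^sup>2 \<le> 2 * (H1_norm \<Omega> (\<lambda>x. f x - g x))\<^sup>2 + 2 * (H1_norm \<Omega> g)\<^sup>2"
proof -
  let ?I = "\<lambda>h. LINT x:\<Omega>|lebesgue. (h x)\<^sup>2"
  have "?I (weak_partial \<Omega> i f) \<le> 2 * ?I (weak_partial \<Omega> i (\<lambda>x. f x - g x)) + 2 * ?I (weak_partial \<Omega> i g)"
    if i: "i \<in> Basis" for i
  proof -
    note w = sobolev_1_weak_partial[OF assms(1) _ i]
    have "AE x in lebesgue. x \<in> \<Omega> \<longrightarrow> weak_partial \<Omega> i f x - weak_partial \<Omega> i g x = weak_partial \<Omega> i (\<lambda>x. f x - g x) x"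
      by (rule has_weak_partial_unique[OF assms(1) has_weak_partial_diff[OF w(1) w(1) i] w(1)])
        (fact assms sobolev_1_diff[OF assms])+
    from L2_AE_cong(2)[OF L2_add_diff(1)[OF w(2)[OF assms(2)] w(2)[OF assms(3)]] this]
      L2_square_triangle[OF w(2)[OF assms(2)] w(2)[OF assms(3)]]
    show ?thesis by simp
  qed
  then have "(\<Sum>i\<in>Basis. ?I (weak_partial \<Omega> i f)) \<le> (\<Sum>i\<in>Basis. 2 * ?I (weak_partial \<Omega> i (\<lambda>x. f x - g x)) + 2 * ?I (weak_partial \<Omega> i g))"
    by (rule sum_mono)
  moreover have "?I f \<le> 2 * ?I (\<lambda>x. f x - g x) + 2 * ?I g"
    using assms by (intro L2_square_triangle) auto
  ultimately show ?thesis unfolding H1_norm_square by (simp add: sum.distrib sum_distrib_left algebra_simps)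
qed

text \<open>The approximant comes with a bound on its classical gradient in terms of the norm of the
  limit. This is what survives a passage to the limit by Fatou's lemma or by an integration by
  parts.\<close>

lemma sobolev_zero_approximation:
  assumes \<Omega>: "open \<Omega>" and f: "sobolev_zero \<Omega> f" and e: "e > 0"
  obtains v where "v \<in> Cc_infinity \<Omega>" "(LINT x:\<Omega>|lebesgue. (f x - v x)\<^sup>2) < e"
    "(LINT x:\<Omega>|lebesgue. (v x)\<^sup>2) + (\<Sum>i\<in>Basis. LINT x:\<Omega>|lebesgue. (partial_deriv i v x)\<^sup>2) \<le> 2 * (H1_norm \<Omega> f)\<^sup>2 + e"
proof -
  have s: "sobolev 1 \<Omega> f" using f by (simp add: sobolev_zero_def)
  \<comment> \<open>The squared distance is then below e / 2, and the factor 2 in the triangle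
    inequality for squares turns this into e.\<close>
  have "sqrt (e / 2) > 0" using e by simp
  then obtain v where v: "v \<in> Cc_infinity \<Omega>" "H1_norm \<Omega> (\<lambda>x. f x - v x) < sqrt (e / 2)"
    using f unfolding sobolev_zero_def by blast
  note sv = sobolev_1_Cc_infinity[OF v(1)]
  have nn: "0 \<le> (LINT x:\<Omega>|lebesgue. (g x)\<^sup>2)" for g :: "'a \<Rightarrow> real"
    unfolding set_lebesgue_integral_def by (rule integral_nonneg_AE) simp
  have "H1_norm \<Omega> g \<ge> 0" for g unfolding H1_norm_def by (simp add: sum_nonneg)
  then have sm: "(H1_norm \<Omega> (\<lambda>x. f x - v x))\<^sup>2 < e / 2"
    using v(2) e real_less_rsqrt real_sqrt_less_iff by (smt (verit) power_strict_mono real_sqrt_pow2 zero_less_numeral half_gt_zero)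
  then have "(LINT x:\<Omega>|lebesgue. (f x - v x)\<^sup>2) < e"
    using e sum_nonneg[of Basis "\<lambda>i. LINT x:\<Omega>|lebesgue. (weak_partial \<Omega> i (\<lambda>x. f x - v x) x)\<^sup>2"] nn unfolding H1_norm_square by fastforce
  moreover have "(H1_norm \<Omega> v)\<^sup>2 \<le> 2 * (H1_norm \<Omega> (\<lambda>x. f x - v x))\<^sup>2 + 2 * (H1_norm \<Omega> f)\<^sup>2"
  proof -
    \<comment> \<open>Even symmetry of the distance needs an argument, since the weak derivatives of
      \<open>f - v\<close> and \<open>v - f\<close> are chosen independently of each other.\<close>
    have eq: "(H1_norm \<Omega> (\<lambda>x. v x - f x))\<^sup>2 = (H1_norm \<Omega> (\<lambda>x. f x - v x))\<^sup>2"
    proof -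
      have "(LINT x:\<Omega>|lebesgue. (weak_partial \<Omega> i (\<lambda>x. v x - f x) x)\<^sup>2) = (LINT x:\<Omega>|lebesgue. (weak_partial \<Omega> i (\<lambda>x. f x - v x) x)\<^sup>2)"
        if i: "i \<in> Basis" for i
      proof -
        note w = sobolev_1_weak_partial[OF \<Omega> _ i]
        note w1 = w[OF sobolev_1_diff[OF \<Omega> s sv]] and w2 = w[OF sobolev_1_diff[OF \<Omega> sv s]]
        note h = has_weak_partial_diff[OF w(1)[OF s] w(1)[OF sv] i]
          has_weak_partial_diff[OF w(1)[OF sv] w(1)[OF s] i]
        have "AE x in lebesgue. x \<in> \<Omega> \<longrightarrow> weak_partial \<Omega> i (\<lambda>x. f x - v x) x = weak_partial \<Omega> i f x - weak_partial \<Omega> i v x"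
          by (rule has_weak_partial_unique[OF \<Omega> w1(1) h(1)])
        from L2_AE_cong(2)[OF w1(2) this]
        have 1: "(LINT x:\<Omega>|lebesgue. (weak_partial \<Omega> i (\<lambda>x. f x - v x) x)\<^sup>2) = (LINT x:\<Omega>|lebesgue. (weak_partial \<Omega> i f x - weak_partial \<Omega> i v x)\<^sup>2)" .
        have "AE x in lebesgue. x \<in> \<Omega> \<longrightarrow> weak_partial \<Omega> i (\<lambda>x. v x - f x) x = weak_partial \<Omega> i v x - weak_partial \<Omega> i f x"
          by (rule has_weak_partial_unique[OF \<Omega> w2(1) h(2)])
        from L2_AE_cong(2)[OF w2(2) this] 1 show ?thesis by (simp add: power2_commute)
      qed
      then show ?thesis unfolding H1_norm_square by (simp add: power2_commute)
    qed
    show ?thesis using H1_norm_square_triangle[OF \<Omega> sv s] unfolding eq .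
  qed
  moreover have "(LINT x:\<Omega>|lebesgue. (weak_partial \<Omega> i v x)\<^sup>2) = (LINT x:\<Omega>|lebesgue. (partial_deriv i v x)\<^sup>2)" if "i \<in> Basis" for i
    by (rule L2_AE_cong(2)[OF sobolev_1_weak_partial(2)[OF \<Omega> sv that] weak_partial_Cc_infinity[OF \<Omega> v(1) that]])
  ultimately show ?thesis using v(1) sm that unfolding H1_norm_square[of \<Omega> v] by (simp add: algebra_simps)
qed

text \<open>Near each time the triangle inequality for squares gives the bound 2 + 2 |u(t)|^2.
  Finitely many such neighbourhoods cover the interval, and the sum of their bounds serves for all
  of it.\<close>

lemma H1_norm_bounded_on_compact:
  assumes \<Omega>: "open \<Omega>" and s: "\<And>t. 0 \<le> t \<Longrightarrow> sobolev 1 \<Omega> (u t)"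
    and c: "continuous_in_norm (H1_norm \<Omega>) {0..} u"
  obtains B where "\<And>t. t \<in> {0..S} \<Longrightarrow> (H1_norm \<Omega> (u t))\<^sup>2 \<le> B"
proof -
  have "\<exists>U. open U \<and> t \<in> U \<and> (\<forall>r\<in>U \<inter> {0..S}. (H1_norm \<Omega> (u r))\<^sup>2 \<le> 2 + 2 * (H1_norm \<Omega> (u t))\<^sup>2)"
    if t: "t \<in> {0..S}" for t
  proof -
    have "((\<lambda>r. H1_norm \<Omega> (\<lambda>x. u r x - u t x)) \<longlongrightarrow> 0) (at t within {0..})"
      using c t by (auto simp: continuous_in_norm_def)
    then have "\<forall>\<^sub>F r in at t within {0..}. \<bar>H1_norm \<Omega> (\<lambda>x. u r x - u t x)\<bar> < 1"
      by (auto simp: tendsto_iff dist_real_def dest: spec[of _ 1])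
    then obtain U where U: "open U" "t \<in> U" "\<And>r. r \<in> U \<Longrightarrow> r \<noteq> t \<Longrightarrow> r \<in> {0..} \<Longrightarrow> \<bar>H1_norm \<Omega> (\<lambda>x. u r x - u t x)\<bar> < 1"
      by (auto simp: eventually_at_topological)
    have "(H1_norm \<Omega> (u r))\<^sup>2 \<le> 2 + 2 * (H1_norm \<Omega> (u t))\<^sup>2" if r: "r \<in> U \<inter> {0..S}" for r
    proof (cases "r = t")
      case False
      have "(H1_norm \<Omega> (\<lambda>x. u r x - u t x))\<^sup>2 \<le> 1"
        using U(3)[of r] r False by (simp add: abs_square_le_1)
      then show ?thesis using H1_norm_square_triangle[OF \<Omega> s s, of r t] r t by auto
    qed simp
    with U show ?thesis by blast
  qed
  then obtain U where U: "\<And>t. t \<in> {0..S} \<Longrightarrow> open (U t)" "\<And>t. t \<in> {0..S} \<Longrightarrow> t \<in> U t"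
    "\<And>t r. t \<in> {0..S} \<Longrightarrow> r \<in> U t \<inter> {0..S} \<Longrightarrow> (H1_norm \<Omega> (u r))\<^sup>2 \<le> 2 + 2 * (H1_norm \<Omega> (u t))\<^sup>2"
    by metis
  obtain D where D: "D \<subseteq> {0..S}" "finite D" "{0..S} \<subseteq> (\<Union>t\<in>D. U t)"
    by (rule compactE_image[of "{0..S}" "{0..S}" U]) (use U in auto)
  have "(H1_norm \<Omega> (u r))\<^sup>2 \<le> (\<Sum>t\<in>D. 2 + 2 * (H1_norm \<Omega> (u t))\<^sup>2)" if r: "r \<in> {0..S}" for r
  proof -
    from D(3) r obtain t where t: "t \<in> D" "r \<in> U t" by blast
    have "(H1_norm \<Omega> (u r))\<^sup>2 \<le> 2 + 2 * (H1_norm \<Omega> (u t))\<^sup>2" using U(3)[of t r] t r D(1) by blast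
    also have "\<dots> \<le> (\<Sum>t\<in>D. 2 + 2 * (H1_norm \<Omega> (u t))\<^sup>2)"
      using member_le_sum[OF t(1), of "\<lambda>t. 2 + 2 * (H1_norm \<Omega> (u t))\<^sup>2"] D(2) by simp
    finally show ?thesis .
  qed
  then show ?thesis using that by blast
qed

section \<open>The fourth-power bound in low dimension\<close>

text \<open>The square at \<open>a\<close> is the integral of \<open>2 * g s * g' s\<close> from a
  point to the left of the support, and 2 |g g'| <= g^2 + g'^2.\<close>

lemma square_le_nn_integral_line:
  fixes g g' :: "real \<Rightarrow> real"
  assumes der: "\<And>s. (g has_real_derivative g' s) (at s)" and cont: "continuous_on UNIV g'"
    and supp: "\<And>s. s < - r \<Longrightarrow> g s = 0"
  shows "ennreal ((g a)\<^sup>2) \<le> (\<integral>\<^sup>+s. ennreal ((g s)\<^sup>2 + (g' s)\<^sup>2) \<partial>lborel)"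
proof -
  define c where "c = min a (- r - 1)"
  have c: "c \<le> a" "g c = 0" using supp by (auto simp: c_def)
  have cg: "continuous_on UNIV g"
    using der DERIV_isCont by (intro continuous_at_imp_continuous_on) blast
  have cgg: "continuous_on UNIV (\<lambda>s. 2 * g s * g' s)" by (intro continuous_intros cg cont)
  have d: "((\<lambda>s. (g s)\<^sup>2) has_real_derivative 2 * g s * g' s) (at s)" for s
    by (auto intro!: derivative_eq_intros der)
  have fi: "has_bochner_integral lborel (\<lambda>s. (2 * g s * g' s) * indicator {c..a} s) ((g a)\<^sup>2 - (g c)\<^sup>2)"
    by (rule has_bochner_integral_FTC_Icc_real[OF c(1) d])
      (use cgg in \<open>simp add: continuous_on_eq_continuous_at\<close>)
  have "ennreal (norm (integral\<^sup>L lborel (\<lambda>s. (2 * g s * g' s) * indicator {c..a} s)))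
      \<le> (\<integral>\<^sup>+s. norm ((2 * g s * g' s) * indicator {c..a} s) \<partial>lborel)"
    by (rule integral_norm_bound_ennreal) (use fi has_bochner_integral_iff in blast)
  also have "\<dots> \<le> (\<integral>\<^sup>+s. ennreal ((g s)\<^sup>2 + (g' s)\<^sup>2) \<partial>lborel)"
  proof (intro nn_integral_mono ennreal_leI)
    fix s
    have "2 * \<bar>g s\<bar> * \<bar>g' s\<bar> \<le> (g s)\<^sup>2 + (g' s)\<^sup>2"
      using sum_squares_bound[of "\<bar>g s\<bar>" "\<bar>g' s\<bar>"] by simp
    then show "norm (2 * g s * g' s * indicator {c..a} s) \<le> (g s)\<^sup>2 + (g' s)\<^sup>2"
      by (auto simp: abs_mult indicator_def)
  qed
  finally show ?thesis
    using fi c(2) by (simp add: has_bochner_integral_integral_eq)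
qed

lemma nn_integral_lborel_DIM_1:
  fixes e :: "'a::euclidean_space" and f :: "'a \<Rightarrow> ennreal"
  assumes B: "(Basis :: 'a set) = {e}" and f: "f \<in> borel_measurable borel"
  shows "(\<integral>\<^sup>+x. f x \<partial>lborel) = (\<integral>\<^sup>+s. f (s *\<^sub>R e) \<partial>lborel)"
proof -
  have "e \<in> Basis" unfolding B by simp
  then have e: "e \<bullet> e = 1" by (rule inner_same_Basis)
  have "lborel = distr lborel borel (\<lambda>s::real. s *\<^sub>R e)"
  proof (rule lborel_eqI)
    fix l u :: 'a assume le: "\<And>b. b \<in> Basis \<Longrightarrow> l \<bullet> b \<le> u \<bullet> b"
    have "(\<lambda>s::real. s *\<^sub>R e) -` box l u = {l \<bullet> e<..<u \<bullet> e}"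
      using e by (auto simp: mem_box B)
    then show "emeasure (distr lborel borel (\<lambda>s::real. s *\<^sub>R e)) (box l u) = (\<Prod>b\<in>Basis. (u - l) \<bullet> b)"
      using le[of e] by (simp add: emeasure_distr B inner_diff_left)
  qed simp
  then have "(\<integral>\<^sup>+x. f x \<partial>lborel) = (\<integral>\<^sup>+x. f x \<partial>(distr lborel borel (\<lambda>s::real. s *\<^sub>R e)))" by simp
  also have "\<dots> = (\<integral>\<^sup>+s. f (s *\<^sub>R e) \<partial>lborel)"
    by (rule nn_integral_distr) (use f in auto)
  finally show ?thesis .
qed

text \<open>The measure \<open>lborel\<close> is determined by its values on boxes, and the image of
  the plane measure under the coordinate map has the same values. Tonelli's theorem then applies in
  the abstract two-dimensional space.\<close>

lemma nn_integral_lborel_DIM_2: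
  fixes e1 e2 :: "'a::euclidean_space" and f :: "'a \<Rightarrow> ennreal"
  assumes B: "(Basis :: 'a set) = {e1, e2}" "e1 \<noteq> e2" and f[measurable]: "f \<in> borel_measurable borel"
  shows "(\<integral>\<^sup>+x. f x \<partial>lborel) = (\<integral>\<^sup>+s. \<integral>\<^sup>+t. f (s *\<^sub>R e1 + t *\<^sub>R e2) \<partial>lborel \<partial>lborel)"
proof -
  let ?T = "\<lambda>z::real \<times> real. fst z *\<^sub>R e1 + snd z *\<^sub>R e2"
  have e: "e1 \<bullet> e1 = 1" "e2 \<bullet> e2 = 1" "e1 \<bullet> e2 = 0" "e2 \<bullet> e1 = 0"
  proof -
    have "e1 \<in> Basis" "e2 \<in> Basis" unfolding B by simp_all
    then show "e1 \<bullet> e1 = 1" "e2 \<bullet> e2 = 1" "e1 \<bullet> e2 = 0" "e2 \<bullet> e1 = 0"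
      using B(2) by (simp_all add: inner_same_Basis inner_not_same_Basis)
  qed
  have [measurable]: "?T \<in> borel_measurable borel"
    by (intro borel_measurable_continuous_onI continuous_intros)
  have "lborel = distr lborel borel ?T"
  proof (rule lborel_eqI)
    fix l u :: 'a assume le: "\<And>b. b \<in> Basis \<Longrightarrow> l \<bullet> b \<le> u \<bullet> b"
    have le': "l \<bullet> e1 \<le> u \<bullet> e1" "l \<bullet> e2 \<le> u \<bullet> e2" using le unfolding B by auto
    have "?T -` box l u = {l \<bullet> e1<..<u \<bullet> e1} \<times> {l \<bullet> e2<..<u \<bullet> e2}"
      using e by (auto simp: mem_box B inner_add_left)
    moreover have "emeasure lborel ({l \<bullet> e1<..<u \<bullet> e1} \<times> {l \<bullet> e2<..<u \<bullet> e2}) =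
        ennreal (u \<bullet> e1 - l \<bullet> e1) * ennreal (u \<bullet> e2 - l \<bullet> e2)"
      using le' by (simp add: lborel_prod[symmetric] lborel.emeasure_pair_measure_Times)
    ultimately show "emeasure (distr lborel borel ?T) (box l u) = (\<Prod>b\<in>Basis. (u - l) \<bullet> b)"
      using le' B(2) by (simp add: B(1) emeasure_distr inner_diff_left ennreal_mult)
  qed simp
  then have "(\<integral>\<^sup>+x. f x \<partial>lborel) = (\<integral>\<^sup>+x. f x \<partial>(distr lborel borel ?T))" by simp
  also have "\<dots> = (\<integral>\<^sup>+z. f (?T z) \<partial>lborel)"
    by (rule nn_integral_distr) auto
  also have "\<dots> = (\<integral>\<^sup>+z. f (?T z) \<partial>(lborel \<Otimes>\<^sub>M lborel))" by (simp add: lborel_prod)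
  also have "\<dots> = (\<integral>\<^sup>+s. \<integral>\<^sup>+t. f (?T (s, t)) \<partial>lborel \<partial>lborel)"
    by (rule lborel.nn_integral_fst[symmetric]) (simp add: lborel_prod)
  finally show ?thesis by simp
qed

text \<open>With h = v^2 + |grad v|^2, integrating along coordinate lines bounds v^2 by a line
  integral of h. In dimension 2 the two lines through a point give v^4 <= Q(s) R(t), whose integral
  factorises into the square of the integral of h. In dimension 1 the line is the whole space, so
  v^2 is bounded by the integral of h, and the other factor v^2 is integrated.\<close>

lemma ladyzhenskaya_inequality:
  fixes v :: "'a::euclidean_space \<Rightarrow> real"
  assumes dim: "DIM('a) \<le> 2" and v: "Ck_on 1 UNIV v" and supp: "\<And>x. r < norm x \<Longrightarrow> v x = 0"
  shows "(\<integral>\<^sup>+x. ennreal ((v x) ^ 4) \<partial>lborel) \<le>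
    (\<integral>\<^sup>+x. ennreal ((v x)\<^sup>2 + (\<Sum>i\<in>Basis. (partial_deriv i v x)\<^sup>2)) \<partial>lborel)\<^sup>2"
proof -
  define h where "h x = ennreal ((v x)\<^sup>2 + (\<Sum>i\<in>Basis. (partial_deriv i v x)\<^sup>2))" for x
  have cv: "continuous_on UNIV v" by (rule Ck_on_imp_continuous_on[OF v])
  have cp: "continuous_on UNIV (partial_deriv i v)" if "i \<in> Basis" for i using v that by simp
  have [measurable]: "v \<in> borel_measurable borel" using cv by (rule borel_measurable_continuous_onI)
  have [measurable]: "h \<in> borel_measurable borel" unfolding h_def[abs_def]
    by (intro measurable_compose[OF _ measurable_ennreal] borel_measurable_continuous_onI continuous_intros cv cp)
  have line: "ennreal ((v (x + a *\<^sub>R i))\<^sup>2) \<le> (\<integral>\<^sup>+s. h (x + s *\<^sub>R i) \<partial>lborel)" if i: "i \<in> Basis" for x i a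
  proof -
    have "ennreal ((v (x + a *\<^sub>R i))\<^sup>2) \<le>
        (\<integral>\<^sup>+s. ennreal ((v (x + s *\<^sub>R i))\<^sup>2 + (partial_deriv i v (x + s *\<^sub>R i))\<^sup>2) \<partial>lborel)"
    proof (rule square_le_nn_integral_line[where r="r + norm x"])
      show "((\<lambda>s. v (x + s *\<^sub>R i)) has_real_derivative partial_deriv i v (x + s *\<^sub>R i)) (at s)" for s
        by (rule DERIV_partial_deriv) (use v in simp)
      show "continuous_on UNIV (\<lambda>s. partial_deriv i v (x + s *\<^sub>R i))"
        by (rule continuous_on_compose2[OF cp[OF i]]) (auto intro!: continuous_intros)
      show "v (x + s *\<^sub>R i) = 0" if "s < - (r + norm x)" for s
      proof -
        have "norm (s *\<^sub>R i) = \<bar>s\<bar>" using i by simp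
        moreover have "norm (s *\<^sub>R i) \<le> norm (x + s *\<^sub>R i) + norm x"
          using norm_triangle_ineq4[of "x + s *\<^sub>R i" x] by simp
        ultimately show ?thesis using that by (intro supp) linarith
      qed
    qed
    also have "\<dots> \<le> (\<integral>\<^sup>+s. h (x + s *\<^sub>R i) \<partial>lborel)"
      unfolding h_def using i
      by (intro nn_integral_mono ennreal_leI add_left_mono) (rule member_le_sum, auto)
    finally show ?thesis .
  qed
  have v4: "ennreal ((v x) ^ 4) = ennreal ((v x)\<^sup>2) * ennreal ((v x)\<^sup>2)" for x
    by (simp add: ennreal_mult[symmetric] power_add[symmetric])
  have "DIM('a) = 1 \<or> DIM('a) = 2" using dim DIM_positive[where 'a='a] by linarith
  then have "(\<integral>\<^sup>+x. ennreal ((v x) ^ 4) \<partial>lborel) \<le> (\<integral>\<^sup>+x. h x \<partial>lborel)\<^sup>2"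
  proof
    assume "DIM('a) = 1"
    then obtain e where B: "(Basis :: 'a set) = {e}" by (rule card_1_singletonE)
    let ?H = "\<integral>\<^sup>+x. h x \<partial>lborel"
    have H: "?H = (\<integral>\<^sup>+s. h (s *\<^sub>R e) \<partial>lborel)"
      by (rule nn_integral_lborel_DIM_1[OF B]) simp
    have le: "ennreal ((v x)\<^sup>2) \<le> ?H" for x
      using line[of e 0 "x \<bullet> e"] euclidean_representation[of x] unfolding H by (simp add: B)
    have "(\<integral>\<^sup>+x. ennreal ((v x) ^ 4) \<partial>lborel) \<le> (\<integral>\<^sup>+x. ennreal ((v x)\<^sup>2) * ?H \<partial>lborel)"
      unfolding v4 by (intro nn_integral_mono mult_left_mono le) simp
    also have "\<dots> = (\<integral>\<^sup>+x. ennreal ((v x)\<^sup>2) \<partial>lborel) * ?H"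
      by (rule nn_integral_multc) simp
    also have "\<dots> \<le> ?H * ?H"
      unfolding h_def by (intro mult_right_mono nn_integral_mono ennreal_leI) (auto simp: sum_nonneg)
    finally show ?thesis by (simp add: power2_eq_square)
  next
    assume "DIM('a) = 2"
    then obtain e1 e2 where B: "(Basis :: 'a set) = {e1, e2}" "e1 \<noteq> e2" by (auto simp: card_2_iff)
    then have B': "(Basis :: 'a set) = {e2, e1}" "e2 \<noteq> e1" by auto
    let ?H = "\<integral>\<^sup>+x. h x \<partial>lborel"
    define Q where "Q s = (\<integral>\<^sup>+t. h (s *\<^sub>R e1 + t *\<^sub>R e2) \<partial>lborel)" for s
    define R where "R t = (\<integral>\<^sup>+s. h (t *\<^sub>R e2 + s *\<^sub>R e1) \<partial>lborel)" for t
    have [measurable]: "Q \<in> borel_measurable borel" "R \<in> borel_measurable borel"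
      unfolding Q_def[abs_def] R_def[abs_def] by measurable
    have H: "?H = (\<integral>\<^sup>+s. Q s \<partial>lborel)" "?H = (\<integral>\<^sup>+t. R t \<partial>lborel)"
      unfolding Q_def R_def using nn_integral_lborel_DIM_2[OF B, of h] nn_integral_lborel_DIM_2[OF B', of h] by auto
    have le: "ennreal ((v (s *\<^sub>R e1 + t *\<^sub>R e2))\<^sup>2) \<le> Q s" "ennreal ((v (s *\<^sub>R e1 + t *\<^sub>R e2))\<^sup>2) \<le> R t" for s t
      using line[of e2 "s *\<^sub>R e1" t] line[of e1 "t *\<^sub>R e2" s] B unfolding Q_def R_def by (auto simp: add.commute)
    have "(\<integral>\<^sup>+x. ennreal ((v x) ^ 4) \<partial>lborel) = (\<integral>\<^sup>+s. \<integral>\<^sup>+t. ennreal ((v (s *\<^sub>R e1 + t *\<^sub>R e2)) ^ 4) \<partial>lborel \<partial>lborel)"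
      by (rule nn_integral_lborel_DIM_2[OF B]) simp
    also have "\<dots> \<le> (\<integral>\<^sup>+s. \<integral>\<^sup>+t. Q s * R t \<partial>lborel \<partial>lborel)"
      unfolding v4 by (intro nn_integral_mono mult_mono le) simp_all
    also have "\<dots> = (\<integral>\<^sup>+s. Q s * ?H \<partial>lborel)"
      by (simp add: nn_integral_cmult H(2))
    also have "\<dots> = ?H * ?H" using H(1) by (simp add: nn_integral_multc)
    finally show ?thesis by (simp add: power2_eq_square)
  qed
  then show ?thesis unfolding h_def .
qed

text \<open>Smooth approximants have uniformly bounded gradient norms, hence uniformly bounded
  fourth-power integrals; Fatou's lemma passes the bound to the limit.\<close>

lemma sobolev_zero_fourth_power:
  fixes f :: "'a::euclidean_space \<Rightarrow> real"
  assumes dim: "DIM('a) \<le> 2" and \<Omega>: "open \<Omega>" and f: "sobolev_zero \<Omega> f"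
  shows "set_integrable lebesgue \<Omega> (\<lambda>x. \<bar>f x\<bar> ^ 4)"
    and "(LINT x:\<Omega>|lebesgue. \<bar>f x\<bar> ^ 4) \<le> (2 * (H1_norm \<Omega> f)\<^sup>2 + 1)\<^sup>2"
proof -
  let ?E = "2 * (H1_norm \<Omega> f)\<^sup>2 + 1"
  have L2f: "L2 \<Omega> f" using f by (simp add: sobolev_zero_def)
  have ex: "\<exists>v. v \<in> Cc_infinity \<Omega> \<and> (LINT x:\<Omega>|lebesgue. (f x - v x)\<^sup>2) < 1 / Suc n \<and>
      (LINT x:\<Omega>|lebesgue. (v x)\<^sup>2) + (\<Sum>i\<in>Basis. LINT x:\<Omega>|lebesgue. (partial_deriv i v x)\<^sup>2) \<le> ?E" for n
  proof -
    have e: "1 / real (Suc n) > 0" "1 / real (Suc n) \<le> 1" by simp_all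
    obtain w where w: "w \<in> Cc_infinity \<Omega>" "(LINT x:\<Omega>|lebesgue. (f x - w x)\<^sup>2) < 1 / Suc n"
      "(LINT x:\<Omega>|lebesgue. (w x)\<^sup>2) + (\<Sum>i\<in>Basis. LINT x:\<Omega>|lebesgue. (partial_deriv i w x)\<^sup>2)
        \<le> 2 * (H1_norm \<Omega> f)\<^sup>2 + 1 / Suc n"
      by (rule sobolev_zero_approximation[OF \<Omega> f e(1)])
    have "(LINT x:\<Omega>|lebesgue. (w x)\<^sup>2) + (\<Sum>i\<in>Basis. LINT x:\<Omega>|lebesgue. (partial_deriv i w x)\<^sup>2) \<le> ?E"
      by (rule order_trans[OF w(3)]) (use e(2) in linarith)
    with w(1,2) show ?thesis by blast
  qed
  from choice[OF allI[OF ex]] obtain v where v_all: "\<forall>n. v n \<in> Cc_infinity \<Omega> \<and> (LINT x:\<Omega>|lebesgue. (f x - v n x)\<^sup>2) < 1 / Suc n \<and>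
      (LINT x:\<Omega>|lebesgue. (v n x)\<^sup>2) + (\<Sum>i\<in>Basis. LINT x:\<Omega>|lebesgue. (partial_deriv i (v n) x)\<^sup>2) \<le> ?E" ..
  have v: "\<And>n. v n \<in> Cc_infinity \<Omega>"
    "\<And>n. (LINT x:\<Omega>|lebesgue. (f x - v n x)\<^sup>2) < 1 / Suc n"
    "\<And>n. (LINT x:\<Omega>|lebesgue. (v n x)\<^sup>2) + (\<Sum>i\<in>Basis. LINT x:\<Omega>|lebesgue. (partial_deriv i (v n) x)\<^sup>2) \<le> ?E"
    using spec[OF v_all] by (simp_all only: simp_thms conj_assoc)
  have cv: "continuous_on UNIV (v n)" for n
    by (rule Ck_on_imp_continuous_on[OF Cc_infinity_D(1)[OF v(1), of 0]])
  have [measurable]: "v n \<in> borel_measurable lebesgue" for n by (rule continuous_set_borel_measurable[OF cv])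
  have fm[measurable]: "(\<lambda>x. indicator \<Omega> x * f x) \<in> borel_measurable lebesgue"
    using L2f by (simp add: L2_def set_borel_measurable_def)
  have iv: "set_integrable lebesgue \<Omega> (\<lambda>x. (f x - v n x)\<^sup>2)" for n
    using L2_add_diff(1)[OF L2f L2_Cc_infinity(1)[OF v(1)]] by (simp add: L2_def)
  \<comment> \<open>Convergence in L^2 gives pointwise convergence only along a subsequence, which
    is enough for Fatou's lemma.\<close>
  have "\<exists>r::nat\<Rightarrow>nat. strict_mono r \<and> (AE x in lebesgue. (\<lambda>n. indicator \<Omega> x *\<^sub>R (f x - v (r n) x)\<^sup>2) \<longlonglongrightarrow> 0)"
  proof (rule tendsto_L1_AE_subseq)
    show "integrable lebesgue (\<lambda>x. indicator \<Omega> x *\<^sub>R (f x - v n x)\<^sup>2)" for n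
      using iv[of n] by (simp add: set_integrable_def)
    have eq: "(\<integral>x. norm (indicator \<Omega> x *\<^sub>R (f x - v n x)\<^sup>2) \<partial>lebesgue) = (LINT x:\<Omega>|lebesgue. (f x - v n x)\<^sup>2)" for n
      unfolding set_lebesgue_integral_def by simp
    show "(\<lambda>n. \<integral>x. norm (indicator \<Omega> x *\<^sub>R (f x - v n x)\<^sup>2) \<partial>lebesgue) \<longlonglongrightarrow> 0"
    proof (rule tendsto_sandwich)
      show "\<forall>\<^sub>F n in sequentially. 0 \<le> (\<integral>x. norm (indicator \<Omega> x *\<^sub>R (f x - v n x)\<^sup>2) \<partial>lebesgue)"
        by (intro always_eventually allI integral_nonneg_AE) simp
      show "\<forall>\<^sub>F n in sequentially. (\<integral>x. norm (indicator \<Omega> x *\<^sub>R (f x - v n x)\<^sup>2) \<partial>lebesgue) \<le> 1 / real (Suc n)"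
        unfolding eq using v(2) by (intro always_eventually allI less_imp_le) simp
    qed (simp, rule LIMSEQ_Suc[OF lim_1_over_n])
  qed
  then obtain r :: "nat \<Rightarrow> nat" where r: "AE x in lebesgue. (\<lambda>n. indicator \<Omega> x *\<^sub>R (f x - v (r n) x)\<^sup>2) \<longlonglongrightarrow> 0"
    by blast
  have lim: "AE x in lebesgue. ennreal ((indicator \<Omega> x * f x) ^ 4) = liminf (\<lambda>n. ennreal ((v (r n) x) ^ 4))"
    using r
  proof eventually_elim
    case (elim x)
    have "(\<lambda>n. v (r n) x) \<longlonglongrightarrow> indicator \<Omega> x * f x"
    proof (cases "x \<in> \<Omega>")
      case True
      then have "(\<lambda>n. sqrt ((f x - v (r n) x)\<^sup>2)) \<longlonglongrightarrow> sqrt 0"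
        using elim by (intro tendsto_real_sqrt) simp
      then have "(\<lambda>n. v (r n) x - f x) \<longlonglongrightarrow> 0"
        using tendsto_minus[of "\<lambda>n. f x - v (r n) x" 0] by (simp add: tendsto_rabs_zero_iff)
      then show ?thesis using True by (simp add: LIM_zero_iff)
    qed (simp add: Cc_infinity_D(2)[OF v(1)])
    then have "(\<lambda>n. ennreal ((v (r n) x) ^ 4)) \<longlonglongrightarrow> ennreal ((indicator \<Omega> x * f x) ^ 4)"
      by (intro tendsto_intros)
    then show ?case by (intro lim_imp_Liminf[symmetric]) simp_all
  qed
  have bound: "(\<integral>\<^sup>+x. ennreal ((v n x) ^ 4) \<partial>lebesgue) \<le> ennreal (?E\<^sup>2)" for n
  proof -
    note d = Cc_infinity_D[OF v(1)]
    obtain \<rho> where \<rho>: "\<And>x. \<rho> < norm x \<Longrightarrow> v n x = 0" using d(4) by blast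
    have v1: "Ck_on 1 UNIV (v n)" by (rule d(1))
    have cp: "continuous_on UNIV (partial_deriv i (v n))" if "i \<in> Basis" for i using v1 that by simp
    have i1: "integrable lborel (\<lambda>x. (v n x)\<^sup>2)"
      by (rule integrable_continuous_compact_support[of _ \<rho>]) (auto intro!: continuous_intros cv \<rho>)
    have i2: "integrable lborel (\<lambda>x. (partial_deriv i (v n) x)\<^sup>2)" if "i \<in> Basis" for i
      by (rule integrable_continuous_compact_support[of _ \<rho>])
        (use that partial_deriv_zero_outside[OF \<rho>] in \<open>auto intro!: continuous_intros cp\<close>)
    have "(\<integral>\<^sup>+x. ennreal ((v n x)\<^sup>2 + (\<Sum>i\<in>Basis. (partial_deriv i (v n) x)\<^sup>2)) \<partial>lborel) =
        ennreal (\<integral>x. (v n x)\<^sup>2 + (\<Sum>i\<in>Basis. (partial_deriv i (v n) x)\<^sup>2) \<partial>lborel)"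
      by (rule nn_integral_eq_integral) (use i1 i2 in \<open>auto simp: sum_nonneg\<close>)
    also have "(\<integral>x. (v n x)\<^sup>2 + (\<Sum>i\<in>Basis. (partial_deriv i (v n) x)\<^sup>2) \<partial>lborel) =
        (\<integral>x. (v n x)\<^sup>2 \<partial>lborel) + (\<Sum>i\<in>Basis. \<integral>x. (partial_deriv i (v n) x)\<^sup>2 \<partial>lborel)"
      using i1 i2 by simp
    also have "\<dots> = (LINT x:\<Omega>|lebesgue. (v n x)\<^sup>2) + (\<Sum>i\<in>Basis. LINT x:\<Omega>|lebesgue. (partial_deriv i (v n) x)\<^sup>2)"
      using i1 i2 by (simp add: set_integral_eq_integral d lebesgue_integral_lborel borel_measurable_integrable)
    also have "\<dots> \<le> ?E" by (rule v(3))
    finally have "(\<integral>\<^sup>+x. ennreal ((v n x)\<^sup>2 + (\<Sum>i\<in>Basis. (partial_deriv i (v n) x)\<^sup>2)) \<partial>lborel) \<le> ennreal ?E"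
      by (simp add: ennreal_leI)
    then have sq: "(\<integral>\<^sup>+x. ennreal ((v n x)\<^sup>2 + (\<Sum>i\<in>Basis. (partial_deriv i (v n) x)\<^sup>2)) \<partial>lborel)\<^sup>2 \<le> (ennreal ?E)\<^sup>2"
      by (rule power_mono) simp
    have 4: "(\<integral>\<^sup>+x. ennreal ((v n x) ^ 4) \<partial>lborel) \<le>
        (\<integral>\<^sup>+x. ennreal ((v n x)\<^sup>2 + (\<Sum>i\<in>Basis. (partial_deriv i (v n) x)\<^sup>2)) \<partial>lborel)\<^sup>2"
      by (rule ladyzhenskaya_inequality[OF dim v1 \<rho>])
    have eE: "(ennreal ?E)\<^sup>2 = ennreal (?E\<^sup>2)" by (rule ennreal_power) simp
    have "(\<integral>\<^sup>+x. ennreal ((v n x) ^ 4) \<partial>lborel) \<le> ennreal (?E\<^sup>2)"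
      using order_trans[OF 4 sq] unfolding eE .
    then show ?thesis by (simp only: nn_integral_completion)
  qed
  have "(\<integral>\<^sup>+x. ennreal ((indicator \<Omega> x * f x) ^ 4) \<partial>lebesgue) = (\<integral>\<^sup>+x. liminf (\<lambda>n. ennreal ((v (r n) x) ^ 4)) \<partial>lebesgue)"
    by (rule nn_integral_cong_AE[OF lim])
  also have "\<dots> \<le> liminf (\<lambda>n. \<integral>\<^sup>+x. ennreal ((v (r n) x) ^ 4) \<partial>lebesgue)"
    by (rule nn_integral_liminf) measurable
  also have "\<dots> \<le> ennreal (?E\<^sup>2)"
    by (rule order_trans[OF Liminf_mono[OF always_eventually, of _ "\<lambda>n. ennreal (?E\<^sup>2)"]]) (auto simp: bound Liminf_const)
  finally have fin: "(\<integral>\<^sup>+x. ennreal ((indicator \<Omega> x * f x) ^ 4) \<partial>lebesgue) \<le> ennreal (?E\<^sup>2)" .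
  have int: "integrable lebesgue (\<lambda>x. (indicator \<Omega> x * f x) ^ 4)"
    by (rule integrableI_nonneg) (use fin in \<open>auto simp: top_unique less_top[symmetric] intro: le_less_trans\<close>)
  have eq: "(indicator \<Omega> x * f x) ^ 4 = indicator \<Omega> x *\<^sub>R (\<bar>f x\<bar> ^ 4)" for x by (simp add: indicator_def)
  show "set_integrable lebesgue \<Omega> (\<lambda>x. \<bar>f x\<bar> ^ 4)"
    using int unfolding eq by (simp only: set_integrable_def)
  have "ennreal (\<integral>x. (indicator \<Omega> x * f x) ^ 4 \<partial>lebesgue) \<le> ennreal (?E\<^sup>2)"
    using fin nn_integral_eq_integral[OF int] by simp
  then show "(LINT x:\<Omega>|lebesgue. \<bar>f x\<bar> ^ 4) \<le> ?E\<^sup>2"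
    unfolding eq set_lebesgue_integral_def by simp
qed

section \<open>Differences of powers\<close>

lemma powr_diff_le_aux:
  fixes a b :: real
  assumes "1 < p" "0 \<le> b" "b \<le> a"
  shows "a powr p - b powr p \<le> p * a powr (p - 1) * (a - b)"
\<comment> \<open>The mean value theorem requires a nondegenerate interval of positive numbers,
  where \<open>powr\<close> is differentiable.\<close>
proof (cases "b = 0 \<or> b = a")
  case True
  then show ?thesis
  proof
    assume b: "b = 0"
    have "a powr p = a powr (p - 1) * a" using assms by (cases "a = 0") (simp_all add: powr_mult_base powr_diff)
    moreover have "a powr (p - 1) * a \<le> p * (a powr (p - 1) * a)"
      using assms by (intro mult_right_mono[of 1 p, simplified]) auto
    ultimately show ?thesis using b assms by simp
  qed simp
next
  case False
  with assms have "0 < b" "b < a" by auto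
  then have "\<exists>z. b < z \<and> z < a \<and> a powr p - b powr p = (a - b) * (p * z powr (p - 1))"
    by (intro MVT2) (auto intro!: derivative_eq_intros)
  then obtain z where z: "b < z" "z < a" "a powr p - b powr p = (a - b) * (p * z powr (p - 1))" by blast
  have "z powr (p - 1) \<le> a powr (p - 1)" using z \<open>0 < b\<close> assms by (intro powr_mono2) auto
  then have "(a - b) * (p * z powr (p - 1)) \<le> (a - b) * (p * a powr (p - 1))"
    using assms by (intro mult_left_mono) auto
  then show ?thesis using z by (simp add: mult_ac)
qed

lemma powr_le_one_plus_power:
  assumes "0 \<le> (a::real)" "0 \<le> p" "p \<le> real q"
  shows "a powr p \<le> 1 + a ^ q"
proof (cases "a \<le> 1")
  case True
  have "a powr p \<le> 1 powr p" using assms True by (intro powr_mono2) auto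
  then show ?thesis using assms by (simp add: add_increasing2)
next
  case False
  have "a powr p \<le> a powr real q" using assms False by (intro powr_mono) auto
  then show ?thesis using False by (simp add: powr_realpow)
qed

text \<open>The mean value theorem bounds the difference by p a^(p-1) |a - b|, which Young's
  inequality splits. The small factor \<open>l\<close> goes to the power 2 (p - 1), controlled by
  the q-th power integrals; the large factor goes to the squared difference, which tends to 0 in the
  application.\<close>

lemma powr_abs_diff_le:
  fixes a b :: real
  assumes p: "1 < p" and q: "2 * (p - 1) \<le> real q" and l: "l > 0"
  shows "\<bar>\<bar>a\<bar> powr p - \<bar>b\<bar> powr p\<bar> \<le> l * (1 + \<bar>a\<bar> ^ q + \<bar>b\<bar> ^ q) + p\<^sup>2 / l * (a - b)\<^sup>2"
proof -
  have *: "x powr p - y powr p \<le> l * (1 + x ^ q + y ^ q) + p\<^sup>2 / l * (x - y)\<^sup>2" if "0 \<le> y" "y \<le> x" for x y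
  proof -
    let ?M = "x powr (p - 1)"
    have "0 \<le> (l * ?M - p * (x - y))\<^sup>2" by simp
    then have "2 * (l * ?M * (p * (x - y))) \<le> l\<^sup>2 * ?M\<^sup>2 + p\<^sup>2 * (x - y)\<^sup>2"
      by (simp add: power2_eq_square algebra_simps)
    moreover have "0 \<le> l * ?M * (p * (x - y))" using l p that by simp
    ultimately have "l * ?M * (p * (x - y)) \<le> l\<^sup>2 * ?M\<^sup>2 + p\<^sup>2 * (x - y)\<^sup>2" by linarith
    then have "p * ?M * (x - y) \<le> l * ?M\<^sup>2 + p\<^sup>2 / l * (x - y)\<^sup>2"
      using l by (simp add: field_simps power2_eq_square)
    moreover have "?M\<^sup>2 \<le> 1 + x ^ q"
    proof -
      have "?M\<^sup>2 = x powr (2 * (p - 1))"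
        unfolding power2_eq_square powr_add[symmetric] by (simp add: algebra_simps)
      then show ?thesis using powr_le_one_plus_power[of x "2 * (p - 1)" q] that p q by simp
    qed
    then have "l * ?M\<^sup>2 \<le> l * (1 + x ^ q + y ^ q)"
      using l that by (intro mult_left_mono) (auto simp: add_increasing2)
    ultimately show ?thesis using powr_diff_le_aux[OF p that] by linarith
  qed
  have sq: "(\<bar>a\<bar> - \<bar>b\<bar>)\<^sup>2 \<le> (a - b)\<^sup>2" by (simp add: abs_le_square_iff[symmetric])
  then have sq': "p\<^sup>2 / l * (\<bar>a\<bar> - \<bar>b\<bar>)\<^sup>2 \<le> p\<^sup>2 / l * (a - b)\<^sup>2"
    using l by (intro mult_left_mono) auto
  show ?thesis
  proof (cases "\<bar>b\<bar> \<le> \<bar>a\<bar>")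
    case True
    then have "\<bar>b\<bar> powr p \<le> \<bar>a\<bar> powr p" using p by (intro powr_mono2) auto
    then show ?thesis using *[of "\<bar>b\<bar>" "\<bar>a\<bar>"] True sq' by linarith
  next
    case False
    then have "\<bar>a\<bar> powr p \<le> \<bar>b\<bar> powr p" using p by (intro powr_mono2) auto
    then show ?thesis using *[of "\<bar>a\<bar>" "\<bar>b\<bar>"] False sq' power2_commute[of "\<bar>a\<bar>" "\<bar>b\<bar>"]
      by (simp add: algebra_simps)
  qed
qed

section \<open>Weights\<close>

text \<open>The multipliers integrated against the solution. Continuity is not part of the notion,
  because \<open>inner_part\<close> jumps at the radius of its ball. Vanishing outside the domain
  turns integrals over the domain into integrals over the whole space.\<close>

definition weight :: "'a::euclidean_space set \<Rightarrow> ('a \<Rightarrow> real) \<Rightarrow> bool" where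
  "weight \<Omega> g \<longleftrightarrow> g \<in> borel_measurable lebesgue \<and> (\<forall>x. x \<notin> \<Omega> \<longrightarrow> g x = 0) \<and>
     (\<exists>B. \<forall>x. \<bar>g x\<bar> \<le> B) \<and> (\<exists>r. \<forall>x. r < norm x \<longrightarrow> g x = 0)"

lemma weight_measurable: "weight \<Omega> g \<Longrightarrow> g \<in> borel_measurable lebesgue"
  by (simp add: weight_def)

lemma weight_outside: "weight \<Omega> g \<Longrightarrow> x \<notin> \<Omega> \<Longrightarrow> g x = 0"
  by (simp add: weight_def)

lemma weight_dominated:
  assumes "weight \<Omega> g"
  obtains B r where "\<And>x. \<bar>g x\<bar> \<le> B * indicator (cball 0 r) x" "B > 0"
proof -
  obtain B r where B: "\<And>x. \<bar>g x\<bar> \<le> B" and r: "\<And>x. r < norm x \<Longrightarrow> g x = 0"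
    using assms unfolding weight_def by blast
  have "\<bar>g x\<bar> \<le> (\<bar>B\<bar> + 1) * indicator (cball 0 r) x" for x
    using B[of x] r[of x] by (cases "r < norm x") (auto simp: indicator_def)
  then show ?thesis by (rule that) simp
qed

lemma integrable_indicator_cball: "integrable lebesgue (\<lambda>x::'a::euclidean_space. c * indicator (cball a r) x :: real)"
proof -
  have "integrable lborel (indicator (cball a r) :: 'a \<Rightarrow> real)"
    by (intro integrable_real_indicator) (use emeasure_bounded_finite[of "cball a r"] in \<open>simp_all add: infinity_ennreal_def\<close>)
  then show ?thesis by (intro integrable_mult_right integrable_lebesgue_lborel)
qed

lemma weight_continuous_on:
  assumes "open \<Omega>" "continuous_on \<Omega> g" "\<And>x. x \<notin> \<Omega> \<Longrightarrow> g x = 0"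
    "\<And>x. x \<in> \<Omega> \<Longrightarrow> \<bar>g x\<bar> \<le> B" "\<And>x. x \<in> \<Omega> \<Longrightarrow> r < norm x \<Longrightarrow> g x = 0"
  shows "weight \<Omega> (g :: 'a::euclidean_space \<Rightarrow> real)"
  unfolding weight_def
proof (intro conjI)
  have "(\<lambda>x. indicator \<Omega> x *\<^sub>R g x) \<in> borel_measurable borel"
    using assms(1,2) by (intro borel_measurable_continuous_on_indicator) auto
  moreover have "indicator \<Omega> x *\<^sub>R g x = g x" for x using assms(3)[of x] by (cases "x \<in> \<Omega>") auto
  ultimately have "g \<in> borel_measurable borel" by (simp only:)
  then show "g \<in> borel_measurable lebesgue" by (intro measurable_completion) simp
  have "\<bar>g x\<bar> \<le> \<bar>B\<bar>" for x using assms(3,4)[of x] by (cases "x \<in> \<Omega>") auto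
  then show "\<exists>B. \<forall>x. \<bar>g x\<bar> \<le> B" by blast
  have "g x = 0" if "r < norm x" for x using assms(3,5)[of x] that by blast
  then show "\<exists>r. \<forall>x. r < norm x \<longrightarrow> g x = 0" by blast
qed (use assms(3) in blast)

lemma weight_L2:
  assumes "weight \<Omega> g"
  shows "L2 \<Omega> g"
proof -
  obtain B r where B: "\<And>x. \<bar>g x\<bar> \<le> B * indicator (cball 0 r) x" "B > 0" using weight_dominated[OF assms] by blast
  have [measurable]: "g \<in> borel_measurable lebesgue" by (rule weight_measurable[OF assms])
  have "integrable lebesgue (\<lambda>x. (g x)\<^sup>2)"
  proof (rule Bochner_Integration.integrable_bound[OF integrable_indicator_cball])
    show "AE x in lebesgue. norm ((g x)\<^sup>2) \<le> norm (B\<^sup>2 * indicator (cball 0 r) x)"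
    proof (intro AE_I2)
      fix x
      have "\<bar>g x\<bar>\<^sup>2 \<le> (B * indicator (cball 0 r) x)\<^sup>2" by (rule power_mono[OF B(1)]) simp
      also have "\<dots> = B\<^sup>2 * indicator (cball 0 r) x" by (simp add: indicator_def)
      finally show "norm ((g x)\<^sup>2) \<le> norm (B\<^sup>2 * indicator (cball 0 r) x)" by simp
    qed
  qed measurable
  then show ?thesis using weight_outside[OF assms]
    by (simp add: L2_def set_integral_eq_integral)
qed

lemma weight_integrable:
  assumes "weight \<Omega> g" "L2 \<Omega> f"
  shows "integrable lebesgue (\<lambda>x. f x * g x)" "(LINT x:\<Omega>|lebesgue. f x * g x) = (\<integral>x. f x * g x \<partial>lebesgue)"
  using L2_mult[OF assms(2) weight_L2[OF assms(1)]] weight_outside[OF assms(1)]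
  by (simp_all add: set_integral_eq_integral)

text \<open>Young's inequality with a free parameter, in the role of Cauchy-Schwarz: it is applied
  where one of the two integrals is fixed and the other is small.\<close>

lemma weight_pairing_le:
  assumes g: "weight \<Omega> g" and f: "L2 \<Omega> f" and l: "l > 0"
  shows "\<bar>\<integral>x. f x * g x \<partial>lebesgue\<bar> \<le> l * (\<integral>x. (g x)\<^sup>2 \<partial>lebesgue) + 1 / l * (LINT x:\<Omega>|lebesgue. (f x)\<^sup>2)"
proof -
  have i: "integrable lebesgue (\<lambda>x. f x * g x)" by (rule weight_integrable[OF g f])
  have i2: "integrable lebesgue (\<lambda>x. (g x)\<^sup>2)"
    using weight_L2[OF g] weight_outside[OF g] by (simp add: L2_def set_integral_eq_integral)
  have i3: "integrable lebesgue (\<lambda>x. indicator \<Omega> x * (f x)\<^sup>2)" using f by (simp add: L2_def set_integrable_def)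
  have "\<bar>\<integral>x. f x * g x \<partial>lebesgue\<bar> \<le> (\<integral>x. \<bar>f x * g x\<bar> \<partial>lebesgue)"
    by (rule integral_abs_bound)
  also have "\<dots> \<le> (\<integral>x. l * (g x)\<^sup>2 + 1 / l * (indicator \<Omega> x * (f x)\<^sup>2) \<partial>lebesgue)"
  proof (rule integral_mono)
    show "integrable lebesgue (\<lambda>x. l * (g x)\<^sup>2 + 1 / l * (indicator \<Omega> x * (f x)\<^sup>2))"
      using i2 i3 by (intro Bochner_Integration.integrable_add integrable_mult_right) auto
    show "\<bar>f x * g x\<bar> \<le> l * (g x)\<^sup>2 + 1 / l * (indicator \<Omega> x * (f x)\<^sup>2)" for x
    proof (cases "x \<in> \<Omega>")
      case True
      have "0 \<le> (l * \<bar>g x\<bar> - \<bar>f x\<bar>)\<^sup>2" by simp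
      then have "2 * (l * \<bar>f x * g x\<bar>) \<le> l\<^sup>2 * (g x)\<^sup>2 + (f x)\<^sup>2"
        by (simp add: power2_diff power_mult_distrib abs_mult mult_ac)
      moreover have "0 \<le> l * \<bar>f x * g x\<bar>" using l by simp
      ultimately have "l * \<bar>f x * g x\<bar> \<le> l\<^sup>2 * (g x)\<^sup>2 + (f x)\<^sup>2" by linarith
      then show ?thesis using l True by (simp add: field_simps power2_eq_square)
    qed (simp add: weight_outside[OF g] l less_imp_le)
  qed (use i in simp)
  also have "\<dots> = l * (\<integral>x. (g x)\<^sup>2 \<partial>lebesgue) + 1 / l * (\<integral>x. indicator \<Omega> x * (f x)\<^sup>2 \<partial>lebesgue)"
    using i2 i3 by simp
  finally show ?thesis by (simp add: set_lebesgue_integral_def)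
qed

text \<open>The order of choices matters: \<open>K\<close> is fixed, while \<open>C l\<close> may
  explode as \<open>l\<close> tends to 0. First \<open>l\<close> makes the first term small, then
  the filter makes \<open>N s\<close> small for that \<open>l\<close>.\<close>

lemma tendsto_by_absorption:
  fixes f N :: "'b \<Rightarrow> real"
  assumes N: "(N \<longlongrightarrow> 0) F"
    and le: "\<And>l. l > 0 \<Longrightarrow> \<forall>\<^sub>F s in F. \<bar>f s - L\<bar> \<le> l * K + C l * N s"
  shows "(f \<longlongrightarrow> L) F"
proof (rule tendstoI)
  fix e :: real assume e: "e > 0"
  define l where "l = e / (2 * (\<bar>K\<bar> + 1))"
  have l: "l > 0" using e by (simp add: l_def)
  have "l * K \<le> e / 2"
  proof -
    have "l * K \<le> l * (\<bar>K\<bar> + 1)" using l by (intro mult_left_mono) auto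
    also have "\<dots> = e / 2" by (simp add: l_def field_simps add_eq_0_iff)
    finally show ?thesis .
  qed
  have "((\<lambda>s. C l * N s) \<longlongrightarrow> C l * 0) F" by (intro tendsto_intros N)
  then have "\<forall>\<^sub>F s in F. \<bar>C l * N s\<bar> < e / 2"
    using order_tendstoD(2)[OF tendsto_rabs[of _ 0], of _ F "e / 2"] e by simp
  with le[OF l] show "\<forall>\<^sub>F s in F. dist (f s) L < e"
    by eventually_elim (use \<open>l * K \<le> e / 2\<close> in \<open>simp add: dist_real_def\<close>)
qed

lemma weight_power_integrable:
  assumes g: "weight \<Omega> g" and f: "set_borel_measurable lebesgue \<Omega> f"
    and q: "set_integrable lebesgue \<Omega> (\<lambda>x. \<bar>f x\<bar> ^ q)" and p: "0 \<le> p" "p \<le> real q"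
  shows "integrable lebesgue (\<lambda>x. \<bar>f x\<bar> powr p * g x)"
    "(LINT x:\<Omega>|lebesgue. \<bar>f x\<bar> powr p * g x) = (\<integral>x. \<bar>f x\<bar> powr p * g x \<partial>lebesgue)"
proof -
  obtain B r where B: "\<And>x. \<bar>g x\<bar> \<le> B * indicator (cball 0 r) x" "B > 0" using weight_dominated[OF g] by blast
  have [measurable]: "g \<in> borel_measurable lebesgue" by (rule weight_measurable[OF g])
  have [measurable]: "(\<lambda>x. indicator \<Omega> x * f x) \<in> borel_measurable lebesgue"
    using f by (simp add: set_borel_measurable_def)
  have eq: "\<bar>indicator \<Omega> x * f x\<bar> powr p * g x = \<bar>f x\<bar> powr p * g x" for x
    using weight_outside[OF g, of x] by (cases "x \<in> \<Omega>") auto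
  have "(\<lambda>x. \<bar>indicator \<Omega> x * f x\<bar> powr p * g x) \<in> borel_measurable lebesgue" by measurable
  then have m: "(\<lambda>x. \<bar>f x\<bar> powr p * g x) \<in> borel_measurable lebesgue" unfolding eq .
  show "integrable lebesgue (\<lambda>x. \<bar>f x\<bar> powr p * g x)"
  proof (rule Bochner_Integration.integrable_bound)
    show "integrable lebesgue (\<lambda>x. B * indicator (cball 0 r) x + B * (indicator \<Omega> x *\<^sub>R \<bar>f x\<bar> ^ q))"
      using q by (intro Bochner_Integration.integrable_add integrable_indicator_cball integrable_mult_right)
        (simp only: set_integrable_def)
    show "AE x in lebesgue. norm (\<bar>f x\<bar> powr p * g x) \<le>
        norm (B * indicator (cball 0 r) x + B * (indicator \<Omega> x *\<^sub>R \<bar>f x\<bar> ^ q))"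
    proof (intro AE_I2)
      fix x
      have "\<bar>f x\<bar> powr p * \<bar>g x\<bar> \<le> B * indicator (cball 0 r) x + B * (indicator \<Omega> x *\<^sub>R \<bar>f x\<bar> ^ q)"
      proof (cases "x \<in> \<Omega> \<and> norm x \<le> r")
        case True
        have "\<bar>f x\<bar> powr p * \<bar>g x\<bar> \<le> (1 + \<bar>f x\<bar> ^ q) * B"
          using B(1)[of x] True p by (intro mult_mono powr_le_one_plus_power) auto
        then show ?thesis using True by (simp add: algebra_simps)
      next
        case False
        then have "g x = 0" using weight_outside[OF g, of x] B(1)[of x] by auto
        then show ?thesis using B(2) by simp
      qed
      then show "norm (\<bar>f x\<bar> powr p * g x) \<le>
        norm (B * indicator (cball 0 r) x + B * (indicator \<Omega> x *\<^sub>R \<bar>f x\<bar> ^ q))"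
        by (simp add: abs_mult)
    qed
  qed (rule m)
  show "(LINT x:\<Omega>|lebesgue. \<bar>f x\<bar> powr p * g x) = (\<integral>x. \<bar>f x\<bar> powr p * g x \<partial>lebesgue)"
    using weight_outside[OF g] by (simp add: set_integral_eq_integral)
qed

section \<open>Continuity in time of the pairings with a weight\<close>

definition good_curve :: "'a::euclidean_space set \<Rightarrow> nat \<Rightarrow> (real \<Rightarrow> 'a \<Rightarrow> real) \<Rightarrow> bool" where
  "good_curve \<Omega> q u \<longleftrightarrow> (\<forall>t\<ge>0. L2 \<Omega> (u t)) \<and> (\<forall>t\<ge>0. set_integrable lebesgue \<Omega> (\<lambda>x. \<bar>u t x\<bar> ^ q)) \<and>
     (\<forall>S. \<exists>Q. \<forall>t\<in>{0..S}. (LINT x:\<Omega>|lebesgue. \<bar>u t x\<bar> ^ q) \<le> Q) \<and>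
     (\<forall>t\<ge>0. ((\<lambda>s. LINT x:\<Omega>|lebesgue. (u s x - u t x)\<^sup>2) \<longlongrightarrow> 0) (at t within {0..}))"

lemma continuous_on_pairing:
  assumes u: "good_curve \<Omega> q u" and g: "weight \<Omega> g"
  shows "continuous_on {0..} (\<lambda>t. \<integral>x. u t x * g x \<partial>lebesgue)"
  unfolding continuous_on_def
proof
  fix t :: real assume t: "t \<in> {0..}"
  show "((\<lambda>s. \<integral>x. u s x * g x \<partial>lebesgue) \<longlongrightarrow> (\<integral>x. u t x * g x \<partial>lebesgue)) (at t within {0..})"
  proof (rule tendsto_by_absorption)
    show "((\<lambda>s. LINT x:\<Omega>|lebesgue. (u s x - u t x)\<^sup>2) \<longlongrightarrow> 0) (at t within {0..})"
      using u t unfolding good_curve_def by simp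
    fix l :: real assume l: "l > 0"
    have "\<bar>(\<integral>x. u s x * g x \<partial>lebesgue) - (\<integral>x. u t x * g x \<partial>lebesgue)\<bar> \<le>
        l * (\<integral>x. (g x)\<^sup>2 \<partial>lebesgue) + 1 / l * (LINT x:\<Omega>|lebesgue. (u s x - u t x)\<^sup>2)" if "s \<ge> 0" for s
    proof -
      have L: "L2 \<Omega> (u s)" "L2 \<Omega> (u t)" using u t that unfolding good_curve_def by auto
      have "(\<integral>x. u s x * g x \<partial>lebesgue) - (\<integral>x. u t x * g x \<partial>lebesgue) = (\<integral>x. (u s x - u t x) * g x \<partial>lebesgue)"
        using weight_integrable(1)[OF g L(1)] weight_integrable(1)[OF g L(2)] by (simp add: left_diff_distrib)
      with weight_pairing_le[OF g L2_add_diff(1)[OF L] l] show ?thesis by simp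
    qed
    then show "\<forall>\<^sub>F s in at t within {0..}. \<bar>(\<integral>x. u s x * g x \<partial>lebesgue) - (\<integral>x. u t x * g x \<partial>lebesgue)\<bar> \<le>
        l * (\<integral>x. (g x)\<^sup>2 \<partial>lebesgue) + 1 / l * (LINT x:\<Omega>|lebesgue. (u s x - u t x)\<^sup>2)"
      by (simp add: eventually_at_filter)
  qed
qed

text \<open>The time integrals of the nonlinear term need this continuity. By
  \<open>powr_abs_diff_le\<close> the difference is at most a small multiple of locally bounded q-th
  power integrals plus a large multiple of the squared L^2 distance.\<close>

lemma continuous_on_power_pairing:
  assumes u: "good_curve \<Omega> q u" and g: "weight \<Omega> g"
    and p: "1 < p" "p \<le> real q" "2 * (p - 1) \<le> real q"
  shows "continuous_on {0..} (\<lambda>t. \<integral>x. \<bar>u t x\<bar> powr p * g x \<partial>lebesgue)"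
  unfolding continuous_on_def
proof
  fix t :: real assume t: "t \<in> {0..}"
  obtain B r where B: "\<And>x. \<bar>g x\<bar> \<le> B * indicator (cball 0 r) x" "B > 0" using weight_dominated[OF g] by blast
  \<comment> \<open>The bound has to hold uniformly near \<open>t\<close>; the interval up to
    \<open>t + 1\<close> contains a neighbourhood of \<open>t\<close> within the half-line.\<close>
  obtain Q where Q: "\<And>s. s \<in> {0..t + 1} \<Longrightarrow> (LINT x:\<Omega>|lebesgue. \<bar>u s x\<bar> ^ q) \<le> Q"
    using u unfolding good_curve_def by blast
  let ?V = "\<integral>x. (indicator (cball (0::'a) r) x :: real) \<partial>lebesgue"
  show "((\<lambda>s. \<integral>x. \<bar>u s x\<bar> powr p * g x \<partial>lebesgue) \<longlongrightarrow> (\<integral>x. \<bar>u t x\<bar> powr p * g x \<partial>lebesgue)) (at t within {0..})"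
  proof (rule tendsto_by_absorption[where K="B * (?V + 2 * Q)" and C="\<lambda>l. B * (p\<^sup>2 / l)"])
    show "((\<lambda>s. LINT x:\<Omega>|lebesgue. (u s x - u t x)\<^sup>2) \<longlongrightarrow> 0) (at t within {0..})"
      using u t unfolding good_curve_def by simp
    fix l :: real assume l: "l > 0"
    have "\<bar>(\<integral>x. \<bar>u s x\<bar> powr p * g x \<partial>lebesgue) - (\<integral>x. \<bar>u t x\<bar> powr p * g x \<partial>lebesgue)\<bar> \<le>
        l * (B * (?V + 2 * Q)) + B * (p\<^sup>2 / l) * (LINT x:\<Omega>|lebesgue. (u s x - u t x)\<^sup>2)" if s: "s \<in> {0..t + 1}" for s
    proof -
      have L: "L2 \<Omega> (u s)" "L2 \<Omega> (u t)" using u t s unfolding good_curve_def by auto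
      have q: "set_integrable lebesgue \<Omega> (\<lambda>x. \<bar>u s x\<bar> ^ q)" "set_integrable lebesgue \<Omega> (\<lambda>x. \<bar>u t x\<bar> ^ q)"
        using u t s unfolding good_curve_def by auto
      have m: "set_borel_measurable lebesgue \<Omega> (u s)" "set_borel_measurable lebesgue \<Omega> (u t)"
        using L by (auto simp: L2_def)
      have p0: "0 \<le> p" using p by simp
      note i = weight_power_integrable(1)[OF g m(1) q(1) p0 p(2)] weight_power_integrable(1)[OF g m(2) q(2) p0 p(2)]
      let ?D = "\<lambda>x. \<bar>u s x\<bar> powr p * g x - \<bar>u t x\<bar> powr p * g x"
      let ?W = "\<lambda>x. B * l * indicator (cball 0 r) x + B * l * (indicator \<Omega> x *\<^sub>R \<bar>u s x\<bar> ^ q) +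
          B * l * (indicator \<Omega> x *\<^sub>R \<bar>u t x\<bar> ^ q) + B * (p\<^sup>2 / l) * (indicator \<Omega> x *\<^sub>R (u s x - u t x)\<^sup>2)"
      have iW: "integrable lebesgue (\<lambda>x::'a. B * l * indicator (cball 0 r) x)"
          "integrable lebesgue (\<lambda>x. indicator \<Omega> x *\<^sub>R \<bar>u s x\<bar> ^ q)" "integrable lebesgue (\<lambda>x. indicator \<Omega> x *\<^sub>R \<bar>u t x\<bar> ^ q)"
          "integrable lebesgue (\<lambda>x. indicator \<Omega> x *\<^sub>R (u s x - u t x)\<^sup>2)"
        using q L2_add_diff(1)[OF L] integrable_indicator_cball unfolding L2_def set_integrable_def by blast+
      have "\<bar>(\<integral>x. \<bar>u s x\<bar> powr p * g x \<partial>lebesgue) - (\<integral>x. \<bar>u t x\<bar> powr p * g x \<partial>lebesgue)\<bar> = \<bar>\<integral>x. ?D x \<partial>lebesgue\<bar>"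
        using i by simp
      also have "\<dots> \<le> (\<integral>x. \<bar>?D x\<bar> \<partial>lebesgue)" by (rule integral_abs_bound)
      also have "\<dots> \<le> (\<integral>x. ?W x \<partial>lebesgue)"
      proof (rule integral_mono)
        show "integrable lebesgue ?W"
          by (intro Bochner_Integration.integrable_add iW integrable_mult_right)
        show "\<bar>?D x\<bar> \<le> ?W x" for x
        proof (cases "x \<in> \<Omega> \<and> norm x \<le> r")
          case True
          have "\<bar>?D x\<bar> = \<bar>g x\<bar> * \<bar>\<bar>u s x\<bar> powr p - \<bar>u t x\<bar> powr p\<bar>"
            by (simp add: abs_mult[symmetric] algebra_simps)
          also have "\<dots> \<le> B * (l * (1 + \<bar>u s x\<bar> ^ q + \<bar>u t x\<bar> ^ q) + p\<^sup>2 / l * (u s x - u t x)\<^sup>2)"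
            using B(1)[of x] True B(2) by (intro mult_mono powr_abs_diff_le[OF p(1,3) l]) auto
          also have "\<dots> = ?W x" using True by (simp add: algebra_simps)
          finally show ?thesis .
        next
          case False
          then have "g x = 0" using weight_outside[OF g, of x] B(1)[of x] by auto
          then show ?thesis using B(2) l by simp
        qed
      qed (use i in simp)
      also have "\<dots> = B * l * ?V + B * l * (LINT x:\<Omega>|lebesgue. \<bar>u s x\<bar> ^ q) +
          B * l * (LINT x:\<Omega>|lebesgue. \<bar>u t x\<bar> ^ q) + B * (p\<^sup>2 / l) * (LINT x:\<Omega>|lebesgue. (u s x - u t x)\<^sup>2)"
        unfolding set_lebesgue_integral_def using iW
        by (subst Bochner_Integration.integral_add, (intro Bochner_Integration.integrable_add iW integrable_mult_right)+)+ simp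
      also have "\<dots> \<le> B * l * ?V + B * l * Q + B * l * Q + B * (p\<^sup>2 / l) * (LINT x:\<Omega>|lebesgue. (u s x - u t x)\<^sup>2)"
        using B l Q[OF s] Q[of t] t by (intro add_mono mult_left_mono) auto
      finally show ?thesis by (simp add: algebra_simps)
    qed
    moreover have "\<forall>\<^sub>F s in at t within {0..}. s \<in> {0..t + 1}"
      using t by (auto simp: eventually_at dist_real_def intro!: exI[of _ 1])
    ultimately show "\<forall>\<^sub>F s in at t within {0..}. \<bar>(\<integral>x. \<bar>u s x\<bar> powr p * g x \<partial>lebesgue) - (\<integral>x. \<bar>u t x\<bar> powr p * g x \<partial>lebesgue)\<bar> \<le>
        l * (B * (?V + 2 * Q)) + B * (p\<^sup>2 / l) * (LINT x:\<Omega>|lebesgue. (u s x - u t x)\<^sup>2)"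
      by (rule eventually_mono[rotated])
  qed
qed

section \<open>Maximum principle and interior gradient estimate\<close>

text \<open>A second derivative along a single line, for an arbitrary direction. It makes reflected
  functions and explicit barriers accessible to the maximum principle without a chain rule for
  second derivatives in several variables.\<close>

definition has_dir2 :: "('a::euclidean_space \<Rightarrow> real) \<Rightarrow> 'a \<Rightarrow> 'a \<Rightarrow> real \<Rightarrow> bool" where
  "has_dir2 w x j h \<longleftrightarrow> (\<exists>g d. d > 0 \<and> (\<forall>s. \<bar>s\<bar> < d \<longrightarrow> ((\<lambda>s. w (x + s *\<^sub>R j)) has_real_derivative g s) (at s)) \<and>
     (g has_real_derivative h) (at 0))"

lemma has_dir2_lin:
  assumes "has_dir2 w x j h" "has_dir2 v x j k"
  shows "has_dir2 (\<lambda>x. a * w x + b * v x) x j (a * h + b * k)"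
proof -
  obtain g d where g: "d > 0" "\<And>s. \<bar>s\<bar> < d \<Longrightarrow> ((\<lambda>s. w (x + s *\<^sub>R j)) has_real_derivative g s) (at s)"
     "(g has_real_derivative h) (at 0)" using assms(1) unfolding has_dir2_def by blast
  obtain g' d' where g': "d' > 0" "\<And>s. \<bar>s\<bar> < d' \<Longrightarrow> ((\<lambda>s. v (x + s *\<^sub>R j)) has_real_derivative g' s) (at s)"
     "(g' has_real_derivative k) (at 0)" using assms(2) unfolding has_dir2_def by blast
  show ?thesis unfolding has_dir2_def
  proof (intro exI[of _ "\<lambda>s. a * g s + b * g' s"] exI[of _ "min d d'"] conjI allI impI)
    show "((\<lambda>s. a * w (x + s *\<^sub>R j) + b * v (x + s *\<^sub>R j)) has_real_derivative a * g s + b * g' s) (at s)"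
      if "\<bar>s\<bar> < min d d'" for s
      using that by (intro DERIV_add DERIV_cmult g(2) g'(2)) auto
  qed (use g g' in \<open>auto intro!: DERIV_add DERIV_cmult\<close>)
qed

text \<open>Second derivatives are even in the direction. This is used for the reflection, which
  reverses one coordinate direction.\<close>

lemma has_dir2_uminus:
  assumes "has_dir2 w x j h"
  shows "has_dir2 w x (- j) h"
proof -
  obtain g d where g: "d > 0" "\<And>s. \<bar>s\<bar> < d \<Longrightarrow> ((\<lambda>s. w (x + s *\<^sub>R j)) has_real_derivative g s) (at s)"
     "(g has_real_derivative h) (at 0)" using assms(1) unfolding has_dir2_def by blast
  have 1: "((\<lambda>s. w (x + s *\<^sub>R (- j))) has_real_derivative - g (- s)) (at s)" if "\<bar>s\<bar> < d" for s
  proof -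
    have m: "(uminus has_real_derivative - 1) (at s)" by (auto intro!: derivative_eq_intros)
    have "((\<lambda>s. w (x + s *\<^sub>R j)) has_real_derivative g (- s)) (at (- s))" using g(2)[of "- s"] that by simp
    from DERIV_chain2[OF this m] show ?thesis by simp
  qed
  have 2: "((\<lambda>s. - g (- s)) has_real_derivative h) (at 0)"
  proof -
    have m: "(uminus has_real_derivative - 1) (at (0::real))" by (auto intro!: derivative_eq_intros)
    have "(g has_real_derivative h) (at (- 0))" using g(3) by simp
    from DERIV_minus[OF DERIV_chain2[OF this m]] show ?thesis by simp
  qed
  show ?thesis unfolding has_dir2_def
    by (intro exI[of _ "\<lambda>s. - g (- s)"] exI[of _ d]) (use g(1) 1 2 in blast)
qed

lemma has_dir2_partial_deriv:
  assumes S: "open S" "Ck_on 2 S f" "x \<in> S" and j: "j \<in> Basis"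
  shows "has_dir2 f x j (partial_deriv j (partial_deriv j f) x)"
proof -
  obtain d where d: "d > 0" "ball x d \<subseteq> S" using S open_contains_ball by blast
  have "x + s *\<^sub>R j \<in> S" if "\<bar>s\<bar> < d" for s
    using d that j by (auto simp: dist_norm intro!: subsetD[OF d(2)])
  then have "((\<lambda>s. f (x + s *\<^sub>R j)) has_real_derivative partial_deriv j f (x + s *\<^sub>R j)) (at s)" if "\<bar>s\<bar> < d" for s
    using that Ck_on_2_D(1)[OF S(2)] by (intro DERIV_partial_deriv) blast
  moreover have "((\<lambda>s. partial_deriv j f (x + s *\<^sub>R j)) has_real_derivative partial_deriv j (partial_deriv j f) x) (at 0)"
    using DERIV_partial_deriv[of "partial_deriv j f" x 0 j] Ck_on_2_D(2)[OF S(2,3) j] by simp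
  ultimately show ?thesis unfolding has_dir2_def
    by (intro exI[of _ "\<lambda>s. partial_deriv j f (x + s *\<^sub>R j)"] exI[of _ d]) (use d(1) in blast)
qed

text \<open>At the maximum the first derivative is 0; a positive second derivative would make the
  first derivative positive just to the right, and the mean value theorem would produce a larger
  value.\<close>

lemma has_dir2_local_max:
  assumes h: "has_dir2 w x j h" and e: "e > 0" and max: "\<And>s. \<bar>s\<bar> < e \<Longrightarrow> w (x + s *\<^sub>R j) \<le> w x"
  shows "h \<le> 0"
proof (rule ccontr)
  assume "\<not> h \<le> 0"
  then have hp: "h > 0" by simp
  obtain g d where g: "d > 0" "\<And>s. \<bar>s\<bar> < d \<Longrightarrow> ((\<lambda>s. w (x + s *\<^sub>R j)) has_real_derivative g s) (at s)"
     "(g has_real_derivative h) (at 0)" using h unfolding has_dir2_def by blast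
  have "g 0 = 0"
    by (rule DERIV_local_max[OF g(2)[of 0] e]) (use g(1) max in auto)
  with DERIV_pos_inc_right[OF g(3) hp] obtain d' where d': "d' > 0" "\<And>s. 0 < s \<Longrightarrow> s < d' \<Longrightarrow> 0 < g s" by auto
  define s where "s = min (min d d') e / 2"
  have s: "0 < s" "s < d" "s < d'" "s < e" using g(1) d'(1) e by (auto simp: s_def)
  have "\<exists>z. 0 < z \<and> z < s \<and> w (x + s *\<^sub>R j) - w (x + 0 *\<^sub>R j) = (s - 0) * g z"
    by (rule MVT2[OF s(1)]) (use g(2) s in auto)
  then obtain z where z: "0 < z" "z < s" "w (x + s *\<^sub>R j) - w x = s * g z" by auto
  have "0 < s * g z" using s z d'(2)[of z] by simp
  then show False using z(3) max[of s] s by simp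
qed

lemma has_dir2_norm_square:
  assumes "j \<in> Basis"
  shows "has_dir2 (\<lambda>y. (norm y)\<^sup>2) x j 2"
proof -
  have eq: "(norm (x + s *\<^sub>R j))\<^sup>2 = (norm x)\<^sup>2 + 2 * s * (x \<bullet> j) + s\<^sup>2" for s
    unfolding power2_norm_eq_inner using inner_same_Basis[OF assms]
    by (simp add: inner_add_left inner_add_right inner_commute[of j x] power2_eq_square algebra_simps)
  show ?thesis unfolding has_dir2_def eq
    by (intro exI[of _ "\<lambda>s. 2 * (x \<bullet> j) + 2 * s"] exI[of _ 1])
      (auto intro!: derivative_eq_intros)
qed

text \<open>Adding \<delta> |x|^2 makes the sum of the second derivatives strictly positive, which
  excludes an interior maximum. For small \<delta> the perturbation cannot lift the boundary values
  to the positive value at \<open>x0\<close>.\<close>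

lemma weak_maximum_principle:
  fixes w :: "'a::euclidean_space \<Rightarrow> real"
  assumes U: "open U" "bounded U" and w: "continuous_on (closure U) w"
    and dir: "\<And>x j. x \<in> U \<Longrightarrow> j \<in> Basis \<Longrightarrow> has_dir2 w x j (H x j)"
    and H: "\<And>x. x \<in> U \<Longrightarrow> 0 \<le> (\<Sum>j\<in>Basis. H x j)"
    and fr: "\<And>x. x \<in> frontier U \<Longrightarrow> w x \<le> 0"
    and x0: "x0 \<in> U"
  shows "w x0 \<le> 0"
proof (rule ccontr)
  assume "\<not> w x0 \<le> 0"
  then have p: "w x0 > 0" by simp
  have K: "compact (closure U)" using U(2) by simp
  obtain R where R: "\<And>x. x \<in> closure U \<Longrightarrow> norm x \<le> R"
    using compact_imp_bounded[OF K] by (auto simp: bounded_iff)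
  \<comment> \<open>Chosen such that \<delta> R^2 stays below the value at \<open>x0\<close>; adding
    1 keeps the denominator positive even if R is 0.\<close>
  define \<delta> where "\<delta> = w x0 / (2 * (R\<^sup>2 + 1))"
  have R1: "R\<^sup>2 + 1 > 0" by (simp add: add_nonneg_pos)
  have \<delta>: "\<delta> > 0" using p R1 by (simp add: \<delta>_def)
  have \<delta>R: "\<delta> * R\<^sup>2 < w x0"
  proof -
    have "\<delta> * R\<^sup>2 < \<delta> * (2 * (R\<^sup>2 + 1))" using \<delta> R1 by (intro mult_strict_left_mono) auto
    also have "\<dots> = w x0" using R1 by (simp add: \<delta>_def)
    finally show ?thesis .
  qed
  define W where "W x = w x + \<delta> * (norm x)\<^sup>2" for x
  have x0c: "x0 \<in> closure U" using x0 closure_subset by blast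
  have cW: "continuous_on (closure U) W" unfolding W_def by (intro continuous_intros w)
  have "closure U \<noteq> {}" using x0 by auto
  then obtain m where m: "m \<in> closure U" "\<And>y. y \<in> closure U \<Longrightarrow> W y \<le> W m"
    using continuous_attains_sup[OF K _ cW] by blast
  have "0 \<le> \<delta> * (norm x0)\<^sup>2" using \<delta> by simp
  then have Wm: "w x0 \<le> W m" using m(2)[OF x0c] unfolding W_def by linarith
  have "m \<in> U"
  proof (rule ccontr)
    assume "m \<notin> U"
    then have "m \<in> frontier U" using m(1) U(1) by (simp add: frontier_def interior_open)
    then have "W m \<le> \<delta> * (norm m)\<^sup>2" using fr by (simp add: W_def)
    also have "\<dots> \<le> \<delta> * R\<^sup>2" using \<delta> R[OF m(1)] by (intro mult_left_mono power_mono) auto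
    finally show False using Wm \<delta>R by simp
  qed
  then obtain e where e: "e > 0" "ball m e \<subseteq> U" using U(1) open_contains_ball by blast
  have "H m j + 2 * \<delta> \<le> 0" if j: "j \<in> Basis" for j
  proof (rule has_dir2_local_max[OF _ e(1)])
    show "has_dir2 W m j (H m j + 2 * \<delta>)"
      using has_dir2_lin[OF dir[OF \<open>m \<in> U\<close> j] has_dir2_norm_square[OF j], of 1 \<delta>] by (simp add: W_def[abs_def] mult.commute)
    show "W (m + s *\<^sub>R j) \<le> W m" if "\<bar>s\<bar> < e" for s
    proof (rule m(2))
      have "m + s *\<^sub>R j \<in> ball m e" using that j by (simp add: dist_norm)
      then show "m + s *\<^sub>R j \<in> closure U" using e(2) closure_subset by blast
    qed
  qed
  then have "(\<Sum>j\<in>(Basis::'a set). H m j + 2 * \<delta>) \<le> 0" by (rule sum_nonpos)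
  then have "(\<Sum>j\<in>Basis. H m j) + 2 * \<delta> * DIM('a) \<le> 0" by (simp add: sum.distrib mult_ac)
  moreover have "0 < 2 * \<delta> * DIM('a)" using \<delta> by simp
  ultimately show False using H[OF \<open>m \<in> U\<close>] by linarith
qed

text \<open>The interior gradient estimate in the half cube \<open>0 < y \<bullet> i < d\<close>: the odd part of \<open>f\<close> in direction
  \<open>i\<close> is compared with the harmonic barrier \<open>M / d\<^sup>2 * (\<bar>y\<bar>\<^sup>2 + n d y\<^sub>i - n y\<^sub>i\<^sup>2)\<close>.\<close>

lemma harmonic_gradient_bound:
  fixes f :: "'a::euclidean_space \<Rightarrow> real" and d M :: real
  assumes S: "open S" "Ck_on 2 S f" and harm: "\<And>x. x \<in> S \<Longrightarrow> laplacian f x = 0"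
    and d: "d > 0" and cube: "\<And>y. (\<And>j. j \<in> Basis \<Longrightarrow> \<bar>y \<bullet> j\<bar> \<le> d) \<Longrightarrow> x0 + y \<in> S \<and> \<bar>f (x0 + y)\<bar> \<le> M"
    and i: "i \<in> Basis"
  shows "\<bar>partial_deriv i f x0\<bar> \<le> DIM('a) * M / d"
proof -
  let ?n = "real DIM('a)"
  have M: "0 \<le> M" using cube[of 0] d by fastforce
  \<comment> \<open>Reflection in the hyperplane orthogonal to \<open>i\<close>. The function x -> f
    (x0 + x) - f (x0 + \<open>rf\<close> x) is odd across it and harmonic.\<close>
  define rf where "rf y = y - (2 * (y \<bullet> i)) *\<^sub>R i" for y :: 'a
  have rf_i: "rf y \<bullet> i = - (y \<bullet> i)" for y using i by (simp add: rf_def inner_diff_left)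
  have rf_j: "rf y \<bullet> j = y \<bullet> j" if "j \<in> Basis" "j \<noteq> i" for y j
    using i that by (simp add: rf_def inner_diff_left inner_not_same_Basis)
  have rf_add: "rf (y + s *\<^sub>R j) = rf y + s *\<^sub>R rf j" for y s j
    by (simp add: rf_def inner_add_left algebra_simps)
  have rf_abs: "\<bar>rf y \<bullet> j\<bar> = \<bar>y \<bullet> j\<bar>" if "j \<in> Basis" for y j
    using rf_i rf_j[OF that] by (cases "j = i") auto
  define a where "a = (\<Sum>j\<in>Basis. (if j = i then 0 else - d) *\<^sub>R j)"
  define b :: 'a where "b = (\<Sum>j\<in>Basis. d *\<^sub>R j)"
  have ab: "a \<bullet> j = (if j = i then 0 else - d)" "b \<bullet> j = d" if "j \<in> Basis" for j
    using that by (simp_all add: a_def b_def)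
  define v where "v y = M / d\<^sup>2 * ((norm y)\<^sup>2 + ?n * (d * (y \<bullet> i) - (y \<bullet> i)\<^sup>2))" for y
  have in_cube: "\<bar>y \<bullet> j\<bar> \<le> d" if "y \<in> cbox a b" "j \<in> Basis" for y j
    using that d ab[OF that(2)] by (auto simp: mem_box split: if_splits dest!: bspec[OF _ that(2)])
  have yi: "0 \<le> y \<bullet> i" "y \<bullet> i \<le> d" if "y \<in> cbox a b" for y
    using that ab[OF i] i by (auto simp: mem_box)
  have Sy: "x0 + y \<in> S" "\<bar>f (x0 + y)\<bar> \<le> M" "x0 + rf y \<in> S" "\<bar>f (x0 + rf y)\<bar> \<le> M" if "y \<in> cbox a b" for y
    using cube[of y] cube[of "rf y"] in_cube[OF that] rf_abs by auto
  \<comment> \<open>The sign \<sigma> yields both directions of the estimate. The Laplacian of the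
    barrier vanishes because |y|^2 contributes 2 n and - n y_i^2 contributes - 2 n.\<close>
  have main: "\<sigma> / 2 * (f (x0 + y) - f (x0 + rf y)) - v y \<le> 0" if y: "y \<in> box a b" and \<sigma>: "\<bar>\<sigma>\<bar> = 1" for y \<sigma>
  proof (rule weak_maximum_principle[where U="box a b" and H="\<lambda>y j. \<sigma> / 2 * (partial_deriv j (partial_deriv j f) (x0 + y) - partial_deriv j (partial_deriv j f) (x0 + rf y))
        - M / d\<^sup>2 * (2 - (if j = i then 2 * ?n else 0))"])
    have ne: "box a b \<noteq> {}" using y by blast
    have cl: "closure (box a b) = cbox a b" using ne by (rule closure_box)
    have cf: "continuous_on S f" by (rule Ck_on_imp_continuous_on[OF S(2)])
    have crf: "continuous_on UNIV rf" unfolding rf_def by (intro continuous_intros)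
    show "continuous_on (closure (box a b)) (\<lambda>y. \<sigma> / 2 * (f (x0 + y) - f (x0 + rf y)) - v y)"
      unfolding cl v_def
      by (intro continuous_intros continuous_on_compose2[OF cf] continuous_on_subset[OF crf]) (use Sy in auto)
    show "has_dir2 (\<lambda>y. \<sigma> / 2 * (f (x0 + y) - f (x0 + rf y)) - v y) z j
        (\<sigma> / 2 * (partial_deriv j (partial_deriv j f) (x0 + z) - partial_deriv j (partial_deriv j f) (x0 + rf z))
        - M / d\<^sup>2 * (2 - (if j = i then 2 * ?n else 0)))" if z: "z \<in> box a b" and j: "j \<in> Basis" for z j
    proof -
      have zc: "z \<in> cbox a b" using z box_subset_cbox by blast
      note h1 = has_dir2_partial_deriv[OF S Sy(1)[OF zc] j]
      note h2 = has_dir2_partial_deriv[OF S Sy(3)[OF zc] j]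
      have d1: "has_dir2 (\<lambda>y. f (x0 + y)) z j (partial_deriv j (partial_deriv j f) (x0 + z))"
        using h1 by (simp add: has_dir2_def add.assoc)
      have "has_dir2 f (x0 + rf z) (rf j) (partial_deriv j (partial_deriv j f) (x0 + rf z))"
      proof (cases "j = i")
        case True
        then have "rf j = - j" using i by (simp add: rf_def scaleR_2 scaleR_left_diff_distrib algebra_simps flip: scaleR_2)
        then show ?thesis using has_dir2_uminus[OF h2] by simp
      next
        case False
        then have "rf j = j" using i j by (simp add: rf_def inner_not_same_Basis)
        then show ?thesis using h2 by simp
      qed
      then have d2: "has_dir2 (\<lambda>y. f (x0 + rf y)) z j (partial_deriv j (partial_deriv j f) (x0 + rf z))"
        unfolding has_dir2_def rf_add by (simp add: add.assoc)
      have d3: "has_dir2 (\<lambda>y. ?n * (d * (y \<bullet> i) - (y \<bullet> i)\<^sup>2)) z j (if j = i then - 2 * ?n else 0)"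
      proof -
        have ij: "j \<bullet> i = (if j = i then 1 else 0)" using i j by (simp add: inner_Basis)
        show ?thesis unfolding has_dir2_def inner_add_left inner_scaleR_left ij
          by (intro exI[of _ "\<lambda>s. if j = i then ?n * (d - 2 * (z \<bullet> i + s)) else 0"] exI[of _ 1])
            (auto intro!: derivative_eq_intros simp: algebra_simps)
      qed
      note l1 = has_dir2_lin[OF d1 d2, of 1 "-1"]
      note l2 = has_dir2_lin[OF has_dir2_norm_square[OF j, of z] d3, of 1 1]
      note l3 = has_dir2_lin[OF l1 l2, of "\<sigma> / 2" "- (M / d\<^sup>2)"]
      show ?thesis using l3 unfolding v_def by (cases "j = i") (simp_all add: algebra_simps)
    qed
    show "0 \<le> (\<Sum>j\<in>Basis. \<sigma> / 2 * (partial_deriv j (partial_deriv j f) (x0 + z) - partial_deriv j (partial_deriv j f) (x0 + rf z))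
        - M / d\<^sup>2 * (2 - (if j = i then 2 * ?n else 0)))" if z: "z \<in> box a b" for z
    proof -
      have zc: "z \<in> cbox a b" using z box_subset_cbox by blast
      have "(\<Sum>j\<in>Basis. 2 - (if j = i then 2 * ?n else 0)) = 0"
        using i by (simp add: sum_subtractf)
      then have "(\<Sum>j\<in>Basis. M / d\<^sup>2 * (2 - (if j = i then 2 * ?n else 0))) = 0"
        unfolding sum_distrib_left[symmetric] by simp
      moreover have "(\<Sum>j\<in>Basis. \<sigma> / 2 * (partial_deriv j (partial_deriv j f) (x0 + z) - partial_deriv j (partial_deriv j f) (x0 + rf z))) =
         \<sigma> / 2 * (laplacian f (x0 + z) - laplacian f (x0 + rf z))"
        unfolding laplacian_def by (simp only: sum_distrib_left sum_subtractf right_diff_distrib)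
      ultimately show ?thesis using harm Sy[OF zc] by (simp only: sum_subtractf) simp
    qed
    show "\<sigma> / 2 * (f (x0 + z) - f (x0 + rf z)) - v z \<le> 0" if z: "z \<in> frontier (box a b)" for z
    proof -
      have zc: "z \<in> cbox a b" and zb: "z \<notin> box a b" using z ne by (auto simp: frontier_box split: if_splits)
      have t: "0 \<le> d * (z \<bullet> i) - (z \<bullet> i)\<^sup>2"
        using yi[OF zc] by (simp add: power2_eq_square mult_right_mono algebra_simps)
      have v0: "M / d\<^sup>2 * (norm z)\<^sup>2 \<le> v z"
        unfolding v_def using M t by (intro mult_left_mono) auto
      obtain j where j: "j \<in> Basis" "\<not> (a \<bullet> j < z \<bullet> j \<and> z \<bullet> j < b \<bullet> j)" using zb by (auto simp: mem_box)
      \<comment> \<open>On the face where y_i = 0 the odd part vanishes and the barrier is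
        nonnegative. On every other face some coordinate has absolute value d, so |y| >= d and the
        barrier is at least M.\<close>
      show ?thesis
      proof (cases "z \<bullet> i = 0")
        case True
        then have "rf z = z" by (simp add: rf_def)
        moreover have "0 \<le> v z" using order_trans[OF _ v0] M by simp
        ultimately show ?thesis by simp
      next
        case False
        then have "\<bar>z \<bullet> j\<bar> = d"
          using j ab[OF j(1)] in_cube[OF zc j(1)] yi[OF zc] by (auto split: if_splits)
        then have "d \<le> norm z" using Basis_le_norm[OF j(1), of z] by simp
        then have "d\<^sup>2 \<le> (norm z)\<^sup>2" using d by (intro power_mono) auto
        then have "M / d\<^sup>2 * d\<^sup>2 \<le> M / d\<^sup>2 * (norm z)\<^sup>2" using M by (intro mult_left_mono) auto
        then have "M \<le> v z" using v0 d by simp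
        moreover have "\<sigma> / 2 * (f (x0 + z) - f (x0 + rf z)) \<le> M"
        proof -
          have "\<sigma> / 2 * (f (x0 + z) - f (x0 + rf z)) \<le> \<bar>\<sigma> / 2 * (f (x0 + z) - f (x0 + rf z))\<bar>" by simp
          also have "\<dots> = 1 / 2 * \<bar>f (x0 + z) - f (x0 + rf z)\<bar>" using \<sigma> by (simp add: abs_mult)
          also have "\<bar>f (x0 + z) - f (x0 + rf z)\<bar> \<le> M + M"
            by (rule order_trans[OF abs_triangle_ineq4 add_mono[OF Sy(2,4)[OF zc]]])
          finally show ?thesis by simp
        qed
        ultimately show ?thesis by simp
      qed
    qed
  qed (use y in auto)
  \<comment> \<open>On the axis the barrier is M / d^2 times n d t + (1 - n) t^2. Its quadratic part
    is nonpositive, so its slope at 0 gives the constant n M / d.\<close>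
  have est: "\<bar>f (x0 + t *\<^sub>R i) - f (x0 - t *\<^sub>R i)\<bar> \<le> 2 * (?n * M / d) * t" if t: "0 < t" "t < d" for t
  proof -
    let ?y = "t *\<^sub>R i"
    have yb: "?y \<in> box a b"
      unfolding mem_box using t d i by (auto simp: ab inner_Basis)
    have "rf ?y = - ?y" using i by (simp add: rf_def algebra_simps flip: scaleR_2)
    then have "\<bar>f (x0 + ?y) - f (x0 - ?y)\<bar> \<le> 2 * v ?y"
      using main[OF yb, of 1] main[OF yb, of "-1"] by (intro abs_leI) (simp_all add: field_simps)
    also have "v ?y = M / d\<^sup>2 * (?n * d * t + (1 - ?n) * t\<^sup>2)"
      using i t by (simp add: v_def algebra_simps power2_eq_square)
    also have "\<dots> \<le> M / d\<^sup>2 * (?n * d * t)"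
    proof -
      have "1 \<le> ?n" using DIM_positive[where 'a='a] by linarith
      then have "(1 - ?n) * t\<^sup>2 \<le> 0" by (simp add: mult_nonpos_nonneg)
      then show ?thesis using M by (intro mult_left_mono) auto
    qed
    also have "\<dots> = ?n * M / d * t" using d by (simp add: power2_eq_square)
    finally show ?thesis by simp
  qed
  have x0S: "x0 \<in> S" using cube[of 0] d by simp
  have fd: "f differentiable at x0" by (rule Ck_on_2_D(1)[OF S(2) x0S])
  have D: "((\<lambda>s. f (x0 + s *\<^sub>R i)) has_real_derivative partial_deriv i f x0) (at 0)"
    using DERIV_partial_deriv[of f x0 0 i] fd by simp
  have D': "((\<lambda>s. f (x0 + (- s) *\<^sub>R i)) has_real_derivative - partial_deriv i f x0) (at 0)"
  proof -
    have m: "(uminus has_real_derivative - 1) (at (0::real))" by (auto intro!: derivative_eq_intros)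
    have "((\<lambda>s. f (x0 + s *\<^sub>R i)) has_real_derivative partial_deriv i f x0) (at (- 0))" using D by simp
    from DERIV_chain2[OF this m] show ?thesis by simp
  qed
  \<comment> \<open>The symmetric difference has twice the partial derivative as its derivative at
    0, so the bound on the difference passes to the limit.\<close>
  have "((\<lambda>s. f (x0 + s *\<^sub>R i) - f (x0 - s *\<^sub>R i)) has_real_derivative 2 * partial_deriv i f x0) (at 0)"
    using DERIV_diff[OF D D'] by simp
  then have "((\<lambda>t. (f (x0 + t *\<^sub>R i) - f (x0 - t *\<^sub>R i)) / t) \<longlongrightarrow> 2 * partial_deriv i f x0) (at 0)"
    by (simp add: DERIV_def)
  then have "((\<lambda>t. (f (x0 + t *\<^sub>R i) - f (x0 - t *\<^sub>R i)) / t) \<longlongrightarrow> 2 * partial_deriv i f x0) (at_right 0)"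
    by (rule filterlim_mono) (auto simp: at_le)
  then have "((\<lambda>t. \<bar>(f (x0 + t *\<^sub>R i) - f (x0 - t *\<^sub>R i)) / t\<bar>) \<longlongrightarrow> \<bar>2 * partial_deriv i f x0\<bar>) (at_right 0)"
    by (rule tendsto_rabs)
  then have "\<bar>2 * partial_deriv i f x0\<bar> \<le> 2 * (?n * M / d)"
  proof (rule tendsto_upperbound)
    have "\<forall>\<^sub>F t in at_right (0::real). 0 < t \<and> t < d"
      using d eventually_at_right_real[OF d] by (simp add: greaterThanLessThan_iff)
    then show "\<forall>\<^sub>F t in at_right 0. \<bar>(f (x0 + t *\<^sub>R i) - f (x0 - t *\<^sub>R i)) / t\<bar> \<le> 2 * (?n * M / d)"
    proof eventually_elim
      case (elim t)
      then show ?case using est[of t] by (simp add: abs_divide pos_divide_le_eq)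
    qed
  qed simp
  then show ?thesis by simp
qed

section \<open>Truncations and cutoffs\<close>

text \<open>The kink of max at 0 is invisible to a function with derivative 0 there. This one fact
  gives the regularity of the truncations and of the cutoffs at all their junctions.\<close>

lemma DERIV_max_0_compose:
  fixes f f' :: "real \<Rightarrow> real"
  assumes d: "\<And>z. (f has_real_derivative f' z) (at z)" and 0: "f' 0 = 0"
  shows "((\<lambda>y. f (max 0 y)) has_real_derivative f' (max 0 y)) (at y)"
proof -
  consider "y < 0" | "y = 0" | "y > 0" by linarith
  then show ?thesis
  proof cases
    case 1
    have "((\<lambda>y. f 0) has_real_derivative 0) (at y)" by simp
    then have "((\<lambda>y. f (max 0 y)) has_real_derivative 0) (at y)"
      by (rule has_field_derivative_transform_within_open[where S="{..<0}"]) (use 1 in auto)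
    then show ?thesis using 1 0 by simp
  next
    case 2
    have "((\<lambda>h. (f h - f 0) / h) \<longlongrightarrow> 0) (at 0)" using d[of 0] 0 by (simp add: DERIV_def)
    then have "((\<lambda>h. (f (max 0 h) - f 0) / h) \<longlongrightarrow> 0) (at 0)"
    proof (rule Lim_null_comparison[rotated, OF tendsto_rabs_zero])
      have "norm ((f (max 0 h) - f 0) / h) \<le> \<bar>(f h - f 0) / h\<bar>" for h
      proof (cases "0 \<le> h")
        case False
        then have "norm ((f (max 0 h) - f 0) / h) = 0" by simp
        then show ?thesis using abs_ge_zero[of "(f h - f 0) / h"] by linarith
      qed simp
      then show "\<forall>\<^sub>F h in at 0. norm ((f (max 0 h) - f 0) / h) \<le> \<bar>(f h - f 0) / h\<bar>" by simp
    qed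
    then show ?thesis using 2 0 by (simp add: DERIV_def)
  next
    case 3
    show ?thesis
      by (rule has_field_derivative_transform_within_open[where S="{0<..}" and f=f]) (use 3 d[of y] in auto)
  qed
qed

text \<open>In terms of y its derivative is y^2 / (1 + y^2): a double zero at y = 0 makes the
  function C^2 across s = \<epsilon>, monotonicity for y >= 0 makes it convex, and the slope tends
  to 1 as \<epsilon> tends to 0.\<close>

definition soft_trunc :: "real \<Rightarrow> real \<Rightarrow> real" where
  "soft_trunc \<epsilon> s = \<epsilon> * (max 0 (s / \<epsilon> - 1) - arctan (max 0 (s / \<epsilon> - 1)))"

definition soft_trunc' :: "real \<Rightarrow> real \<Rightarrow> real" where
  "soft_trunc' \<epsilon> s = 1 - 1 / (1 + (max 0 (s / \<epsilon> - 1))\<^sup>2)"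

definition soft_trunc'' :: "real \<Rightarrow> real \<Rightarrow> real" where
  "soft_trunc'' \<epsilon> s = 2 * max 0 (s / \<epsilon> - 1) / (1 + (max 0 (s / \<epsilon> - 1))\<^sup>2)\<^sup>2 / \<epsilon>"

lemma one_plus_square_pos: "0 < 1 + (z::real)\<^sup>2" by (simp add: add_pos_nonneg)

lemma DERIV_soft_trunc:
  assumes "\<epsilon> > 0"
  shows "(soft_trunc \<epsilon> has_real_derivative soft_trunc' \<epsilon> s) (at s)"
    and "(soft_trunc' \<epsilon> has_real_derivative soft_trunc'' \<epsilon> s) (at s)"
    and "continuous_on UNIV (soft_trunc'' \<epsilon>)"
proof -
  have l: "((\<lambda>s. s / \<epsilon> - 1) has_real_derivative 1 / \<epsilon>) (at s)"
    using assms by (auto intro!: derivative_eq_intros)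
  have "((\<lambda>z. z - arctan z) has_real_derivative 1 - 1 / (1 + z\<^sup>2)) (at z)" for z
    by (auto intro!: derivative_eq_intros simp: inverse_eq_divide)
  from DERIV_cmult[OF DERIV_chain2[OF DERIV_max_0_compose[OF this] l], of \<epsilon>]
  show "(soft_trunc \<epsilon> has_real_derivative soft_trunc' \<epsilon> s) (at s)"
    using assms by (simp add: soft_trunc_def[abs_def] soft_trunc'_def)
  have "((\<lambda>z. 1 - 1 / (1 + z\<^sup>2)) has_real_derivative 2 * z / (1 + z\<^sup>2)\<^sup>2) (at z)" for z :: real
    using one_plus_square_pos[of z] by (auto intro!: derivative_eq_intros simp: power2_eq_square)
  from DERIV_chain2[OF DERIV_max_0_compose[OF this] l]
  show "(soft_trunc' \<epsilon> has_real_derivative soft_trunc'' \<epsilon> s) (at s)"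
    by (simp add: soft_trunc'_def[abs_def] soft_trunc''_def)
  have "1 + (max 0 (s / \<epsilon> - 1))\<^sup>2 \<noteq> 0" for s using one_plus_square_pos[of "max 0 (s / \<epsilon> - 1)"] by linarith
  then show "continuous_on UNIV (soft_trunc'' \<epsilon>)"
    using assms unfolding soft_trunc''_def[abs_def] by (intro continuous_intros) auto
qed

lemma soft_trunc_zero: "\<epsilon> > 0 \<Longrightarrow> s \<le> \<epsilon> \<Longrightarrow> soft_trunc \<epsilon> s = 0"
  by (simp add: soft_trunc_def max_absorb1)

lemma arctan_le_self: "0 \<le> z \<Longrightarrow> arctan z \<le> z"
proof -
  assume z: "0 \<le> z"
  have "arctan z - z \<le> arctan 0 - 0"
    by (rule DERIV_nonpos_imp_nonincreasing[OF z])
      (auto intro!: exI derivative_eq_intros simp: inverse_eq_divide divide_le_eq_1 one_plus_square_pos)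
  then show ?thesis by simp
qed

text \<open>\<epsilon> y differs from s by at most \<epsilon>, and arctan is below 2; this is the
  origin of 3 \<epsilon>.\<close>

lemma soft_trunc_bounds:
  assumes e: "\<epsilon> > 0" and s: "0 \<le> s"
  shows "0 \<le> soft_trunc \<epsilon> s" "soft_trunc \<epsilon> s \<le> s" "\<bar>soft_trunc \<epsilon> s - s\<bar> \<le> 3 * \<epsilon>"
proof -
  let ?z = "max 0 (s / \<epsilon> - 1)"
  have z: "0 \<le> ?z" by simp
  have a: "0 \<le> arctan ?z" "arctan ?z \<le> ?z" "arctan ?z < 2"
    using z arctan_le_self[OF z] arctan_ubound[of ?z] pi_less_4 by (auto simp: zero_le_arctan_iff)
  have zs: "\<epsilon> * ?z \<le> s" "s \<le> \<epsilon> * ?z + \<epsilon>"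
    using e s by (auto simp: max_def field_simps)
  show "0 \<le> soft_trunc \<epsilon> s" using a e by (simp add: soft_trunc_def)
  have m: "0 \<le> \<epsilon> * arctan ?z" "\<epsilon> * arctan ?z \<le> \<epsilon> * 2" using a e by (auto intro: mult_left_mono)
  then show "soft_trunc \<epsilon> s \<le> s" using zs by (simp only: soft_trunc_def right_diff_distrib)
  show "\<bar>soft_trunc \<epsilon> s - s\<bar> \<le> 3 * \<epsilon>" using zs m by (simp only: soft_trunc_def right_diff_distrib)
qed

lemma soft_trunc'_bounds: "0 \<le> soft_trunc' \<epsilon> s" "soft_trunc' \<epsilon> s \<le> 1"
  by (auto simp: soft_trunc'_def divide_le_eq_1 one_plus_square_pos add_nonneg_nonneg)

lemma soft_trunc''_nonneg: "\<epsilon> > 0 \<Longrightarrow> 0 \<le> soft_trunc'' \<epsilon> s"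
  by (auto simp: soft_trunc''_def intro!: divide_nonneg_nonneg mult_nonneg_nonneg)

lemma soft_trunc'_tendsto:
  assumes "s > 0"
  shows "(\<lambda>n. soft_trunc' (1 / real (Suc n)) s) \<longlonglongrightarrow> 1"
proof -
  have a: "filterlim (\<lambda>n. s * real (Suc n) + - 1) at_top sequentially"
    using assms by real_asymp
  then have "\<forall>\<^sub>F n in sequentially. 0 \<le> s * real (Suc n) + - 1"
    using a unfolding filterlim_at_top by blast
  then have ev: "\<forall>\<^sub>F n in sequentially. 1 - 1 / (1 + (s * real (Suc n) + - 1)\<^sup>2) = soft_trunc' (1 / real (Suc n)) s"
    by eventually_elim (simp add: soft_trunc'_def max_absorb2)
  have "((\<lambda>y::real. 1 - 1 / (1 + y\<^sup>2)) \<longlongrightarrow> 1) at_top" by real_asymp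
  from filterlim_compose[OF this a] show ?thesis
    by (rule Lim_transform_eventually) (rule ev)
qed

section \<open>Polynomial cutoffs in time and space\<close>

definition cutoff_base :: "real \<Rightarrow> real" where
  "cutoff_base s = max 0 (1 - (max 0 (s - 1)) ^ 3)"

text \<open>The cube makes the base C^2 at s = 1, where it leaves the value 1. At s = 2 it reaches 0
  with a corner, which the power removes; the size of the power also controls the loss under
  differentiation.\<close>

definition cutoff :: "nat \<Rightarrow> real \<Rightarrow> real" where
  "cutoff k s = cutoff_base s ^ k"

definition cutoff' :: "nat \<Rightarrow> real \<Rightarrow> real" where
  "cutoff' k s = k * cutoff_base s ^ (k - 1) * - (3 * (max 0 (s - 1))\<^sup>2)"

definition cutoff'' :: "nat \<Rightarrow> real \<Rightarrow> real" where
  "cutoff'' k s = k * ((k - 1) * cutoff_base s ^ (k - 2) * - (3 * (max 0 (s - 1))\<^sup>2)) * - (3 * (max 0 (s - 1))\<^sup>2)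
     + k * cutoff_base s ^ (k - 1) * - (6 * max 0 (s - 1))"

lemma DERIV_cutoff:
  assumes k: "4 \<le> k"
  shows "(cutoff k has_real_derivative cutoff' k s) (at s)" "(cutoff' k has_real_derivative cutoff'' k s) (at s)"
    "continuous_on UNIV (cutoff'' k)"
proof -
  have l: "((\<lambda>s. s - 1) has_real_derivative 1) (at s)" for s :: real by (auto intro!: derivative_eq_intros)
  have c3: "((\<lambda>z. z ^ 3) has_real_derivative 3 * z\<^sup>2) (at z)" for z :: real
    by (auto intro!: derivative_eq_intros)
  have c2: "((\<lambda>z. 3 * z\<^sup>2) has_real_derivative 6 * z) (at z)" for z :: real
    by (auto intro!: derivative_eq_intros)
  have i: "((\<lambda>s. 1 - (max 0 (s - 1)) ^ 3) has_real_derivative - (3 * (max 0 (s - 1))\<^sup>2)) (at s)" for s :: real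
    using DERIV_diff[OF DERIV_const DERIV_chain2[OF DERIV_max_0_compose[OF c3] l]] by simp
  have i2: "((\<lambda>s. - (3 * (max 0 (s - 1))\<^sup>2)) has_real_derivative - (6 * max 0 (s - 1))) (at s)" for s :: real
    using DERIV_minus[OF DERIV_chain2[OF DERIV_max_0_compose[OF c2] l]] by simp
  have p: "((\<lambda>z. z ^ j) has_real_derivative real j * z ^ (j - 1)) (at z)" for j and z :: real
    using DERIV_pow[of j z] by simp
  \<comment> \<open>The rule for max applies a second time, at the corner s = 2: a power with
    exponent at least 2 has derivative 0 at 0.\<close>
  have q: "((\<lambda>s. cutoff_base s ^ j) has_real_derivative real j * cutoff_base s ^ (j - 1) * - (3 * (max 0 (s - 1))\<^sup>2)) (at s)"
    if "2 \<le> j" for j s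
    using DERIV_chain2[OF DERIV_max_0_compose[OF p[of j]] i] that by (simp add: cutoff_base_def)
  show "(cutoff k has_real_derivative cutoff' k s) (at s)"
    using q[of k s] k by (simp add: cutoff_def[abs_def] cutoff'_def)
  have "((\<lambda>s. cutoff_base s ^ (k - 1)) has_real_derivative real (k - 1) * cutoff_base s ^ (k - 2) * - (3 * (max 0 (s - 1))\<^sup>2)) (at s)"
    using q[of "k - 1" s] k by (simp add: numeral_2_eq_2)
  from DERIV_mult[OF DERIV_cmult[OF this, of "real k"] i2]
  show "(cutoff' k has_real_derivative cutoff'' k s) (at s)"
    using k by (simp add: cutoff'_def[abs_def] cutoff''_def mult_ac add_ac)
  show "continuous_on UNIV (cutoff'' k)"
    unfolding cutoff''_def[abs_def] cutoff_base_def by (intro continuous_intros)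
qed

lemma cutoff_base_range: "0 \<le> cutoff_base s" "cutoff_base s \<le> 1"
  by (auto simp: cutoff_base_def)

lemma cutoff_range: "0 \<le> cutoff k s" "cutoff k s \<le> 1"
  unfolding cutoff_def using cutoff_base_range[of s] by (auto intro: power_le_one)

lemma cutoff_inner: "s \<le> 1 \<Longrightarrow> cutoff k s = 1" "s \<le> 1 \<Longrightarrow> 2 \<le> k \<Longrightarrow> cutoff' k s = 0" "s \<le> 1 \<Longrightarrow> cutoff'' k s = 0"
  by (auto simp: cutoff_def cutoff'_def cutoff''_def cutoff_base_def max_absorb1)

lemma cutoff_base_outer: "2 \<le> s \<Longrightarrow> cutoff_base s = 0"
proof -
  assume "2 \<le> s"
  then have "1 \<le> max 0 (s - 1) ^ 3" by (intro one_le_power) auto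
  then show ?thesis by (simp add: cutoff_base_def)
qed

lemma cutoff_outer: "2 \<le> s \<Longrightarrow> 4 \<le> k \<Longrightarrow> cutoff k s = 0" "2 \<le> s \<Longrightarrow> 4 \<le> k \<Longrightarrow> cutoff' k s = 0" "2 \<le> s \<Longrightarrow> 4 \<le> k \<Longrightarrow> cutoff'' k s = 0"
  using cutoff_base_outer[of s] by (auto simp: cutoff_def cutoff'_def cutoff''_def power_0_left)

text \<open>Two derivatives remove at most two factors of the base, and base^(k-2) <= base^(k/p)
  because k / p <= k - 2 and the base is at most 1. The constant is 9 + 6, from the squared first
  derivative and from the second derivative of the cube.\<close>

lemma cutoff_deriv_bounds:
  assumes k: "4 \<le> k" and p: "1 < p" "real k \<le> p * (real k - 2)"
  shows "\<bar>cutoff' k s\<bar> \<le> 15 * (real k)\<^sup>2 * cutoff k s powr (1 / p)" "\<bar>cutoff'' k s\<bar> \<le> 15 * (real k)\<^sup>2 * cutoff k s powr (1 / p)"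
proof -
  let ?q = "cutoff_base s" and ?m = "max 0 (s - 1)"
  have "\<bar>cutoff' k s\<bar> \<le> 15 * (real k)\<^sup>2 * cutoff k s powr (1 / p) \<and> \<bar>cutoff'' k s\<bar> \<le> 15 * (real k)\<^sup>2 * cutoff k s powr (1 / p)"
  proof (cases "2 \<le> s")
    case True
    then show ?thesis using k by (simp add: cutoff_outer)
  next
    case False
    then have m: "0 \<le> ?m" "?m \<le> 1" by auto
    then have m2: "0 \<le> ?m\<^sup>2" "?m\<^sup>2 \<le> 1" by (auto intro: power_le_one)
    have q: "0 \<le> ?q" "?q \<le> 1" by (rule cutoff_base_range)+
    let ?Q = "?q ^ (k - 2)"
    have Q: "0 \<le> ?Q" using q by simp
    have q1: "0 \<le> ?q ^ (k - 1)" "?q ^ (k - 1) \<le> ?Q" using q k by (auto intro: power_decreasing)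
    have "?Q \<le> cutoff k s powr (1 / p)"
    proof (cases "?q = 0")
      case True
      then show ?thesis using k by (simp add: power_0_left)
    next
      case False
      then have qp: "0 < ?q" using q by simp
      have "cutoff k s powr (1 / p) = ?q powr (real k / p)"
        using qp by (simp add: cutoff_def powr_realpow[symmetric] powr_powr)
      moreover have "?Q = ?q powr (real k - 2)"
        using qp k by (simp add: powr_realpow[symmetric] of_nat_diff)
      moreover have "real k / p \<le> real k - 2" using p by (simp add: field_simps)
      then have "?q powr (real k - 2) \<le> ?q powr (real k / p)"
        using qp q(2) by (intro powr_mono') auto
      ultimately show ?thesis by simp
    qed
    then have fin: "15 * (real k)\<^sup>2 * ?Q \<le> 15 * (real k)\<^sup>2 * cutoff k s powr (1 / p)"
      by (intro mult_left_mono) auto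
    have kk: "real k \<le> (real k)\<^sup>2" using k by (simp add: power2_eq_square)
    have A: "real k * ?q ^ (k - 1) * (3 * ?m\<^sup>2) \<le> (real k)\<^sup>2 * ?Q * 3"
      using kk q1 m2 Q by (intro mult_mono) auto
    have B: "real k * ?q ^ (k - 1) * (6 * ?m) \<le> (real k)\<^sup>2 * ?Q * 6"
      using kk q1 m Q by (intro mult_mono) auto
    have "real k * ((real k - 1) * ?Q * (3 * ?m\<^sup>2)) * (3 * ?m\<^sup>2) \<le> real k * (real k * ?Q * 3) * 3"
      using k Q m2 by (intro mult_mono) auto
    then have C: "real k * ((real k - 1) * ?Q * (3 * ?m\<^sup>2)) * (3 * ?m\<^sup>2) \<le> (real k)\<^sup>2 * ?Q * 9"
      by (simp add: power2_eq_square mult_ac)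
    have N: "0 \<le> real k * ?q ^ (k - 1) * (3 * ?m\<^sup>2)" "0 \<le> real k * ?q ^ (k - 1) * (6 * ?m)"
      "0 \<le> real k * ((real k - 1) * ?Q * (3 * ?m\<^sup>2)) * (3 * ?m\<^sup>2)" "0 \<le> (real k)\<^sup>2 * ?Q"
      using q1 Q m m2 k by auto
    have e1: "cutoff' k s = - (real k * ?q ^ (k - 1) * (3 * ?m\<^sup>2))" by (simp add: cutoff'_def)
    have e2: "cutoff'' k s = real k * ((real k - 1) * ?Q * (3 * ?m\<^sup>2)) * (3 * ?m\<^sup>2) - real k * ?q ^ (k - 1) * (6 * ?m)"
      using k by (simp add: cutoff''_def of_nat_diff)
    show ?thesis unfolding e1 e2 using A B C N fin by (intro conjI; linarith)
  qed
  then show "\<bar>cutoff' k s\<bar> \<le> 15 * (real k)\<^sup>2 * cutoff k s powr (1 / p)" "\<bar>cutoff'' k s\<bar> \<le> 15 * (real k)\<^sup>2 * cutoff k s powr (1 / p)"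
    by auto
qed

text \<open>The squared norm keeps the function regular at the origin. It also means that the cutoff
  is already 0 from radius sqrt 2 times R on; the estimates use the rounder radius 2 R.\<close>

definition space_cut :: "nat \<Rightarrow> real \<Rightarrow> 'a::euclidean_space \<Rightarrow> real" where
  "space_cut k R x = cutoff k ((norm x / R)\<^sup>2)"

lemma space_cut_eq: "space_cut k R = (\<lambda>x. cutoff k (inverse (R\<^sup>2) * (norm x)\<^sup>2))"
  by (simp add: space_cut_def fun_eq_iff power_divide divide_inverse power_mult_distrib power_inverse mult.commute)

lemma Ck_on_norm_square: "Ck_on k S (\<lambda>x::'a::euclidean_space. c * (norm x)\<^sup>2)"
proof -
  have "Ck_on k UNIV (\<lambda>x::'a. c * (\<Sum>i\<in>Basis. (x \<bullet> i) * (x \<bullet> i)))"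
    by (intro Ck_on_mult Ck_on_const Ck_on_sum Ck_on_linear bounded_linear_inner_left open_UNIV)
  moreover have "(norm x)\<^sup>2 = (\<Sum>i\<in>Basis. (x \<bullet> i) * (x \<bullet> i))" for x :: 'a
    by (simp add: power2_norm_eq_inner euclidean_inner[of x x])
  ultimately show ?thesis using Ck_on_subset[of k UNIV _ S] by simp
qed

lemma partial_deriv_norm_square:
  assumes "i \<in> Basis"
  shows "partial_deriv i (\<lambda>x::'a::euclidean_space. c * (norm x)\<^sup>2) = (\<lambda>x. 2 * c * (x \<bullet> i))"
proof
  fix x :: 'a
  have "((\<lambda>x. c * (norm x)\<^sup>2) has_derivative (\<lambda>h. c * (2 * (x \<bullet> h)))) (at x)"
    unfolding power2_norm_eq_inner by (auto intro!: derivative_eq_intros simp: inner_commute)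
  from partial_deriv_eqI[OF this, of i] show "partial_deriv i (\<lambda>x. c * (norm x)\<^sup>2) x = 2 * c * (x \<bullet> i)" by simp
qed

lemma laplacian_norm_square: "laplacian (\<lambda>x::'a::euclidean_space. c * (norm x)\<^sup>2) x = 2 * c * DIM('a)"
proof -
  have "partial_deriv i (partial_deriv i (\<lambda>x::'a. c * (norm x)\<^sup>2)) x = 2 * c" if i: "i \<in> Basis" for i
  proof -
    have "((\<lambda>x. 2 * c * (x \<bullet> i)) has_derivative (\<lambda>h. 2 * c * (h \<bullet> i))) (at x)"
      by (auto intro!: derivative_eq_intros)
    from partial_deriv_eqI[OF this, of i] show ?thesis
      using i by (simp add: partial_deriv_norm_square)
  qed
  then show ?thesis by (simp add: laplacian_def)
qed

lemma Ck_on_space_cut: "4 \<le> k \<Longrightarrow> Ck_on 2 UNIV (space_cut k R)"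
  unfolding space_cut_eq
  by (rule Ck_on_2_compose[OF open_UNIV Ck_on_norm_square DERIV_cutoff(1) DERIV_cutoff(2) DERIV_cutoff(3)])

lemma partial_deriv_space_cut:
  assumes k: "4 \<le> k" and i: "i \<in> Basis"
  shows "partial_deriv i (space_cut k R) x = cutoff' k ((norm x / R)\<^sup>2) * (2 * (x \<bullet> i) / R\<^sup>2)"
proof -
  let ?f = "\<lambda>x::'a. inverse (R\<^sup>2) * (norm x)\<^sup>2"
  have d: "?f differentiable at x"
    using Ck_on_norm_square[of 1 UNIV "inverse (R\<^sup>2)"] by simp
  have "partial_deriv i (\<lambda>x. cutoff k (?f x)) x = cutoff' k (?f x) * partial_deriv i ?f x"
    by (rule partial_deriv_compose(1)[OF d DERIV_cutoff(1)[OF k]])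
  moreover have "?f x = (norm x / R)\<^sup>2" by (simp add: power_divide divide_inverse power_mult_distrib power_inverse mult.commute)
  ultimately show ?thesis unfolding space_cut_eq partial_deriv_norm_square[OF i]
    by (simp add: divide_inverse mult_ac)
qed

lemma laplacian_space_cut:
  assumes k: "4 \<le> k"
  shows "laplacian (space_cut k R) (x :: 'a::euclidean_space) =
    cutoff'' k ((norm x / R)\<^sup>2) * (4 * (norm x)\<^sup>2 / R ^ 4) + cutoff' k ((norm x / R)\<^sup>2) * (2 * DIM('a) / R\<^sup>2)"
proof -
  let ?f = "\<lambda>x::'a. inverse (R\<^sup>2) * (norm x)\<^sup>2"
  have "laplacian (\<lambda>x. cutoff k (?f x)) x = cutoff'' k (?f x) * (\<Sum>i\<in>Basis. (partial_deriv i ?f x)\<^sup>2) + cutoff' k (?f x) * laplacian ?f x"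
    by (rule laplacian_compose[OF open_UNIV Ck_on_norm_square _ DERIV_cutoff(1)[OF k] DERIV_cutoff(2)[OF k]]) simp
  moreover have "(\<Sum>i\<in>Basis. (partial_deriv i ?f x)\<^sup>2) = 4 * (norm x)\<^sup>2 / R ^ 4"
  proof -
    have "(\<Sum>i\<in>Basis. (partial_deriv i ?f x)\<^sup>2) = (\<Sum>i\<in>Basis. 4 / R ^ 4 * ((x \<bullet> i) * (x \<bullet> i)))"
    proof (rule sum.cong[OF refl])
      fix i :: 'a assume i: "i \<in> Basis"
      show "(partial_deriv i ?f x)\<^sup>2 = 4 / R ^ 4 * ((x \<bullet> i) * (x \<bullet> i))"
        unfolding partial_deriv_norm_square[OF i] by (simp add: power2_eq_square power4_eq_xxxx divide_inverse mult_ac)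
    qed
    also have "\<dots> = 4 / R ^ 4 * (norm x)\<^sup>2"
      unfolding sum_distrib_left[symmetric] by (simp add: power2_norm_eq_inner euclidean_inner[of x x])
    finally show ?thesis by simp
  qed
  moreover have "?f x = (norm x / R)\<^sup>2" by (simp add: power_divide divide_inverse power_mult_distrib power_inverse mult.commute)
  ultimately show ?thesis unfolding space_cut_eq laplacian_norm_square
    by (simp add: divide_inverse mult_ac)
qed

lemma space_cut_inner:
  assumes "R > 0" "norm x \<le> R"
  shows "space_cut k R x = 1" "4 \<le> k \<Longrightarrow> i \<in> Basis \<Longrightarrow> partial_deriv i (space_cut k R) x = 0"
    "4 \<le> k \<Longrightarrow> laplacian (space_cut k R) x = 0"
proof -
  have "(norm x / R)\<^sup>2 \<le> 1" using assms by (simp add: power_le_one)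
  then show "space_cut k R x = 1" "4 \<le> k \<Longrightarrow> i \<in> Basis \<Longrightarrow> partial_deriv i (space_cut k R) x = 0"
    "4 \<le> k \<Longrightarrow> laplacian (space_cut k R) x = 0"
    by (simp_all add: space_cut_def cutoff_inner partial_deriv_space_cut laplacian_space_cut)
qed

lemma space_cut_outer:
  assumes "R > 0" "2 * R \<le> norm x" "4 \<le> k"
  shows "space_cut k R x = 0" "i \<in> Basis \<Longrightarrow> partial_deriv i (space_cut k R) x = 0"
    "laplacian (space_cut k R) x = 0"
proof -
  have "2 \<le> norm x / R" using assms by (simp add: field_simps)
  then have "2\<^sup>2 \<le> (norm x / R)\<^sup>2" by (rule power_mono) simp
  then have "2 \<le> (norm x / R)\<^sup>2" by simp
  then show "space_cut k R x = 0" "i \<in> Basis \<Longrightarrow> partial_deriv i (space_cut k R) x = 0"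
    "laplacian (space_cut k R) x = 0"
    using assms(3) by (simp_all add: space_cut_def cutoff_outer partial_deriv_space_cut laplacian_space_cut)
qed

lemma space_cut_range: "0 \<le> space_cut k R x" "space_cut k R x \<le> 1"
  by (simp_all add: space_cut_def cutoff_range)

text \<open>For |x| <= 2 R the inner derivatives satisfy |2 x_i / R^2| <= 4 / R and 4 |x|^2 / R^4 <=
  16 / R^2. Multiplying by 15 gives 60 and 240, and the Laplacian 2 n / R^2 of the inner function
  gives 30 n.\<close>

lemma space_cut_deriv_bounds:
  fixes x :: "'a::euclidean_space"
  assumes k: "4 \<le> k" and p: "1 < p" "real k \<le> p * (real k - 2)" and R: "R > 0"
  shows "i \<in> Basis \<Longrightarrow> \<bar>partial_deriv i (space_cut k R) x\<bar> \<le> 60 * (real k)\<^sup>2 / R * space_cut k R x powr (1 / p)"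
    and "\<bar>laplacian (space_cut k R) x\<bar> \<le> (240 + 30 * DIM('a)) * (real k)\<^sup>2 / R\<^sup>2 * space_cut k R x powr (1 / p)"
proof -
  let ?C = "15 * (real k)\<^sup>2" and ?P = "space_cut k R x powr (1 / p)"
  note b = cutoff_deriv_bounds[OF k p, of "(norm x / R)\<^sup>2", folded space_cut_def]
  have CP: "0 \<le> ?C * ?P" by simp
  show "\<bar>partial_deriv i (space_cut k R) x\<bar> \<le> 60 * (real k)\<^sup>2 / R * ?P" if i: "i \<in> Basis"
  proof (cases "norm x \<le> 2 * R")
    case True
    have "\<bar>2 * (x \<bullet> i) / R\<^sup>2\<bar> \<le> 4 / R"
      using True Basis_le_norm[OF i, of x] R by (simp add: abs_mult field_simps power2_eq_square)
    then have "\<bar>cutoff' k ((norm x / R)\<^sup>2)\<bar> * \<bar>2 * (x \<bullet> i) / R\<^sup>2\<bar> \<le> ?C * ?P * (4 / R)"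
      by (intro mult_mono b CP) auto
    then show ?thesis by (simp add: partial_deriv_space_cut[OF k i] abs_mult mult_ac)
  qed (use space_cut_outer[of R x k] R k i in simp)
  show "\<bar>laplacian (space_cut k R) x\<bar> \<le> (240 + 30 * DIM('a)) * (real k)\<^sup>2 / R\<^sup>2 * ?P"
  proof (cases "norm x \<le> 2 * R")
    case True
    have "(norm x)\<^sup>2 \<le> (2 * R)\<^sup>2" using True by (intro power_mono) auto
    then have "4 * (norm x)\<^sup>2 / R ^ 4 \<le> 16 / R\<^sup>2"
      using R by (simp add: field_simps power2_eq_square power4_eq_xxxx)
    then have "\<bar>cutoff'' k ((norm x / R)\<^sup>2)\<bar> * (4 * (norm x)\<^sup>2 / R ^ 4) \<le> ?C * ?P * (16 / R\<^sup>2)"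
      by (intro mult_mono b CP) auto
    moreover have "\<bar>cutoff' k ((norm x / R)\<^sup>2)\<bar> * (2 * DIM('a) / R\<^sup>2) \<le> ?C * ?P * (2 * DIM('a) / R\<^sup>2)"
      by (intro mult_right_mono b) auto
    moreover have "\<bar>laplacian (space_cut k R) x\<bar> \<le> \<bar>cutoff'' k ((norm x / R)\<^sup>2)\<bar> * (4 * (norm x)\<^sup>2 / R ^ 4) + \<bar>cutoff' k ((norm x / R)\<^sup>2)\<bar> * (2 * DIM('a) / R\<^sup>2)"
      unfolding laplacian_space_cut[OF k] by (rule order_trans[OF abs_triangle_ineq]) (simp add: abs_mult)
    ultimately have "\<bar>laplacian (space_cut k R) x\<bar> \<le> ?C * ?P * (16 / R\<^sup>2) + ?C * ?P * (2 * DIM('a) / R\<^sup>2)" by linarith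
    also have "\<dots> = (240 + 30 * DIM('a)) * (real k)\<^sup>2 / R\<^sup>2 * ?P" using R by (simp add: field_simps)
    finally show ?thesis .
  qed (use space_cut_outer[of R x k] R k in simp)
qed

lemma laplacian_diff:
  fixes f g :: "'a::euclidean_space \<Rightarrow> real"
  assumes "open S" "Ck_on 2 S f" "Ck_on 2 S g" "x \<in> S"
  shows "laplacian (\<lambda>x. f x - g x) x = laplacian f x - laplacian g x"
proof -
  have "partial_deriv i (partial_deriv i (\<lambda>x. f x - g x)) x = partial_deriv i (partial_deriv i f) x - partial_deriv i (partial_deriv i g) x"
    if i: "i \<in> Basis" for i
  proof -
    have "partial_deriv i (partial_deriv i (\<lambda>x. f x - g x)) x = partial_deriv i (\<lambda>x. partial_deriv i f x - partial_deriv i g x) x"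
      by (rule partial_deriv_cong[OF assms(1,4)], rule partial_deriv_diff)
        (erule Ck_on_2_D(1)[OF assms(2)], erule Ck_on_2_D(1)[OF assms(3)])
    also have "\<dots> = partial_deriv i (partial_deriv i f) x - partial_deriv i (partial_deriv i g) x"
      by (rule partial_deriv_diff[OF Ck_on_2_D(2)[OF assms(2,4) i] Ck_on_2_D(2)[OF assms(3,4) i]])
    finally show ?thesis .
  qed
  then show ?thesis by (simp add: laplacian_def sum_subtractf)
qed

text \<open>The product is regular on the domain and identically 0 on the complement of the compact
  set; these two open sets cover the space. The values of \<open>g\<close> outside the domain are
  multiplied by 0.\<close>

lemma Ck_on_mult_compact_support:
  assumes \<Omega>: "open \<Omega>" and K: "compact K" "K \<subseteq> \<Omega>"
    and h: "Ck_on k UNIV h" "\<And>x. x \<notin> K \<Longrightarrow> h x = 0" and g: "Ck_on k \<Omega> g"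
  shows "Ck_on k UNIV (\<lambda>x::'a::euclidean_space. h x * g x :: real)"
proof -
  have oK: "open (- K)" using K(1) by (simp add: compact_imp_closed open_Compl)
  have "Ck_on k \<Omega> (\<lambda>x. h x * g x)"
    by (rule Ck_on_mult[OF \<Omega> Ck_on_subset[OF h(1)] g]) simp
  moreover have "Ck_on k (- K) (\<lambda>x. h x * g x) \<longleftrightarrow> Ck_on k (- K) (\<lambda>x. 0)"
    by (rule Ck_on_cong[OF oK]) (simp add: h(2))
  ultimately have "Ck_on k (\<Omega> \<union> - K) (\<lambda>x. h x * g x)"
    by (intro Ck_on_Un[OF \<Omega> oK]) simp_all
  moreover have "\<Omega> \<union> - K = UNIV" using K(2) by blast
  ultimately show ?thesis by simp
qed

lemma Cc_infinity_support:
  assumes "v \<in> Cc_infinity \<Omega>"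
  obtains K where "compact K" "K \<subseteq> \<Omega>" "\<And>x. x \<notin> K \<Longrightarrow> v x = 0" "\<And>x i. x \<notin> K \<Longrightarrow> partial_deriv i v x = 0"
proof -
  let ?K = "closure {x. v x \<noteq> 0}"
  have K: "compact ?K" "?K \<subseteq> \<Omega>" using assms by (auto simp: Cc_infinity_def)
  have z: "v x = 0" if "x \<notin> ?K" for x using that closure_subset[of "{x. v x \<noteq> 0}"] by blast
  have z': "partial_deriv i v x = 0" if "x \<notin> ?K" for x i
  proof -
    have "partial_deriv i v x = partial_deriv i (\<lambda>x. 0) x"
      by (rule partial_deriv_cong[of "- ?K"], simp only: open_Compl closed_closure) (use that in blast, use z in blast)
    then show ?thesis by simp
  qed
  show ?thesis by (rule that[OF K z z'])
qed

section \<open>Truncated test functions\<close>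

text \<open>What all dimensions have in common. The dimension enters only through growth at
  infinity, which is added in a later locale.\<close>

locale exterior_harmonic_setup =
  fixes \<Omega> :: "'a::euclidean_space set" and \<phi> :: "'a \<Rightarrow> real"
  assumes open_dom: "open \<Omega>" and C2: "Ck_on 2 \<Omega> \<phi>" and cont_closure: "continuous_on (closure \<Omega>) \<phi>"
    and harmonic: "x \<in> \<Omega> \<Longrightarrow> laplacian \<phi> x = 0" and boundary: "x \<in> frontier \<Omega> \<Longrightarrow> \<phi> x = 0"
    and pos: "x \<in> \<Omega> \<Longrightarrow> 0 < \<phi> x"
begin

text \<open>An open neighbourhood of the complement of the domain on which the truncation is 0. It
  is open because \<phi> is continuous up to the closure, and it contains the boundary because
  \<phi> is 0 there.\<close>

definition collar :: "real \<Rightarrow> 'a set" where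
  "collar \<epsilon> = - {x \<in> closure \<Omega>. \<epsilon> \<le> \<phi> x}"

definition trunc :: "real \<Rightarrow> 'a \<Rightarrow> real" where
  "trunc \<epsilon> x = (if x \<in> \<Omega> then soft_trunc \<epsilon> (\<phi> x) else 0)"

lemma open_collar: "open (collar \<epsilon>)"
  unfolding collar_def
  by (intro open_Compl continuous_on_closed_Collect_le cont_closure continuous_on_const) simp

lemma collar_Un: assumes "\<epsilon> > 0" shows "\<Omega> \<union> collar \<epsilon> = UNIV"
proof -
  have "x \<in> collar \<epsilon>" if "x \<notin> \<Omega>" for x
  proof (cases "x \<in> closure \<Omega>")
    case True
    then have "x \<in> frontier \<Omega>" using that open_dom by (simp add: frontier_def interior_open)
    then show ?thesis using boundary assms by (simp add: collar_def)
  qed (simp add: collar_def)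
  then show ?thesis by blast
qed

lemma trunc_collar: "\<epsilon> > 0 \<Longrightarrow> x \<in> collar \<epsilon> \<Longrightarrow> trunc \<epsilon> x = 0"
  using closure_subset[of \<Omega>] by (auto simp: collar_def trunc_def intro!: soft_trunc_zero)

lemma not_in_domain_collar: "\<epsilon> > 0 \<Longrightarrow> x \<notin> \<Omega> \<Longrightarrow> x \<in> collar \<epsilon>"
  using collar_Un by blast

lemma Ck_on_soft_trunc: "\<epsilon> > 0 \<Longrightarrow> Ck_on 2 \<Omega> (\<lambda>x. soft_trunc \<epsilon> (\<phi> x))"
  by (rule Ck_on_2_compose[OF open_dom C2 DERIV_soft_trunc(1) DERIV_soft_trunc(2) DERIV_soft_trunc(3)])

text \<open>The domain and the collar are open and cover the space; the truncation is a composition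
  on the first and 0 on the second.\<close>

lemma Ck_on_trunc:
  assumes e: "\<epsilon> > 0"
  shows "Ck_on 2 UNIV (trunc \<epsilon>)"
proof -
  have "Ck_on 2 \<Omega> (trunc \<epsilon>) \<longleftrightarrow> Ck_on 2 \<Omega> (\<lambda>x. soft_trunc \<epsilon> (\<phi> x))"
    by (rule Ck_on_cong[OF open_dom]) (simp add: trunc_def)
  moreover have "Ck_on 2 (collar \<epsilon>) (trunc \<epsilon>) \<longleftrightarrow> Ck_on 2 (collar \<epsilon>) (\<lambda>x. 0)"
    by (rule Ck_on_cong[OF open_collar]) (rule trunc_collar[OF e])
  ultimately have "Ck_on 2 (\<Omega> \<union> collar \<epsilon>) (trunc \<epsilon>)"
    using Ck_on_soft_trunc[OF e] by (intro Ck_on_Un open_dom open_collar) (simp_all only: Ck_on_const)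
  then show ?thesis by (simp only: collar_Un[OF e])
qed

lemma trunc_range:
  assumes e: "\<epsilon> > 0"
  shows "0 \<le> trunc \<epsilon> x" "x \<in> \<Omega> \<Longrightarrow> trunc \<epsilon> x \<le> \<phi> x" "x \<in> \<Omega> \<Longrightarrow> \<bar>trunc \<epsilon> x - \<phi> x\<bar> \<le> 3 * \<epsilon>"
  using soft_trunc_bounds[OF e, of "\<phi> x"] pos[of x] by (auto simp: trunc_def)

lemma partial_deriv_trunc:
  assumes e: "\<epsilon> > 0"
  shows "x \<in> \<Omega> \<Longrightarrow> partial_deriv i (trunc \<epsilon>) x = soft_trunc' \<epsilon> (\<phi> x) * partial_deriv i \<phi> x"
    "x \<notin> \<Omega> \<Longrightarrow> partial_deriv i (trunc \<epsilon>) x = 0"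
proof -
  show "partial_deriv i (trunc \<epsilon>) x = soft_trunc' \<epsilon> (\<phi> x) * partial_deriv i \<phi> x" if x: "x \<in> \<Omega>"
  proof -
    have "partial_deriv i (trunc \<epsilon>) x = partial_deriv i (\<lambda>x. soft_trunc \<epsilon> (\<phi> x)) x"
      by (rule partial_deriv_cong[OF open_dom x]) (simp add: trunc_def)
    also have "\<dots> = soft_trunc' \<epsilon> (\<phi> x) * partial_deriv i \<phi> x"
      by (rule partial_deriv_compose(1)[OF Ck_on_2_D(1)[OF C2 x] DERIV_soft_trunc(1)[OF e]])
    finally show ?thesis .
  qed
  show "partial_deriv i (trunc \<epsilon>) x = 0" if "x \<notin> \<Omega>"
  proof -
    have "partial_deriv i (trunc \<epsilon>) x = partial_deriv i (\<lambda>x. 0) x"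
      by (rule partial_deriv_cong[OF open_collar not_in_domain_collar[OF e that]]) (rule trunc_collar[OF e])
    then show ?thesis by simp
  qed
qed

text \<open>A convex function of a harmonic function is subharmonic. The extra factor is the one met
  in Caccioppoli's identity, and it settles the points outside the domain.\<close>

lemma laplacian_trunc_nonneg:
  assumes e: "\<epsilon> > 0"
  shows "0 \<le> trunc \<epsilon> x * laplacian (trunc \<epsilon>) x"
proof (cases "x \<in> \<Omega>")
  case True
  have "laplacian (trunc \<epsilon>) x = laplacian (\<lambda>x. soft_trunc \<epsilon> (\<phi> x)) x"
    by (rule laplacian_cong[OF open_dom True]) (simp add: trunc_def)
  also have "\<dots> = soft_trunc'' \<epsilon> (\<phi> x) * (\<Sum>i\<in>Basis. (partial_deriv i \<phi> x)\<^sup>2) + soft_trunc' \<epsilon> (\<phi> x) * laplacian \<phi> x"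
    by (rule laplacian_compose[OF open_dom C2 True DERIV_soft_trunc(1)[OF e] DERIV_soft_trunc(2)[OF e]])
  finally have "0 \<le> laplacian (trunc \<epsilon>) x"
    using harmonic[OF True] soft_trunc''_nonneg[OF e] by (simp add: sum_nonneg)
  then show ?thesis using trunc_range(1)[OF e] by simp
qed (simp add: trunc_def)

lemma bounded_on_ball:
  obtains M where "M > 0" "\<And>x. x \<in> \<Omega> \<Longrightarrow> norm x \<le> r \<Longrightarrow> \<phi> x \<le> M"
proof -
  have "compact (closure \<Omega> \<inter> cball 0 r)" by (simp add: closed_Int_compact)
  moreover have "continuous_on (closure \<Omega> \<inter> cball 0 r) \<phi>"
    using cont_closure by (rule continuous_on_subset) simp
  ultimately have "bounded (\<phi> ` (closure \<Omega> \<inter> cball 0 r))"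
    by (intro compact_imp_bounded compact_continuous_image)
  then obtain M where M: "M > 0" "\<And>x. x \<in> closure \<Omega> \<inter> cball 0 r \<Longrightarrow> \<bar>\<phi> x\<bar> \<le> M"
    by (auto simp: bounded_pos)
  have "\<phi> x \<le> M" if "x \<in> \<Omega>" "norm x \<le> r" for x
    using M(2)[of x] that closure_subset[of \<Omega>] by auto
  with M(1) show ?thesis using that by blast
qed

context
  fixes k :: nat and R :: real
  assumes k: "4 \<le> k" and R: "R > 0"
begin

abbreviation ch :: "'a \<Rightarrow> real" where "ch \<equiv> space_cut k R"

lemma C2_ch: "Ck_on 2 UNIV ch" by (rule Ck_on_space_cut[OF k])

lemma continuous_laplacian_UNIV: "Ck_on 2 UNIV f \<Longrightarrow> continuous_on UNIV (laplacian f)"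
  by (rule Ck_on_laplacian)

lemma ch_outside: "2 * R < norm x \<Longrightarrow> ch x = 0" "2 * R < norm x \<Longrightarrow> i \<in> Basis \<Longrightarrow> partial_deriv i ch x = 0"
    "2 * R < norm x \<Longrightarrow> laplacian ch x = 0"
  using space_cut_outer[OF R _ k, of x] by auto

lemma continuous_partial_UNIV: "Ck_on 2 UNIV f \<Longrightarrow> i \<in> Basis \<Longrightarrow> continuous_on UNIV (partial_deriv i f)"
  by (rule Ck_on_imp_continuous_on[OF Ck_on_2_D(3)[of UNIV f 0]]) simp_all

text \<open>Caccioppoli's inequality for the truncations; the field
  \<open>f ch \<nabla>f - f\<^sup>2 \<nabla>ch / 2\<close> is chosen such that the mixed terms cancel.\<close>

lemma integral_gradient_trunc_le:
  assumes e: "\<epsilon> > 0" and M: "\<And>x. x \<in> \<Omega> \<Longrightarrow> norm x \<le> 2 * R \<Longrightarrow> \<phi> x \<le> M"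
  shows "integrable lebesgue (\<lambda>x. ch x * (\<Sum>i\<in>Basis. (partial_deriv i (trunc \<epsilon>) x)\<^sup>2))"
    and "(\<integral>x. ch x * (\<Sum>i\<in>Basis. (partial_deriv i (trunc \<epsilon>) x)\<^sup>2) \<partial>lebesgue) \<le>
      1 / 2 * (M\<^sup>2 * (\<integral>x. \<bar>laplacian ch x\<bar> \<partial>lebesgue))"
proof -
  let ?f = "trunc \<epsilon>"
  note C2f = Ck_on_trunc[OF e]
  have C1: "Ck_on 1 UNIV ?f" "Ck_on 1 UNIV ch" by (rule Ck_on_mono[OF C2f], simp, rule Ck_on_mono[OF C2_ch], simp)
  define X where "X i x = (?f x * ch x) * partial_deriv i ?f x - (1 / 2 * ?f x * ?f x) * partial_deriv i ch x" for i x
  have C1X: "Ck_on 1 UNIV (X i)" if i: "i \<in> Basis" for i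
    unfolding X_def[abs_def] using Ck_on_2_D(3)[OF C2f _ i] Ck_on_2_D(3)[OF C2_ch _ i]
    by (intro Ck_on_diff Ck_on_mult Ck_on_const C1 open_UNIV) auto
  have X0: "X i x = 0" if "2 * R < norm x" "i \<in> Basis" for i x
    using ch_outside[OF that(1)] that(2) by (simp add: X_def)
  have dX: "partial_deriv i (X i) x = ch x * (partial_deriv i ?f x)\<^sup>2 + ?f x * ch x * partial_deriv i (partial_deriv i ?f) x
      - 1 / 2 * (?f x)\<^sup>2 * partial_deriv i (partial_deriv i ch) x" if i: "i \<in> Basis" for i x
  proof -
    have d: "?f differentiable at x" "ch differentiable at x" "partial_deriv i ?f differentiable at x" "partial_deriv i ch differentiable at x"
      using Ck_on_2_D(1,2)[OF C2f _ ] Ck_on_2_D(1,2)[OF C2_ch] i by auto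
    have d2: "(\<lambda>x. ?f x * ch x) differentiable at x" "(\<lambda>x. 1 / 2 * ?f x) differentiable at x" "(\<lambda>x. 1 / 2 * ?f x * ?f x) differentiable at x"
      by (intro differentiable_mult differentiable_const d)+
    have "partial_deriv i (X i) x = partial_deriv i (\<lambda>x. (?f x * ch x) * partial_deriv i ?f x) x -
        partial_deriv i (\<lambda>x. (1 / 2 * ?f x * ?f x) * partial_deriv i ch x) x"
      unfolding X_def[abs_def] by (rule partial_deriv_diff) (intro differentiable_mult d2 d)+
    then show ?thesis
      unfolding partial_deriv_mult[OF d2(1) d(3)] partial_deriv_mult[OF d2(3) d(4)] partial_deriv_mult[OF d(1,2)]
        partial_deriv_mult[OF d2(2) d(1)] partial_deriv_cmult[OF d(1)]
      by (simp add: algebra_simps power2_eq_square)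
  qed
  let ?A = "\<lambda>x. ch x * (\<Sum>i\<in>Basis. (partial_deriv i ?f x)\<^sup>2)"
  let ?B = "\<lambda>x. ch x * (?f x * laplacian ?f x)"
  let ?C = "\<lambda>x. 1 / 2 * (?f x)\<^sup>2 * laplacian ch x"
  have sumX: "(\<Sum>i\<in>Basis. partial_deriv i (X i) x) = ?A x + ?B x - ?C x" for x
  proof -
    have "(\<Sum>i\<in>Basis. partial_deriv i (X i) x) = (\<Sum>i\<in>Basis. ch x * (partial_deriv i ?f x)\<^sup>2 +
        ?f x * ch x * partial_deriv i (partial_deriv i ?f) x - 1 / 2 * (?f x)\<^sup>2 * partial_deriv i (partial_deriv i ch) x)"
      by (rule sum.cong[OF refl dX])
    also have "\<dots> = ch x * (\<Sum>i\<in>Basis. (partial_deriv i ?f x)\<^sup>2) + ?f x * ch x * laplacian ?f x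
        - 1 / 2 * (?f x)\<^sup>2 * laplacian ch x"
      unfolding laplacian_def by (simp only: sum.distrib sum_subtractf sum_distrib_left)
    finally show ?thesis by (simp add: mult_ac)
  qed
  have cf: "continuous_on UNIV ?f" by (rule Ck_on_imp_continuous_on[OF C2f])
  have cch: "continuous_on UNIV ch" by (rule Ck_on_imp_continuous_on[OF C2_ch])
  note cl = continuous_laplacian_UNIV[OF C2f] continuous_laplacian_UNIV[OF C2_ch]
  note cp = continuous_partial_UNIV[OF C2f]
  have iA: "integrable lebesgue ?A"
    by (rule integrable_continuous_compact_support_lebesgue[of _ "2 * R"])
      (auto intro!: continuous_intros cch cp simp: ch_outside)
  have iB: "integrable lebesgue ?B"
    by (rule integrable_continuous_compact_support_lebesgue[of _ "2 * R"])
      (auto intro!: continuous_intros cch cf cl simp: ch_outside)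
  have iC: "integrable lebesgue ?C"
    by (rule integrable_continuous_compact_support_lebesgue[of _ "2 * R"])
      (auto intro!: continuous_intros cf cl simp: ch_outside)
  show "integrable lebesgue ?A" by (rule iA)
  have iX: "integrable lebesgue (partial_deriv i (X i))" if i: "i \<in> Basis" for i
  proof (rule integrable_continuous_compact_support_lebesgue[of _ "2 * R"])
    show "continuous_on UNIV (partial_deriv i (X i))" using C1X[OF i] i by simp
  qed (rule partial_deriv_zero_outside[OF X0[OF _ i]])
  have "(\<integral>x. (\<Sum>i\<in>Basis. partial_deriv i (X i) x) \<partial>lebesgue) = (\<Sum>i\<in>Basis. integral\<^sup>L lebesgue (partial_deriv i (X i)))"
    using iX by (intro Bochner_Integration.integral_sum) auto
  also have "\<dots> = 0"
    using integral_partial_deriv_eq_0(2)[OF C1X X0] by (intro sum.neutral) auto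
  finally have "integral\<^sup>L lebesgue ?A + integral\<^sup>L lebesgue ?B - integral\<^sup>L lebesgue ?C = 0"
    unfolding sumX using iA iB iC by simp
  \<comment> \<open>The term with the Laplacian of the truncation has a favourable sign and is
    dropped. Only the term with the Laplacian of the cutoff must be estimated, and its bound does
    not depend on \<epsilon>.\<close>
  moreover have "0 \<le> integral\<^sup>L lebesgue ?B"
    by (intro integral_nonneg_AE AE_I2 mult_nonneg_nonneg laplacian_trunc_nonneg[OF e] space_cut_range)
  moreover have "integral\<^sup>L lebesgue ?C \<le> (\<integral>x. 1 / 2 * (M\<^sup>2 * \<bar>laplacian ch x\<bar>) \<partial>lebesgue)"
  proof (rule integral_mono[OF iC])
    show "integrable lebesgue (\<lambda>x. 1 / 2 * (M\<^sup>2 * \<bar>laplacian ch x\<bar>))"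
      by (rule integrable_continuous_compact_support_lebesgue[of _ "2 * R"])
        (auto intro!: continuous_intros cl simp: ch_outside)
    fix x
    show "?C x \<le> 1 / 2 * (M\<^sup>2 * \<bar>laplacian ch x\<bar>)"
    proof (cases "x \<in> \<Omega> \<and> norm x \<le> 2 * R")
      case True
      have "(?f x)\<^sup>2 \<le> M\<^sup>2"
        using trunc_range[OF e, of x] M[of x] True by (intro power_mono) auto
      then have "(?f x)\<^sup>2 * \<bar>laplacian ch x\<bar> \<le> M\<^sup>2 * \<bar>laplacian ch x\<bar>" by (intro mult_right_mono) auto
      moreover have "(?f x)\<^sup>2 * laplacian ch x \<le> (?f x)\<^sup>2 * \<bar>laplacian ch x\<bar>" by (intro mult_left_mono) auto
      ultimately have "(?f x)\<^sup>2 * laplacian ch x \<le> M\<^sup>2 * \<bar>laplacian ch x\<bar>" by linarith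
      then show ?thesis by simp
    next
      case False
      then have "?C x = 0" using ch_outside(3)[of x] by (auto simp: trunc_def)
      also have "0 \<le> 1 / 2 * (M\<^sup>2 * \<bar>laplacian ch x\<bar>)" by simp
      finally show ?thesis .
    qed
  qed
  ultimately show "integral\<^sup>L lebesgue ?A \<le> 1 / 2 * (M\<^sup>2 * (\<integral>x. \<bar>laplacian ch x\<bar> \<partial>lebesgue))" by simp
qed

text \<open>The gradients of the truncations converge pointwise to that of \<phi>, and their
  energies are bounded independently of \<epsilon>; Fatou's lemma gives finite energy of \<phi> up
  to the boundary.\<close>

lemma gradient_integrable:
  "integrable lebesgue (\<lambda>x. indicator \<Omega> x * (ch x * (\<Sum>i\<in>Basis. (partial_deriv i \<phi> x)\<^sup>2)))"
proof -
  obtain M where M: "\<And>x. x \<in> \<Omega> \<Longrightarrow> norm x \<le> 2 * R \<Longrightarrow> \<phi> x \<le> M" using bounded_on_ball[of "2 * R"] by blast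
  let ?e = "\<lambda>n. 1 / real (Suc n)"
  let ?G = "\<lambda>x. indicator \<Omega> x * (ch x * (\<Sum>i\<in>Basis. (partial_deriv i \<phi> x)\<^sup>2))"
  let ?A = "\<lambda>n x. ch x * (\<Sum>i\<in>Basis. (partial_deriv i (trunc (?e n)) x)\<^sup>2)"
  let ?K = "1 / 2 * (M\<^sup>2 * (\<integral>x. \<bar>laplacian ch x\<bar> \<partial>lebesgue))"
  have e: "?e n > 0" for n by simp
  have nnA: "0 \<le> ?A n x" for n x by (intro mult_nonneg_nonneg space_cut_range sum_nonneg) simp
  have lim: "(\<lambda>n. ?A n x) \<longlonglongrightarrow> ?G x" for x
  proof (cases "x \<in> \<Omega>")
    case True
    have "(\<lambda>n. ch x * (\<Sum>i\<in>Basis. (soft_trunc' (?e n) (\<phi> x) * partial_deriv i \<phi> x)\<^sup>2)) \<longlonglongrightarrow>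
        ch x * (\<Sum>i\<in>Basis. (1 * partial_deriv i \<phi> x)\<^sup>2)"
      by (intro tendsto_intros soft_trunc'_tendsto pos True)
    then show ?thesis using True unfolding partial_deriv_trunc(1)[OF e True] by simp
  next
    case False
    then show ?thesis unfolding partial_deriv_trunc(2)[OF e False] by simp
  qed
  have mA: "?A n \<in> borel_measurable lebesgue" for n
    using integral_gradient_trunc_le(1)[OF e M] by simp
  have mG: "?G \<in> borel_measurable lebesgue"
    by (rule borel_measurable_LIMSEQ_real[OF _ mA]) (rule lim)
  have "(\<integral>\<^sup>+x. ennreal (?G x) \<partial>lebesgue) = (\<integral>\<^sup>+x. liminf (\<lambda>n. ennreal (?A n x)) \<partial>lebesgue)"
    by (intro nn_integral_cong lim_imp_Liminf[symmetric] tendsto_ennrealI lim) simp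
  also have "\<dots> \<le> liminf (\<lambda>n. \<integral>\<^sup>+x. ennreal (?A n x) \<partial>lebesgue)"
    by (rule nn_integral_liminf) (use mA in measurable)
  also have "\<dots> \<le> ennreal ?K"
  proof (rule order_trans[OF Liminf_mono[OF always_eventually, of _ "\<lambda>n. ennreal ?K"]])
    show "\<forall>n. (\<integral>\<^sup>+x. ennreal (?A n x) \<partial>lebesgue) \<le> ennreal ?K"
    proof
      fix n
      have "(\<integral>\<^sup>+x. ennreal (?A n x) \<partial>lebesgue) = ennreal (integral\<^sup>L lebesgue (?A n))"
        by (rule nn_integral_eq_integral[OF integral_gradient_trunc_le(1)[OF e M]]) (use nnA in auto)
      also have "\<dots> \<le> ennreal ?K" by (intro ennreal_leI integral_gradient_trunc_le(2)[OF e M])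
      finally show "(\<integral>\<^sup>+x. ennreal (?A n x) \<partial>lebesgue) \<le> ennreal ?K" .
    qed
  qed (simp add: Liminf_const)
  finally have fin: "(\<integral>\<^sup>+x. ennreal (?G x) \<partial>lebesgue) \<le> ennreal ?K" .
  show ?thesis
  proof (rule integrableI_nonneg[OF mG])
    show "AE x in lebesgue. 0 \<le> ?G x"
      by (intro AE_I2 mult_nonneg_nonneg space_cut_range sum_nonneg) simp_all
    show "(\<integral>\<^sup>+x. ennreal (?G x) \<partial>lebesgue) < \<infinity>" using fin by (rule le_less_trans) simp
  qed
qed

section \<open>The limit of the truncations, tested against functions vanishing on the
  boundary\<close>

definition test_fun :: "real \<Rightarrow> 'a \<Rightarrow> real" where
  "test_fun \<epsilon> x = trunc \<epsilon> x * ch x"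

definition err :: "real \<Rightarrow> 'a \<Rightarrow> real" where
  "err \<epsilon> x = test_fun \<epsilon> x - \<phi> x * ch x"

definition err_energy :: "real \<Rightarrow> real" where
  "err_energy \<epsilon> = (\<integral>x. indicator \<Omega> x * (\<Sum>i\<in>Basis. (partial_deriv i (err \<epsilon>) x)\<^sup>2) \<partial>lebesgue)"

lemma Ck_on_test_fun: "\<epsilon> > 0 \<Longrightarrow> Ck_on 2 UNIV (test_fun \<epsilon>)"
  unfolding test_fun_def[abs_def] by (intro Ck_on_mult Ck_on_trunc C2_ch open_UNIV)

lemma Ck_on_phi_ch: "Ck_on 2 \<Omega> (\<lambda>x. \<phi> x * ch x)"
  by (intro Ck_on_mult open_dom C2 Ck_on_subset[OF C2_ch]) simp

lemma Ck_on_err: "\<epsilon> > 0 \<Longrightarrow> Ck_on 2 \<Omega> (err \<epsilon>)"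
  unfolding err_def[abs_def] by (intro Ck_on_diff Ck_on_phi_ch open_dom Ck_on_subset[OF Ck_on_test_fun]) auto

lemma partial_deriv_err:
  assumes e: "\<epsilon> > 0" and x: "x \<in> \<Omega>"
  shows "partial_deriv i (err \<epsilon>) x = (trunc \<epsilon> x - \<phi> x) * partial_deriv i ch x + (soft_trunc' \<epsilon> (\<phi> x) - 1) * partial_deriv i \<phi> x * ch x"
proof -
  have d: "trunc \<epsilon> differentiable at x" "\<phi> differentiable at x" "ch differentiable at x"
    using Ck_on_2_D(1)[OF Ck_on_trunc[OF e]] Ck_on_2_D(1)[OF C2 x] Ck_on_2_D(1)[OF C2_ch] by auto
  have eq: "err \<epsilon> = (\<lambda>x. (trunc \<epsilon> x - \<phi> x) * ch x)" by (simp add: fun_eq_iff err_def test_fun_def left_diff_distrib)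
  show ?thesis
    unfolding eq partial_deriv_mult[OF differentiable_diff[OF d(1,2)] d(3)] partial_deriv_diff[OF d(1,2)] partial_deriv_trunc(1)[OF e x]
    by (simp add: algebra_simps)
qed

text \<open>A dominating function independent of \<epsilon>. From (a + b)^2 <= 2 a^2 + 2 b^2 and
  |trunc - \<phi>| <= 3 comes the constant 2 * 9; in the second summand ch^2 <= ch and the slope
  defect is at most 1.\<close>

lemma err_energy_bound:
  assumes e: "\<epsilon> > 0" "\<epsilon> \<le> 1"
  shows "indicator \<Omega> x * (\<Sum>i\<in>Basis. (partial_deriv i (err \<epsilon>) x)\<^sup>2) \<le>
    18 * (\<Sum>i\<in>Basis. (partial_deriv i ch x)\<^sup>2) + 2 * (indicator \<Omega> x * (ch x * (\<Sum>i\<in>Basis. (partial_deriv i \<phi> x)\<^sup>2)))"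
proof (cases "x \<in> \<Omega>")
  case True
  have "(partial_deriv i (err \<epsilon>) x)\<^sup>2 \<le> 18 * (partial_deriv i ch x)\<^sup>2 + 2 * (ch x * (partial_deriv i \<phi> x)\<^sup>2)" for i
  proof -
    let ?a = "(trunc \<epsilon> x - \<phi> x) * partial_deriv i ch x" and ?b = "(soft_trunc' \<epsilon> (\<phi> x) - 1) * partial_deriv i \<phi> x * ch x"
    have "0 \<le> (?a - ?b)\<^sup>2" by simp
    then have "(?a + ?b)\<^sup>2 \<le> 2 * ?a\<^sup>2 + 2 * ?b\<^sup>2" unfolding power2_diff power2_sum by linarith
    moreover have "?a\<^sup>2 \<le> 3\<^sup>2 * (partial_deriv i ch x)\<^sup>2"
    proof -
      have "\<bar>trunc \<epsilon> x - \<phi> x\<bar> \<le> 3" using trunc_range(3)[OF e(1) True] e(2) by linarith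
      then have "\<bar>trunc \<epsilon> x - \<phi> x\<bar>\<^sup>2 \<le> 3\<^sup>2" by (intro power_mono) auto
      then show ?thesis unfolding power_mult_distrib by (intro mult_right_mono) auto
    qed
    moreover have "?b\<^sup>2 \<le> ch x * (partial_deriv i \<phi> x)\<^sup>2"
    proof -
      have "\<bar>soft_trunc' \<epsilon> (\<phi> x) - 1\<bar>\<^sup>2 \<le> 1"
        using soft_trunc'_bounds[of \<epsilon> "\<phi> x"] by (intro power_le_one) auto
      then have 1: "(soft_trunc' \<epsilon> (\<phi> x) - 1)\<^sup>2 \<le> 1" by simp
      have 2: "(ch x)\<^sup>2 \<le> ch x" using space_cut_range[of k R x] by (simp add: power2_eq_square mult_left_le_one_le)
      have "?b\<^sup>2 = (soft_trunc' \<epsilon> (\<phi> x) - 1)\<^sup>2 * (partial_deriv i \<phi> x)\<^sup>2 * (ch x)\<^sup>2" by (simp add: power_mult_distrib)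
      also have "\<dots> \<le> 1 * (partial_deriv i \<phi> x)\<^sup>2 * ch x"
        using 1 2 by (intro mult_mono) auto
      finally show ?thesis by (simp add: mult.commute)
    qed
    ultimately show ?thesis unfolding partial_deriv_err[OF e(1) True] by simp
  qed
  then have "(\<Sum>i\<in>Basis. (partial_deriv i (err \<epsilon>) x)\<^sup>2) \<le> (\<Sum>i\<in>Basis. 18 * (partial_deriv i ch x)\<^sup>2 + 2 * (ch x * (partial_deriv i \<phi> x)\<^sup>2))"
    by (intro sum_mono)
  then show ?thesis using True by (simp add: sum.distrib sum_distrib_left)
qed (simp add: sum_nonneg)

lemma err_energy_integrable:
  assumes e: "\<epsilon> > 0" "\<epsilon> \<le> 1"
  shows "integrable lebesgue (\<lambda>x. indicator \<Omega> x * (\<Sum>i\<in>Basis. (partial_deriv i (err \<epsilon>) x)\<^sup>2))"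
    and "integrable lebesgue (\<lambda>x. 18 * (\<Sum>i\<in>Basis. (partial_deriv i ch x)\<^sup>2) + 2 * (indicator \<Omega> x * (ch x * (\<Sum>i\<in>Basis. (partial_deriv i \<phi> x)\<^sup>2))))"
proof -
  have "integrable lebesgue (\<lambda>x. \<Sum>i\<in>Basis. (partial_deriv i ch x)\<^sup>2)"
    by (rule integrable_continuous_compact_support_lebesgue[of _ "2 * R"])
      (auto intro!: continuous_intros continuous_partial_UNIV[OF C2_ch] simp: ch_outside)
  then show i: "integrable lebesgue (\<lambda>x. 18 * (\<Sum>i\<in>Basis. (partial_deriv i ch x)\<^sup>2) + 2 * (indicator \<Omega> x * (ch x * (\<Sum>i\<in>Basis. (partial_deriv i \<phi> x)\<^sup>2))))"
    by (intro Bochner_Integration.integrable_add integrable_mult_right gradient_integrable)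
  have c: "continuous_on \<Omega> (\<lambda>x. \<Sum>i\<in>Basis. (partial_deriv i (err \<epsilon>) x)\<^sup>2)"
  proof (intro continuous_intros)
    fix i :: 'a assume i: "i \<in> Basis"
    show "continuous_on \<Omega> (partial_deriv i (err \<epsilon>))"
      using Ck_on_err[OF e(1)] i by (auto simp: numeral_2_eq_2 intro!: differentiable_imp_continuous_on_Ball)
  qed
  have "(\<lambda>x. indicator \<Omega> x *\<^sub>R (\<Sum>i\<in>Basis. (partial_deriv i (err \<epsilon>) x)\<^sup>2)) \<in> borel_measurable borel"
    using open_dom c by (intro borel_measurable_continuous_on_indicator) auto
  then have m: "(\<lambda>x. indicator \<Omega> x * (\<Sum>i\<in>Basis. (partial_deriv i (err \<epsilon>) x)\<^sup>2)) \<in> borel_measurable lebesgue"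
    by (intro measurable_completion) simp
  show "integrable lebesgue (\<lambda>x. indicator \<Omega> x * (\<Sum>i\<in>Basis. (partial_deriv i (err \<epsilon>) x)\<^sup>2))"
  proof (rule Bochner_Integration.integrable_bound[OF i m], intro AE_I2)
    fix x
    have "0 \<le> indicator \<Omega> x * (\<Sum>i\<in>Basis. (partial_deriv i (err \<epsilon>) x)\<^sup>2)" by (intro mult_nonneg_nonneg sum_nonneg) simp_all
    then show "norm (indicator \<Omega> x * (\<Sum>i\<in>Basis. (partial_deriv i (err \<epsilon>) x)\<^sup>2)) \<le>
        norm (18 * (\<Sum>i\<in>Basis. (partial_deriv i ch x)\<^sup>2) + 2 * (indicator \<Omega> x * (ch x * (\<Sum>i\<in>Basis. (partial_deriv i \<phi> x)\<^sup>2))))"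
      using err_energy_bound[OF e, of x] by simp
  qed
qed

text \<open>At every point of the domain \<phi> is positive, so the truncation converges to \<phi>
  and its slope to 1. The finite energy of \<phi> supplies the domination.\<close>

lemma err_energy_tendsto: "(\<lambda>n. err_energy (1 / real (Suc n))) \<longlonglongrightarrow> 0"
proof -
  let ?e = "\<lambda>n. 1 / real (Suc n)"
  have e: "?e n > 0" "?e n \<le> 1" for n by simp_all
  have "(\<lambda>n. err_energy (?e n)) \<longlonglongrightarrow> integral\<^sup>L (lebesgue :: 'a measure) (\<lambda>x. 0)"
    unfolding err_energy_def
  proof (rule integral_dominated_convergence[OF _ _ err_energy_integrable(2)[OF e(1)[of 0] e(2)[of 0]]])
    show "(\<lambda>x. indicator \<Omega> x * (\<Sum>i\<in>Basis. (partial_deriv i (err (?e n)) x)\<^sup>2)) \<in> borel_measurable lebesgue" for n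
      using err_energy_integrable(1)[OF e] by simp
    show "AE x in lebesgue. norm (indicator \<Omega> x * (\<Sum>i\<in>Basis. (partial_deriv i (err (?e n)) x)\<^sup>2)) \<le>
      18 * (\<Sum>i\<in>Basis. (partial_deriv i ch x)\<^sup>2) + 2 * (indicator \<Omega> x * (ch x * (\<Sum>i\<in>Basis. (partial_deriv i \<phi> x)\<^sup>2)))" for n
    proof (intro AE_I2)
      fix x
      have "0 \<le> indicator \<Omega> x * (\<Sum>i\<in>Basis. (partial_deriv i (err (?e n)) x)\<^sup>2)" by (intro mult_nonneg_nonneg sum_nonneg) simp_all
      then show "norm (indicator \<Omega> x * (\<Sum>i\<in>Basis. (partial_deriv i (err (?e n)) x)\<^sup>2)) \<le>
        18 * (\<Sum>i\<in>Basis. (partial_deriv i ch x)\<^sup>2) + 2 * (indicator \<Omega> x * (ch x * (\<Sum>i\<in>Basis. (partial_deriv i \<phi> x)\<^sup>2)))"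
        using err_energy_bound[OF e, of x n] by simp
    qed
    show "AE x in lebesgue. (\<lambda>n. indicator \<Omega> x * (\<Sum>i\<in>Basis. (partial_deriv i (err (?e n)) x)\<^sup>2)) \<longlonglongrightarrow> 0"
    proof (intro AE_I2)
      fix x
      show "(\<lambda>n. indicator \<Omega> x * (\<Sum>i\<in>Basis. (partial_deriv i (err (?e n)) x)\<^sup>2)) \<longlonglongrightarrow> 0"
      proof (cases "x \<in> \<Omega>")
        case True
        have "(\<lambda>n. \<bar>trunc (?e n) x - \<phi> x\<bar>) \<longlonglongrightarrow> 0"
        proof (rule tendsto_sandwich[OF _ _ tendsto_const])
          show "\<forall>\<^sub>F n in sequentially. \<bar>trunc (?e n) x - \<phi> x\<bar> \<le> 3 * ?e n"
            using trunc_range(3)[OF e(1) True] by simp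
          show "(\<lambda>n. 3 * ?e n) \<longlonglongrightarrow> 0"
            using tendsto_mult_left[OF LIMSEQ_Suc[OF lim_1_over_n[where 'a=real]], of 3] by simp
        qed simp
        then have t: "(\<lambda>n. trunc (?e n) x - \<phi> x) \<longlonglongrightarrow> 0" by (rule tendsto_rabs_zero_cancel)
        have "(\<lambda>n. \<Sum>i\<in>Basis. ((trunc (?e n) x - \<phi> x) * partial_deriv i ch x + (soft_trunc' (?e n) (\<phi> x) - 1) * partial_deriv i \<phi> x * ch x)\<^sup>2)
          \<longlonglongrightarrow> (\<Sum>i\<in>(Basis::'a set). (0 * partial_deriv i ch x + (1 - 1) * partial_deriv i \<phi> x * ch x)\<^sup>2)"
          by (intro tendsto_intros t soft_trunc'_tendsto pos True)
        then show ?thesis using True unfolding partial_deriv_err[OF e(1) True] by simp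
      qed simp
    qed
  qed simp
  then show ?thesis by simp
qed

text \<open>The classical Laplacian inside the domain, extended by 0. The part of
  \<open>laplacian (test_fun \<epsilon>)\<close> that concentrates near the boundary leaves no trace
  here, because it is tested only with elements of H^1_0.\<close>

definition limit_lap :: "'a \<Rightarrow> real" where
  "limit_lap x = (if x \<in> \<Omega> then laplacian (\<lambda>x. \<phi> x * ch x) x else 0)"

lemma limit_lap_eq:
  "x \<in> \<Omega> \<Longrightarrow> limit_lap x = \<phi> x * laplacian ch x + 2 * (\<Sum>i\<in>Basis. partial_deriv i \<phi> x * partial_deriv i ch x)"
  using laplacian_mult[OF open_dom C2 Ck_on_subset[OF C2_ch, of \<Omega>]] harmonic by (simp add: limit_lap_def)

lemma test_fun_outside: "x \<notin> \<Omega> \<Longrightarrow> test_fun \<epsilon> x = 0" "2 * R < norm x \<Longrightarrow> test_fun \<epsilon> x = 0"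
  by (simp_all add: test_fun_def trunc_def ch_outside)

lemma weight_laplacian_test_fun:
  assumes e: "\<epsilon> > 0"
  shows "weight \<Omega> (laplacian (test_fun \<epsilon>))"
proof -
  have c: "continuous_on UNIV (laplacian (test_fun \<epsilon>))" by (rule continuous_laplacian_UNIV[OF Ck_on_test_fun[OF e]])
  have o: "laplacian (test_fun \<epsilon>) x = 0" if "2 * R < norm x" for x
  proof -
    have "laplacian (test_fun \<epsilon>) x = laplacian (\<lambda>x. 0) x"
      by (rule laplacian_cong[of "{x. 2 * R < norm x}"])
        (auto simp: test_fun_outside that intro!: open_Collect_less continuous_intros)
    then show ?thesis by (simp add: laplacian_def)
  qed
  have z: "laplacian (test_fun \<epsilon>) x = 0" if "x \<notin> \<Omega>" for x
  proof -
    have "laplacian (test_fun \<epsilon>) x = laplacian (\<lambda>x. 0) x"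
      by (rule laplacian_cong[OF open_collar not_in_domain_collar[OF e that]]) (simp add: test_fun_def trunc_collar[OF e])
    then show ?thesis by (simp add: laplacian_def)
  qed
  obtain B where "\<And>x. \<bar>laplacian (test_fun \<epsilon>) x\<bar> \<le> B"
    using bounded_continuous_compact_support[OF c o] by blast
  then show ?thesis unfolding weight_def using continuous_set_borel_measurable[OF c] z o by blast
qed

lemma weight_limit_lap:
  assumes B: "\<And>x. x \<in> \<Omega> \<Longrightarrow> \<bar>limit_lap x\<bar> \<le> B"
  shows "weight \<Omega> limit_lap"
proof (rule weight_continuous_on[OF open_dom _ _ B, where r="2 * R"])
  have "continuous_on \<Omega> (laplacian (\<lambda>x. \<phi> x * ch x))" by (rule Ck_on_laplacian[OF Ck_on_phi_ch])
  then show "continuous_on \<Omega> limit_lap"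
    by (rule continuous_on_eq) (simp add: limit_lap_def)
  show "limit_lap x = 0" if "x \<in> \<Omega>" "2 * R < norm x" for x
    unfolding limit_lap_eq[OF that(1)] using ch_outside[OF that(2)] by simp
qed (simp add: limit_lap_def)

text \<open>Since \<open>v\<close> has compact support inside the domain, one integration by parts
  replaces the Laplacian of the error by its gradient. Young's inequality then leaves the energy of
  the error, while second derivatives drop out of the bound.\<close>

lemma pairing_error_smooth:
  assumes e: "\<epsilon> > 0" "\<epsilon> \<le> 1" and v: "v \<in> Cc_infinity \<Omega>" and l: "l > 0"
  shows "\<bar>\<integral>x. v x * (laplacian (test_fun \<epsilon>) x - limit_lap x) \<partial>lebesgue\<bar> \<le>
    l * (\<Sum>i\<in>Basis. LINT x:\<Omega>|lebesgue. (partial_deriv i v x)\<^sup>2) + 1 / l * err_energy \<epsilon>"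
proof -
  obtain K where K: "compact K" "K \<subseteq> \<Omega>" "\<And>x. x \<notin> K \<Longrightarrow> v x = 0" "\<And>x i. x \<notin> K \<Longrightarrow> partial_deriv i v x = 0"
    using Cc_infinity_support[OF v] by blast
  obtain \<rho> where \<rho>: "\<And>x. x \<in> K \<Longrightarrow> norm x \<le> \<rho>" using compact_imp_bounded[OF K(1)] by (auto simp: bounded_iff)
  have Ko: "x \<notin> K" if "\<rho> < norm x" for x using \<rho>[of x] that by auto
  let ?w = "err \<epsilon>"
  note C2w = Ck_on_err[OF e(1)]
  note vd = Cc_infinity_D[OF v]
  define Y where "Y i x = v x * partial_deriv i ?w x" for i x
  have C1Y: "Ck_on 1 UNIV (Y i)" if i: "i \<in> Basis" for i
  proof -
    have "Ck_on 1 \<Omega> (partial_deriv i ?w)" using C2w i by (simp add: numeral_2_eq_2)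
    then show ?thesis unfolding Y_def[abs_def]
      by (intro Ck_on_mult_compact_support[OF open_dom K(1,2) vd(1) K(3)])
  qed
  have Y0: "Y i x = 0" if "\<rho> < norm x" for i x using K(3)[OF Ko[OF that]] by (simp add: Y_def)
  let ?P = "\<lambda>i x. v x * partial_deriv i (partial_deriv i ?w) x" and ?Q = "\<lambda>i x. partial_deriv i v x * partial_deriv i ?w x"
  have dY: "partial_deriv i (Y i) x = ?P i x + ?Q i x" if i: "i \<in> Basis" for i x
  proof (cases "x \<in> \<Omega>")
    case True
    have "v differentiable at x" by (rule Ck_on_imp_differentiable[OF vd(1)[of 1]]) simp_all
    then show ?thesis unfolding Y_def[abs_def] by (rule partial_deriv_mult[OF _ Ck_on_2_D(2)[OF C2w True i]])
  next
    case False
    then have xK: "x \<in> - K" using K(2) by blast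
    have "partial_deriv i (Y i) x = partial_deriv i (\<lambda>x. 0) x"
      by (rule partial_deriv_cong[OF _ xK]) (use open_Compl[OF compact_imp_closed[OF K(1)]] in \<open>simp_all add: Y_def K(3)\<close>)
    then show ?thesis using xK K(3,4) by simp
  qed
  have iP: "integrable lebesgue (?P i)" and iQ: "integrable lebesgue (?Q i)" if i: "i \<in> Basis" for i
  proof -
    have "Ck_on 0 \<Omega> (partial_deriv i (partial_deriv i ?w))" "Ck_on 0 \<Omega> (partial_deriv i ?w)"
      using C2w i by (auto simp: numeral_2_eq_2 intro: differentiable_imp_continuous_on_Ball)
    moreover have "Ck_on 0 UNIV (partial_deriv i v)" using vd(1)[of 1] i by simp
    ultimately have "Ck_on 0 UNIV (?P i)" "Ck_on 0 UNIV (?Q i)"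
      by (intro Ck_on_mult_compact_support[OF open_dom K(1,2)] vd(1) K(3,4); simp)+
    then have c: "continuous_on UNIV (?P i)" "continuous_on UNIV (?Q i)" by simp_all
    show "integrable lebesgue (?P i)"
      by (rule integrable_continuous_compact_support_lebesgue[OF c(1), of \<rho>]) (simp add: K(3) Ko)
    show "integrable lebesgue (?Q i)"
      by (rule integrable_continuous_compact_support_lebesgue[OF c(2), of \<rho>]) (simp add: K(4) Ko)
  qed
  have PQ: "integral\<^sup>L lebesgue (?P i) = - integral\<^sup>L lebesgue (?Q i)" if i: "i \<in> Basis" for i
  proof -
    have "integral\<^sup>L lebesgue (partial_deriv i (Y i)) = 0"
      by (rule integral_partial_deriv_eq_0(2)[OF C1Y[OF i] Y0 i])
    then show ?thesis using iP[OF i] iQ[OF i] unfolding dY[OF i] by simp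
  qed
  have "v x * (laplacian (test_fun \<epsilon>) x - limit_lap x) = (\<Sum>i\<in>Basis. ?P i x)" for x
  proof (cases "x \<in> \<Omega>")
    case True
    have "laplacian ?w x = laplacian (test_fun \<epsilon>) x - laplacian (\<lambda>x. \<phi> x * ch x) x"
      unfolding err_def[abs_def]
      by (rule laplacian_diff[OF open_dom Ck_on_subset[OF Ck_on_test_fun[OF e(1)]] Ck_on_phi_ch True]) simp
    then have "v x * (laplacian (test_fun \<epsilon>) x - limit_lap x) = v x * laplacian ?w x"
      using True by (simp add: limit_lap_def)
    also have "\<dots> = (\<Sum>i\<in>Basis. ?P i x)" unfolding laplacian_def by (rule sum_distrib_left)
    finally show ?thesis .
  qed (simp add: vd(2))
  then have "(\<integral>x. v x * (laplacian (test_fun \<epsilon>) x - limit_lap x) \<partial>lebesgue) = (\<Sum>i\<in>Basis. integral\<^sup>L lebesgue (?P i))"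
    using iP by (simp add: Bochner_Integration.integral_sum)
  also have "\<dots> = - (\<Sum>i\<in>Basis. integral\<^sup>L lebesgue (?Q i))" by (simp add: PQ sum_negf)
  also have "(\<Sum>i\<in>Basis. integral\<^sup>L lebesgue (?Q i)) = (\<integral>x. (\<Sum>i\<in>Basis. ?Q i x) \<partial>lebesgue)"
    using iQ by (simp add: Bochner_Integration.integral_sum)
  finally have "\<bar>\<integral>x. v x * (laplacian (test_fun \<epsilon>) x - limit_lap x) \<partial>lebesgue\<bar> = \<bar>\<integral>x. (\<Sum>i\<in>Basis. ?Q i x) \<partial>lebesgue\<bar>" by simp
  also have "\<dots> \<le> (\<integral>x. \<bar>\<Sum>i\<in>Basis. ?Q i x\<bar> \<partial>lebesgue)" by (rule integral_abs_bound)
  also have "\<dots> \<le> (\<integral>x. l * (\<Sum>i\<in>Basis. indicator \<Omega> x *\<^sub>R (partial_deriv i v x)\<^sup>2) + 1 / l * (indicator \<Omega> x * (\<Sum>i\<in>Basis. (partial_deriv i ?w x)\<^sup>2)) \<partial>lebesgue)"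
  proof (rule integral_mono)
    have iv: "integrable lebesgue (\<lambda>x. indicator \<Omega> x *\<^sub>R (partial_deriv i v x)\<^sup>2)" if "i \<in> Basis" for i
      using L2_Cc_infinity(2)[OF v that] by (simp add: L2_def set_integrable_def)
    show "integrable lebesgue (\<lambda>x. \<bar>\<Sum>i\<in>Basis. ?Q i x\<bar>)"
      using iQ by (intro integrable_abs Bochner_Integration.integrable_sum)
    show "integrable lebesgue (\<lambda>x. l * (\<Sum>i\<in>Basis. indicator \<Omega> x *\<^sub>R (partial_deriv i v x)\<^sup>2) + 1 / l * (indicator \<Omega> x * (\<Sum>i\<in>Basis. (partial_deriv i ?w x)\<^sup>2)))"
      by (intro Bochner_Integration.integrable_add integrable_mult_right Bochner_Integration.integrable_sum iv err_energy_integrable(1)[OF e])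
    fix x
    show "\<bar>\<Sum>i\<in>Basis. ?Q i x\<bar> \<le> l * (\<Sum>i\<in>Basis. indicator \<Omega> x *\<^sub>R (partial_deriv i v x)\<^sup>2) + 1 / l * (indicator \<Omega> x * (\<Sum>i\<in>Basis. (partial_deriv i ?w x)\<^sup>2))"
    proof (cases "x \<in> \<Omega>")
      case True
      have "\<bar>?Q i x\<bar> \<le> l * (partial_deriv i v x)\<^sup>2 + 1 / l * (partial_deriv i ?w x)\<^sup>2" for i
      proof -
        let ?a = "partial_deriv i v x" and ?b = "partial_deriv i ?w x"
        have "0 \<le> (l * \<bar>?a\<bar> - \<bar>?b\<bar>)\<^sup>2" by simp
        then have "2 * (l * \<bar>?a * ?b\<bar>) \<le> l\<^sup>2 * ?a\<^sup>2 + ?b\<^sup>2"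
          by (simp add: power2_diff power_mult_distrib abs_mult mult_ac)
        moreover have "0 \<le> l * \<bar>?a * ?b\<bar>" using l by simp
        ultimately have "l * \<bar>?a * ?b\<bar> \<le> l\<^sup>2 * ?a\<^sup>2 + ?b\<^sup>2" by linarith
        then show ?thesis using l by (simp add: field_simps power2_eq_square)
      qed
      then have "(\<Sum>i\<in>Basis. \<bar>?Q i x\<bar>) \<le> (\<Sum>i\<in>Basis. l * (partial_deriv i v x)\<^sup>2 + 1 / l * (partial_deriv i ?w x)\<^sup>2)"
        by (intro sum_mono)
      from order_trans[OF sum_abs this] show ?thesis using True by (simp add: sum.distrib sum_distrib_left)
    qed (simp add: vd(3))
  qed
  also have "\<dots> = l * (\<Sum>i\<in>Basis. LINT x:\<Omega>|lebesgue. (partial_deriv i v x)\<^sup>2) + 1 / l * err_energy \<epsilon>"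
  proof -
    have iv: "integrable lebesgue (\<lambda>x. indicator \<Omega> x *\<^sub>R (partial_deriv i v x)\<^sup>2)" if "i \<in> Basis" for i
      using L2_Cc_infinity(2)[OF v that] by (simp add: L2_def set_integrable_def)
    then have 1: "integrable lebesgue (\<lambda>x. l * (\<Sum>i\<in>Basis. indicator \<Omega> x *\<^sub>R (partial_deriv i v x)\<^sup>2))"
      by (intro integrable_mult_right Bochner_Integration.integrable_sum)
    have 2: "integrable lebesgue (\<lambda>x. 1 / l * (indicator \<Omega> x * (\<Sum>i\<in>Basis. (partial_deriv i ?w x)\<^sup>2)))"
      by (intro integrable_mult_right err_energy_integrable(1)[OF e])
    show ?thesis unfolding Bochner_Integration.integral_add[OF 1 2] err_energy_def set_lebesgue_integral_def
      using Bochner_Integration.integral_sum[of Basis lebesgue "\<lambda>i x. indicator \<Omega> x *\<^sub>R (partial_deriv i v x)\<^sup>2"] iv by simp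
  qed
  finally show ?thesis .
qed

text \<open>A smooth approximant of \<open>f\<close> is chosen after \<epsilon>, so close in L^2
  that the L^2 norms of both weights, however large, do no harm. The resulting bound involves only
  the norm of \<open>f\<close> and the energy of the error.\<close>

lemma pairing_error:
  assumes e: "\<epsilon> > 0" "\<epsilon> \<le> 1" and f: "sobolev_zero \<Omega> f" and l: "l > 0"
    and B: "\<And>x. x \<in> \<Omega> \<Longrightarrow> \<bar>limit_lap x\<bar> \<le> B"
  shows "\<bar>(\<integral>x. f x * laplacian (test_fun \<epsilon>) x \<partial>lebesgue) - (\<integral>x. f x * limit_lap x \<partial>lebesgue)\<bar> \<le>
    l * (2 * (H1_norm \<Omega> f)\<^sup>2 + 5) + 1 / l * err_energy \<epsilon>"
proof -
  note w1 = weight_laplacian_test_fun[OF e(1)] and w2 = weight_limit_lap[OF B]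
  let ?G1 = "\<integral>x. (laplacian (test_fun \<epsilon>) x)\<^sup>2 \<partial>lebesgue" and ?G2 = "\<integral>x. (limit_lap x)\<^sup>2 \<partial>lebesgue"
  \<comment> \<open>\<open>s\<close> makes the weight integrals contribute at most \<open>l\<close>
    in total; \<open>d\<close> then makes each of the two approximation errors divided by
    \<open>s\<close> at most \<open>l\<close>.\<close>
  define s where "s = l / (1 + \<bar>?G1\<bar> + \<bar>?G2\<bar>)"
  define d where "d = min 1 (s * l)"
  have s: "s > 0" using l by (simp add: s_def add_pos_nonneg)
  have d: "d > 0" "d \<le> 1" "d \<le> s * l" using s l by (auto simp: d_def)
  have L2f: "L2 \<Omega> f" using f by (simp add: sobolev_zero_def)
  obtain v where v: "v \<in> Cc_infinity \<Omega>" "(LINT x:\<Omega>|lebesgue. (f x - v x)\<^sup>2) < d"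
    "(LINT x:\<Omega>|lebesgue. (v x)\<^sup>2) + (\<Sum>i\<in>Basis. LINT x:\<Omega>|lebesgue. (partial_deriv i v x)\<^sup>2) \<le> 2 * (H1_norm \<Omega> f)\<^sup>2 + d"
    using sobolev_zero_approximation[OF open_dom f d(1)] by blast
  note L2v = L2_Cc_infinity(1)[OF v(1)]
  note L2d = L2_add_diff(1)[OF L2f L2v]
  let ?p1 = "\<lambda>h. \<integral>x. h x * laplacian (test_fun \<epsilon>) x \<partial>lebesgue" and ?p2 = "\<lambda>h. \<integral>x. h x * limit_lap x \<partial>lebesgue"
  have split: "?p1 f = ?p1 v + ?p1 (\<lambda>x. f x - v x)" "?p2 f = ?p2 v + ?p2 (\<lambda>x. f x - v x)"
    using weight_integrable(1)[OF w1 L2v] weight_integrable(1)[OF w1 L2f] weight_integrable(1)[OF w2 L2v] weight_integrable(1)[OF w2 L2f]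
    by (simp_all add: left_diff_distrib)
  have "s * (1 + \<bar>?G1\<bar> + \<bar>?G2\<bar>) = l" by (simp add: s_def add_pos_nonneg add_nonneg_eq_0_iff)
  then have sG: "s * ?G1 + s * ?G2 \<le> l"
    using s abs_ge_self[of ?G1] abs_ge_self[of ?G2] mult_left_mono[of "?G1 + ?G2" "1 + \<bar>?G1\<bar> + \<bar>?G2\<bar>" s] by (simp add: distrib_left)
  have sd: "1 / s * (LINT x:\<Omega>|lebesgue. (f x - v x)\<^sup>2) \<le> l"
    using v(2) d(3) s by (simp add: pos_divide_le_eq mult.commute)
  have a1: "\<bar>?p1 (\<lambda>x. f x - v x)\<bar> \<le> s * ?G1 + l"
    using weight_pairing_le[OF w1 L2d s] sd by linarith
  have a2: "\<bar>?p2 (\<lambda>x. f x - v x)\<bar> \<le> s * ?G2 + l"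
    using weight_pairing_le[OF w2 L2d s] sd by linarith
  have "?p1 v - ?p2 v = (\<integral>x. v x * (laplacian (test_fun \<epsilon>) x - limit_lap x) \<partial>lebesgue)"
    using weight_integrable(1)[OF w1 L2v] weight_integrable(1)[OF w2 L2v] by (simp add: right_diff_distrib)
  then have a3: "\<bar>?p1 v - ?p2 v\<bar> \<le> l * (\<Sum>i\<in>Basis. LINT x:\<Omega>|lebesgue. (partial_deriv i v x)\<^sup>2) + 1 / l * err_energy \<epsilon>"
    using pairing_error_smooth[OF e v(1) l] by simp
  have "0 \<le> (LINT x:\<Omega>|lebesgue. (v x)\<^sup>2)"
    unfolding set_lebesgue_integral_def by (rule integral_nonneg_AE) simp
  then have "(\<Sum>i\<in>Basis. LINT x:\<Omega>|lebesgue. (partial_deriv i v x)\<^sup>2) \<le> 2 * (H1_norm \<Omega> f)\<^sup>2 + 1" using v(3) d(2) by linarith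
  then have "l * (\<Sum>i\<in>Basis. LINT x:\<Omega>|lebesgue. (partial_deriv i v x)\<^sup>2) \<le> l * (2 * (H1_norm \<Omega> f)\<^sup>2 + 1)"
    using l by (intro mult_left_mono) auto
  then have "\<bar>?p1 f - ?p2 f\<bar> \<le> l * (2 * (H1_norm \<Omega> f)\<^sup>2 + 1) + 1 / l * err_energy \<epsilon> + (s * ?G1 + l) + (s * ?G2 + l)"
    using a1 a2 a3 split by linarith
  also have "\<dots> \<le> l * (2 * (H1_norm \<Omega> f)\<^sup>2 + 5) + 1 / l * err_energy \<epsilon>"
    using sG l by (simp add: distrib_left)
  finally show ?thesis .
qed

end

end

section \<open>The weak identity\<close>

lemma Ck_on_imp_up_to_boundary: "Ck_on k UNIV f \<Longrightarrow> Ck_up_to_boundary k S f"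
proof (induction k arbitrary: f)
  case 0
  then show ?case by (auto simp: extends_continuously_def intro!: exI[of _ f] continuous_on_subset[of UNIV f])
next
  case (Suc k)
  have "continuous_on (closure S) f"
    using Ck_on_imp_continuous_on[OF Suc.prems] by (rule continuous_on_subset) simp
  then have "extends_continuously S f" unfolding extends_continuously_def by blast
  then show ?case using Suc by simp
qed

lemma Ck_on_compose_snd:
  fixes \<psi> :: "'a::euclidean_space \<Rightarrow> real"
  assumes "Ck_on k UNIV \<psi>"
  shows "Ck_on k UNIV (\<lambda>z :: real \<times> 'a. \<psi> (snd z))"
  using assms
proof (induction k arbitrary: \<psi>)
  case 0
  then show ?case by (auto intro!: continuous_on_compose2[of UNIV \<psi>] continuous_on_snd)
next
  case (Suc k)
  have "(\<lambda>z :: real \<times> 'a. \<psi> (snd z)) differentiable at z" for z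
  proof -
    have "\<psi> differentiable at (snd z)" using Suc.prems by simp
    then obtain D where "(\<psi> has_derivative D) (at (snd z))" by (auto simp: differentiable_def)
    from has_derivative_compose[OF has_derivative_snd[OF has_derivative_ident] this]
    show ?thesis by (auto simp: differentiable_def)
  qed
  moreover have "Ck_on k UNIV (partial_deriv b (\<lambda>z :: real \<times> 'a. \<psi> (snd z)))" if "b \<in> Basis" for b
  proof -
    from that consider u where "b = (u, 0)" | i where "b = (0, i)" "i \<in> Basis" by (auto simp: Basis_prod_def)
    then show ?thesis
    proof cases
      case 1
      then have "partial_deriv b (\<lambda>z :: real \<times> 'a. \<psi> (snd z)) = (\<lambda>z. 0)" by (simp add: partial_deriv_def fun_eq_iff)
      then show ?thesis by simp
    next
      case 2
      then have "partial_deriv b (\<lambda>z :: real \<times> 'a. \<psi> (snd z)) = (\<lambda>z. partial_deriv i \<psi> (snd z))" by (simp add: partial_deriv_def fun_eq_iff)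
      then show ?thesis using Suc.IH[of "partial_deriv i \<psi>"] Suc.prems 2(2) by simp
    qed
  qed
  ultimately show ?case by simp
qed

lemma laplacian_cmult:
  fixes g :: "'a::euclidean_space \<Rightarrow> real"
  assumes "Ck_on 2 UNIV g"
  shows "laplacian (\<lambda>x. c * g x) x = c * laplacian g x"
  using laplacian_mult[OF open_UNIV Ck_on_const assms, of x c] by (simp add: laplacian_def)

text \<open>\<open>time_deriv\<close> is one-sided at the endpoints. On a nondegenerate interval the
  derivative within it is unique, so any differentiable function on the line with the same values on
  the interval determines it.\<close>

lemma vector_derivative_within_Icc:
  fixes f :: "real \<Rightarrow> real"
  assumes "0 < S" "t \<in> {0..S}" "(h has_real_derivative d) (at t)" "\<And>s. s \<in> {0..S} \<Longrightarrow> f s = h s"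
  shows "vector_derivative f (at t within {0..S}) = d"
proof -
  have h: "(h has_vector_derivative d) (at t within {0..S})"
    using assms(3) by (simp add: has_real_derivative_iff_has_vector_derivative[symmetric] has_field_derivative_at_within)
  have "(f has_vector_derivative d) (at t within cbox 0 S)"
    unfolding box_real by (rule has_vector_derivative_transform[OF assms(2,4) h])
  then show ?thesis using vector_derivative_within_cbox[of 0 S t f d] assms(1,2) by (simp add: box_real)
qed

text \<open>For a product the third-order expression in the definition of test functions is
  \<open>\<eta>' t * laplacian \<psi> x\<close>, so second derivatives of \<open>\<psi>\<close>
  suffice. The factor in time takes care of the conditions at the final time.\<close>

lemma product_test_function:
  fixes \<psi> :: "'a::euclidean_space \<Rightarrow> real" and \<eta> \<eta>' \<eta>'' :: "real \<Rightarrow> real"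
  assumes \<Omega>: "open \<Omega>" and \<psi>: "Ck_on 2 UNIV \<psi>" "\<And>x. x \<notin> \<Omega> \<Longrightarrow> \<psi> x = 0" "\<And>x. r < norm x \<Longrightarrow> \<psi> x = 0"
    and \<eta>: "\<And>t. (\<eta> has_real_derivative \<eta>' t) (at t)" "\<And>t. (\<eta>' has_real_derivative \<eta>'' t) (at t)"
      "continuous_on UNIV \<eta>''" "\<eta> S = 0" "\<eta>' S = 0" and S: "0 < S"
  defines "\<Phi> \<equiv> (\<lambda>z. \<eta> (fst z) * \<psi> (snd z))"
  shows "test_function \<Omega> S \<Phi>"
    and "t \<in> {0..S} \<Longrightarrow> time_deriv S \<Phi> (t, x) = \<eta>' t * \<psi> x"
    and "t \<in> {0..S} \<Longrightarrow> time_deriv S (time_deriv S \<Phi>) (t, x) = \<eta>'' t * \<psi> x"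
    and "space_laplacian \<Phi> (t, x) = \<eta> t * laplacian \<psi> x"
    and "t \<in> {0..S} \<Longrightarrow> space_laplacian (time_deriv S \<Phi>) (t, x) = \<eta>' t * laplacian \<psi> x"
proof -
  show td: "time_deriv S \<Phi> (t, x) = \<eta>' t * \<psi> x" if "t \<in> {0..S}" for t x
    unfolding time_deriv_def \<Phi>_def prod.case
    by (rule vector_derivative_within_Icc[OF S that DERIV_cmult_right[OF \<eta>(1)]]) simp
  show "time_deriv S (time_deriv S \<Phi>) (t, x) = \<eta>'' t * \<psi> x" if "t \<in> {0..S}"
    unfolding time_deriv_def[of S "time_deriv S \<Phi>"] prod.case
    by (rule vector_derivative_within_Icc[OF S that DERIV_cmult_right[OF \<eta>(2)]]) (rule td)
  show "space_laplacian \<Phi> (t, x) = \<eta> t * laplacian \<psi> x"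
    by (simp add: space_laplacian_def \<Phi>_def laplacian_cmult[OF \<psi>(1)])
  have tdf: "(\<lambda>y. time_deriv S \<Phi> (t, y)) = (\<lambda>y. \<eta>' t * \<psi> y)" if "t \<in> {0..S}" for t
    using td[OF that] by auto
  show sl: "space_laplacian (time_deriv S \<Phi>) (t, x) = \<eta>' t * laplacian \<psi> x" if "t \<in> {0..S}" for t x
    unfolding space_laplacian_def prod.case tdf[OF that] by (rule laplacian_cmult[OF \<psi>(1)])
  have c\<psi>: "continuous_on UNIV \<psi>" by (rule Ck_on_imp_continuous_on[OF \<psi>(1)])
  have c\<eta>: "continuous_on UNIV \<eta>" "continuous_on UNIV \<eta>'"
    using \<eta>(1,2) DERIV_isCont by (intro continuous_at_imp_continuous_on, blast)+
  have C2\<Phi>: "Ck_on 2 UNIV \<Phi>"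
    unfolding \<Phi>_def
    by (intro Ck_on_mult Ck_on_2_compose[OF open_UNIV _ \<eta>(1,2,3)] Ck_on_compose_snd \<psi>(1) Ck_on_linear bounded_linear_fst open_UNIV)
  show "test_function \<Omega> S \<Phi>"
    unfolding test_function_def
  proof (intro conjI ballI)
    show "continuous_on ({0..S} \<times> closure \<Omega>) \<Phi>"
      by (rule continuous_on_subset[OF Ck_on_imp_continuous_on[OF C2\<Phi>]]) simp
    show "Ck_up_to_boundary 2 ({0<..<S} \<times> \<Omega>) \<Phi>" by (rule Ck_on_imp_up_to_boundary[OF C2\<Phi>])
    have "{z \<in> {0..S} \<times> closure \<Omega>. \<Phi> z \<noteq> 0} \<subseteq> {0..S} \<times> cball 0 r"
      using \<psi>(3) by (force simp: \<Phi>_def not_less)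
    then have "bounded {z \<in> {0..S} \<times> closure \<Omega>. \<Phi> z \<noteq> 0}"
      by (rule bounded_subset[rotated]) (intro bounded_Times bounded_closed_interval bounded_cball)
    then show "compact (closure {z \<in> {0..S} \<times> closure \<Omega>. \<Phi> z \<noteq> 0})" by simp
    show "(\<lambda>s. partial_deriv i (\<lambda>y. time_deriv S \<Phi> (t, y)) (x + s *\<^sub>R i)) differentiable at 0"
      if t: "t \<in> {0<..<S}" and x: "x \<in> \<Omega>" and i: "i \<in> Basis" for t x i
    proof -
      have t': "t \<in> {0..S}" using t by simp
      have "partial_deriv i (\<lambda>y. \<eta>' t * \<psi> y) = (\<lambda>y. \<eta>' t * partial_deriv i \<psi> y)"
        by (rule ext, rule partial_deriv_cmult, rule Ck_on_2_D(1)[OF \<psi>(1)]) simp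
      moreover have "((\<lambda>s. \<eta>' t * partial_deriv i \<psi> (x + s *\<^sub>R i)) has_real_derivative
          \<eta>' t * partial_deriv i (partial_deriv i \<psi>) (x + 0 *\<^sub>R i)) (at 0)"
        by (intro DERIV_cmult DERIV_partial_deriv Ck_on_2_D(2)[OF \<psi>(1)] i) simp
      ultimately show ?thesis
        unfolding tdf[OF t'] by (simp add: real_differentiable_def) blast
    qed
    show "extends_continuously ({0<..<S} \<times> \<Omega>) (space_laplacian (time_deriv S \<Phi>))"
      unfolding extends_continuously_def
    proof (intro exI conjI ballI)
      show "continuous_on (closure ({0<..<S} \<times> \<Omega>)) (\<lambda>z. \<eta>' (fst z) * laplacian \<psi> (snd z))"
        by (intro continuous_on_mult continuous_on_compose2[OF c\<eta>(2)] continuous_on_compose2[OF Ck_on_laplacian[OF \<psi>(1)]]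
            continuous_on_fst continuous_on_snd continuous_on_id) auto
      show "\<eta>' (fst z) * laplacian \<psi> (snd z) = space_laplacian (time_deriv S \<Phi>) z" if "z \<in> {0<..<S} \<times> \<Omega>" for z
        using sl[of "fst z" "snd z"] that by auto
    qed
    show "\<Phi> (t, x) = 0" if "t \<in> {0..S}" "x \<in> frontier \<Omega>" for t x
      using \<psi>(2)[of x] that \<Omega> by (simp add: \<Phi>_def frontier_def interior_open)
    show "\<Phi> (S, x) = 0" if "x \<in> closure \<Omega>" for x using \<eta>(4) by (simp add: \<Phi>_def)
    show "time_deriv S \<Phi> (S, x) = 0" if "x \<in> closure \<Omega>" for x using td[of S x] \<eta>(5) S by simp
  qed
qed

section \<open>Passing to the limit in the weak identity\<close>

lemma set_integral_Icc_tendsto_uniform: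
  fixes f :: "nat \<Rightarrow> real \<Rightarrow> real"
  assumes f: "\<And>n. continuous_on {0..S} (f n)" and g: "continuous_on {0..S} g"
    and a: "\<And>n t. t \<in> {0..S} \<Longrightarrow> \<bar>f n t - g t\<bar> \<le> a n" "a \<longlonglongrightarrow> 0"
  shows "(\<lambda>n. LINT t:{0..S}|lebesgue. f n t) \<longlonglongrightarrow> (LINT t:{0..S}|lebesgue. g t)"
proof -
  have i: "set_integrable lebesgue {0..S} h" if "continuous_on {0..S} h" for h :: "real \<Rightarrow> real"
    using borel_integrable_compact[OF compact_Icc that] unfolding set_integrable_def by (rule integrable_lebesgue_lborel)
  have "(\<lambda>n. (LINT t:{0..S}|lebesgue. f n t) - (LINT t:{0..S}|lebesgue. g t)) \<longlonglongrightarrow> 0"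
  proof (rule Lim_null_comparison)
    show "\<forall>\<^sub>F n in sequentially. norm ((LINT t:{0..S}|lebesgue. f n t) - (LINT t:{0..S}|lebesgue. g t)) \<le> (LINT t:{0..S}|lebesgue. 1) * a n"
    proof (intro always_eventually allI)
      fix n
      have "norm ((LINT t:{0..S}|lebesgue. f n t) - (LINT t:{0..S}|lebesgue. g t)) = norm (LINT t:{0..S}|lebesgue. f n t - g t)"
        using i[OF f] i[OF g] by simp
      also have "\<dots> \<le> (LINT t:{0..S}|lebesgue. norm (f n t - g t))"
        by (rule set_integral_norm_bound) (use i[OF f] i[OF g] in auto)
      also have "\<dots> \<le> (LINT t:{0..S}|lebesgue. a n)"
      proof (rule set_integral_mono)
        show "set_integrable lebesgue {0..S} (\<lambda>t. norm (f n t - g t))" by (intro i continuous_intros f g)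
        show "set_integrable lebesgue {0..S} (\<lambda>t. a n)" by (intro i continuous_intros)
      qed (use a(1) in simp)
      also have "\<dots> = (LINT t:{0..S}|lebesgue. 1) * a n" by (simp add: set_lebesgue_integral_def)
      finally show "norm ((LINT t:{0..S}|lebesgue. f n t) - (LINT t:{0..S}|lebesgue. g t)) \<le> (LINT t:{0..S}|lebesgue. 1) * a n" .
    qed
    show "(\<lambda>n. (LINT t:{0..S}|lebesgue. 1) * a n) \<longlonglongrightarrow> 0" using tendsto_mult_left[OF a(2)] by simp
  qed
  then show ?thesis by (rule LIM_zero_cancel)
qed

text \<open>Here \<open>g\<close> stands for the datum u1 - Laplacian of u0. The exponent
  \<open>q\<close> is one for which the q-th powers of the solution are integrable with locally
  bounded integrals; it is 4 in dimension at most 2 and 2 above.\<close>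

locale global_solution = exterior_harmonic_setup \<Omega> \<phi>
  for \<Omega> :: "'a::euclidean_space set" and \<phi> :: "'a \<Rightarrow> real" +
  fixes u :: "real \<Rightarrow> 'a \<Rightarrow> real" and g u0 :: "'a \<Rightarrow> real" and p :: real and q :: nat
  assumes curve: "good_curve \<Omega> q u"
    and H10: "0 \<le> t \<Longrightarrow> sobolev_zero \<Omega> (u t)"
    and H1_bounded: "\<exists>E. \<forall>t\<in>{0..S}. (H1_norm \<Omega> (u t))\<^sup>2 \<le> E"
    and p: "1 < p" "p \<le> real q" "2 * (p - 1) \<le> real q"
    and data: "set_integrable lebesgue \<Omega> (\<lambda>x. g x * \<phi> x)" "(LINT x:\<Omega>|lebesgue. g x * \<phi> x) > 0"
    and weak: "0 < S \<Longrightarrow> test_function \<Omega> S \<Phi> \<Longrightarrow>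
       (LINT t:{0..S}|lebesgue. LINT x:\<Omega>|lebesgue. \<bar>u t x\<bar> powr p * \<Phi> (t, x))
          + (LINT x:\<Omega>|lebesgue. g x * \<Phi> (0, x))
          - (LINT x:\<Omega>|lebesgue. u0 x * time_deriv S \<Phi> (0, x))
        = (LINT t:{0..S}|lebesgue. LINT x:\<Omega>|lebesgue. u t x * time_deriv S (time_deriv S \<Phi>) (t, x))
          + (LINT t:{0..S}|lebesgue. LINT x:\<Omega>|lebesgue. u t x * space_laplacian (time_deriv S \<Phi>) (t, x))
          - (LINT t:{0..S}|lebesgue. LINT x:\<Omega>|lebesgue. u t x * space_laplacian \<Phi> (t, x))"
begin

definition pow_pairing :: "('a \<Rightarrow> real) \<Rightarrow> real \<Rightarrow> real" where
  "pow_pairing w t = (\<integral>x. \<bar>u t x\<bar> powr p * w x \<partial>lebesgue)"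

definition lin_pairing :: "('a \<Rightarrow> real) \<Rightarrow> real \<Rightarrow> real" where
  "lin_pairing w t = (\<integral>x. u t x * w x \<partial>lebesgue)"

lemma L2_u: "0 \<le> t \<Longrightarrow> L2 \<Omega> (u t)" using curve by (simp add: good_curve_def)

lemma pow_pairing_integrable:
  assumes w: "weight \<Omega> w" and t: "0 \<le> t"
  shows "integrable lebesgue (\<lambda>x. \<bar>u t x\<bar> powr p * w x)" "(LINT x:\<Omega>|lebesgue. \<bar>u t x\<bar> powr p * w x) = pow_pairing w t"
proof -
  have m: "set_borel_measurable lebesgue \<Omega> (u t)" using L2_u[OF t] by (simp add: L2_def)
  have qi: "set_integrable lebesgue \<Omega> (\<lambda>x. \<bar>u t x\<bar> ^ q)" using curve t by (simp add: good_curve_def)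
  have p0: "0 \<le> p" using p by simp
  show "integrable lebesgue (\<lambda>x. \<bar>u t x\<bar> powr p * w x)" "(LINT x:\<Omega>|lebesgue. \<bar>u t x\<bar> powr p * w x) = pow_pairing w t"
    unfolding pow_pairing_def by (rule weight_power_integrable[OF w m qi p0 p(2)])+
qed

lemma lin_pairing_integrable:
  assumes w: "weight \<Omega> w" and t: "0 \<le> t"
  shows "integrable lebesgue (\<lambda>x. u t x * w x)" "(LINT x:\<Omega>|lebesgue. u t x * w x) = lin_pairing w t"
  unfolding lin_pairing_def by (rule weight_integrable[OF w L2_u[OF t]])+

lemma continuous_on_pow_pairing: "weight \<Omega> w \<Longrightarrow> continuous_on {0..S} (pow_pairing w)"
  unfolding pow_pairing_def[abs_def] using continuous_on_power_pairing[OF curve _ p] by (rule continuous_on_subset) auto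

lemma continuous_on_lin_pairing: "weight \<Omega> w \<Longrightarrow> continuous_on {0..S} (lin_pairing w)"
  unfolding lin_pairing_def[abs_def] using continuous_on_pairing[OF curve] by (rule continuous_on_subset) auto

text \<open>The condition \<open>\<eta>' 0 = 0\<close> removes the initial displacement from the
  identity, and \<open>\<eta> 0 = 1\<close> keeps the datum with coefficient 1.\<close>

lemma weak_product:
  fixes \<eta> \<eta>' \<eta>'' :: "real \<Rightarrow> real"
  assumes \<psi>: "Ck_on 2 UNIV \<psi>" "weight \<Omega> \<psi>" "weight \<Omega> (laplacian \<psi>)"
    and \<eta>: "\<And>t. (\<eta> has_real_derivative \<eta>' t) (at t)" "\<And>t. (\<eta>' has_real_derivative \<eta>'' t) (at t)"
      "continuous_on UNIV \<eta>''" "\<eta> S = 0" "\<eta>' S = 0" "\<eta> 0 = 1" "\<eta>' 0 = 0" and S: "0 < S"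
  shows "(LINT t:{0..S}|lebesgue. \<eta> t * pow_pairing \<psi> t) + (LINT x:\<Omega>|lebesgue. g x * \<psi> x) =
    (LINT t:{0..S}|lebesgue. \<eta>'' t * lin_pairing \<psi> t) + (LINT t:{0..S}|lebesgue. \<eta>' t * lin_pairing (laplacian \<psi>) t)
    - (LINT t:{0..S}|lebesgue. \<eta> t * lin_pairing (laplacian \<psi>) t)"
proof -
  let ?\<Phi> = "\<lambda>z. \<eta> (fst z) * \<psi> (snd z)"
  obtain r where r: "\<And>x. r < norm x \<Longrightarrow> \<psi> x = 0" using \<psi>(2) unfolding weight_def by blast
  note tf = product_test_function[OF open_dom \<psi>(1) weight_outside[OF \<psi>(2)] r \<eta>(1-5) S]
  have e1: "(LINT x:\<Omega>|lebesgue. \<bar>u t x\<bar> powr p * ?\<Phi> (t, x)) = \<eta> t * pow_pairing \<psi> t" if "t \<in> {0..S}" for t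
    using pow_pairing_integrable(2)[OF \<psi>(2), of t] that by (simp add: mult.left_commute)
  have e2: "(LINT x:\<Omega>|lebesgue. u t x * time_deriv S (time_deriv S ?\<Phi>) (t, x)) = \<eta>'' t * lin_pairing \<psi> t" if "t \<in> {0..S}" for t
    using lin_pairing_integrable(2)[OF \<psi>(2), of t] that by (simp add: tf(3) mult.left_commute)
  have e3: "(LINT x:\<Omega>|lebesgue. u t x * space_laplacian (time_deriv S ?\<Phi>) (t, x)) = \<eta>' t * lin_pairing (laplacian \<psi>) t" if "t \<in> {0..S}" for t
    using lin_pairing_integrable(2)[OF \<psi>(3), of t] that by (simp add: tf(5) mult.left_commute)
  have e4: "(LINT x:\<Omega>|lebesgue. u t x * space_laplacian ?\<Phi> (t, x)) = \<eta> t * lin_pairing (laplacian \<psi>) t" if "t \<in> {0..S}" for t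
    using lin_pairing_integrable(2)[OF \<psi>(3), of t] that by (simp add: tf(4) mult.left_commute)
  have cong: "(LINT t:{0..S}|lebesgue. a t) = (LINT t:{0..S}|lebesgue. b t)" if "\<And>t. t \<in> {0..S} \<Longrightarrow> a t = b t" for a b :: "real \<Rightarrow> real"
    unfolding set_lebesgue_integral_def by (rule Bochner_Integration.integral_cong[OF refl]) (use that in \<open>auto simp: indicator_def\<close>)
  have z: "(LINT x:\<Omega>|lebesgue. u0 x * time_deriv S ?\<Phi> (0, x)) = 0"
    using S \<eta>(7) by (simp add: tf(2))
  have "(LINT x:\<Omega>|lebesgue. g x * ?\<Phi> (0, x)) = (LINT x:\<Omega>|lebesgue. g x * \<psi> x)" using \<eta>(6) by simp
  with weak[OF S tf(1)] z cong[OF e1] cong[OF e2] cong[OF e3] cong[OF e4] show ?thesis by (simp only:) simp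
qed

definition ext_cut :: "nat \<Rightarrow> real \<Rightarrow> 'a \<Rightarrow> real" where
  "ext_cut k R x = (if x \<in> \<Omega> then \<phi> x * space_cut k R x else 0)"

lemma weight_ext_cut:
  assumes k: "4 \<le> k" and R: "R > 0"
  shows "weight \<Omega> (ext_cut k R)"
proof -
  obtain M where M: "M > 0" "\<And>x. x \<in> \<Omega> \<Longrightarrow> norm x \<le> 2 * R \<Longrightarrow> \<phi> x \<le> M" using bounded_on_ball[of "2 * R"] by blast
  show ?thesis
  proof (rule weight_continuous_on[OF open_dom, where B=M and r="2 * R"])
    have "continuous_on \<Omega> (\<lambda>x. \<phi> x * space_cut k R x)"
      by (rule Ck_on_imp_continuous_on[OF Ck_on_phi_ch[OF k R]])
    then show "continuous_on \<Omega> (ext_cut k R)" by (rule continuous_on_eq) (simp add: ext_cut_def)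
    show "\<bar>ext_cut k R x\<bar> \<le> M" if x: "x \<in> \<Omega>" for x
    proof (cases "norm x \<le> 2 * R")
      case True
      have "\<phi> x * space_cut k R x \<le> M * 1"
        using M x True pos[OF x] space_cut_range[of k R x] by (intro mult_mono) auto
      moreover have "0 \<le> \<phi> x * space_cut k R x" using pos[OF x] space_cut_range[of k R x] by simp
      ultimately show ?thesis using x by (simp add: ext_cut_def)
    next
      case False
      then show ?thesis using ch_outside(1)[OF k R, of x] M(1) by (simp add: ext_cut_def)
    qed
    show "ext_cut k R x = 0" if "2 * R < norm x" for x using ch_outside(1)[OF k R that] by (simp add: ext_cut_def)
  qed (simp add: ext_cut_def)
qed

lemma weight_test_fun:
  assumes k: "4 \<le> k" and R: "R > 0" and e: "\<epsilon> > 0"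
  shows "weight \<Omega> (test_fun k R \<epsilon>)"
proof -
  have c: "continuous_on UNIV (test_fun k R \<epsilon>)" by (rule Ck_on_imp_continuous_on[OF Ck_on_test_fun[OF k R e]])
  obtain B where "\<And>x. \<bar>test_fun k R \<epsilon> x\<bar> \<le> B"
    using bounded_continuous_compact_support[OF c test_fun_outside(2)[OF k R]] by blast
  then show ?thesis unfolding weight_def
    using continuous_set_borel_measurable[OF c] test_fun_outside[OF k R] by blast
qed

lemma test_fun_diff:
  assumes k: "4 \<le> k" and R: "R > 0" and e: "\<epsilon> > 0"
  shows "\<bar>test_fun k R \<epsilon> x - ext_cut k R x\<bar> \<le> 3 * \<epsilon> * space_cut k R x"
    "x \<notin> \<Omega> \<Longrightarrow> test_fun k R \<epsilon> x - ext_cut k R x = 0"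
proof -
  show "\<bar>test_fun k R \<epsilon> x - ext_cut k R x\<bar> \<le> 3 * \<epsilon> * space_cut k R x"
  proof (cases "x \<in> \<Omega>")
    case True
    have "test_fun k R \<epsilon> x - ext_cut k R x = (trunc \<epsilon> x - \<phi> x) * space_cut k R x"
      using True by (simp add: test_fun_def[OF k R] ext_cut_def left_diff_distrib)
    then show ?thesis using trunc_range(3)[OF e True] space_cut_range[of k R x]
      by (simp add: abs_mult mult_right_mono)
  next
    case False
    then show ?thesis using test_fun_outside(1)[OF k R False] space_cut_range[of k R x] e by (simp add: ext_cut_def)
  qed
  show "x \<notin> \<Omega> \<Longrightarrow> test_fun k R \<epsilon> x - ext_cut k R x = 0"
    using test_fun_outside(1)[OF k R] by (simp add: ext_cut_def)
qed

lemma weight_ind_cut: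
  assumes k: "4 \<le> k" and R: "R > 0"
  shows "weight \<Omega> (\<lambda>x. if x \<in> \<Omega> then space_cut k R x else 0)"
proof (rule weight_continuous_on[OF open_dom, where B=1 and r="2 * R"])
  have "continuous_on \<Omega> (space_cut k R)"
    by (rule continuous_on_subset[OF Ck_on_imp_continuous_on[OF C2_ch[OF k R]]]) simp
  then show "continuous_on \<Omega> (\<lambda>x. if x \<in> \<Omega> then space_cut k R x else 0)"
    by (rule continuous_on_eq) simp
  show "\<bar>if x \<in> \<Omega> then space_cut k R x else 0\<bar> \<le> 1" for x
    using space_cut_range[of k R x] by simp
qed (use ch_outside(1)[OF k R] in auto)

text \<open>All pairings converge uniformly in time, as their errors depend on the solution only
  through quantities bounded on [0, S]. The Laplacian terms use \<open>pairing_error\<close>, the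
  others the uniform distance 3 \<epsilon> between the test functions and their limit.\<close>

lemma weak_limit:
  fixes \<eta> \<eta>' \<eta>'' :: "real \<Rightarrow> real"
  assumes k: "4 \<le> k" and R: "R > 0" and B: "\<And>x. x \<in> \<Omega> \<Longrightarrow> \<bar>limit_lap k R x\<bar> \<le> B"
    and \<eta>: "\<And>t. (\<eta> has_real_derivative \<eta>' t) (at t)" "\<And>t. (\<eta>' has_real_derivative \<eta>'' t) (at t)"
      "continuous_on UNIV \<eta>''" "\<eta> S = 0" "\<eta>' S = 0" "\<eta> 0 = 1" "\<eta>' 0 = 0" and S: "0 < S"
  shows "(LINT t:{0..S}|lebesgue. \<eta> t * pow_pairing (ext_cut k R) t) + (LINT x:\<Omega>|lebesgue. g x * ext_cut k R x) =
    (LINT t:{0..S}|lebesgue. \<eta>'' t * lin_pairing (ext_cut k R) t) + (LINT t:{0..S}|lebesgue. \<eta>' t * lin_pairing (limit_lap k R) t)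
    - (LINT t:{0..S}|lebesgue. \<eta> t * lin_pairing (limit_lap k R) t)"
proof -
  let ?e = "\<lambda>n. 1 / real (Suc n)"
  let ?\<psi> = "\<lambda>n. test_fun k R (?e n)"
  let ?\<kappa> = "\<lambda>x. if x \<in> \<Omega> then space_cut k R x else 0"
  have e: "?e n > 0" "?e n \<le> 1" for n by simp_all
  have e0: "?e \<longlonglongrightarrow> 0" by (rule LIMSEQ_Suc[OF lim_1_over_n])
  note w\<psi> = weight_test_fun[OF k R e(1)] and wl = weight_laplacian_test_fun[OF k R e(1)]
  note w0 = weight_ext_cut[OF k R] and wL = weight_limit_lap[OF k R B] and w\<kappa> = weight_ind_cut[OF k R]
  have diff_le: "\<bar>?\<psi> n x - ext_cut k R x\<bar> \<le> 3 * ?e n * ?\<kappa> x" for n x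
    using test_fun_diff[OF k R e(1)[of n], of x] by (cases "x \<in> \<Omega>") auto
  have c\<eta>: "continuous_on A \<eta>" "continuous_on A \<eta>'" "continuous_on A \<eta>''" for A
    using \<eta>(1,2) DERIV_isCont by (intro continuous_at_imp_continuous_on, blast)+ (rule continuous_on_subset[OF \<eta>(3)], simp)
  have bdd: "\<exists>H. \<forall>t\<in>{0..S}. \<bar>h t\<bar> \<le> H" if "continuous_on {0..S} h" for h :: "real \<Rightarrow> real"
    using compact_imp_bounded[OF compact_continuous_image[OF that compact_Icc]] by (auto simp: bounded_iff)
  obtain H0 where H0: "\<And>t. t \<in> {0..S} \<Longrightarrow> \<bar>\<eta> t\<bar> \<le> H0" using bdd[OF c\<eta>(1)] by blast
  obtain H1 where H1: "\<And>t. t \<in> {0..S} \<Longrightarrow> \<bar>\<eta>' t\<bar> \<le> H1" using bdd[OF c\<eta>(2)] by blast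
  obtain H2 where H2: "\<And>t. t \<in> {0..S} \<Longrightarrow> \<bar>\<eta>'' t\<bar> \<le> H2" using bdd[OF c\<eta>(3)] by blast
  obtain PK where PK: "\<And>t. t \<in> {0..S} \<Longrightarrow> \<bar>pow_pairing ?\<kappa> t\<bar> \<le> PK" using bdd[OF continuous_on_pow_pairing[OF w\<kappa>]] by blast
  obtain E where E: "\<And>t. t \<in> {0..S} \<Longrightarrow> (H1_norm \<Omega> (u t))\<^sup>2 \<le> E" using H1_bounded by blast
  let ?V = "\<integral>x. (?\<kappa> x)\<^sup>2 \<partial>lebesgue"
  have S0: "0 \<in> {0..S}" using S by simp
  have nn: "0 \<le> H0" "0 \<le> H1" "0 \<le> H2" "0 \<le> E"
    using H0[OF S0] H1[OF S0] H2[OF S0] E[OF S0] by (auto intro: order_trans[OF abs_ge_zero] order_trans[OF zero_le_power2])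
  have L2E: "(LINT x:\<Omega>|lebesgue. (u t x)\<^sup>2) \<le> E" if "t \<in> {0..S}" for t
  proof -
    have "0 \<le> (\<Sum>i\<in>Basis. LINT x:\<Omega>|lebesgue. (weak_partial \<Omega> i (u t) x)\<^sup>2)"
      by (intro sum_nonneg) (simp add: set_lebesgue_integral_def)
    then show ?thesis using E[OF that] unfolding H1_norm_square by linarith
  qed
  have pd: "\<bar>pow_pairing (?\<psi> n) t - pow_pairing (ext_cut k R) t\<bar> \<le> 3 * ?e n * PK" if t: "t \<in> {0..S}" for n t
  proof -
    have t0: "0 \<le> t" using t by simp
    note i = pow_pairing_integrable(1)[OF w\<psi> t0, of n] pow_pairing_integrable(1)[OF w0 t0] pow_pairing_integrable(1)[OF w\<kappa> t0]
    have "pow_pairing (?\<psi> n) t - pow_pairing (ext_cut k R) t = (\<integral>x. \<bar>u t x\<bar> powr p * (?\<psi> n x - ext_cut k R x) \<partial>lebesgue)"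
      unfolding pow_pairing_def right_diff_distrib using i by simp
    also have "\<bar>\<dots>\<bar> \<le> (\<integral>x. \<bar>\<bar>u t x\<bar> powr p * (?\<psi> n x - ext_cut k R x)\<bar> \<partial>lebesgue)" by (rule integral_abs_bound)
    also have "\<dots> \<le> (\<integral>x. 3 * ?e n * (\<bar>u t x\<bar> powr p * ?\<kappa> x) \<partial>lebesgue)"
    proof (rule integral_mono)
      show "integrable lebesgue (\<lambda>x. \<bar>\<bar>u t x\<bar> powr p * (?\<psi> n x - ext_cut k R x)\<bar>)"
        unfolding right_diff_distrib by (intro integrable_abs Bochner_Integration.integrable_diff i)
      show "integrable lebesgue (\<lambda>x. 3 * ?e n * (\<bar>u t x\<bar> powr p * ?\<kappa> x))" by (intro integrable_mult_right i)
      fix x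
      have "\<bar>u t x\<bar> powr p * \<bar>?\<psi> n x - ext_cut k R x\<bar> \<le> \<bar>u t x\<bar> powr p * (3 * ?e n * ?\<kappa> x)"
        by (intro mult_left_mono diff_le) simp
      then show "\<bar>\<bar>u t x\<bar> powr p * (?\<psi> n x - ext_cut k R x)\<bar> \<le> 3 * ?e n * (\<bar>u t x\<bar> powr p * ?\<kappa> x)"
        unfolding abs_mult abs_of_nonneg[OF powr_ge_zero] mult.left_commute[of "\<bar>u t x\<bar> powr p" "3 * ?e n"] .
    qed
    also have "\<dots> = 3 * ?e n * pow_pairing ?\<kappa> t" unfolding pow_pairing_def by (rule integral_mult_right_zero)
    also have "\<dots> \<le> 3 * ?e n * PK" using PK[OF t] by (intro mult_left_mono) auto
    finally show ?thesis .
  qed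
  have ld: "\<bar>lin_pairing (?\<psi> n) t - lin_pairing (ext_cut k R) t\<bar> \<le> 3 * ?e n * (E + ?V)" if t: "t \<in> {0..S}" for n t
  proof -
    have t0: "0 \<le> t" using t by simp
    have iV: "integrable lebesgue (\<lambda>x. (?\<kappa> x)\<^sup>2)"
      using weight_L2[OF w\<kappa>] weight_outside[OF w\<kappa>] by (simp add: L2_def set_integral_eq_integral)
    have iu: "integrable lebesgue (\<lambda>x. indicator \<Omega> x * (u t x)\<^sup>2)" using L2_u[OF t0] by (simp add: L2_def set_integrable_def)
    note i = lin_pairing_integrable(1)[OF w\<psi> t0, of n] lin_pairing_integrable(1)[OF w0 t0]
    have "lin_pairing (?\<psi> n) t - lin_pairing (ext_cut k R) t = (\<integral>x. u t x * (?\<psi> n x - ext_cut k R x) \<partial>lebesgue)"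
      unfolding lin_pairing_def right_diff_distrib using i by simp
    also have "\<bar>\<dots>\<bar> \<le> (\<integral>x. \<bar>u t x * (?\<psi> n x - ext_cut k R x)\<bar> \<partial>lebesgue)" by (rule integral_abs_bound)
    also have "\<dots> \<le> (\<integral>x. 3 * ?e n * (indicator \<Omega> x * (u t x)\<^sup>2 + (?\<kappa> x)\<^sup>2) \<partial>lebesgue)"
    proof (rule integral_mono)
      show "integrable lebesgue (\<lambda>x. \<bar>u t x * (?\<psi> n x - ext_cut k R x)\<bar>)"
        unfolding right_diff_distrib by (intro integrable_abs Bochner_Integration.integrable_diff i)
      show "integrable lebesgue (\<lambda>x. 3 * ?e n * (indicator \<Omega> x * (u t x)\<^sup>2 + (?\<kappa> x)\<^sup>2))"
        by (intro integrable_mult_right Bochner_Integration.integrable_add iu iV)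
      fix x
      have "\<bar>u t x * (?\<psi> n x - ext_cut k R x)\<bar> \<le> \<bar>u t x\<bar> * (3 * ?e n * ?\<kappa> x)"
        unfolding abs_mult by (intro mult_left_mono diff_le) simp
      also have "\<dots> = 3 * ?e n * (\<bar>u t x\<bar> * ?\<kappa> x)" by (simp only: mult.left_commute)
      also have "\<dots> \<le> 3 * ?e n * (indicator \<Omega> x * (u t x)\<^sup>2 + (?\<kappa> x)\<^sup>2)"
      proof (intro mult_left_mono)
        show "\<bar>u t x\<bar> * ?\<kappa> x \<le> indicator \<Omega> x * (u t x)\<^sup>2 + (?\<kappa> x)\<^sup>2"
        proof (cases "x \<in> \<Omega>")
          case True
          have "0 \<le> (\<bar>u t x\<bar> - ?\<kappa> x)\<^sup>2" "0 \<le> \<bar>u t x\<bar> * ?\<kappa> x" using space_cut_range[of k R x] by auto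
          then show ?thesis using True unfolding power2_diff by simp
        qed simp
      qed simp
      finally show "\<bar>u t x * (?\<psi> n x - ext_cut k R x)\<bar> \<le> 3 * ?e n * (indicator \<Omega> x * (u t x)\<^sup>2 + (?\<kappa> x)\<^sup>2)" .
    qed
    also have "\<dots> = 3 * ?e n * ((LINT x:\<Omega>|lebesgue. (u t x)\<^sup>2) + ?V)"
      unfolding integral_mult_right_zero Bochner_Integration.integral_add[OF iu iV] by (simp add: set_lebesgue_integral_def)
    also have "\<dots> \<le> 3 * ?e n * (E + ?V)" using L2E[OF t] by (intro mult_left_mono) auto
    finally show ?thesis .
  qed
  \<comment> \<open>The free parameter of \<open>pairing_error\<close> is the square root of the
    error energy, so that both the parameter and the energy divided by it tend to 0. The added
    \<open>?e n\<close> keeps it positive.\<close>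
  define s where "s n = sqrt (err_energy k R (?e n)) + ?e n" for n
  have err0: "0 \<le> err_energy k R (?e n)" for n
    unfolding err_energy_def[OF k R] by (intro integral_nonneg_AE AE_I2 mult_nonneg_nonneg sum_nonneg) simp_all
  have s0: "s \<longlonglongrightarrow> 0"
    using tendsto_add[OF tendsto_real_sqrt[OF err_energy_tendsto[OF k R]] e0] by (simp add: s_def[abs_def])
  have spos: "0 < s n" for n using err0[of n] e(1)[of n] unfolding s_def by (intro add_nonneg_pos) auto
  have es: "1 / s n * err_energy k R (?e n) \<le> s n" for n
  proof -
    have "err_energy k R (?e n) = (sqrt (err_energy k R (?e n)))\<^sup>2" using err0[of n] by simp
    also have "\<dots> \<le> (s n)\<^sup>2" unfolding s_def using err0[of n] by (intro power_mono) auto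
    finally show ?thesis using spos[of n] by (simp add: pos_divide_le_eq power2_eq_square)
  qed
  have lL: "\<bar>lin_pairing (laplacian (?\<psi> n)) t - lin_pairing (limit_lap k R) t\<bar> \<le> s n * (2 * E + 6)" if t: "t \<in> {0..S}" for n t
  proof -
    have t0: "0 \<le> t" using t by simp
    have "\<bar>lin_pairing (laplacian (?\<psi> n)) t - lin_pairing (limit_lap k R) t\<bar> \<le> s n * (2 * (H1_norm \<Omega> (u t))\<^sup>2 + 5) + 1 / s n * err_energy k R (?e n)"
      unfolding lin_pairing_def by (rule pairing_error[OF k R e H10[OF t0] spos B])
    also have "\<dots> \<le> s n * (2 * E + 5) + s n"
      using E[OF t] spos[of n] es[of n] by (intro add_mono mult_left_mono) auto
    finally show ?thesis by (simp add: distrib_left)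
  qed
  have T: "(\<lambda>n. LINT t:{0..S}|lebesgue. h t * F n t) \<longlonglongrightarrow> (LINT t:{0..S}|lebesgue. h t * G t)"
    if h: "continuous_on {0..S} h" "\<And>t. t \<in> {0..S} \<Longrightarrow> \<bar>h t\<bar> \<le> H" "0 \<le> H"
      and F: "\<And>n. continuous_on {0..S} (F n)" and G: "continuous_on {0..S} G"
      and FG: "\<And>n t. t \<in> {0..S} \<Longrightarrow> \<bar>F n t - G t\<bar> \<le> a n" and a: "a \<longlonglongrightarrow> 0" for h G :: "real \<Rightarrow> real" and F H a
  proof (rule set_integral_Icc_tendsto_uniform[where a="\<lambda>n. H * a n"])
    show "\<bar>h t * F n t - h t * G t\<bar> \<le> H * a n" if "t \<in> {0..S}" for n t
      unfolding right_diff_distrib[symmetric] abs_mult using h(2)[OF that] h(3) FG[OF that] by (intro mult_mono) auto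
    show "(\<lambda>n. H * a n) \<longlonglongrightarrow> 0" using tendsto_mult_left[OF a, of H] by simp
  qed (intro continuous_intros h F G)+
  have a1: "(\<lambda>n. 3 * ?e n * c) \<longlonglongrightarrow> 0" for c using tendsto_mult_right[OF tendsto_mult_left[OF e0, of 3], of c] by simp
  have a2: "(\<lambda>n. s n * (2 * E + 6)) \<longlonglongrightarrow> 0" using tendsto_mult_right[OF s0, of "2 * E + 6"] by simp
  note t1 = T[OF c\<eta>(1) H0 nn(1) continuous_on_pow_pairing[OF w\<psi>] continuous_on_pow_pairing[OF w0] pd a1]
  note t2 = T[OF c\<eta>(3) H2 nn(3) continuous_on_lin_pairing[OF w\<psi>] continuous_on_lin_pairing[OF w0] ld a1]
  note t3 = T[OF c\<eta>(2) H1 nn(2) continuous_on_lin_pairing[OF wl] continuous_on_lin_pairing[OF wL] lL a2]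
  note t4 = T[OF c\<eta>(1) H0 nn(1) continuous_on_lin_pairing[OF wl] continuous_on_lin_pairing[OF wL] lL a2]
  \<comment> \<open>The datum is known to be integrable only together with the factor \<phi>, so the
    domination is by |g \<phi>|, using that the truncation is at most \<phi>.\<close>
  have t5: "(\<lambda>n. LINT x:\<Omega>|lebesgue. g x * ?\<psi> n x) \<longlonglongrightarrow> (LINT x:\<Omega>|lebesgue. g x * ext_cut k R x)"
    unfolding set_lebesgue_integral_def
  proof (rule integral_dominated_convergence)
    have gi: "integrable lebesgue (\<lambda>x. indicator \<Omega> x *\<^sub>R (g x * \<phi> x))" using data(1) by (simp add: set_integrable_def)
    then show "integrable lebesgue (\<lambda>x. norm (indicator \<Omega> x *\<^sub>R (g x * \<phi> x)))" by (rule integrable_norm)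
    \<comment> \<open>Measurability of the datum is likewise known only after multiplication by
      \<phi>. Since \<phi> is positive in the domain, it can be divided out.\<close>
    have meas: "(\<lambda>x. indicator \<Omega> x *\<^sub>R (g x * w x)) \<in> borel_measurable lebesgue" if "continuous_on \<Omega> w" for w
    proof -
      have "continuous_on \<Omega> (\<lambda>x. w x / \<phi> x)"
        using pos by (intro continuous_intros that Ck_on_imp_continuous_on[OF C2]) force
      then have "(\<lambda>x. indicator \<Omega> x *\<^sub>R (w x / \<phi> x)) \<in> borel_measurable borel"
        using open_dom by (intro borel_measurable_continuous_on_indicator) auto
      then have "(\<lambda>x. indicator \<Omega> x *\<^sub>R (w x / \<phi> x)) \<in> borel_measurable lebesgue" by (intro measurable_completion) simp
      then have "(\<lambda>x. (indicator \<Omega> x *\<^sub>R (g x * \<phi> x)) * (indicator \<Omega> x *\<^sub>R (w x / \<phi> x))) \<in> borel_measurable lebesgue"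
        using gi by (intro borel_measurable_times) auto
      moreover have "(indicator \<Omega> x *\<^sub>R (g x * \<phi> x)) * (indicator \<Omega> x *\<^sub>R (w x / \<phi> x)) = indicator \<Omega> x *\<^sub>R (g x * w x)" for x
        using pos[of x] by (cases "x \<in> \<Omega>") auto
      ultimately show ?thesis by (simp only:)
    qed
    have "continuous_on \<Omega> (ext_cut k R)"
      by (rule continuous_on_eq[OF Ck_on_imp_continuous_on[OF Ck_on_phi_ch[OF k R]]]) (simp add: ext_cut_def)
    then show "(\<lambda>x. indicator \<Omega> x *\<^sub>R (g x * ext_cut k R x)) \<in> borel_measurable lebesgue" by (rule meas)
    show "(\<lambda>x. indicator \<Omega> x *\<^sub>R (g x * ?\<psi> n x)) \<in> borel_measurable lebesgue" for n
      by (rule meas, rule continuous_on_subset[OF Ck_on_imp_continuous_on[OF Ck_on_test_fun[OF k R e(1)]]]) simp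
    show "AE x in lebesgue. (\<lambda>n. indicator \<Omega> x *\<^sub>R (g x * ?\<psi> n x)) \<longlonglongrightarrow> indicator \<Omega> x *\<^sub>R (g x * ext_cut k R x)"
    proof (intro AE_I2)
      fix x
      have "(\<lambda>n. ?\<psi> n x - ext_cut k R x) \<longlonglongrightarrow> 0"
        by (rule Lim_null_comparison[OF _ a1[of "?\<kappa> x"]]) (use diff_le[of _ x] in simp)
      then have "(\<lambda>n. ?\<psi> n x) \<longlonglongrightarrow> ext_cut k R x" by (rule LIM_zero_cancel)
      then show "(\<lambda>n. indicator \<Omega> x *\<^sub>R (g x * ?\<psi> n x)) \<longlonglongrightarrow> indicator \<Omega> x *\<^sub>R (g x * ext_cut k R x)"
        by (intro tendsto_intros)
    qed
    show "AE x in lebesgue. norm (indicator \<Omega> x *\<^sub>R (g x * ?\<psi> n x)) \<le> norm (indicator \<Omega> x *\<^sub>R (g x * \<phi> x))" for n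
    proof (intro AE_I2)
      fix x
      show "norm (indicator \<Omega> x *\<^sub>R (g x * ?\<psi> n x)) \<le> norm (indicator \<Omega> x *\<^sub>R (g x * \<phi> x))"
      proof (cases "x \<in> \<Omega>")
        case True
        have "\<bar>?\<psi> n x\<bar> = trunc (?e n) x * space_cut k R x"
          using trunc_range(1)[OF e(1)[of n], of x] space_cut_range[of k R x] by (simp add: test_fun_def[OF k R] abs_mult)
        also have "\<dots> \<le> \<phi> x * 1"
          using trunc_range[OF e(1)[of n], of x] True space_cut_range[of k R x] pos[OF True] by (intro mult_mono) auto
        finally have "\<bar>?\<psi> n x\<bar> \<le> \<bar>\<phi> x\<bar>" using pos[OF True] by simp
        then show ?thesis using True by (simp add: abs_mult mult_left_mono)
      qed simp
    qed
  qed
  have eq: "(LINT t:{0..S}|lebesgue. \<eta> t * pow_pairing (?\<psi> n) t) + (LINT x:\<Omega>|lebesgue. g x * ?\<psi> n x) =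
    (LINT t:{0..S}|lebesgue. \<eta>'' t * lin_pairing (?\<psi> n) t) + (LINT t:{0..S}|lebesgue. \<eta>' t * lin_pairing (laplacian (?\<psi> n)) t)
    - (LINT t:{0..S}|lebesgue. \<eta> t * lin_pairing (laplacian (?\<psi> n)) t)" for n
    by (rule weak_product[OF Ck_on_test_fun[OF k R e(1)] w\<psi> wl \<eta> S])
  have "(\<lambda>n. LINT t:{0..S}|lebesgue. \<eta> t * pow_pairing (?\<psi> n) t) \<longlonglongrightarrow> (LINT t:{0..S}|lebesgue. \<eta> t * pow_pairing (ext_cut k R) t)"
    by (rule t1)
  note lhs = tendsto_add[OF this t5]
  have "(\<lambda>n. LINT t:{0..S}|lebesgue. \<eta>'' t * lin_pairing (?\<psi> n) t) \<longlonglongrightarrow> (LINT t:{0..S}|lebesgue. \<eta>'' t * lin_pairing (ext_cut k R) t)"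
    by (rule t2)
  moreover have "(\<lambda>n. LINT t:{0..S}|lebesgue. \<eta>' t * lin_pairing (laplacian (?\<psi> n)) t) \<longlonglongrightarrow> (LINT t:{0..S}|lebesgue. \<eta>' t * lin_pairing (limit_lap k R) t)"
    by (rule t3)
  moreover have "(\<lambda>n. LINT t:{0..S}|lebesgue. \<eta> t * lin_pairing (laplacian (?\<psi> n)) t) \<longlonglongrightarrow> (LINT t:{0..S}|lebesgue. \<eta> t * lin_pairing (limit_lap k R) t)"
    by (rule t4)
  ultimately have rhs: "(\<lambda>n. (LINT t:{0..S}|lebesgue. \<eta>'' t * lin_pairing (?\<psi> n) t) + (LINT t:{0..S}|lebesgue. \<eta>' t * lin_pairing (laplacian (?\<psi> n)) t)
      - (LINT t:{0..S}|lebesgue. \<eta> t * lin_pairing (laplacian (?\<psi> n)) t)) \<longlonglongrightarrow>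
    (LINT t:{0..S}|lebesgue. \<eta>'' t * lin_pairing (ext_cut k R) t) + (LINT t:{0..S}|lebesgue. \<eta>' t * lin_pairing (limit_lap k R) t)
    - (LINT t:{0..S}|lebesgue. \<eta> t * lin_pairing (limit_lap k R) t)"
    by (intro tendsto_diff tendsto_add)
  show ?thesis by (rule LIMSEQ_unique[OF lhs rhs[folded eq]])
qed

end

text \<open>Split according to whether \<open>b \<le> K a\<^sup>p\<^sup>-\<^sup>1\<close>.\<close>

lemma mult_le_powr_add_powr:
  fixes a b p K :: real
  assumes p: "1 < p" and K: "0 < K" and a: "0 \<le> a" and b: "0 \<le> b"
  shows "a * b \<le> K * a powr p + K powr (- 1 / (p - 1)) * b powr (p / (p - 1))"
proof (cases "b \<le> K * a powr (p - 1)")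
  case True
  have "a * b \<le> a * (K * a powr (p - 1))" using True a by (rule mult_left_mono)
  also have "\<dots> = K * a powr p"
    using a by (cases "a = 0") (simp_all add: powr_diff)
  finally show ?thesis by (rule order_trans) simp
next
  case False
  then have bp: "0 < b" using K by (smt (verit) mult_nonneg_nonneg powr_ge_zero)
  have "a powr (p - 1) \<le> b / K" using False K by (simp add: field_simps)
  then have "(a powr (p - 1)) powr (1 / (p - 1)) \<le> (b / K) powr (1 / (p - 1))"
    using p by (intro powr_mono2) auto
  then have "a \<le> (b / K) powr (1 / (p - 1))" using p a by (cases "a = 0") (simp_all add: powr_powr)
  then have "a * b \<le> (b / K) powr (1 / (p - 1)) * b" using b by (rule mult_right_mono)
  also have "\<dots> = K powr (- 1 / (p - 1)) * (b powr (1 / (p - 1)) * b powr 1)"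
    using bp K by (simp add: powr_divide powr_minus_divide)
  also have "b powr (1 / (p - 1)) * b powr 1 = b powr (p / (p - 1))"
    unfolding powr_add[symmetric] using p by (simp add: field_simps)
  finally show ?thesis using K by (simp add: add_increasing)
qed

section \<open>The blow-up argument\<close>

text \<open>\<open>m\<close> is the size of \<phi> at radius R. The lower bound on the annulus is as
  essential as the upper one: it trades powers of m(R) for powers of \<phi> inside the kernel. The
  last assumption asks for boundedness only, which is all a critical exponent offers.\<close>

locale global_solution_growth = global_solution \<Omega> \<phi> u g u0 p q
  for \<Omega> :: "'a::euclidean_space set" and \<phi> :: "'a \<Rightarrow> real" and u g u0 p q +
  fixes m :: "real \<Rightarrow> real" and M R0 :: real
  assumes M: "1 \<le> M" and R0: "1 \<le> R0"
    and m_pos: "R0 \<le> R \<Longrightarrow> 0 < m R"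
    and upper: "R0 \<le> R \<Longrightarrow> x \<in> \<Omega> \<Longrightarrow> norm x \<le> 2 * R \<Longrightarrow> \<phi> x \<le> M * m R"
    and lower: "R0 \<le> R \<Longrightarrow> x \<in> \<Omega> \<Longrightarrow> R \<le> norm x \<Longrightarrow> norm x \<le> 2 * R \<Longrightarrow> m R \<le> M * \<phi> x"
    and grad: "R0 \<le> R \<Longrightarrow> x \<in> \<Omega> \<Longrightarrow> R \<le> norm x \<Longrightarrow> norm x \<le> 2 * R \<Longrightarrow> i \<in> Basis \<Longrightarrow>
       \<bar>partial_deriv i \<phi> x\<bar> \<le> M * m R / R"
    and scaling: "R0 \<le> R \<Longrightarrow> m R * R ^ (DIM('a) + 1) * R powr (- 2 * (p / (p - 1))) \<le> M"
begin

text \<open>Writing p' = p / (p - 1), the condition k <= p (k - 2) of the cutoff estimates says k >=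
  2 p'. The summand 4 provides the regularity of the cutoffs.\<close>

definition k :: nat where "k = 4 + nat \<lceil>2 * (p / (p - 1))\<rceil>"

lemma k: "4 \<le> k" "real k \<le> p * (real k - 2)"
proof -
  show "4 \<le> k" by (simp add: k_def)
  have "2 * (p / (p - 1)) \<le> real k" unfolding k_def by linarith
  then have "2 * p \<le> real k * (p - 1)" using p(1) by (simp add: field_simps)
  then show "real k \<le> p * (real k - 2)" by (simp add: algebra_simps)
qed

definition c :: real where "c = 15 * (real k)\<^sup>2"

text \<open>The first summand comes from \<phi> times the Laplacian of the cutoff, the second from
  twice the n mixed products of first derivatives.\<close>

definition c1 :: real where "c1 = (240 + 30 * DIM('a)) * (real k)\<^sup>2 + 2 * DIM('a) * (60 * (real k)\<^sup>2)"

lemma c_nonneg: "0 \<le> c" "0 \<le> c1" by (simp_all add: c_def c1_def)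

lemma powr_le_self_01: "0 \<le> (y::real) \<Longrightarrow> y \<le> 1 \<Longrightarrow> y \<le> y powr (1 / p)"
  using powr_mono'[of "1 / p" 1 y] p(1) by (cases "y = 0") simp_all

text \<open>Where the cutoff is constant only the Laplacian of \<phi> could remain, and \<phi> is
  harmonic.\<close>

lemma limit_lap_inner:
  assumes R: "R0 \<le> R" and x: "x \<in> \<Omega>" "norm x \<le> R"
  shows "limit_lap k R x = 0"
  using space_cut_inner[of R x k] R R0 x k(1) by (simp add: limit_lap_eq[OF k(1)])

lemma limit_lap_outer:
  assumes R: "R0 \<le> R" and x: "x \<in> \<Omega>" "2 * R < norm x"
  shows "limit_lap k R x = 0"
  using space_cut_outer[of R x k] R R0 x k(1) by (simp add: limit_lap_eq[OF k(1)])

lemma limit_lap_bound_cut: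
  assumes R: "R0 \<le> R" and x: "x \<in> \<Omega>" "R \<le> norm x" "norm x \<le> 2 * R"
  shows "\<bar>limit_lap k R x\<bar> \<le> c1 * (M * m R) / R\<^sup>2 * space_cut k R x powr (1 / p)"
proof -
  let ?P = "space_cut k R x powr (1 / p)"
  have Rp: "0 < R" using R R0 by simp
  have Mm: "0 \<le> M * m R" using M m_pos[OF R] by simp
  note b = space_cut_deriv_bounds(1)[OF k(1) p(1) k(2) Rp, of _ x] space_cut_deriv_bounds(2)[OF k(1) p(1) k(2) Rp, of x]
  have "\<bar>\<phi> x * laplacian (space_cut k R) x\<bar> \<le> (M * m R) * ((240 + 30 * DIM('a)) * (real k)\<^sup>2 / R\<^sup>2 * ?P)"
    unfolding abs_mult using upper[OF R x(1,3)] pos[OF x(1)] Mm by (intro mult_mono b(2)) auto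
  moreover have "\<bar>\<Sum>i\<in>Basis. partial_deriv i \<phi> x * partial_deriv i (space_cut k R) x\<bar> \<le>
      (\<Sum>i\<in>(Basis::'a set). (M * m R / R) * (60 * (real k)\<^sup>2 / R * ?P))"
  proof (rule order_trans[OF sum_abs], rule sum_mono)
    fix i :: 'a assume i: "i \<in> Basis"
    show "\<bar>partial_deriv i \<phi> x * partial_deriv i (space_cut k R) x\<bar> \<le> (M * m R / R) * (60 * (real k)\<^sup>2 / R * ?P)"
      unfolding abs_mult using Mm Rp by (intro mult_mono grad[OF R x i] b(1)[OF i]) auto
  qed
  moreover have "(\<Sum>i\<in>(Basis::'a set). (M * m R / R) * (60 * (real k)\<^sup>2 / R * ?P)) = DIM('a) * ((M * m R / R) * (60 * (real k)\<^sup>2 / R * ?P))"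
    by simp
  ultimately have "\<bar>limit_lap k R x\<bar> \<le> (M * m R) * ((240 + 30 * DIM('a)) * (real k)\<^sup>2 / R\<^sup>2 * ?P) + 2 * (DIM('a) * ((M * m R / R) * (60 * (real k)\<^sup>2 / R * ?P)))"
    unfolding limit_lap_eq[OF k(1) Rp x(1)] by linarith
  also have "\<dots> = c1 * (M * m R) / R\<^sup>2 * ?P" using Rp by (simp add: c1_def field_simps power2_eq_square)
  finally show ?thesis .
qed

lemma limit_lap_bounded:
  assumes R: "R0 \<le> R" and x: "x \<in> \<Omega>"
  shows "\<bar>limit_lap k R x\<bar> \<le> c1 * (M * m R) / R\<^sup>2"
proof -
  have nn: "0 \<le> c1 * (M * m R) / R\<^sup>2" using M m_pos[OF R] c_nonneg by simp
  consider "norm x < R" | "2 * R < norm x" | "R \<le> norm x" "norm x \<le> 2 * R" by linarith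
  then show ?thesis
  proof cases
    case 3
    have "space_cut k R x powr (1 / p) \<le> 1" using space_cut_range[of k R x] p(1) by (intro powr_le1) auto
    then have "c1 * (M * m R) / R\<^sup>2 * space_cut k R x powr (1 / p) \<le> c1 * (M * m R) / R\<^sup>2 * 1"
      using nn by (intro mult_left_mono) auto
    then show ?thesis using limit_lap_bound_cut[OF R x 3] by linarith
  qed (use limit_lap_inner[OF R x] limit_lap_outer[OF R x] nn in auto)
qed

text \<open>The weight on the ball where the spatial cutoff equals 1. On this ball
  \<open>limit_lap\<close> vanishes, and up to time R so do the time derivatives of the
  cutoff.\<close>

definition inner_part :: "real \<Rightarrow> 'a \<Rightarrow> real" where
  "inner_part R x = (if x \<in> \<Omega> \<and> norm x \<le> R then \<phi> x else 0)"

lemma weight_inner_part: "weight \<Omega> (inner_part R)"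
proof -
  obtain B where B: "B > 0" "\<And>x. x \<in> \<Omega> \<Longrightarrow> norm x \<le> R \<Longrightarrow> \<phi> x \<le> B" using bounded_on_ball[of R] by blast
  have "(\<lambda>x. indicator \<Omega> x *\<^sub>R \<phi> x) \<in> borel_measurable borel"
    using open_dom Ck_on_imp_continuous_on[OF C2] by (intro borel_measurable_continuous_on_indicator) auto
  then have "(\<lambda>x. indicator (cball 0 R) x * (indicator \<Omega> x *\<^sub>R \<phi> x)) \<in> borel_measurable borel"
    by (intro borel_measurable_times borel_measurable_indicator) auto
  moreover have "indicator (cball 0 R) x * (indicator \<Omega> x *\<^sub>R \<phi> x) = inner_part R x" for x
    by (simp add: inner_part_def indicator_def)
  ultimately have "inner_part R \<in> borel_measurable borel" by (simp only:)
  then have "inner_part R \<in> borel_measurable lebesgue" by (intro measurable_completion) simp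
  moreover have "\<bar>inner_part R x\<bar> \<le> B" for x using B pos[of x] by (auto simp: inner_part_def less_imp_le)
  moreover have "inner_part R x = 0" if "R < norm x" for x using that by (simp add: inner_part_def)
  moreover have "inner_part R x = 0" if "x \<notin> \<Omega>" for x using that by (simp add: inner_part_def)
  ultimately show ?thesis unfolding weight_def by blast
qed

lemma inner_part_nonneg: "0 \<le> inner_part R x" using pos[of x] by (simp add: inner_part_def less_imp_le)

lemma pow_pairing_mono:
  assumes "weight \<Omega> v" "weight \<Omega> w" "0 \<le> t" "\<And>x. v x \<le> w x"
  shows "pow_pairing v t \<le> pow_pairing w t"
  unfolding pow_pairing_def
  by (rule integral_mono[OF pow_pairing_integrable(1)[OF assms(1,3)] pow_pairing_integrable(1)[OF assms(2,3)]])
    (intro mult_left_mono assms(4), simp)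

lemma pow_pairing_nonneg:
  assumes "\<And>x. 0 \<le> w x"
  shows "0 \<le> pow_pairing w t"
  unfolding pow_pairing_def by (intro integral_nonneg_AE AE_I2 mult_nonneg_nonneg assms) simp

section \<open>Time cutoff and the kernel of the linear terms\<close>

definition tcut :: "real \<Rightarrow> real \<Rightarrow> real" where "tcut R t = cutoff k (t / R)"
definition tcut' :: "real \<Rightarrow> real \<Rightarrow> real" where "tcut' R t = cutoff' k (t / R) / R"
definition tcut'' :: "real \<Rightarrow> real \<Rightarrow> real" where "tcut'' R t = cutoff'' k (t / R) / R\<^sup>2"

lemma tcut_deriv:
  assumes R: "R > 0"
  shows "(tcut R has_real_derivative tcut' R t) (at t)" "(tcut' R has_real_derivative tcut'' R t) (at t)"
    "continuous_on UNIV (tcut'' R)"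
proof -
  have l: "((\<lambda>t. t / R) has_real_derivative 1 / R) (at t)" using R by (auto intro!: derivative_eq_intros)
  from DERIV_chain2[OF DERIV_cutoff(1)[OF k(1)] l]
  show "(tcut R has_real_derivative tcut' R t) (at t)" by (simp add: tcut_def[abs_def] tcut'_def)
  from DERIV_cdivide[OF DERIV_chain2[OF DERIV_cutoff(2)[OF k(1)] l], of R]
  show "(tcut' R has_real_derivative tcut'' R t) (at t)" by (simp add: tcut'_def[abs_def] tcut''_def power2_eq_square)
  show "continuous_on UNIV (tcut'' R)" unfolding tcut''_def[abs_def]
    by (intro continuous_on_divide continuous_on_compose2[OF DERIV_cutoff(3)[OF k(1)]] continuous_on_const continuous_on_id) (use R in auto)
qed

lemma tcut_ends:
  assumes R: "R > 0"
  shows "tcut R (2 * R) = 0" "tcut' R (2 * R) = 0" "tcut R 0 = 1" "tcut' R 0 = 0"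
  using R k(1) by (simp_all add: tcut_def tcut'_def cutoff_outer cutoff_inner)

lemma tcut_inner:
  assumes "R > 0" "t \<le> R"
  shows "tcut R t = 1" "tcut' R t = 0" "tcut'' R t = 0"
  using assms k(1) by (simp_all add: tcut_def tcut'_def tcut''_def cutoff_inner)

lemma tcut_range: "0 \<le> tcut R t" "tcut R t \<le> 1"
  by (simp_all add: tcut_def cutoff_range)

text \<open>The difference is the coefficient of \<open>limit_lap\<close>. Its part -
  \<open>tcut\<close> does not decay in R; there y <= y^(1/p) on [0, 1] yields the required power,
  and the decay is left to \<open>limit_lap\<close>.\<close>

lemma tcut_bounds:
  assumes R: "1 \<le> R"
  shows "\<bar>tcut'' R t\<bar> \<le> c * tcut R t powr (1 / p) / R\<^sup>2" "\<bar>tcut' R t - tcut R t\<bar> \<le> (c + 1) * tcut R t powr (1 / p)"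
proof -
  note b = cutoff_deriv_bounds[OF k(1) p(1) k(2), of "t / R", folded tcut_def c_def]
  show "\<bar>tcut'' R t\<bar> \<le> c * tcut R t powr (1 / p) / R\<^sup>2"
    unfolding tcut''_def using b(2) by (simp add: divide_right_mono)
  have "\<bar>tcut' R t\<bar> \<le> \<bar>cutoff' k (t / R)\<bar>" using R by (simp add: tcut'_def divide_le_eq mult_left_le_one_le mult_le_cancel_left1)
  then have "\<bar>tcut' R t\<bar> \<le> c * tcut R t powr (1 / p)" using b(1) by linarith
  moreover have "tcut R t \<le> tcut R t powr (1 / p)" by (rule powr_le_self_01[OF tcut_range])
  ultimately show "\<bar>tcut' R t - tcut R t\<bar> \<le> (c + 1) * tcut R t powr (1 / p)"
    using tcut_range[of R t] by (simp add: distrib_right)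
qed

definition c2 :: real where "c2 = c * M powr (1 - 1 / p) + (c + 1) * (c1 * M * M powr (1 / p))"

lemma c2_nonneg: "0 \<le> c2" using c_nonneg M by (simp add: c2_def)

abbreviation ext :: "real \<Rightarrow> 'a \<Rightarrow> real" where "ext R \<equiv> ext_cut k R"

lemma ext_nonneg: "0 \<le> ext R x"
  using pos[of x] space_cut_range[of k R x] by (simp add: ext_cut_def less_imp_le)

text \<open>The shape is dictated by Young's inequality: the first factor, multiplied by |u| and
  raised to the power p, is exactly the integrand of the nonlinear term, and the second does not
  depend on t and x.\<close>

lemma kernel_bound:
  assumes R: "R0 \<le> R" and x: "x \<in> \<Omega>"
  shows "\<bar>tcut'' R t * ext R x + (tcut' R t - tcut R t) * limit_lap k R x\<bar> \<le>
    (tcut R t * ext R x) powr (1 / p) * (c2 * m R powr (1 - 1 / p) / R\<^sup>2)"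
proof -
  have R1: "1 \<le> R" and Rp: "0 < R" using R R0 by auto
  note mp = m_pos[OF R]
  have Mp: "0 < M" using M by simp
  let ?T = "tcut R t powr (1 / p)" and ?X = "ext R x powr (1 / p)" and ?\<mu> = "m R powr (1 - 1 / p)"
  \<comment> \<open>\<phi> \<chi> is split as its power 1/p times its power 1 - 1/p, and only the
    latter is bounded by the maximal size M m(R).\<close>
  have A: "ext R x \<le> ?X * (M powr (1 - 1 / p) * ?\<mu>)"
  proof (cases "ext R x = 0")
    case False
    then have ep: "0 < ext R x" using ext_nonneg[of R x] by simp
    have nx: "norm x \<le> 2 * R"
    proof (rule ccontr)
      assume "\<not> norm x \<le> 2 * R"
      then have "space_cut k R x = 0" using ch_outside(1)[OF k(1) Rp, of x] by simp
      then show False using False by (simp add: ext_cut_def split: if_splits)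
    qed
    have "ext R x \<le> \<phi> x * 1" unfolding ext_cut_def using x pos[OF x] space_cut_range[of k R x] by (simp add: mult_left_le)
    also have "\<dots> \<le> M * m R" using upper[OF R x nx] by simp
    finally have le: "ext R x \<le> M * m R" .
    have "ext R x = ?X * ext R x powr (1 - 1 / p)" unfolding powr_add[symmetric] using ep by simp
    also have "\<dots> \<le> ?X * (M * m R) powr (1 - 1 / p)"
      using le ep p(1) by (intro mult_left_mono powr_mono2) (auto simp: field_simps)
    also have "(M * m R) powr (1 - 1 / p) = M powr (1 - 1 / p) * ?\<mu>" using Mp mp by (simp add: powr_mult)
    finally show ?thesis .
  qed simp
  \<comment> \<open>Here m(R) is split in the same way, and the lower bound on the annulus turns
    m(R)^(1/p) into \<phi>^(1/p), which joins the cutoff to form the power 1/p of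
    \<open>ext R x\<close>.\<close>
  have B: "\<bar>limit_lap k R x\<bar> \<le> c1 * M * M powr (1 / p) * (?X * ?\<mu>) / R\<^sup>2"
  proof -
    have nn: "0 \<le> c1 * M * M powr (1 / p) * (?X * ?\<mu>) / R\<^sup>2" using c_nonneg M by simp
    consider "norm x < R" | "2 * R < norm x" | "R \<le> norm x" "norm x \<le> 2 * R" by linarith
    then show ?thesis
    proof cases
      case 3
      let ?P = "space_cut k R x powr (1 / p)"
      have X: "?X = \<phi> x powr (1 / p) * ?P"
        using x pos[OF x] space_cut_range[of k R x] by (simp add: ext_cut_def powr_mult)
      have "m R powr (1 / p) \<le> (M * \<phi> x) powr (1 / p)"
        using lower[OF R x 3] mp p(1) by (intro powr_mono2) auto
      also have "\<dots> = M powr (1 / p) * \<phi> x powr (1 / p)" using Mp pos[OF x] by (simp add: powr_mult)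
      finally have "m R powr (1 / p) * ?P \<le> M powr (1 / p) * \<phi> x powr (1 / p) * ?P" by (rule mult_right_mono) simp
      then have mP: "m R powr (1 / p) * ?P \<le> M powr (1 / p) * ?X" unfolding X by (simp add: mult.assoc)
      have mm: "m R = ?\<mu> * m R powr (1 / p)" unfolding powr_add[symmetric] using mp by simp
      have "c1 * (M * m R) / R\<^sup>2 * ?P = c1 * M / R\<^sup>2 * ?\<mu> * (m R powr (1 / p) * ?P)"
        by (subst mm) (simp add: mult_ac)
      also have "\<dots> \<le> c1 * M / R\<^sup>2 * ?\<mu> * (M powr (1 / p) * ?X)"
        using c_nonneg M by (intro mult_left_mono mP) auto
      also have "\<dots> = c1 * M * M powr (1 / p) * (?X * ?\<mu>) / R\<^sup>2" by (simp add: mult_ac)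
      finally show ?thesis using limit_lap_bound_cut[OF R x 3] by linarith
    qed (use limit_lap_inner[OF R x] limit_lap_outer[OF R x] nn in auto)
  qed
  note tb = tcut_bounds[OF R1, of t]
  have "\<bar>tcut'' R t * ext R x + (tcut' R t - tcut R t) * limit_lap k R x\<bar> \<le>
      \<bar>tcut'' R t\<bar> * ext R x + \<bar>tcut' R t - tcut R t\<bar> * \<bar>limit_lap k R x\<bar>"
    using ext_nonneg[of R x] by (intro order_trans[OF abs_triangle_ineq]) (simp add: abs_mult)
  also have "\<dots> \<le> (c * ?T / R\<^sup>2) * (?X * (M powr (1 - 1 / p) * ?\<mu>)) + ((c + 1) * ?T) * (c1 * M * M powr (1 / p) * (?X * ?\<mu>) / R\<^sup>2)"
    using ext_nonneg[of R x] c_nonneg by (intro add_mono mult_mono tb A B) auto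
  also have "\<dots> = (?T * ?X) * (c2 * ?\<mu> / R\<^sup>2)" by (simp add: c2_def algebra_simps add_divide_distrib)
  also have "?T * ?X = (tcut R t * ext R x) powr (1 / p)"
    using tcut_range[of R t] ext_nonneg[of R x] by (simp add: powr_mult)
  finally show ?thesis .
qed

definition c3 :: real where "c3 = c2 powr (p / (p - 1))"

text \<open>(1 - 1/p) times p / (p - 1) is 1, so m(R) survives to the first power.\<close>

lemma source_scaling:
  assumes "R0 \<le> R"
  shows "(c2 * m R powr (1 - 1 / p) / R\<^sup>2) powr (p / (p - 1)) = c3 * (m R * R powr (- 2 * (p / (p - 1))))"
proof -
  have Rp: "0 < R" using assms R0 by simp
  have e: "(1 - 1 / p) * (p / (p - 1)) = 1" using p(1) by (simp add: field_simps)
  have "(R\<^sup>2) powr (p / (p - 1)) = R powr (2 * (p / (p - 1)))"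
  proof -
    have "R\<^sup>2 = R powr 2" using Rp by (simp add: powr_numeral)
    then show ?thesis by (simp only: powr_powr)
  qed
  then have "1 / (R\<^sup>2) powr (p / (p - 1)) = R powr (- 2 * (p / (p - 1)))" by (simp add: powr_minus_divide)
  moreover have "(m R powr (1 - 1 / p)) powr (p / (p - 1)) = m R"
    unfolding powr_powr e using m_pos[OF assms] by simp
  moreover have "(c2 * m R powr (1 - 1 / p) / R\<^sup>2) powr (p / (p - 1)) =
      c2 powr (p / (p - 1)) * (m R powr (1 - 1 / p)) powr (p / (p - 1)) * (1 / (R\<^sup>2) powr (p / (p - 1)))"
    using c2_nonneg by (simp add: powr_divide powr_mult)
  ultimately show ?thesis by (simp only: c3_def mult.assoc)
qed

text \<open>Where t <= R and |x| <= R the kernel is 0, and the subtracted part equals the full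
  weight, so nothing is lost. Elsewhere Young's inequality is applied to the kernel bound, and the
  subtracted part is 0.\<close>

lemma pointwise_estimate:
  assumes R: "R0 \<le> R" and K: "0 < K"
  shows "\<bar>u t x * (tcut'' R t * ext R x + (tcut' R t - tcut R t) * limit_lap k R x)\<bar> \<le>
    K * (\<bar>u t x\<bar> powr p * (tcut R t * ext R x - (if t \<le> R then inner_part R x else 0)))
    + K powr (- 1 / (p - 1)) * (c3 * (m R * R powr (- 2 * (p / (p - 1))))) * indicator (cball 0 (2 * R)) x"
proof -
  have Rp: "0 < R" using R R0 by simp
  let ?b = "c2 * m R powr (1 - 1 / p) / R\<^sup>2"
  let ?D = "K powr (- 1 / (p - 1)) * (c3 * (m R * R powr (- 2 * (p / (p - 1)))))"
  have D: "0 \<le> ?D" using m_pos[OF R] by (simp add: c3_def)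
  show ?thesis
  proof (cases "x \<in> \<Omega> \<and> norm x \<le> 2 * R")
    case False
    then have "ext R x = 0" "limit_lap k R x = 0" "inner_part R x = 0"
      using ch_outside(1)[OF k(1) Rp, of x] limit_lap_outer[OF R, of x] Rp
      by (auto simp: ext_cut_def limit_lap_def[OF k(1) Rp] inner_part_def not_le)
    then show ?thesis using D by simp
  next
    case True
    then have x: "x \<in> \<Omega>" and ind: "indicator (cball 0 (2 * R)) x = (1::real)" by auto
    show ?thesis
    proof (cases "t \<le> R \<and> norm x \<le> R")
      case True
      then have "ext R x = inner_part R x" using space_cut_inner(1)[OF Rp, of x k] x by (simp add: ext_cut_def inner_part_def)
      then show ?thesis
        using True tcut_inner[OF Rp, of t] limit_lap_inner[OF R x] D ind by simp
    next
      case False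
      then have z: "(if t \<le> R then inner_part R x else 0) = 0" by (auto simp: inner_part_def)
      let ?a = "\<bar>u t x\<bar> * (tcut R t * ext R x) powr (1 / p)"
      have tx: "0 \<le> tcut R t * ext R x" using tcut_range[of R t] ext_nonneg[of R x] by simp
      have "\<bar>u t x * (tcut'' R t * ext R x + (tcut' R t - tcut R t) * limit_lap k R x)\<bar> \<le>
          \<bar>u t x\<bar> * ((tcut R t * ext R x) powr (1 / p) * ?b)"
        unfolding abs_mult[of "u t x"] by (intro mult_left_mono kernel_bound[OF R x]) simp
      also have "\<dots> = ?a * ?b" by (simp only: mult.assoc)
      also have "\<dots> \<le> K * ?a powr p + K powr (- 1 / (p - 1)) * ?b powr (p / (p - 1))"
        using c2_nonneg by (intro mult_le_powr_add_powr p K) auto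
      also have "?a powr p = \<bar>u t x\<bar> powr p * (tcut R t * ext R x)"
        using tcut_range[of R t] ext_nonneg[of R x] p(1) by (simp add: powr_mult powr_powr)
      also have "?b powr (p / (p - 1)) = c3 * (m R * R powr (- 2 * (p / (p - 1))))" by (rule source_scaling[OF R])
      finally show ?thesis unfolding z ind by simp
    qed
  qed
qed

section \<open>The integrated inequality and the doubling argument\<close>

definition I :: "real \<Rightarrow> real" where "I R = (LINT t:{0..2 * R}|lebesgue. tcut R t * pow_pairing (ext R) t)"
definition Y :: "real \<Rightarrow> real" where "Y R = (LINT t:{0..R}|lebesgue. pow_pairing (inner_part R) t)"
definition J :: "real \<Rightarrow> real" where "J R = (LINT x:\<Omega>|lebesgue. g x * ext R x)"
text \<open>The factor 2 comes from the time interval [0, 2 R], the next ones from the volume of the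
  ball of radius 2 R, and M from the scaling assumption.\<close>

definition c4 :: real where "c4 = 2 * c3 * (unit_ball_vol (real DIM('a)) * 2 ^ DIM('a)) * M"

lemma set_integrable_Icc: "continuous_on {a..b} h \<Longrightarrow> set_integrable lebesgue {a..b::real} (h :: real \<Rightarrow> real)"
  using borel_integrable_compact[OF compact_Icc, of a b h] unfolding set_integrable_def by (intro integrable_lebesgue_lborel)

lemma continuous_tcut: "R > 0 \<Longrightarrow> continuous_on A (tcut R)" "R > 0 \<Longrightarrow> continuous_on A (tcut' R)" "R > 0 \<Longrightarrow> continuous_on A (tcut'' R)"
proof -
  show "continuous_on A (tcut R)" if R: "R > 0"
    by (intro continuous_at_imp_continuous_on ballI DERIV_isCont) (rule tcut_deriv(1)[OF R])
  show "continuous_on A (tcut' R)" if R: "R > 0"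
    by (intro continuous_at_imp_continuous_on ballI DERIV_isCont) (rule tcut_deriv(2)[OF R])
  show "continuous_on A (tcut'' R)" if R: "R > 0"
    by (rule continuous_on_subset[OF tcut_deriv(3)[OF R]]) simp
qed

text \<open>The limiting weak identity with S = 2 R expresses the left side as an integral of the
  kernel against the solution; \<open>pointwise_estimate\<close> is integrated over space and then
  over time.\<close>

lemma inequality:
  assumes R: "R0 \<le> R" and K: "0 < K"
  shows "I R + J R \<le> K * (I R - Y R) + K powr (- 1 / (p - 1)) * c4"
proof -
  have Rp: "0 < R" using R R0 by simp
  let ?L = "limit_lap k R"
  let ?D = "K powr (- 1 / (p - 1)) * (c3 * (m R * R powr (- 2 * (p / (p - 1)))))"
  let ?V = "\<integral>x. (indicator (cball (0::'a) (2 * R)) x :: real) \<partial>lebesgue"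
  note w0 = weight_ext_cut[OF k(1) Rp] and wL = weight_limit_lap[OF k(1) Rp limit_lap_bounded[OF R]] and wi = weight_inner_part[of R]
  note ct = continuous_tcut[OF Rp, of "{0..2 * R}"]
  note cl = continuous_on_lin_pairing[OF w0, of "2 * R"] continuous_on_lin_pairing[OF wL, of "2 * R"] continuous_on_pow_pairing[OF w0, of "2 * R"]
  have S: "0 < 2 * R" using Rp by simp
  define W where "W t = tcut'' R t * lin_pairing (ext R) t + (tcut' R t - tcut R t) * lin_pairing ?L t" for t
  have cW: "continuous_on {0..2 * R} W" unfolding W_def[abs_def] by (intro continuous_intros ct cl)
  have "I R + J R = (LINT t:{0..2 * R}|lebesgue. tcut'' R t * lin_pairing (ext R) t) + (LINT t:{0..2 * R}|lebesgue. tcut' R t * lin_pairing ?L t)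
      - (LINT t:{0..2 * R}|lebesgue. tcut R t * lin_pairing ?L t)"
    unfolding I_def J_def
    by (rule weak_limit[OF k(1) Rp limit_lap_bounded[OF R] tcut_deriv[OF Rp] tcut_ends[OF Rp] S])
  also have "\<dots> = (LINT t:{0..2 * R}|lebesgue. W t)"
  proof -
    note i = set_integrable_Icc[OF continuous_on_mult[OF ct(3) cl(1)]] set_integrable_Icc[OF continuous_on_mult[OF ct(2) cl(2)]]
      set_integrable_Icc[OF continuous_on_mult[OF ct(1) cl(2)]]
    have "(LINT t:{0..2 * R}|lebesgue. tcut'' R t * lin_pairing (ext R) t + (tcut' R t * lin_pairing ?L t - tcut R t * lin_pairing ?L t)) =
        (LINT t:{0..2 * R}|lebesgue. tcut'' R t * lin_pairing (ext R) t) + (LINT t:{0..2 * R}|lebesgue. tcut' R t * lin_pairing ?L t - tcut R t * lin_pairing ?L t)"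
      by (rule set_integral_add(2)[OF i(1) set_integral_diff(1)[OF i(2,3)]])
    also have "(LINT t:{0..2 * R}|lebesgue. tcut' R t * lin_pairing ?L t - tcut R t * lin_pairing ?L t) =
        (LINT t:{0..2 * R}|lebesgue. tcut' R t * lin_pairing ?L t) - (LINT t:{0..2 * R}|lebesgue. tcut R t * lin_pairing ?L t)"
      by (rule set_integral_diff(2)[OF i(2,3)])
    finally show ?thesis unfolding W_def left_diff_distrib by simp
  qed
  also have "\<dots> \<le> (LINT t:{0..2 * R}|lebesgue. K * (tcut R t * pow_pairing (ext R) t - indicator {0..R} t * pow_pairing (inner_part R) t) + ?D * ?V)"
  proof (rule set_integral_mono)
    show "set_integrable lebesgue {0..2 * R} W" by (rule set_integrable_Icc[OF cW])
    have iI: "set_integrable lebesgue {0..2 * R} (\<lambda>t. indicator {0..R} t * pow_pairing (inner_part R) t)"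
    proof -
      have "indicator {0..2 * R} t *\<^sub>R (indicator {0..R} t * pow_pairing (inner_part R) t) = indicator {0..R} t *\<^sub>R pow_pairing (inner_part R) t" for t
        using Rp by (auto simp: indicator_def)
      then show ?thesis using set_integrable_Icc[OF continuous_on_pow_pairing[OF wi, of R]] by (simp only: set_integrable_def)
    qed
    have i2: "set_integrable lebesgue {0..2 * R} (\<lambda>t. ?D * ?V)" by (rule set_integrable_Icc[OF continuous_on_const])
    note i1 = set_integrable_Icc[OF continuous_on_mult[OF ct(1) cl(3)]] i2
    show "set_integrable lebesgue {0..2 * R} (\<lambda>t. K * (tcut R t * pow_pairing (ext R) t - indicator {0..R} t * pow_pairing (inner_part R) t) + ?D * ?V)"
      by (intro set_integral_add(1) set_integrable_mult_right set_integral_diff(1) i1 iI)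
    fix t assume t: "t \<in> {0..2 * R}"
    then have t0: "0 \<le> t" by simp
    note i = lin_pairing_integrable(1)[OF w0 t0] lin_pairing_integrable(1)[OF wL t0] pow_pairing_integrable(1)[OF w0 t0] pow_pairing_integrable(1)[OF wi t0]
    let ?F = "\<lambda>x. u t x * (tcut'' R t * ext R x + (tcut' R t - tcut R t) * ?L x)"
    let ?G = "\<lambda>x. K * (\<bar>u t x\<bar> powr p * (tcut R t * ext R x - (if t \<le> R then inner_part R x else 0))) + ?D * indicator (cball 0 (2 * R)) x"
    have Feq: "?F x = tcut'' R t * (u t x * ext R x) + (tcut' R t - tcut R t) * (u t x * ?L x)" for x by (simp add: algebra_simps)
    have Geq: "?G x = K * (tcut R t * (\<bar>u t x\<bar> powr p * ext R x) - indicator {0..R} t * (\<bar>u t x\<bar> powr p * inner_part R x)) + ?D * indicator (cball 0 (2 * R)) x" for x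
      using t0 by (simp add: algebra_simps indicator_def)
    have iF: "integrable lebesgue ?F" unfolding Feq by (intro Bochner_Integration.integrable_add integrable_mult_right i)
    have iG: "integrable lebesgue ?G" unfolding Geq
      by (intro Bochner_Integration.integrable_add Bochner_Integration.integrable_diff integrable_mult_right i integrable_indicator_cball)
    have "W t = (\<integral>x. ?F x \<partial>lebesgue)" unfolding Feq W_def lin_pairing_def using i by simp
    also have "\<dots> \<le> (\<integral>x. ?G x \<partial>lebesgue)"
    proof (rule integral_mono[OF iF iG])
      show "?F x \<le> ?G x" for x using pointwise_estimate[OF R K, of t x] by linarith
    qed
    also have "\<dots> = K * (tcut R t * pow_pairing (ext R) t - indicator {0..R} t * pow_pairing (inner_part R) t) + ?D * ?V"
    proof -
      have 1: "integrable lebesgue (\<lambda>x. K * (tcut R t * (\<bar>u t x\<bar> powr p * ext R x) - indicator {0..R} t * (\<bar>u t x\<bar> powr p * inner_part R x)))"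
        by (intro Bochner_Integration.integrable_diff integrable_mult_right i)
      have 2: "integrable lebesgue (\<lambda>x. ?D * indicator (cball (0::'a) (2 * R)) x)" by (rule integrable_indicator_cball)
      show ?thesis unfolding Geq Bochner_Integration.integral_add[OF 1 2] pow_pairing_def using i by simp
    qed
    finally show "W t \<le> K * (tcut R t * pow_pairing (ext R) t - indicator {0..R} t * pow_pairing (inner_part R) t) + ?D * ?V" .
  qed
  also have "\<dots> = K * (I R - Y R) + 2 * R * (?D * ?V)"
  proof -
    have Yeq: "(LINT t:{0..2 * R}|lebesgue. indicator {0..R} t * pow_pairing (inner_part R) t) = Y R"
      "set_integrable lebesgue {0..2 * R} (\<lambda>t. indicator {0..R} t * pow_pairing (inner_part R) t)"
    proof -
      have eq: "indicator {0..2 * R} t *\<^sub>R (indicator {0..R} t * pow_pairing (inner_part R) t) = indicator {0..R} t *\<^sub>R pow_pairing (inner_part R) t" for t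
        using Rp by (auto simp: indicator_def)
      show "(LINT t:{0..2 * R}|lebesgue. indicator {0..R} t * pow_pairing (inner_part R) t) = Y R"
        unfolding set_lebesgue_integral_def eq Y_def ..
      show "set_integrable lebesgue {0..2 * R} (\<lambda>t. indicator {0..R} t * pow_pairing (inner_part R) t)"
        unfolding set_integrable_def eq using set_integrable_Icc[OF continuous_on_pow_pairing[OF wi, of R]] by (simp only: set_integrable_def)
    qed
    have i2: "set_integrable lebesgue {0..2 * R} (\<lambda>t. ?D * ?V)" by (rule set_integrable_Icc[OF continuous_on_const])
    note i1 = set_integrable_Icc[OF continuous_on_mult[OF ct(1) cl(3)]] i2
    have const: "(LINT t:{0..2 * R}|lebesgue. ?D * ?V) = 2 * R * (?D * ?V)"
      using Rp by (simp add: set_lebesgue_integral_def)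
    have dd: "set_integrable lebesgue {0..2 * R} (\<lambda>t. tcut R t * pow_pairing (ext R) t - indicator {0..R} t * pow_pairing (inner_part R) t)"
      by (rule set_integral_diff(1)[OF i1(1) Yeq(2)])
    let ?h = "\<lambda>t. tcut R t * pow_pairing (ext R) t - indicator {0..R} t * pow_pairing (inner_part R) t"
    have "(LINT t:{0..2 * R}|lebesgue. K * ?h t + ?D * ?V) = (LINT t:{0..2 * R}|lebesgue. K * ?h t) + (LINT t:{0..2 * R}|lebesgue. ?D * ?V)"
      using dd by (intro set_integral_add(2) i2) simp
    also have "(LINT t:{0..2 * R}|lebesgue. K * ?h t) = K * (LINT t:{0..2 * R}|lebesgue. ?h t)" by simp
    also have "(LINT t:{0..2 * R}|lebesgue. ?h t) = I R - Y R"
      unfolding I_def Yeq(1)[symmetric] by (rule set_integral_diff(2)[OF i1(1) Yeq(2)])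
    finally show ?thesis unfolding const .
  qed
  \<comment> \<open>The length 2 R and the volume of the ball together supply the power R^(n+1) of
    the scaling assumption.\<close>
  also have "2 * R * (?D * ?V) \<le> K powr (- 1 / (p - 1)) * c4"
  proof -
    have "?V = measure lebesgue (cball (0::'a) (2 * R))" by simp
    also have "\<dots> = unit_ball_vol (real DIM('a)) * (2 * R) ^ DIM('a)"
      using content_cball[of "2 * R" "0::'a"] Rp by (simp add: measure_completion)
    finally have V: "?V = unit_ball_vol (real DIM('a)) * (2 * R) ^ DIM('a)" .
    have "2 * R * (?D * ?V) = K powr (- 1 / (p - 1)) * (2 * c3 * (unit_ball_vol (real DIM('a)) * 2 ^ DIM('a)) * (m R * R ^ (DIM('a) + 1) * R powr (- 2 * (p / (p - 1)))))"
      unfolding V by (simp add: power_mult_distrib mult_ac)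
    also have "\<dots> \<le> K powr (- 1 / (p - 1)) * c4"
      unfolding c4_def by (intro mult_left_mono scaling[OF R]) (simp_all add: c3_def)
    finally show ?thesis .
  qed
  finally show ?thesis by simp
qed

lemma Y_le_I: assumes R: "R0 \<le> R" shows "Y R \<le> I R"
proof -
  have Rp: "0 < R" using R R0 by simp
  note w0 = weight_ext_cut[OF k(1) Rp] and wi = weight_inner_part[of R]
  have "Y R \<le> (LINT t:{0..R}|lebesgue. tcut R t * pow_pairing (ext R) t)"
    unfolding Y_def
  proof (rule set_integral_mono)
    show "set_integrable lebesgue {0..R} (pow_pairing (inner_part R))" by (intro set_integrable_Icc continuous_on_pow_pairing wi)
    show "set_integrable lebesgue {0..R} (\<lambda>t. tcut R t * pow_pairing (ext R) t)"
      by (intro set_integrable_Icc continuous_on_mult continuous_on_pow_pairing continuous_tcut w0 Rp)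
    fix t assume t: "t \<in> {0..R}"
    have "pow_pairing (inner_part R) t \<le> pow_pairing (ext R) t"
    proof (rule pow_pairing_mono[OF wi w0])
      show "inner_part R x \<le> ext R x" for x
        using space_cut_inner(1)[OF Rp, of x k] ext_nonneg[of R x] by (auto simp: inner_part_def ext_cut_def)
    qed (use t in simp)
    then show "pow_pairing (inner_part R) t \<le> tcut R t * pow_pairing (ext R) t" using tcut_inner(1)[OF Rp, of t] t by simp
  qed
  also have "\<dots> \<le> I R" unfolding I_def set_lebesgue_integral_def
  proof (rule integral_mono)
    show "integrable lebesgue (\<lambda>t. indicator {0..R} t *\<^sub>R (tcut R t * pow_pairing (ext R) t))"
      "integrable lebesgue (\<lambda>t. indicator {0..2 * R} t *\<^sub>R (tcut R t * pow_pairing (ext R) t))"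
      unfolding set_integrable_def[symmetric]
      by (intro set_integrable_Icc continuous_on_mult continuous_on_pow_pairing continuous_tcut w0 Rp)+
    show "indicator {0..R} t *\<^sub>R (tcut R t * pow_pairing (ext R) t) \<le> indicator {0..2 * R} t *\<^sub>R (tcut R t * pow_pairing (ext R) t)" for t
      using Rp tcut_range[of R t] pow_pairing_nonneg[of "ext R" t] ext_nonneg[of R] by (auto simp: indicator_def)
  qed
  finally show ?thesis .
qed

text \<open>Both cutoffs are at most 1 and supported within 2 R, the scale on which the inner part
  at 2 R has weight \<phi>. Hence \<open>I R - Y R\<close> is at most the increment of Y from R to 2
  R.\<close>

lemma I_le_Y: assumes R: "R0 \<le> R" shows "I R \<le> Y (2 * R)"
proof -
  have Rp: "0 < R" using R R0 by simp
  note w0 = weight_ext_cut[OF k(1) Rp] and wi = weight_inner_part[of "2 * R"]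
  show ?thesis unfolding I_def Y_def
  proof (rule set_integral_mono)
    show "set_integrable lebesgue {0..2 * R} (pow_pairing (inner_part (2 * R)))" by (intro set_integrable_Icc continuous_on_pow_pairing wi)
    show "set_integrable lebesgue {0..2 * R} (\<lambda>t. tcut R t * pow_pairing (ext R) t)"
      by (intro set_integrable_Icc continuous_on_mult continuous_on_pow_pairing continuous_tcut w0 Rp)
    fix t assume t: "t \<in> {0..2 * R}"
    have "tcut R t * pow_pairing (ext R) t \<le> pow_pairing (ext R) t"
      using tcut_range[of R t] pow_pairing_nonneg[of "ext R" t] ext_nonneg[of R] by (simp add: mult_left_le_one_le)
    also have "\<dots> \<le> pow_pairing (inner_part (2 * R)) t"
    proof (rule pow_pairing_mono[OF w0 wi])
      show "ext R x \<le> inner_part (2 * R) x" for x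
        using space_cut_range[of k R x] ch_outside(1)[OF k(1) Rp, of x] pos[of x]
        by (auto simp: inner_part_def ext_cut_def mult_left_le)
    qed (use t in simp)
    finally show "tcut R t * pow_pairing (ext R) t \<le> pow_pairing (inner_part (2 * R)) t" .
  qed
qed

lemma Y_nonneg: "0 \<le> Y R"
  unfolding Y_def set_lebesgue_integral_def
  by (intro integral_nonneg_AE AE_I2) (simp add: pow_pairing_nonneg inner_part_nonneg)

text \<open>At a fixed point the cutoff is 1 as soon as the radius exceeds |x|, and |g \<phi>|
  dominates.\<close>

lemma J_tendsto: "(\<lambda>n. J (2 ^ n)) \<longlonglongrightarrow> (LINT x:\<Omega>|lebesgue. g x * \<phi> x)"
  unfolding J_def set_lebesgue_integral_def
proof (rule integral_dominated_convergence)
  have gi: "integrable lebesgue (\<lambda>x. indicator \<Omega> x *\<^sub>R (g x * \<phi> x))" using data(1) by (simp add: set_integrable_def)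
  then show "(\<lambda>x. indicator \<Omega> x *\<^sub>R (g x * \<phi> x)) \<in> borel_measurable lebesgue" by simp
  show "integrable lebesgue (\<lambda>x. norm (indicator \<Omega> x *\<^sub>R (g x * \<phi> x)))" using gi by (rule integrable_norm)
  show "(\<lambda>x. indicator \<Omega> x *\<^sub>R (g x * ext (2 ^ n) x)) \<in> borel_measurable lebesgue" for n
  proof -
    have "continuous_on UNIV (space_cut k (2 ^ n) :: 'a \<Rightarrow> real)"
      by (rule Ck_on_imp_continuous_on[OF Ck_on_space_cut[OF k(1)]])
    from continuous_set_borel_measurable[OF this]
    have "(\<lambda>x. (indicator \<Omega> x *\<^sub>R (g x * \<phi> x)) * space_cut k (2 ^ n) x) \<in> borel_measurable lebesgue"
      using gi by (intro borel_measurable_times) auto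
    moreover have "(indicator \<Omega> x *\<^sub>R (g x * \<phi> x)) * space_cut k (2 ^ n) x = indicator \<Omega> x *\<^sub>R (g x * ext (2 ^ n) x)" for x
      by (cases "x \<in> \<Omega>") (simp_all add: ext_cut_def)
    ultimately show ?thesis by (simp only:)
  qed
  show "AE x in lebesgue. norm (indicator \<Omega> x *\<^sub>R (g x * ext (2 ^ n) x)) \<le> norm (indicator \<Omega> x *\<^sub>R (g x * \<phi> x))" for n
  proof (intro AE_I2)
    fix x :: 'a
    show "norm (indicator \<Omega> x *\<^sub>R (g x * ext (2 ^ n) x)) \<le> norm (indicator \<Omega> x *\<^sub>R (g x * \<phi> x))"
    proof (cases "x \<in> \<Omega>")
      case True
      have "\<bar>ext (2 ^ n) x\<bar> \<le> \<bar>\<phi> x\<bar>"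
        using True pos[OF True] space_cut_range[of k "2 ^ n" x] by (simp add: ext_cut_def abs_mult mult_left_le)
      then show ?thesis using True by (simp add: abs_mult mult_left_mono)
    qed simp
  qed
  show "AE x in lebesgue. (\<lambda>n. indicator \<Omega> x *\<^sub>R (g x * ext (2 ^ n) x)) \<longlonglongrightarrow> indicator \<Omega> x *\<^sub>R (g x * \<phi> x)"
  proof (intro AE_I2)
    fix x :: 'a
    obtain N where N: "norm x < 2 ^ N" using real_arch_pow[of 2 "norm x"] by auto
    have "\<forall>\<^sub>F n in sequentially. indicator \<Omega> x *\<^sub>R (g x * ext (2 ^ n) x) = indicator \<Omega> x *\<^sub>R (g x * \<phi> x)"
    proof (rule eventually_sequentiallyI[of N])
      fix n assume "N \<le> n"
      then have "(2::real) ^ N \<le> 2 ^ n" by (rule power_increasing) simp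
      with N have "norm x \<le> 2 ^ n" by (rule order_trans[OF less_imp_le])
      then have "space_cut k (2 ^ n) x = 1" by (intro space_cut_inner(1)) simp_all
      then show "indicator \<Omega> x *\<^sub>R (g x * ext (2 ^ n) x) = indicator \<Omega> x *\<^sub>R (g x * \<phi> x)"
        by (cases "x \<in> \<Omega>") (simp_all add: ext_cut_def)
    qed
    then show "(\<lambda>n. indicator \<Omega> x *\<^sub>R (g x * ext (2 ^ n) x)) \<longlonglongrightarrow> indicator \<Omega> x *\<^sub>R (g x * \<phi> x)"
      by (rule tendsto_eventually)
  qed
qed

lemma contradiction: False
proof -
  let ?c = "LINT x:\<Omega>|lebesgue. g x * \<phi> x"
  obtain N0 where N0: "R0 < 2 ^ N0" using real_arch_pow[of 2 R0] by auto
  have "\<forall>\<^sub>F n in sequentially. 0 < J (2 ^ n)" using order_tendstoD(1)[OF J_tendsto data(2)] .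
  then obtain N1 where N1: "\<And>n. N1 \<le> n \<Longrightarrow> 0 < J (2 ^ n)" by (auto simp: eventually_sequentially)
  define N where "N = max N0 N1"
  have RN: "R0 \<le> 2 ^ (n + N)" for n
  proof -
    have "(2::real) ^ N0 \<le> 2 ^ (n + N)" by (rule power_increasing) (simp_all add: N_def)
    with N0 show ?thesis by (rule order_trans[OF less_imp_le])
  qed
  define y where "y n = Y (2 ^ (n + N))" for n
  have double: "2 * 2 ^ (n + N) = (2::real) ^ (Suc n + N)" for n by simp
  have yI: "y n \<le> I (2 ^ (n + N))" "I (2 ^ (n + N)) \<le> y (Suc n)" for n
    using Y_le_I[OF RN[of n]] I_le_Y[OF RN[of n]] unfolding y_def double by auto
  have mono: "incseq y" by (rule incseq_SucI) (rule order_trans[OF yI])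
  define C where "C = (1 / 2) powr (- 1 / (p - 1)) * c4"
  \<comment> \<open>With K = 1/2 the inequality reads I + Y + 2 J <= 2 C, where J is positive and Y
    nonnegative. A monotone bounded sequence has increments tending to 0.\<close>
  have "y n \<le> 2 * C" for n
  proof -
    have "0 < J (2 ^ (n + N))" by (rule N1) (simp add: N_def)
    moreover have "0 \<le> Y (2 ^ (n + N))" by (rule Y_nonneg)
    moreover have "I (2 ^ (n + N)) + J (2 ^ (n + N)) \<le> 1 / 2 * (I (2 ^ (n + N)) - Y (2 ^ (n + N))) + C"
      unfolding C_def by (rule inequality[OF RN]) simp
    ultimately show ?thesis using yI(1)[of n] by (simp add: field_simps)
  qed
  then obtain L where L: "y \<longlonglongrightarrow> L" using incseq_convergent[OF mono] by blast
  have lim: "?c \<le> \<kappa> * c4" if \<kappa>: "\<kappa> > 0" for \<kappa>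
  proof -
    \<comment> \<open>Reparametrised so that the constant \<open>K powr (- 1 / (p - 1))\<close> in
      front of \<open>c4\<close> is \<kappa>; small \<kappa> means large K, which multiplies only
      the vanishing increments.\<close>
    define K where "K = \<kappa> powr (- (p - 1))"
    have K: "0 < K" using \<kappa> by (simp add: K_def)
    have "- (p - 1) * (- 1 / (p - 1)) = 1" using p(1) by (simp add: divide_eq_eq)
    then have Kk: "K powr (- 1 / (p - 1)) = \<kappa>" unfolding K_def powr_powr using \<kappa> by simp
    have le: "J (2 ^ (n + N)) \<le> K * (y (Suc n) - y n) + \<kappa> * c4" for n
    proof -
      have "I (2 ^ (n + N)) + J (2 ^ (n + N)) \<le> K * (I (2 ^ (n + N)) - y n) + \<kappa> * c4"
        using inequality[OF RN[of n] K] unfolding Kk y_def .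
      moreover have "K * (I (2 ^ (n + N)) - y n) \<le> K * (y (Suc n) - y n)" using K yI(2)[of n] by (intro mult_left_mono) auto
      moreover have "0 \<le> I (2 ^ (n + N))" using yI(1)[of n] Y_nonneg[of "2 ^ (n + N)"] by (simp add: y_def)
      ultimately show ?thesis by linarith
    qed
    have 1: "(\<lambda>n. J (2 ^ (n + N))) \<longlonglongrightarrow> ?c" by (rule LIMSEQ_ignore_initial_segment[OF J_tendsto])
    have 2: "(\<lambda>n. K * (y (Suc n) - y n) + \<kappa> * c4) \<longlonglongrightarrow> K * (L - L) + \<kappa> * c4"
      by (intro tendsto_intros LIMSEQ_Suc L)
    have "?c \<le> K * (L - L) + \<kappa> * c4" by (rule LIMSEQ_le[OF 1 2]) (use le in blast)
    then show ?thesis by simp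
  qed
  \<comment> \<open>For this \<kappa> the bound gives \<open>?c\<close> <= \<open>?c\<close> / 2,
    against positivity.\<close>
  have "0 < ?c / (2 * (\<bar>c4\<bar> + 1))" using data(2) by (intro divide_pos_pos) auto
  from lim[OF this] have "?c \<le> ?c / (2 * (\<bar>c4\<bar> + 1)) * c4" .
  also have "\<dots> \<le> ?c / (2 * (\<bar>c4\<bar> + 1)) * (\<bar>c4\<bar> + 1)"
    using data(2) by (intro mult_left_mono) auto
  also have "\<dots> = ?c / 2" by (simp add: field_simps add_eq_0_iff)
  finally show False using data(2) by simp
qed

end

section \<open>Growth of the harmonic function\<close>

text \<open>The growth assumptions of the blow-up locale as a single predicate, so that the three
  dimensional cases can each assert the existence of m, M and R0.\<close>

definition growth_bounds ::
  "'a::euclidean_space set \<Rightarrow> ('a \<Rightarrow> real) \<Rightarrow> real \<Rightarrow> (real \<Rightarrow> real) \<Rightarrow> real \<Rightarrow> real \<Rightarrow> bool" where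
  "growth_bounds \<Omega> \<phi> p m M R0 \<longleftrightarrow> 1 \<le> M \<and> 1 \<le> R0 \<and> (\<forall>R\<ge>R0. 0 < m R \<and>
     (\<forall>x\<in>\<Omega>. norm x \<le> 2 * R \<longrightarrow> \<phi> x \<le> M * m R) \<and>
     (\<forall>x\<in>\<Omega>. R \<le> norm x \<longrightarrow> norm x \<le> 2 * R \<longrightarrow> m R \<le> M * \<phi> x \<and>
        (\<forall>i\<in>Basis. \<bar>partial_deriv i \<phi> x\<bar> \<le> M * m R / R)) \<and>
     m R * R ^ (DIM('a) + 1) * R powr (- 2 * (p / (p - 1))) \<le> M)"

lemma power_times_powr_le_1:
  fixes R a :: real
  assumes "1 \<le> R" "real n \<le> a"
  shows "R ^ n * R powr (- a) \<le> 1"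
proof -
  have "R ^ n * R powr (- a) = R powr (real n - a)"
    using assms(1) by (simp add: powr_realpow[symmetric] powr_add[symmetric])
  also have "\<dots> \<le> R powr 0" using assms by (intro powr_mono) auto
  finally show ?thesis using assms(1) by simp
qed

lemma exterior_harmonic_setup_DIM_1:
  fixes \<Omega> :: "'a::euclidean_space set"
  assumes B: "(Basis :: 'a set) = {e}" and \<Omega>: "\<Omega> = {x. 0 < x \<bullet> e}"
    and C: "C > 0" "\<And>x. x \<in> closure \<Omega> \<Longrightarrow> \<phi> x = C * (x \<bullet> e)"
  shows "exterior_harmonic_setup \<Omega> \<phi>"
    and "x \<in> \<Omega> \<Longrightarrow> partial_deriv e \<phi> x = C"
proof -
  have e: "e \<in> Basis" unfolding B by simp
  have op: "open \<Omega>" unfolding \<Omega> by (intro open_Collect_less continuous_intros)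
  have eq: "\<phi> x = C * (x \<bullet> e)" if "x \<in> \<Omega>" for x using C(2)[of x] that closure_subset[of \<Omega>] by blast
  have bl: "bounded_linear (\<lambda>x. C * (x \<bullet> e))" by (intro bounded_linear_const_mult bounded_linear_inner_left)
  have pdl: "partial_deriv j (\<lambda>x. C * (x \<bullet> e)) = (\<lambda>x. C * (j \<bullet> e))" for j
    using partial_deriv_eqI[OF bounded_linear_imp_has_derivative[OF bl]] by auto
  show "partial_deriv e \<phi> x = C" if "x \<in> \<Omega>" for x
    using partial_deriv_cong[OF op that, of \<phi> "\<lambda>x. C * (x \<bullet> e)" e] eq e by (simp add: pdl inner_same_Basis)
  show "exterior_harmonic_setup \<Omega> \<phi>"
  proof
    show "open \<Omega>" by (rule op)
    show "Ck_on 2 \<Omega> \<phi>" using Ck_on_cong[OF op eq, where k=2] Ck_on_linear[OF bl, where k=2 and S=\<Omega>] by simp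
    have "continuous_on (closure \<Omega>) (\<lambda>x. C * (x \<bullet> e))" by (intro continuous_intros)
    then show "continuous_on (closure \<Omega>) \<phi>" by (rule continuous_on_eq) (simp add: C(2))
    show "laplacian \<phi> x = 0" if "x \<in> \<Omega>" for x
    proof -
      have "laplacian \<phi> x = laplacian (\<lambda>x. C * (x \<bullet> e)) x" by (rule laplacian_cong[OF op that eq])
      then show ?thesis by (simp add: laplacian_def pdl)
    qed
    show "\<phi> x = 0" if x: "x \<in> frontier \<Omega>" for x
    proof -
      have "closure \<Omega> \<subseteq> {x. 0 \<le> x \<bullet> e}"
        unfolding \<Omega> by (intro closure_minimal closed_Collect_le continuous_intros) auto
      moreover have xc: "x \<in> closure \<Omega>" "x \<notin> \<Omega>" using x op by (auto simp: frontier_def interior_open)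
      ultimately have "x \<bullet> e = 0" unfolding \<Omega> by force
      then show ?thesis using C(2)[OF xc(1)] by simp
    qed
    show "0 < \<phi> x" if "x \<in> \<Omega>" for x using eq[OF that] that C(1) by (simp add: \<Omega>)
  qed
qed

text \<open>On the half-line |x| equals the coordinate, so \<phi> = C |x|. The summand 2 C serves
  the upper bound and the slope, 1 / C the lower bound; the power R^3 is compensated since p <= 3
  means 2 p' >= 3.\<close>

lemma growth_bounds_DIM_1:
  fixes \<Omega> :: "'a::euclidean_space set"
  assumes B: "(Basis :: 'a set) = {e}" and \<Omega>: "\<Omega> = {x. 0 < x \<bullet> e}"
    and C: "C > 0" "\<And>x. x \<in> closure \<Omega> \<Longrightarrow> \<phi> x = C * (x \<bullet> e)" and p: "1 < p" "p \<le> 3"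
  shows "growth_bounds \<Omega> \<phi> p (\<lambda>R. R) (1 + 2 * C + 1 / C) 1"
proof -
  let ?M = "1 + 2 * C + 1 / C"
  have M: "1 \<le> ?M" using C(1) by simp
  have dim: "DIM('a) = 1" unfolding B by simp
  have eq: "\<phi> x = C * (x \<bullet> e)" if "x \<in> \<Omega>" for x using C(2)[of x] that closure_subset[of \<Omega>] by blast
  have nx: "norm x = x \<bullet> e" if "x \<in> \<Omega>" for x
  proof -
    have "x = (x \<bullet> e) *\<^sub>R e" using euclidean_representation[of x] by (simp add: B)
    then have "norm x = \<bar>x \<bullet> e\<bar> * norm e" by (metis norm_scaleR)
    moreover have "norm e = 1" by (rule norm_Basis) (unfold B, simp)
    ultimately show ?thesis using that by (simp add: \<Omega>)
  qed
  show ?thesis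
    unfolding growth_bounds_def
  proof (intro conjI allI impI ballI)
    fix R :: real assume R: "1 \<le> R"
    show "0 < R" using R by simp
    show "\<phi> x \<le> ?M * R" if "x \<in> \<Omega>" "norm x \<le> 2 * R" for x
    proof -
      have "\<phi> x \<le> (2 * C) * R" using eq[OF that(1)] nx[OF that(1)] that(2) C(1) by simp
      also have "\<dots> \<le> ?M * R" using C(1) R by (intro mult_right_mono) auto
      finally show ?thesis .
    qed
    show "R \<le> ?M * \<phi> x" if "x \<in> \<Omega>" "R \<le> norm x" for x
    proof -
      have p0: "0 \<le> \<phi> x" using eq[OF that(1)] that(1) C(1) by (simp add: \<Omega>)
      have "R \<le> 1 / C * \<phi> x" using eq[OF that(1)] nx[OF that(1)] that(2) C(1) by simp
      also have "\<dots> \<le> ?M * \<phi> x" using C(1) p0 by (intro mult_right_mono) auto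
      finally show ?thesis .
    qed
    show "\<bar>partial_deriv i \<phi> x\<bar> \<le> ?M * R / R" if "x \<in> \<Omega>" "i \<in> Basis" for x i
    proof -
      have "i = e" using that(2) unfolding B by simp
      then have "partial_deriv i \<phi> x = C" using exterior_harmonic_setup_DIM_1(2)[OF B \<Omega> C that(1)] by simp
      moreover have "?M * R / R = ?M" using R by simp
      moreover have "0 < 1 / C" using C(1) by simp
      ultimately show ?thesis using C(1) by simp
    qed
    show "R * R ^ (DIM('a) + 1) * R powr (- 2 * (p / (p - 1))) \<le> ?M"
    proof -
      have "3 \<le> 2 * (p / (p - 1))" using p by (simp add: field_simps)
      then have "R ^ 3 * R powr (- (2 * (p / (p - 1)))) \<le> 1" by (intro power_times_powr_le_1 R) simp
      moreover have "R * R ^ (DIM('a) + 1) = R ^ 3" by (simp add: dim power3_eq_cube power2_eq_square)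
      ultimately have "R * R ^ (DIM('a) + 1) * R powr (- 2 * (p / (p - 1))) \<le> 1" by simp
      then show ?thesis using M by linarith
    qed
  qed (use M in auto)
qed

text \<open>A cube of half-side R / (2 n) lies in the ball of radius R / 2 because the norm is at
  most the sum of the coordinates. Centred at x it stays in the annulus where \<phi> is controlled,
  and dividing by the half-side gives 2 n^2 / R.\<close>

lemma gradient_bound_far:
  fixes \<Omega> :: "'a::euclidean_space set"
  assumes S: "open \<Omega>" "Ck_on 2 \<Omega> \<phi>" "\<And>x. x \<in> \<Omega> \<Longrightarrow> laplacian \<phi> x = 0"
    and R: "R > 0" and far: "\<And>z. R / 2 \<le> norm z \<Longrightarrow> norm z \<le> 4 * R \<Longrightarrow> z \<in> \<Omega> \<and> \<bar>\<phi> z\<bar> \<le> A"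
    and x: "R \<le> norm x" "norm x \<le> 2 * R" and i: "i \<in> Basis"
  shows "\<bar>partial_deriv i \<phi> x\<bar> \<le> 2 * (real DIM('a))\<^sup>2 * A / R"
proof -
  let ?n = "real DIM('a)"
  have n: "0 < ?n" by simp
  let ?d = "R / (2 * ?n)"
  have d: "?d > 0" using R n by simp
  have "\<bar>partial_deriv i \<phi> x\<bar> \<le> ?n * A / ?d"
  proof (rule harmonic_gradient_bound[OF S(1,2,3) d _ i])
    fix y :: 'a assume y: "\<And>j. j \<in> Basis \<Longrightarrow> \<bar>y \<bullet> j\<bar> \<le> ?d"
    have "norm y \<le> (\<Sum>j\<in>Basis. \<bar>y \<bullet> j\<bar>)" by (rule norm_le_l1)
    also have "\<dots> \<le> (\<Sum>j\<in>(Basis::'a set). ?d)" by (rule sum_mono) (rule y)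
    also have "\<dots> = R / 2" using n by simp
    finally have ny: "2 * norm y \<le> R" by simp
    have "norm x - norm y \<le> norm (x + y)" using norm_triangle_ineq4[of "x + y" y] by simp
    then have "R / 2 \<le> norm (x + y)" using ny x by simp
    moreover have "norm (x + y) \<le> 4 * R" using norm_triangle_ineq[of x y] ny x R by linarith
    ultimately show "x + y \<in> \<Omega> \<and> \<bar>\<phi> (x + y)\<bar> \<le> A" by (rule far)
  qed
  also have "?n * A / ?d = 2 * ?n\<^sup>2 * A / R" using R n by (simp add: field_simps power2_eq_square)
  finally show ?thesis .
qed

text \<open>\<phi> lies between 1/2 and 1 far out, so m = 1 works. The summand 2 of M serves the
  lower bound, 2 n^2 the gradient; p <= 1 + 2 / (n - 1) is a rewriting of n + 1 <= 2 p'.\<close>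

lemma growth_bounds_DIM_ge_3:
  fixes \<Omega> :: "'a::euclidean_space set"
  assumes hs: "exterior_harmonic_setup \<Omega> \<phi>" and bd: "bounded (- \<Omega>)"
    and lt_1: "\<And>x. x \<in> \<Omega> \<Longrightarrow> \<phi> x < 1" and tends: "(\<phi> \<longlongrightarrow> 1) at_infinity"
    and p: "1 < p" "p \<le> 1 + 2 / (real DIM('a) - 1)" and dim: "3 \<le> DIM('a)"
  shows "\<exists>m M R0. growth_bounds \<Omega> \<phi> p m M R0"
proof -
  interpret exterior_harmonic_setup \<Omega> \<phi> by (rule hs)
  obtain \<rho> where \<rho>: "\<And>x. x \<in> - \<Omega> \<Longrightarrow> norm x \<le> \<rho>" using bd by (auto simp: bounded_iff)
  have "\<forall>\<^sub>F x in at_infinity. 1 / 2 < \<phi> x" using order_tendstoD(1)[OF tends, of "1 / 2"] by simp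
  then obtain R1 where R1: "\<And>x. R1 \<le> norm x \<Longrightarrow> 1 / 2 < \<phi> x" by (auto simp: eventually_at_infinity)
  define R0 where "R0 = 1 + \<bar>R1\<bar> + 2 * \<bar>\<rho>\<bar>"
  define M where "M = 2 + 2 * (real DIM('a))\<^sup>2"
  have "growth_bounds \<Omega> \<phi> p (\<lambda>R. 1) M R0"
    unfolding growth_bounds_def
  proof (intro conjI allI impI ballI)
    show M: "1 \<le> M" by (simp add: M_def add_increasing2)
    show "1 \<le> R0" by (simp add: R0_def)
    fix R assume R: "R0 \<le> R"
    have R1': "1 \<le> R" "R1 \<le> R" "2 * \<rho> < R" using R by (auto simp: R0_def)
    have Rp: "0 < R" using R1'(1) by simp
    show "0 < (1::real)" by simp
    show "\<phi> x \<le> M * 1" if "x \<in> \<Omega>" for x using lt_1[OF that] M by simp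
    show "1 \<le> M * \<phi> x" if "R \<le> norm x" for x
    proof -
      have h: "1 / 2 < \<phi> x" using R1[of x] that R1' by simp
      have "1 \<le> 2 * \<phi> x" using h by simp
      also have "\<dots> \<le> M * \<phi> x" using h by (intro mult_right_mono) (auto simp: M_def)
      finally show ?thesis .
    qed
    show "\<bar>partial_deriv i \<phi> x\<bar> \<le> M * 1 / R" if "x \<in> \<Omega>" "R \<le> norm x" "norm x \<le> 2 * R" "i \<in> Basis" for x i
    proof -
      have "\<bar>partial_deriv i \<phi> x\<bar> \<le> 2 * (real DIM('a))\<^sup>2 * 1 / R"
      proof (rule gradient_bound_far[OF open_dom C2 harmonic Rp _ that(2-4)])
        fix z :: 'a assume "R / 2 \<le> norm z"
        then have "\<rho> < norm z" using R1' by linarith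
        then have z: "z \<in> \<Omega>" using \<rho>[of z] by auto
        then show "z \<in> \<Omega> \<and> \<bar>\<phi> z\<bar> \<le> 1" using lt_1[OF z] pos[OF z] by simp
      qed
      also have "\<dots> \<le> M * 1 / R" using R1' by (intro divide_right_mono) (auto simp: M_def)
      finally show ?thesis .
    qed
    show "1 * R ^ (DIM('a) + 1) * R powr (- 2 * (p / (p - 1))) \<le> M"
    proof -
      have n: "0 < real DIM('a) - 1" using dim by simp
      have "(p - 1) * (real DIM('a) - 1) \<le> 2" using p(2) n by (simp add: field_simps)
      then have "(real DIM('a) + 1) * (p - 1) \<le> 2 * p" by (simp add: algebra_simps)
      then have "real (DIM('a) + 1) \<le> 2 * (p / (p - 1))" using p(1) by (simp add: field_simps)
      then have "R ^ (DIM('a) + 1) * R powr (- (2 * (p / (p - 1)))) \<le> 1" by (intro power_times_powr_le_1 R1')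
      then show ?thesis using M by simp
    qed
  qed
  then show ?thesis by blast
qed

text \<open>Now m = ln, and p < 3 leaves a positive surplus b in the exponent. The bound ln R <= R^b
  / b lets this surplus absorb the logarithm.\<close>

lemma growth_bounds_DIM_2:
  fixes \<Omega> :: "'a::euclidean_space set"
  assumes hs: "exterior_harmonic_setup \<Omega> \<phi>" and bd: "bounded (- \<Omega>)"
    and log: "0 < a1" "0 < a2" "\<forall>\<^sub>F x in at_infinity. a1 * ln (norm x) \<le> \<phi> x \<and> \<phi> x \<le> a2 * ln (norm x)"
    and p: "1 < p" "p < 3" and dim: "DIM('a) = 2"
  shows "\<exists>m M R0. growth_bounds \<Omega> \<phi> p m M R0"
proof -
  interpret exterior_harmonic_setup \<Omega> \<phi> by (rule hs)
  obtain \<rho> where \<rho>: "\<And>x. x \<in> - \<Omega> \<Longrightarrow> norm x \<le> \<rho>" using bd by (auto simp: bounded_iff)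
  obtain R1 where R1: "\<And>x. R1 \<le> norm x \<Longrightarrow> a1 * ln (norm x) \<le> \<phi> x \<and> \<phi> x \<le> a2 * ln (norm x)"
    using log(3) by (auto simp: eventually_at_infinity)
  obtain B where B: "B > 0" "\<And>x. x \<in> \<Omega> \<Longrightarrow> norm x \<le> \<bar>R1\<bar> + 1 \<Longrightarrow> \<phi> x \<le> B"
    using bounded_on_ball[of "\<bar>R1\<bar> + 1"] by blast
  define b where "b = 2 * (p / (p - 1)) - 3"
  have b: "0 < b" using p by (simp add: b_def field_simps)
  \<comment> \<open>exp 1 ensures ln R >= 1; the doubled radii ensure that the half-radius R / 2 is
    still beyond the obstacle and inside the logarithmic regime.\<close>
  define R0 where "R0 = exp 1 + 2 * \<bar>R1\<bar> + 2 * \<bar>\<rho>\<bar>"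
  \<comment> \<open>24 is 2 n^2 * 3 for n = 2, from the gradient bound applied to \<phi> <= 3 a2 ln
    R; B covers the bounded region before the logarithmic regime.\<close>
  define M where "M = 1 + B + 24 * a2 + 1 / a1 + 1 / b"
  have ib: "0 < 1 / a1" "0 < 1 / b" using log(1) b by simp_all
  have Mge: "1 \<le> M" "B \<le> M" "24 * a2 \<le> M" "1 / a1 \<le> M" "1 / b \<le> M"
    unfolding M_def using B(1) log(2) ib by linarith+
  have "growth_bounds \<Omega> \<phi> p ln M R0"
    unfolding growth_bounds_def
  proof (intro conjI allI impI ballI)
    show "1 \<le> M" by (rule Mge)
    have e1: "1 \<le> exp (1::real)" by simp
    show "1 \<le> R0" unfolding R0_def using e1 by linarith
    fix R assume R: "R0 \<le> R"
    have R': "exp 1 \<le> R" "2 * R1 \<le> R" "2 * \<rho> \<le> R" "1 \<le> R" using R e1 unfolding R0_def by linarith+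
    have Rp: "0 < R" using R' by simp
    have rho: "2 * \<rho> < R"
    proof -
      have "0 < exp (1::real)" by simp
      then show ?thesis using R unfolding R0_def by linarith
    qed
    have lnR: "1 \<le> ln R" using R'(1) Rp ln_ge_iff by blast
    then show "0 < ln R" by simp
    \<comment> \<open>4 <= exp 1 * exp 1 <= R^2, so 4 R <= R^3; this is the origin of the factor
      3.\<close>
    have ln4: "ln z \<le> 3 * ln R" if "z \<le> 4 * R" "0 < z" for z
    proof -
      have "(4::real) \<le> exp 1 * exp 1"
      proof -
        have "(2::real) \<le> exp 1" using exp_ge_add_one_self[of 1] by simp
        from mult_mono[OF this this] show ?thesis by simp
      qed
      also have "\<dots> \<le> R * R" using R'(1) Rp by (intro mult_mono) auto
      finally have "4 * R \<le> R ^ 3" using Rp by (simp add: power3_eq_cube)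
      then have "ln z \<le> ln (R ^ 3)" using that Rp by simp
      then show ?thesis using Rp by (simp add: ln_realpow)
    qed
    have up: "\<phi> z \<le> 3 * a2 * ln R" if "R1 \<le> norm z" "norm z \<le> 4 * R" "0 < norm z" for z
    proof -
      have "\<phi> z \<le> a2 * ln (norm z)" using R1[OF that(1)] by simp
      also have "\<dots> \<le> a2 * (3 * ln R)" using log(2) ln4[OF that(2,3)] by (intro mult_left_mono) auto
      finally show ?thesis by (simp add: mult_ac)
    qed
    show "\<phi> x \<le> M * ln R" if x: "x \<in> \<Omega>" "norm x \<le> 2 * R" for x
    proof (cases "norm x \<le> \<bar>R1\<bar> + 1")
      case True
      then have "\<phi> x \<le> B * 1" using B(2)[OF x(1)] by simp
      also have "\<dots> \<le> M * ln R" using Mge B(1) lnR by (intro mult_mono) auto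
      finally show ?thesis .
    next
      case False
      then have "\<phi> x \<le> 3 * a2 * ln R" using x(2) Rp by (intro up) auto
      also have "\<dots> \<le> M * ln R" using Mge log(2) lnR by (intro mult_right_mono) auto
      finally show ?thesis .
    qed
    show "ln R \<le> M * \<phi> x" if x: "x \<in> \<Omega>" "R \<le> norm x" "norm x \<le> 2 * R" for x
    proof -
      have "R1 \<le> norm x" using x(2) R' by linarith
      then have "a1 * ln (norm x) \<le> \<phi> x" using R1 by blast
      then have "ln (norm x) \<le> 1 / a1 * \<phi> x" using log(1) by (simp add: field_simps)
      moreover have "ln R \<le> ln (norm x)" using x(2) Rp by (subst ln_le_cancel_iff) linarith+
      moreover have "1 / a1 * \<phi> x \<le> M * \<phi> x" using Mge pos[OF x(1)] by (intro mult_right_mono) auto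
      ultimately show ?thesis by linarith
    qed
    show "\<bar>partial_deriv i \<phi> x\<bar> \<le> M * ln R / R" if x: "x \<in> \<Omega>" "R \<le> norm x" "norm x \<le> 2 * R" and i: "i \<in> Basis" for x i
    proof -
      have "\<bar>partial_deriv i \<phi> x\<bar> \<le> 2 * (real DIM('a))\<^sup>2 * (3 * a2 * ln R) / R"
      proof (rule gradient_bound_far[OF open_dom C2 harmonic Rp _ x(2,3) i])
        fix z :: 'a assume z: "R / 2 \<le> norm z" "norm z \<le> 4 * R"
        then have z2: "R \<le> 2 * norm z" by simp
        then have "\<rho> < norm z" using rho by linarith
        then have zO: "z \<in> \<Omega>" using \<rho>[of z] by auto
        have "R1 \<le> norm z" "0 < norm z" using z2 R' Rp by linarith+
        then show "z \<in> \<Omega> \<and> \<bar>\<phi> z\<bar> \<le> 3 * a2 * ln R" using up[OF _ z(2)] pos[OF zO] zO by simp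
      qed
      also have "2 * (real DIM('a))\<^sup>2 * (3 * a2 * ln R) = 24 * a2 * ln R" by (simp add: dim)
      also have "24 * a2 * ln R / R \<le> M * ln R / R"
        by (rule divide_right_mono, rule mult_right_mono) (use Mge lnR Rp in linarith)+
      finally show ?thesis .
    qed
    show "ln R * R ^ (DIM('a) + 1) * R powr (- 2 * (p / (p - 1))) \<le> M"
    proof -
      have "R ^ (DIM('a) + 1) = R powr 3" using powr_realpow[OF Rp, of 3] by (simp add: dim)
      then have "R ^ (DIM('a) + 1) * R powr (- 2 * (p / (p - 1))) = R powr (- b)"
        by (simp only: powr_add[symmetric]) (simp add: b_def)
      then have "ln R * R ^ (DIM('a) + 1) * R powr (- 2 * (p / (p - 1))) = ln R * R powr (- b)" by (simp only: mult.assoc)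
      also have "\<dots> \<le> (R powr b / b) * R powr (- b)"
        by (intro mult_right_mono ln_powr_bound R' b) simp
      also have "\<dots> = 1 / b" using Rp by (simp add: powr_minus field_simps)
      finally show ?thesis using Mge by linarith
    qed
  qed
  then show ?thesis by blast
qed

lemma exterior_growth:
  fixes \<Omega> :: "'a::euclidean_space set"
  assumes \<Omega>: "exterior_domain \<Omega>" and h: "exterior_harmonic \<Omega> \<phi>" and p: "1 < p"
    "DIM('a) = 1 \<Longrightarrow> p \<le> 3" "DIM('a) = 2 \<Longrightarrow> p < 3"
    "DIM('a) \<ge> 3 \<Longrightarrow> p \<le> 1 + 2 / (real DIM('a) - 1)"
  shows "exterior_harmonic_setup \<Omega> \<phi> \<and> (\<exists>m M R0. growth_bounds \<Omega> \<phi> p m M R0)"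
proof (cases "DIM('a) = 1")
  case True
  then obtain e where B: "(Basis :: 'a set) = {e}" by (rule card_1_singletonE)
  have O: "\<Omega> = {x. 0 < x \<bullet> e}" using \<Omega> True by (simp add: exterior_domain_def B)
  obtain C where C: "C > 0" "\<And>x. x \<in> closure \<Omega> \<Longrightarrow> \<phi> x = C * (x \<bullet> e)"
    using h True by (auto simp: exterior_harmonic_def B)
  show ?thesis
    using exterior_harmonic_setup_DIM_1(1)[OF B O C] growth_bounds_DIM_1[OF B O C p(1) p(2)[OF True]] by blast
next
  case False
  have O: "open \<Omega>" "bounded (- \<Omega>)" using \<Omega> False by (auto simp: exterior_domain_def)
  note h' = h[unfolded exterior_harmonic_def if_not_P[OF False]]
  note H = h'[THEN conjunct1] h'[THEN conjunct2, THEN conjunct1] h'[THEN conjunct2, THEN conjunct2, THEN conjunct1]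
    h'[THEN conjunct2, THEN conjunct2, THEN conjunct2, THEN conjunct1]
  note H2 = h'[THEN conjunct2, THEN conjunct2, THEN conjunct2, THEN conjunct2]
  have pos: "\<forall>x\<in>\<Omega>. 0 < \<phi> x" using H2 by (simp split: if_splits)
  have hs: "exterior_harmonic_setup \<Omega> \<phi>"
    by unfold_locales (use O H pos in blast)+
  show ?thesis
  proof (cases "DIM('a) = 2")
    case True
    then obtain a1 a2 where "0 < a1" "0 < a2"
      "\<forall>\<^sub>F x in at_infinity. a1 * ln (norm x) \<le> \<phi> x \<and> \<phi> x \<le> a2 * ln (norm x)" using H2 by auto
    from growth_bounds_DIM_2[OF hs O(2) this p(1) p(3)[OF True] True] hs show ?thesis by blast
  next
    case False
    have d: "3 \<le> DIM('a)" using False \<open>DIM('a) \<noteq> 1\<close> DIM_positive[where 'a='a] by linarith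
    have "\<And>x. x \<in> \<Omega> \<Longrightarrow> \<phi> x < 1" "(\<phi> \<longlongrightarrow> 1) at_infinity" using H2 False by auto
    from growth_bounds_DIM_ge_3[OF hs O(2) this p(1) p(4)[OF d] d] hs show ?thesis by blast
  qed
qed

section \<open>From the maximal solution to the assumptions of the argument\<close>

lemma good_curveI:
  fixes \<Omega> :: "'a::euclidean_space set"
  assumes \<Omega>: "open \<Omega>" and s: "\<And>t. 0 \<le> t \<Longrightarrow> sobolev_zero \<Omega> (u t)"
    and c: "continuous_in_norm (H1_norm \<Omega>) {0..} u"
    and q: "q = (if DIM('a) \<le> 2 then 4 else 2)"
  shows "good_curve \<Omega> q u" "\<exists>E. \<forall>t\<in>{0..S}. (H1_norm \<Omega> (u t))\<^sup>2 \<le> E"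
proof -
  have s1: "sobolev 1 \<Omega> (u t)" if "0 \<le> t" for t using s[OF that] by (simp add: sobolev_zero_def)
  have L: "L2 \<Omega> (u t)" if "0 \<le> t" for t using s1[OF that] by simp
  have L2_le: "(LINT x:\<Omega>|lebesgue. (f x)\<^sup>2) \<le> (H1_norm \<Omega> f)\<^sup>2" "0 \<le> (LINT x:\<Omega>|lebesgue. (f x)\<^sup>2)" for f :: "'a \<Rightarrow> real"
  proof -
    have *: "0 \<le> (LINT x:\<Omega>|lebesgue. (g x)\<^sup>2)" for g :: "'a \<Rightarrow> real"
      unfolding set_lebesgue_integral_def by (rule integral_nonneg_AE) simp
    then show "0 \<le> (LINT x:\<Omega>|lebesgue. (f x)\<^sup>2)" .
    have "0 \<le> (\<Sum>i\<in>Basis. LINT x:\<Omega>|lebesgue. (weak_partial \<Omega> i f x)\<^sup>2)" by (intro sum_nonneg *)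
    then show "(LINT x:\<Omega>|lebesgue. (f x)\<^sup>2) \<le> (H1_norm \<Omega> f)\<^sup>2" unfolding H1_norm_square by linarith
  qed
  show bd: "\<exists>E. \<forall>t\<in>{0..S}. (H1_norm \<Omega> (u t))\<^sup>2 \<le> E" for S
  proof (rule H1_norm_bounded_on_compact[OF \<Omega> s1 c])
    fix E assume "\<And>t. t \<in> {0..S} \<Longrightarrow> (H1_norm \<Omega> (u t))\<^sup>2 \<le> E"
    then show ?thesis by (intro exI[of _ E] ballI)
  qed
  show "good_curve \<Omega> q u"
    unfolding good_curve_def
  proof (intro conjI allI impI)
    show "L2 \<Omega> (u t)" if "0 \<le> t" for t by (rule L[OF that])
    show "set_integrable lebesgue \<Omega> (\<lambda>x. \<bar>u t x\<bar> ^ q)" if t: "0 \<le> t" for t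
    proof (cases "DIM('a) \<le> 2")
      case True
      then show ?thesis using sobolev_zero_fourth_power(1)[OF True \<Omega> s[OF t]] by (simp add: q)
    next
      case False
      then show ?thesis using L[OF t] by (simp add: q L2_def)
    qed
    show "\<exists>Q. \<forall>t\<in>{0..S}. (LINT x:\<Omega>|lebesgue. \<bar>u t x\<bar> ^ q) \<le> Q" for S
    proof -
      obtain E where E: "\<And>t. t \<in> {0..S} \<Longrightarrow> (H1_norm \<Omega> (u t))\<^sup>2 \<le> E" using bd by blast
      show ?thesis
      proof (cases "DIM('a) \<le> 2")
        case True
        have "(LINT x:\<Omega>|lebesgue. \<bar>u t x\<bar> ^ 4) \<le> (2 * E + 1)\<^sup>2" if t: "t \<in> {0..S}" for t
        proof -
          have t0: "0 \<le> t" using t by simp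
          have "(2 * (H1_norm \<Omega> (u t))\<^sup>2 + 1)\<^sup>2 \<le> (2 * E + 1)\<^sup>2"
            using E[OF t] by (intro power_mono) auto
          then show ?thesis using sobolev_zero_fourth_power(2)[OF True \<Omega> s[OF t0]] by linarith
        qed
        then show ?thesis using True by (intro exI[of _ "(2 * E + 1)\<^sup>2"] ballI) (simp add: q)
      next
        case False
        have "(LINT x:\<Omega>|lebesgue. (u t x)\<^sup>2) \<le> E" if "t \<in> {0..S}" for t
          by (rule order_trans[OF L2_le(1) E[OF that]])
        then show ?thesis using False by (intro exI[of _ E] ballI) (simp add: q)
      qed
    qed
    show "((\<lambda>r. LINT x:\<Omega>|lebesgue. (u r x - u t x)\<^sup>2) \<longlongrightarrow> 0) (at t within {0..})" if t: "0 \<le> t" for t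
    proof (rule tendsto_sandwich[OF _ _ tendsto_const])
      have "((\<lambda>r. H1_norm \<Omega> (\<lambda>x. u r x - u t x)) \<longlongrightarrow> 0) (at t within {0..})"
        using c t by (simp add: continuous_in_norm_def)
      from tendsto_power[OF this, of 2]
      show "((\<lambda>r. (H1_norm \<Omega> (\<lambda>x. u r x - u t x))\<^sup>2) \<longlongrightarrow> 0) (at t within {0..})" by simp
    qed (intro always_eventually allI L2_le)+
  qed
qed

theorem theorem1:
  fixes \<Omega> :: "'a::euclidean_space set"
    and \<phi>0 u0 u1 :: "'a \<Rightarrow> real"
    and u ut :: "real \<Rightarrow> 'a \<Rightarrow> real"
    and Tmax :: ereal
    and p :: real
  assumes "exterior_domain \<Omega>"
    and "exterior_harmonic \<Omega> \<phi>0"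
    and "sobolev 2 \<Omega> u0" and "sobolev_zero \<Omega> u0" and "L2 \<Omega> u1"
    and "AE x in lebesgue. x \<in> \<Omega> \<longrightarrow> 0 \<le> u0 x"
    and "AE x in lebesgue. x \<in> \<Omega> \<longrightarrow> 0 \<le> u1 x"
    and "(LINT x:\<Omega>|lebesgue. (u1 x - weak_laplacian \<Omega> u0 x) * \<phi>0 x) > 0"
    and "1 < p"
    and "DIM('a) = 1 \<Longrightarrow> p \<le> 3"
    and "DIM('a) = 2 \<Longrightarrow> p < 3"
    and "DIM('a) \<ge> 3 \<Longrightarrow> p \<le> 1 + 2 / (real DIM('a) - 1)"
    and "maximal_weak_solution \<Omega> p u0 u1 Tmax u ut"
  shows "Tmax < \<infinity>"
proof (rule ccontr)
  assume "\<not> Tmax < \<infinity>"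
  then have "Tmax = \<infinity>" by simp
  then have ws: "weak_solution \<Omega> p u0 u1 \<infinity> u ut" using assms(13) by (simp add: maximal_weak_solution_def)
  have Ieq: "{t. 0 \<le> t \<and> ereal t < \<infinity>} = {0..}" by auto
  have s: "\<And>t. 0 \<le> t \<Longrightarrow> sobolev_zero \<Omega> (u t)" and cont: "continuous_in_norm (H1_norm \<Omega>) {0..} u"
    using ws unfolding weak_solution_def Let_def Ieq by auto
  have weak: "(LINT t:{0..S}|lebesgue. LINT x:\<Omega>|lebesgue. \<bar>u t x\<bar> powr p * \<Phi> (t, x))
          + (LINT x:\<Omega>|lebesgue. (u1 x - weak_laplacian \<Omega> u0 x) * \<Phi> (0, x))
          - (LINT x:\<Omega>|lebesgue. u0 x * time_deriv S \<Phi> (0, x))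
        = (LINT t:{0..S}|lebesgue. LINT x:\<Omega>|lebesgue. u t x * time_deriv S (time_deriv S \<Phi>) (t, x))
          + (LINT t:{0..S}|lebesgue. LINT x:\<Omega>|lebesgue. u t x * space_laplacian (time_deriv S \<Phi>) (t, x))
          - (LINT t:{0..S}|lebesgue. LINT x:\<Omega>|lebesgue. u t x * space_laplacian \<Phi> (t, x))"
    if "0 < S" "test_function \<Omega> S \<Phi>" for S \<Phi>
    using ws that unfolding weak_solution_def by simp
  obtain m M R0 where hs: "exterior_harmonic_setup \<Omega> \<phi>0" and gb: "growth_bounds \<Omega> \<phi>0 p m M R0"
    using exterior_growth[OF assms(1,2,9-12)] by blast
  interpret exterior_harmonic_setup \<Omega> \<phi>0 by (rule hs)
  define q :: nat where "q = (if DIM('a) \<le> 2 then 4 else 2)"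
  \<comment> \<open>In dimension at most 2 the exponent p is at most 3, so 2 (p - 1) <= 4. In higher
    dimensions p <= 2, so the square integrability contained in H^1 already suffices.\<close>
  have pq: "p \<le> real q \<and> 2 * (p - 1) \<le> real q"
  proof (cases "DIM('a) \<le> 2")
    case True
    then have "DIM('a) = 1 \<or> DIM('a) = 2" using DIM_positive[where 'a='a] by linarith
    then have "p \<le> 3" using assms(10,11) by auto
    then show ?thesis using True by (simp add: q_def)
  next
    case False
    then have d: "2 \<le> real DIM('a) - 1" by simp
    then have "2 / (real DIM('a) - 1) \<le> 1" by simp
    moreover have "p \<le> 1 + 2 / (real DIM('a) - 1)" using assms(12) False by simp
    ultimately have "p \<le> 2" by linarith
    then show ?thesis using False by (simp add: q_def)
  qed
  \<comment> \<open>The integral of a function that is not integrable is 0 by convention, so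
    positivity of the datum term includes integrability.\<close>
  have data: "set_integrable lebesgue \<Omega> (\<lambda>x. (u1 x - weak_laplacian \<Omega> u0 x) * \<phi>0 x)"
  proof (rule ccontr)
    assume "\<not> set_integrable lebesgue \<Omega> (\<lambda>x. (u1 x - weak_laplacian \<Omega> u0 x) * \<phi>0 x)"
    then have "(LINT x:\<Omega>|lebesgue. (u1 x - weak_laplacian \<Omega> u0 x) * \<phi>0 x) = 0"
      unfolding set_integrable_def set_lebesgue_integral_def by (rule not_integrable_integral_eq)
    then show False using assms(8) by simp
  qed
  have gb1: "1 \<le> M" "1 \<le> R0" using gb by (auto simp: growth_bounds_def)
  have gb2: "0 < m R \<and> (\<forall>x\<in>\<Omega>. norm x \<le> 2 * R \<longrightarrow> \<phi>0 x \<le> M * m R) \<and>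
     (\<forall>x\<in>\<Omega>. R \<le> norm x \<longrightarrow> norm x \<le> 2 * R \<longrightarrow> m R \<le> M * \<phi>0 x \<and>
        (\<forall>i\<in>Basis. \<bar>partial_deriv i \<phi>0 x\<bar> \<le> M * m R / R)) \<and>
     m R * R ^ (DIM('a) + 1) * R powr (- 2 * (p / (p - 1))) \<le> M" if "R0 \<le> R" for R
    using gb that unfolding growth_bounds_def by blast
  have "global_solution_growth \<Omega> \<phi>0 u (\<lambda>x. u1 x - weak_laplacian \<Omega> u0 x) u0 p q m M R0"
  proof (unfold_locales)
    show "good_curve \<Omega> q u" by (rule good_curveI(1)[OF open_dom s cont q_def])
    show "sobolev_zero \<Omega> (u t)" if "0 \<le> t" for t by (rule s[OF that])
    show "\<exists>E. \<forall>t\<in>{0..S}. (H1_norm \<Omega> (u t))\<^sup>2 \<le> E" for S by (rule good_curveI(2)[OF open_dom s cont q_def])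
    show "1 < p" by (rule assms(9))
    show "p \<le> real q" "2 * (p - 1) \<le> real q" using pq by blast+
    show "set_integrable lebesgue \<Omega> (\<lambda>x. (u1 x - weak_laplacian \<Omega> u0 x) * \<phi>0 x)" by (rule data)
    show "0 < (LINT x:\<Omega>|lebesgue. (u1 x - weak_laplacian \<Omega> u0 x) * \<phi>0 x)" by (rule assms(8))
    show "1 \<le> M" "1 \<le> R0" by (rule gb1)+
    show "(LINT t:{0..S}|lebesgue. LINT x:\<Omega>|lebesgue. \<bar>u t x\<bar> powr p * \<Phi> (t, x))
          + (LINT x:\<Omega>|lebesgue. (u1 x - weak_laplacian \<Omega> u0 x) * \<Phi> (0, x))
          - (LINT x:\<Omega>|lebesgue. u0 x * time_deriv S \<Phi> (0, x))
        = (LINT t:{0..S}|lebesgue. LINT x:\<Omega>|lebesgue. u t x * time_deriv S (time_deriv S \<Phi>) (t, x))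
          + (LINT t:{0..S}|lebesgue. LINT x:\<Omega>|lebesgue. u t x * space_laplacian (time_deriv S \<Phi>) (t, x))
          - (LINT t:{0..S}|lebesgue. LINT x:\<Omega>|lebesgue. u t x * space_laplacian \<Phi> (t, x))"
      if "0 < S" "test_function \<Omega> S \<Phi>" for S \<Phi>
      by (rule weak[OF that])
    fix R assume R: "R0 \<le> R"
    show "0 < m R" "m R * R ^ (DIM('a) + 1) * R powr (- 2 * (p / (p - 1))) \<le> M" using gb2[OF R] by blast+
    fix x assume x: "x \<in> \<Omega>"
    show "\<phi>0 x \<le> M * m R" if "norm x \<le> 2 * R" using gb2[OF R] x that by blast
    show "m R \<le> M * \<phi>0 x" if "R \<le> norm x" "norm x \<le> 2 * R" using gb2[OF R] x that by blast
    show "\<bar>partial_deriv i \<phi>0 x\<bar> \<le> M * m R / R" if "R \<le> norm x" "norm x \<le> 2 * R" "i \<in> Basis" for i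
      using gb2[OF R] x that by blast
  qed
  then show False by (rule global_solution_growth.contradiction)
qed

end
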